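(* Let $n\ge 1$, let $(\phi_j)_{j=0}^\infty\subset\mathscr S(\mathbb R^n)$ be a Littlewood-Paley family, which is used to define the Besov spaces $\mathscr B_{pq}^s(\mathbb R^n)$ and Triebel-Lizorkin spaces $\mathscr F_{pq}^s(\mathbb R^n)$. Let $(y_j)_{j=1}^\infty\subset\mathbb R^n$ be a sequence such that $\inf_{j\neq k}|y_j-y_k|>0$. Define $$Tf:=\sum_{j=1}^\infty \tau_{y_j}(\phi_j\ast f)=\sum_{j=1}^\infty(\phi_j\ast f)(\cdot-y_j),\qquad\text{where }\tau_{y}g(x):=g(x-y).$$ Then: (i) $T:\mathscr S'(\mathbb R^n)\to\mathscr S'(\mathbb R^n)$ is bounded (i.e. continuous) linear if and only if there is an $N_0>0$ such that $|y_j|\le 2^{N_0 j}$ for every $j\ge 1$. (ii) $T$ defines a bounded linear operator $T:\mathscr B_{pq}^s(\mathbb R^n)\to\mathscr B_{pq}^s(\mathbb R^n)$ for all $s\in\mathbb R$ and $0<p,q\le\infty$. (iii) For all $s\in\mathbb R$ and $0<p,q\le\infty$ with $p\neq q$, $T(\mathscr F_{pq}^s(\mathbb R^n))\not\subset\mathscr F_{pq}^s(\mathbb R^n)$.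
   Context: The Fourier transform is $\hat f(\xi)=\int f(x)e^{-2\pi i x\cdot\xi}\,dx$. A Littlewood-Paley family is a sequence $\phi=(\phi_j)_{j=0}^\infty$ of Schwartz functions on $\mathbb R^n$ such that $\operatorname{supp}\hat\phi_0\subset B(0,2)$ (open ball), $\hat\phi_0\equiv1$ in a neighborhood of $\overline{B(0,1)}$, and $\hat\phi_j(\xi)=\hat\phi_0(2^{-j}\xi)-\hat\phi_0(2^{1-j}\xi)$ for $j\ge1$. For $0<p,q\le\infty$ and $s\in\mathbb R$ (with the usual modifications when an exponent is $\infty$): $$\|f\|_{\mathscr B_{pq}^s(\phi)}:=\Big(\sum_{j=0}^\infty 2^{jsq}\|\phi_j\ast f\|_{L^p(\mathbb R^n)}^q\Big)^{1/q},$$ $$\|f\|_{\mathscr F_{pq}^s(\phi)}:=\Big(\int_{\mathbb R^n}\Big(\sum_{j=0}^\infty|2^{js}\phi_j\ast f(x)|^q\Big)^{p/q}dx\Big)^{1/p}\quad(p<\infty),$$ $$\|f\|_{\mathscr F_{\infty q}^s(\phi)}:=\sup_{x\in\mathbb R^n,\,J\in\mathbb Z}2^{Jn/q}\big\|(2^{js}\phi_j\ast f)_{j=\max(J,0)}^\infty\big\|_{L^q(B(x,2^{-J});\ell^q)}.$$ For $\mathscr A\in\{\mathscr B,\mathscr F\}$, $\mathscr A_{pq}^s(\mathbb R^n)=\{f\in\mathscr S'(\mathbb R^n):\|f\|_{\mathscr A_{pq}^s(\phi)}<\infty\}$; different choices of $\phi$ give equivalent (quasi-)norms. The series defining $Tf$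 is understood as convergent in $\mathscr S'(\mathbb R^n)$. *)

theory Defs
  imports "HOL-Analysis.Analysis" "HOL-Probability.Essential_Supremum"
begin

section \<open>Schwartz functions\<close>

fun iterated_partial ::
  "'a::euclidean_space list \<Rightarrow> ('a \<Rightarrow> complex) \<Rightarrow> 'a \<Rightarrow> complex" where
  "iterated_partial [] f = f"
| "iterated_partial (b # bs) f = (\<lambda>x. frechet_derivative (iterated_partial bs f) (at x) b)"

definition smooth :: "('a::euclidean_space \<Rightarrow> complex) \<Rightarrow> bool" where
  "smooth f \<longleftrightarrow> (\<forall>bs\<in>lists Basis. \<forall>x. iterated_partial bs f differentiable at x)"

definition schwartz_seminorm :: "nat \<Rightarrow> ('a::euclidean_space \<Rightarrow> complex) \<Rightarrow> ennreal" where
  "schwartz_seminorm N f =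
     (SUP (bs, x)\<in>{bs \<in> lists Basis. length bs \<le> N} \<times> UNIV.
        ennreal ((1 + norm x) ^ N * cmod (iterated_partial bs f x)))"

definition schwartz :: "('a::euclidean_space \<Rightarrow> complex) set" where
  "schwartz = {f. smooth f \<and> (\<forall>N. schwartz_seminorm N f < \<infinity>)}"

definition fourier :: "('a::euclidean_space \<Rightarrow> complex) \<Rightarrow> 'a \<Rightarrow> complex" where
  "fourier f \<xi> = (LINT x|lborel. f x * exp (- 2 * of_real pi * \<i> * of_real (x \<bullet> \<xi>)))"


section \<open>Tempered distributions\<close>

text \<open>
  A tempered distribution is a continuous complex-linear functional on the Schwartz space;
  continuity is the usual bound by one of the (increasing) seminorms that define the topology.
  Functionals are total functions in HOL, so a tempered distribution is extended by zero outside
  the Schwartz space. This makes its representation unique.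
\<close>

definition tempered :: "(('a::euclidean_space \<Rightarrow> complex) \<Rightarrow> complex) set" where
  "tempered = {u.
     (\<forall>f\<in>schwartz. \<forall>g\<in>schwartz. \<forall>a b. u (\<lambda>x. a * f x + b * g x) = a * u f + b * u g) \<and>
     (\<exists>N. \<exists>C::real. \<forall>f\<in>schwartz. ennreal (cmod (u f)) \<le> ennreal C * schwartz_seminorm N f) \<and>
     (\<forall>f. f \<notin> schwartz \<longrightarrow> u f = 0)}"

text \<open>
  The topology on the function type is the product topology (pointwise convergence). As all members
  of \<^const>\<open>tempered\<close> vanish outside \<^const>\<open>schwartz\<close>, the subspace topology is exactly the weak-*
  topology, i.e. pointwise convergence on Schwartz functions.
\<close>

definition tempered_topology :: "(('a::euclidean_space \<Rightarrow> complex) \<Rightarrow> complex) topology" where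
  "tempered_topology = top_of_set tempered"

definition distribution_of ::
  "('a::euclidean_space \<Rightarrow> complex) \<Rightarrow> ('a \<Rightarrow> complex) \<Rightarrow> complex" where
  "distribution_of g = (\<lambda>\<psi>. if \<psi> \<in> schwartz then LINT x|lborel. g x * \<psi> x else 0)"

definition conv ::
  "('a::euclidean_space \<Rightarrow> complex) \<Rightarrow> (('a \<Rightarrow> complex) \<Rightarrow> complex) \<Rightarrow> 'a \<Rightarrow> complex" where
  "conv \<phi> u x = u (\<lambda>t. \<phi> (x - t))"

definition translate :: "'a::euclidean_space \<Rightarrow> ('a \<Rightarrow> complex) \<Rightarrow> 'a \<Rightarrow> complex" where
  "translate y g x = g (x - y)"

definition linear_on_functionals ::
  "('b \<Rightarrow> complex) set \<Rightarrow> (('b \<Rightarrow> complex) \<Rightarrow> 'c \<Rightarrow> complex) \<Rightarrow> bool" where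
  "linear_on_functionals V T \<longleftrightarrow>
     (\<forall>u\<in>V. \<forall>v\<in>V. \<forall>a b. T (\<lambda>\<psi>. a * u \<psi> + b * v \<psi>) = (\<lambda>\<psi>. a * T u \<psi> + b * T v \<psi>))"


section \<open>Littlewood-Paley families and function spaces\<close>

definition littlewood_paley :: "(nat \<Rightarrow> 'a::euclidean_space \<Rightarrow> complex) \<Rightarrow> bool" where
  "littlewood_paley \<phi> \<longleftrightarrow>
     (\<forall>j. \<phi> j \<in> schwartz) \<and>
     closure {\<xi>. fourier (\<phi> 0) \<xi> \<noteq> 0} \<subseteq> ball 0 2 \<and>
     (\<exists>U. open U \<and> cball 0 1 \<subseteq> U \<and> (\<forall>\<xi>\<in>U. fourier (\<phi> 0) \<xi> = 1)) \<and>
     (\<forall>j\<ge>1. \<forall>\<xi>. fourier (\<phi> j) \<xi> =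
        fourier (\<phi> 0) ((2 powr (- real j)) *\<^sub>R \<xi>) - fourier (\<phi> 0) ((2 powr (1 - real j)) *\<^sub>R \<xi>))"

definition ennreal_powr :: "ennreal \<Rightarrow> real \<Rightarrow> ennreal" where
  "ennreal_powr x a = (if x = \<infinity> then \<infinity> else ennreal (enn2real x powr a))"

text \<open>
  The Lebesgue (quasi-)norm of a nonnegative function, with exponent in \<open>(0, \<infinity>]\<close>. Sequence
  norms are the case of a counting measure, where the essential supremum is the supremum.
  Only positive exponents \<open>a\<close> are used in \<^const>\<open>ennreal_powr\<close>.
\<close>

definition Lp_norm :: "ennreal \<Rightarrow> 'b measure \<Rightarrow> ('b \<Rightarrow> ennreal) \<Rightarrow> ennreal" where
  "Lp_norm p M g =
     (if p = \<infinity> then esssup M g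
      else ennreal_powr (\<integral>\<^sup>+ x. ennreal_powr (g x) (enn2real p) \<partial>M) (1 / enn2real p))"

definition besov_norm ::
  "(nat \<Rightarrow> 'a::euclidean_space \<Rightarrow> complex) \<Rightarrow> real \<Rightarrow> ennreal \<Rightarrow> ennreal \<Rightarrow>
   (('a \<Rightarrow> complex) \<Rightarrow> complex) \<Rightarrow> ennreal" where
  "besov_norm \<phi> s p q f =
     Lp_norm q (count_space UNIV)
       (\<lambda>j. ennreal (2 powr (real j * s)) *
            Lp_norm p lborel (\<lambda>x. ennreal (cmod (conv (\<phi> j) f x))))"

text \<open>In the factor \<open>2 powr (J n / q)\<close> below, \<open>1 / q\<close> is \<open>0\<close> for \<open>q = \<infinity>\<close>.\<close>

definition triebel_norm ::
  "(nat \<Rightarrow> 'a::euclidean_space \<Rightarrow> complex) \<Rightarrow> real \<Rightarrow> ennreal \<Rightarrow> ennreal \<Rightarrow>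
   (('a \<Rightarrow> complex) \<Rightarrow> complex) \<Rightarrow> ennreal" where
  "triebel_norm \<phi> s p q f =
     (if p = \<infinity> then
        (SUP (x, J::int)\<in>UNIV.
           ennreal (2 powr (of_int J * real DIM('a) * enn2real (1 / q))) *
           Lp_norm q (restrict_space lborel (ball x (2 powr (- of_int J))))
             (\<lambda>z. Lp_norm q (count_space {nat (max J 0)..})
                (\<lambda>j. ennreal (2 powr (real j * s) * cmod (conv (\<phi> j) f z)))))
      else
        Lp_norm p lborel
          (\<lambda>x. Lp_norm q (count_space UNIV)
             (\<lambda>j. ennreal (2 powr (real j * s) * cmod (conv (\<phi> j) f x)))))"

definition besov ::
  "(nat \<Rightarrow> 'a::euclidean_space \<Rightarrow> complex) \<Rightarrow> real \<Rightarrow> ennreal \<Rightarrow> ennreal \<Rightarrow>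
   (('a \<Rightarrow> complex) \<Rightarrow> complex) set" where
  "besov \<phi> s p q = {f \<in> tempered. besov_norm \<phi> s p q f < \<infinity>}"

definition triebel ::
  "(nat \<Rightarrow> 'a::euclidean_space \<Rightarrow> complex) \<Rightarrow> real \<Rightarrow> ennreal \<Rightarrow> ennreal \<Rightarrow>
   (('a \<Rightarrow> complex) \<Rightarrow> complex) set" where
  "triebel \<phi> s p q = {f \<in> tempered. triebel_norm \<phi> s p q f < \<infinity>}"


section \<open>The operator\<close>

text \<open>
  \<open>T_sums \<phi> y f u\<close>: the series defining \<open>T f\<close> converges to \<open>u\<close> in the space of tempered
  distributions. Limits are unique, so \<open>T_op \<phi> y f\<close> is the sum of the series whenever
  \<open>T_converges \<phi> y f\<close> holds; otherwise its value is unspecified.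
\<close>

definition T_sums ::
  "(nat \<Rightarrow> 'a::euclidean_space \<Rightarrow> complex) \<Rightarrow> (nat \<Rightarrow> 'a) \<Rightarrow>
   (('a \<Rightarrow> complex) \<Rightarrow> complex) \<Rightarrow> (('a \<Rightarrow> complex) \<Rightarrow> complex) \<Rightarrow> bool" where
  "T_sums \<phi> y f u \<longleftrightarrow>
     limitin tempered_topology
       (\<lambda>N \<psi>. \<Sum>j=1..N. distribution_of (translate (y j) (conv (\<phi> j) f)) \<psi>) u sequentially"

definition T_converges ::
  "(nat \<Rightarrow> 'a::euclidean_space \<Rightarrow> complex) \<Rightarrow> (nat \<Rightarrow> 'a) \<Rightarrow>
   (('a \<Rightarrow> complex) \<Rightarrow> complex) \<Rightarrow> bool" where
  "T_converges \<phi> y f \<longleftrightarrow> (\<exists>u. T_sums \<phi> y f u)"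

definition T_op ::
  "(nat \<Rightarrow> 'a::euclidean_space \<Rightarrow> complex) \<Rightarrow> (nat \<Rightarrow> 'a) \<Rightarrow>
   (('a \<Rightarrow> complex) \<Rightarrow> complex) \<Rightarrow> ('a \<Rightarrow> complex) \<Rightarrow> complex" where
  "T_op \<phi> y f = (THE u. T_sums \<phi> y f u)"

end

theory Submission
  imports Defs "HOL-Probability.Probability"
begin

text \<open>
  The proof rests on the almost orthogonality \<open>\<phi> k * \<phi> j = 0\<close> for \<open>\<bar>j - k\<bar> \<ge> 2\<close>: only three terms of
  \<open>T f\<close> are seen by \<open>\<phi> k\<close>, and translations do not change \<open>L\<^sup>p\<close> norms, which gives the Besov bound.
  A bound \<open>norm (y j) \<le> (2 ^ j) ^ N\<close> only costs powers of \<open>2 ^ j\<close>, which the decay of \<open>\<phi> j * \<psi>\<close>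
  for a Schwartz function \<open>\<psi>\<close> absorbs; if all such bounds fail, wave packets near \<open>- y j\<close> with suitably
  growing coefficients tend to \<open>0\<close> in the weak topology while their images under \<open>T\<close>, located near the origin,
  do not. In the Triebel-Lizorkin spaces one takes the packets \<open>k powr (- 1 / min p q) * G\<close>, modulated to
  frequency \<open>2 ^ k\<close>: they are summed in \<open>L\<^sup>q\<close> over \<open>k\<close> where they overlap and in \<open>L\<^sup>p\<close> where they are separated,
  and \<open>T\<close> exchanges the two configurations.
\<close>

section \<open>Calculus on the Schwartz space\<close>

text \<open>Distributions are bare functionals and the family is prescribed only through Fourier
  transforms, so the harmonic analysis is done on functions: \<open>integral_conv\<close> moves
  integrals inside a distribution, and inversion is applied to functions with integrable transform.
  The obstacle in the Besov bound is exponents below 1, where Young's convolution inequality fails.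
  It is recovered for band-limited functions from a Nikolskii inequality, whose loss is compensated
  up to a constant by the size of the power integral of \<open>\<phi> k\<close>. The same inequality
  turns uniform local integral bounds into sup bounds with a power of \<open>2 ^ j\<close>, and such
  bounds survive translation. For weak continuity, \<open>T_op \<phi> y f \<psi>\<close> is
  identified with \<open>f\<close> evaluated at one Schwartz function independent of
  \<open>f\<close>. Packets are centred at frequency \<open>(2 ^ j) *\<^sub>R e\<close> with
  \<open>e\<close> of norm 1, where the transform of \<open>\<phi> j\<close> is 1 and all others
  vanish, so that each packet is seen by one block and is moved exactly. Their coefficients give a
  harmonic series for the smaller exponent and are summable, or bounded, for the larger one;
  separation of the \<open>y k\<close> keeps displaced packets from piling up.\<close>

declare iterated_partial.simps(2) [simp del]

text \<open>Peetre's inequality: the weight at a translated point is paid for by the weight of the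
  translation. Every transfer of decay between \<open>x\<close>, \<open>x - t\<close> and
  \<open>t\<close> below rests on it.\<close>

lemma weight_add: "(1 + norm (x + t)) ^ N \<le> (1 + norm x) ^ N * (1 + norm (t::'a::real_normed_vector)) ^ N"
proof -
  have "1 + norm (x + t) \<le> 1 + (norm x + norm t) + norm x * norm t"
    using norm_triangle_ineq[of x t] mult_nonneg_nonneg[OF norm_ge_zero[of x] norm_ge_zero[of t]] by linarith
  also have "\<dots> = (1 + norm x) * (1 + norm t)"
    by (simp add: algebra_simps)
  finally show ?thesis
    by (metis power_mono power_mult_distrib add_nonneg_nonneg norm_ge_zero zero_le_one)
qed

lemma weight_diff: "(1 + norm (x - t)) ^ N \<le> (1 + norm x) ^ N * (1 + norm (t::'a::real_normed_vector)) ^ N"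
  using weight_add[of x "-t" N] by simp

lemma weight_ge1: "1 \<le> (1 + norm x) ^ N"
  by (simp add: one_le_power)

lemma weight_pos: "0 < (1 + norm x) ^ N"
  using weight_ge1[of x N] by linarith

lemma weight_mono: "N \<le> M \<Longrightarrow> (1 + norm x) ^ N \<le> (1 + norm x) ^ M"
  by (simp add: power_increasing)

text \<open>The order of the weight and the order of differentiation are kept apart, unlike in
  \<open>schwartz_seminorm\<close>, because smoothing trades derivatives for powers of
  \<open>2 ^ j\<close> at a fixed weight. Bounds are real numbers, which keeps the estimates out of
  \<open>ennreal\<close>.\<close>

definition sbound :: "nat \<Rightarrow> nat \<Rightarrow> ('a::euclidean_space \<Rightarrow> complex) \<Rightarrow> real \<Rightarrow> bool" where
  "sbound N k f C \<longleftrightarrow> (\<forall>bs\<in>lists Basis. length bs \<le> k \<longrightarrow>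
     (\<forall>x. (1 + norm x) ^ N * cmod (iterated_partial bs f x) \<le> C))"

lemma sboundD:
  "sbound N k f C \<Longrightarrow> bs \<in> lists Basis \<Longrightarrow> length bs \<le> k \<Longrightarrow>
    (1 + norm x) ^ N * cmod (iterated_partial bs f x) \<le> C"
  by (simp add: sbound_def)

lemma sboundD0: "sbound N k f C \<Longrightarrow> (1 + norm x) ^ N * cmod (f x) \<le> C"
  using sboundD[of N k f C "[]"] by simp

lemma sbound_nonneg: "sbound N k f C \<Longrightarrow> 0 \<le> C"
  using sboundD0[of N k f C 0] by (simp add: order_trans[OF norm_ge_zero])

lemma sbound_mono:
  fixes f :: "'a::euclidean_space \<Rightarrow> complex"
  assumes "sbound N k f C" "N' \<le> N" "k' \<le> k" "C \<le> C'"
  shows "sbound N' k' f C'"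
  unfolding sbound_def
proof (intro ballI impI allI)
  fix bs :: "'a list" and x assume bs: "bs \<in> lists Basis" "length bs \<le> k'"
  then have "(1 + norm x) ^ N * cmod (iterated_partial bs f x) \<le> C"
    by (intro sboundD[OF assms(1)]) (use bs assms(3) in auto)
  moreover have "(1 + norm x) ^ N' * cmod (iterated_partial bs f x)
      \<le> (1 + norm x) ^ N * cmod (iterated_partial bs f x)"
    by (intro mult_right_mono weight_mono assms) auto
  ultimately show "(1 + norm x) ^ N' * cmod (iterated_partial bs f x) \<le> C'"
    using assms(4) by linarith
qed

lemma schwartz_seminorm_le_iff:
  "0 \<le> C \<Longrightarrow> schwartz_seminorm N f \<le> ennreal C \<longleftrightarrow> sbound N N f C"
  unfolding schwartz_seminorm_def sbound_def
  by (auto simp: SUP_le_iff ennreal_le_iff)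

lemma schwartz_iff: "f \<in> schwartz \<longleftrightarrow> smooth f \<and> (\<forall>N k. \<exists>C. sbound N k f C)"
proof -
  have "(\<forall>N. schwartz_seminorm N f < \<infinity>) \<longleftrightarrow> (\<forall>N k. \<exists>C. sbound N k f C)"
  proof safe
    fix N k :: nat assume *: "\<forall>N. schwartz_seminorm N f < \<infinity>"
    define M where "M = max N k"
    have "schwartz_seminorm M f \<le> ennreal (enn2real (schwartz_seminorm M f))"
      using * by (simp add: less_top)
    then have "sbound M M f (enn2real (schwartz_seminorm M f))"
      by (subst (asm) schwartz_seminorm_le_iff) auto
    then show "\<exists>C. sbound N k f C"
      by (intro exI[of _ "enn2real (schwartz_seminorm M f)"], elim sbound_mono) (auto simp: M_def)
  next
    fix N assume "\<forall>N k. \<exists>C. sbound N k f C"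
    then obtain C where C: "sbound N N f C" by blast
    then have "schwartz_seminorm N f \<le> ennreal C"
      using sbound_nonneg schwartz_seminorm_le_iff by blast
    then show "schwartz_seminorm N f < \<infinity>"
      by (auto intro: le_less_trans)
  qed
  then show ?thesis by (simp add: schwartz_def)
qed

lemma schwartzI: "smooth f \<Longrightarrow> (\<And>N k. \<exists>C. sbound N k f C) \<Longrightarrow> f \<in> schwartz"
  by (simp add: schwartz_iff)

lemma schwartz_smooth: "f \<in> schwartz \<Longrightarrow> smooth f"
  by (simp add: schwartz_iff)

lemma schwartz_sboundE:
  assumes "f \<in> schwartz" obtains C where "sbound N k f C" "0 < C"
proof -
  obtain C where C: "sbound N k f C" using assms by (auto simp: schwartz_iff)
  show ?thesis
    by (rule that[of "C + 1"]) (use C sbound_nonneg[OF C] in \<open>auto elim: sbound_mono\<close>)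
qed

text \<open>A guessed family \<open>F\<close> of partial derivatives is correct as soon as one
  derivative formula holds at every list: comparing the Frechet derivative with the coordinate
  formula at a basis vector advances the induction. Derivatives of affine substitutions, series and
  convolutions are all computed this way.\<close>

lemma
  assumes "F [] = f"
    and "\<And>bs x. bs \<in> lists Basis \<Longrightarrow>
      (F bs has_derivative (\<lambda>h. \<Sum>b\<in>Basis. (h \<bullet> b) *\<^sub>R F (b # bs) x)) (at x)"
  shows iterated_partial_eqI: "bs \<in> lists Basis \<Longrightarrow> iterated_partial bs f = F bs"
    and smoothI: "smooth f"
proof -
  have *: "iterated_partial bs f = F bs" if "bs \<in> lists Basis" for bs
    using that
  proof (induction bs)
    case (Cons b bs)
    then have bs: "bs \<in> lists Basis" "b \<in> Basis" by auto
    have "frechet_derivative (F bs) (at x) b = F (b # bs) x" for x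
    proof -
      have "frechet_derivative (F bs) (at x) = (\<lambda>h. \<Sum>b\<in>Basis. (h \<bullet> b) *\<^sub>R F (b # bs) x)"
        using frechet_derivative_at[OF assms(2)[OF bs(1)]] by simp
      moreover have "(\<Sum>c\<in>Basis. (b \<bullet> c) *\<^sub>R F (c # bs) x) = (\<Sum>c\<in>Basis. if c = b then F (b # bs) x else 0)"
        using bs(2) by (intro sum.cong) (auto simp: inner_Basis)
      ultimately show ?thesis
        using bs(2) by simp
    qed
    then show ?case using Cons bs by (auto simp: iterated_partial.simps(2))
  qed (use assms(1) in auto)
  show "bs \<in> lists Basis \<Longrightarrow> iterated_partial bs f = F bs" by (rule *)
  show "smooth f"
    unfolding smooth_def
  proof (intro ballI allI)
    fix bs :: "'a list" and x assume l: "bs \<in> lists Basis"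
    show "iterated_partial bs f differentiable (at x)"
      unfolding *[OF l] by (rule differentiableI[OF assms(2)[OF l]])
  qed
qed

lemma smooth_has_derivative:
  assumes "smooth f" "bs \<in> lists Basis"
  shows "(iterated_partial bs f has_derivative
     (\<lambda>h. \<Sum>b\<in>Basis. (h \<bullet> b) *\<^sub>R iterated_partial (b # bs) f x)) (at x)"
proof -
  let ?D = "frechet_derivative (iterated_partial bs f) (at x)"
  have D: "(iterated_partial bs f has_derivative ?D) (at x)"
    using assms by (auto simp: smooth_def frechet_derivative_works)
  have "?D h = (\<Sum>b\<in>Basis. (h \<bullet> b) *\<^sub>R iterated_partial (b # bs) f x)" for h
  proof -
    have lin: "linear ?D" using D has_derivative_linear by blast
    have "?D h = ?D (\<Sum>b\<in>Basis. (h \<bullet> b) *\<^sub>R b)" by (simp add: euclidean_representation)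
    also have "\<dots> = (\<Sum>b\<in>Basis. (h \<bullet> b) *\<^sub>R ?D b)"
      by (simp add: linear_sum[OF lin] linear_scale[OF lin])
    finally show ?thesis by (simp add: iterated_partial.simps(2))
  qed
  then have "?D = (\<lambda>h. \<Sum>b\<in>Basis. (h \<bullet> b) *\<^sub>R iterated_partial (b # bs) f x)" by (rule ext)
  then show ?thesis by (rule has_derivative_eq_rhs[OF D])
qed

lemma smooth_continuous:
  assumes "smooth f" "bs \<in> lists Basis" shows "continuous_on UNIV (iterated_partial bs f)"
  by (rule continuous_at_imp_continuous_on, rule ballI,
      rule has_derivative_continuous[OF smooth_has_derivative[OF assms]])

lemma schwartz_continuous: "f \<in> schwartz \<Longrightarrow> continuous_on UNIV f"
  using smooth_continuous[of f "[]"] by (simp add: schwartz_smooth)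

section \<open>Affine substitutions and linear combinations\<close>

lemma
  fixes f :: "'a::euclidean_space \<Rightarrow> complex"
  assumes "smooth f"
  shows iterated_partial_affine: "bs \<in> lists Basis \<Longrightarrow> iterated_partial bs (\<lambda>x. f (a + c *\<^sub>R x)) =
       (\<lambda>x. c ^ length bs *\<^sub>R iterated_partial bs f (a + c *\<^sub>R x))"
    and smooth_affine: "smooth (\<lambda>x. f (a + c *\<^sub>R x))"
proof -
  let ?F = "\<lambda>bs x. c ^ length bs *\<^sub>R iterated_partial bs f (a + c *\<^sub>R x)"
  have 1: "?F [] = (\<lambda>x. f (a + c *\<^sub>R x))" by simp
  have 2: "(?F bs has_derivative (\<lambda>h. \<Sum>b\<in>Basis. (h \<bullet> b) *\<^sub>R ?F (b # bs) x)) (at x)"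
    if "bs \<in> lists Basis" for bs x
  proof -
    have g: "((\<lambda>x. a + c *\<^sub>R x) has_derivative (\<lambda>h. c *\<^sub>R h)) (at x)"
      by (auto intro!: derivative_eq_intros)
    have "((\<lambda>x. iterated_partial bs f (a + c *\<^sub>R x)) has_derivative
       (\<lambda>h. \<Sum>b\<in>Basis. ((c *\<^sub>R h) \<bullet> b) *\<^sub>R iterated_partial (b # bs) f (a + c *\<^sub>R x))) (at x)"
      using has_derivative_compose[OF g smooth_has_derivative[OF assms that]] by simp
    then have "(?F bs has_derivative
       (\<lambda>h. c ^ length bs *\<^sub>R (\<Sum>b\<in>Basis. ((c *\<^sub>R h) \<bullet> b) *\<^sub>R iterated_partial (b # bs) f (a + c *\<^sub>R x)))) (at x)"
      by (rule has_derivative_scaleR_right)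
    then show ?thesis
      by (simp add: scaleR_sum_right mult_ac)
  qed
  show "bs \<in> lists Basis \<Longrightarrow> iterated_partial bs (\<lambda>x. f (a + c *\<^sub>R x)) = ?F bs"
    by (rule iterated_partial_eqI[of ?F, OF 1 2])
  show "smooth (\<lambda>x. f (a + c *\<^sub>R x))" by (rule smoothI[of ?F, OF 1 2])
qed

lemma
  assumes "smooth f" "smooth g"
  shows iterated_partial_lincomb: "bs \<in> lists Basis \<Longrightarrow> iterated_partial bs (\<lambda>x. a * f x + b * g x) =
       (\<lambda>x. a * iterated_partial bs f x + b * iterated_partial bs g x)"
    and smooth_lincomb: "smooth (\<lambda>x. a * f x + b * g x)"
proof -
  let ?F = "\<lambda>bs x. a * iterated_partial bs f x + b * iterated_partial bs g x"
  have 1: "?F [] = (\<lambda>x. a * f x + b * g x)" by simp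
  have 2: "(?F bs has_derivative (\<lambda>h. \<Sum>b\<in>Basis. (h \<bullet> b) *\<^sub>R ?F (b # bs) x)) (at x)"
    if "bs \<in> lists Basis" for bs x
    using has_derivative_add[OF has_derivative_mult_right[OF smooth_has_derivative[OF assms(1) that], of a x]
        has_derivative_mult_right[OF smooth_has_derivative[OF assms(2) that], of b x]]
    by (simp add: sum_distrib_left scaleR_add_right sum.distrib)
  show "bs \<in> lists Basis \<Longrightarrow> iterated_partial bs (\<lambda>x. a * f x + b * g x) = ?F bs"
    by (rule iterated_partial_eqI[of ?F, OF 1 2])
  show "smooth (\<lambda>x. a * f x + b * g x)" by (rule smoothI[of ?F, OF 1 2])
qed

lemma sbound_lincomb:
  fixes f g :: "'a::euclidean_space \<Rightarrow> complex"
  assumes "smooth f" "smooth g" "sbound N k f A" "sbound N k g B"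
  shows "sbound N k (\<lambda>x. a * f x + b * g x) (cmod a * A + cmod b * B)"
  unfolding sbound_def
proof (intro ballI impI allI)
  fix bs :: "'a list" and x assume bs: "bs \<in> lists Basis" "length bs \<le> k"
  then have l: "bs \<in> lists Basis" by auto
  have "(1 + norm x) ^ N * cmod (iterated_partial bs (\<lambda>x. a * f x + b * g x) x) \<le>
    (1 + norm x) ^ N * (cmod a * cmod (iterated_partial bs f x) + cmod b * cmod (iterated_partial bs g x))"
    unfolding iterated_partial_lincomb[OF assms(1,2) l]
    by (intro mult_left_mono norm_triangle_le) (auto simp: norm_mult)
  also have "\<dots> = cmod a * ((1 + norm x) ^ N * cmod (iterated_partial bs f x)) +
     cmod b * ((1 + norm x) ^ N * cmod (iterated_partial bs g x))"
    by (simp add: algebra_simps)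
  also have "\<dots> \<le> cmod a * A + cmod b * B"
    by (intro add_mono mult_left_mono sboundD[OF assms(3) l bs(2)] sboundD[OF assms(4) l bs(2)]) auto
  finally show "(1 + norm x) ^ N * cmod (iterated_partial bs (\<lambda>x. a * f x + b * g x) x) \<le> cmod a * A + cmod b * B" .
qed

lemma schwartz_lincomb:
  assumes "f \<in> schwartz" "g \<in> schwartz" shows "(\<lambda>x. a * f x + b * g x) \<in> schwartz"
proof (rule schwartzI)
  show "smooth (\<lambda>x. a * f x + b * g x)" using assms by (intro smooth_lincomb schwartz_smooth)
  fix N k
  obtain A where "sbound N k f A" by (rule schwartz_sboundE[OF assms(1)])
  moreover obtain B where "sbound N k g B" by (rule schwartz_sboundE[OF assms(2)])
  ultimately
  show "\<exists>C. sbound N k (\<lambda>x. a * f x + b * g x) C"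
    using sbound_lincomb[OF assms[THEN schwartz_smooth]] by blast
qed

lemma schwartz_cmult: "f \<in> schwartz \<Longrightarrow> (\<lambda>x. a * f x) \<in> schwartz"
  using schwartz_lincomb[of f f a 0] by simp

lemma schwartz_add: "f \<in> schwartz \<Longrightarrow> g \<in> schwartz \<Longrightarrow> (\<lambda>x. f x + g x) \<in> schwartz"
  using schwartz_lincomb[of f g 1 1] by simp

lemma schwartz_diff: "f \<in> schwartz \<Longrightarrow> g \<in> schwartz \<Longrightarrow> (\<lambda>x. f x - g x) \<in> schwartz"
  using schwartz_lincomb[of f g 1 "-1"] by simp

lemma schwartz_zero: "(\<lambda>x. 0) \<in> schwartz"
proof -
  let ?F = "\<lambda>bs x. 0"
  have "bs \<in> lists Basis \<Longrightarrow> iterated_partial bs (\<lambda>x. 0) = (\<lambda>x. 0)" for bs :: "'a list"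
    by (rule iterated_partial_eqI[of ?F]) auto
  moreover have "smooth (\<lambda>x::'a. 0)"
    by (rule smoothI[of ?F]) auto
  ultimately show ?thesis by (auto intro!: schwartzI exI[of _ 0] simp: sbound_def)
qed

lemma schwartz_sum: "finite I \<Longrightarrow> (\<And>i. i \<in> I \<Longrightarrow> f i \<in> schwartz) \<Longrightarrow> (\<lambda>x. \<Sum>i\<in>I. f i x) \<in> schwartz"
  by (induction I rule: finite_induct) (auto intro: schwartz_zero schwartz_add)

text \<open>The shift contributes a Peetre factor, \<open>1 + norm x\<close> is at most
  \<open>max 1 (1 / \<bar>c\<bar>)\<close> times \<open>1 + norm (c *\<^sub>R x)\<close>, and the
  chain rule yields one factor \<open>c\<close> per derivative. For \<open>c\<close> equal to 1 or
  -1 only the Peetre factor remains.\<close>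

lemma sbound_affine:
  assumes "smooth f" "sbound N k f C" "c \<noteq> 0"
  shows "sbound N k (\<lambda>x. f (a + c *\<^sub>R x))
    ((1 + norm a) ^ N * max 1 (1 / \<bar>c\<bar>) ^ N * max 1 \<bar>c\<bar> ^ k * C)"
  unfolding sbound_def
proof (intro ballI impI allI)
  fix bs :: "'a list" and x assume bs: "bs \<in> lists Basis" "length bs \<le> k"
  then have l: "bs \<in> lists Basis" by auto
  let ?y = "a + c *\<^sub>R x" and ?m = "max 1 (1 / \<bar>c\<bar>)"
  have C: "0 \<le> C" using assms(2) sbound_nonneg by blast
  have "1 + norm x = 1 + norm (c *\<^sub>R x) * (1 / \<bar>c\<bar>)"
    using assms(3) by simp
  also have "\<dots> \<le> ?m + norm (c *\<^sub>R x) * ?m"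
    by (intro add_mono mult_left_mono) auto
  also have "\<dots> = ?m * (1 + norm (?y - a))" by (simp add: algebra_simps)
  finally have "(1 + norm x) ^ N \<le> (?m * (1 + norm (?y - a))) ^ N"
    by (intro power_mono) auto
  also have "\<dots> \<le> ?m ^ N * ((1 + norm ?y) ^ N * (1 + norm a) ^ N)"
    unfolding power_mult_distrib by (intro mult_left_mono weight_diff) auto
  finally have w: "(1 + norm x) ^ N \<le> ?m ^ N * ((1 + norm ?y) ^ N * (1 + norm a) ^ N)" .
  have c: "\<bar>c\<bar> ^ length bs \<le> max 1 \<bar>c\<bar> ^ k"
    by (rule order_trans[OF power_mono power_increasing]) (use bs in auto)
  have "(1 + norm x) ^ N * cmod (iterated_partial bs (\<lambda>x. f (a + c *\<^sub>R x)) x)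
     = \<bar>c\<bar> ^ length bs * ((1 + norm x) ^ N * cmod (iterated_partial bs f ?y))"
    by (simp add: iterated_partial_affine[OF assms(1) l] power_abs)
  also have "\<dots> \<le> max 1 \<bar>c\<bar> ^ k * ((?m ^ N * ((1 + norm ?y) ^ N * (1 + norm a) ^ N)) * cmod (iterated_partial bs f ?y))"
    by (intro mult_mono c mult_right_mono[OF w] mult_nonneg_nonneg) auto
  also have "\<dots> = max 1 \<bar>c\<bar> ^ k * ?m ^ N * (1 + norm a) ^ N * ((1 + norm ?y) ^ N * cmod (iterated_partial bs f ?y))"
    by (simp add: algebra_simps)
  also have "\<dots> \<le> max 1 \<bar>c\<bar> ^ k * ?m ^ N * (1 + norm a) ^ N * C"
    by (intro mult_left_mono sboundD[OF assms(2) l bs(2)]) auto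
  finally show "(1 + norm x) ^ N * cmod (iterated_partial bs (\<lambda>x. f (a + c *\<^sub>R x)) x)
    \<le> (1 + norm a) ^ N * ?m ^ N * max 1 \<bar>c\<bar> ^ k * C"
    by (simp add: algebra_simps)
qed

lemma schwartz_affine:
  assumes "f \<in> schwartz" "c \<noteq> 0" shows "(\<lambda>x. f (a + c *\<^sub>R x)) \<in> schwartz"
proof (rule schwartzI)
  show "smooth (\<lambda>x. f (a + c *\<^sub>R x))" using assms by (intro smooth_affine schwartz_smooth)
  fix N k
  obtain A where "sbound N k f A" by (rule schwartz_sboundE[OF assms(1)])
  then show "\<exists>C. sbound N k (\<lambda>x. f (a + c *\<^sub>R x)) C"
    using sbound_affine[OF schwartz_smooth[OF assms(1)] _ assms(2)] by blast
qed

lemma schwartz_shift: "f \<in> schwartz \<Longrightarrow> (\<lambda>x. f (x + a)) \<in> schwartz"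
  using schwartz_affine[of f 1 a] by (simp add: add.commute)

lemma sbound_shift: "smooth f \<Longrightarrow> sbound N k f C \<Longrightarrow> sbound N k (\<lambda>x. f (x + a)) ((1 + norm a) ^ N * C)"
  using sbound_affine[of f N k C 1 a] by (simp add: add.commute)

lemma schwartz_reflect: "f \<in> schwartz \<Longrightarrow> (\<lambda>x. f (a - x)) \<in> schwartz"
  using schwartz_affine[of f "-1" a] by simp

lemma sbound_reflect: "smooth f \<Longrightarrow> sbound N k f C \<Longrightarrow> sbound N k (\<lambda>x. f (a - x)) ((1 + norm a) ^ N * C)"
  using sbound_affine[of f N k C "-1" a] by simp

section \<open>Weighted mean value and Taylor estimates\<close>

lemma onorm_partials_le:
  fixes v :: "'a::euclidean_space \<Rightarrow> complex"
  assumes "\<And>b. b \<in> Basis \<Longrightarrow> cmod (v b) \<le> B"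
  shows "onorm (\<lambda>h. \<Sum>b\<in>Basis. (h \<bullet> b) *\<^sub>R v b) \<le> real DIM('a) * B"
proof (rule onorm_le)
  fix h :: 'a
  have "cmod (\<Sum>b\<in>Basis. (h \<bullet> b) *\<^sub>R v b) \<le> (\<Sum>b\<in>(Basis::'a set). norm h * B)"
    by (rule sum_norm_le) (auto intro!: mult_mono assms Basis_le_norm)
  then show "cmod (\<Sum>b\<in>Basis. (h \<bullet> b) *\<^sub>R v b) \<le> real DIM('a) * B * norm h"
    by (simp add: algebra_simps)
qed

text \<open>Mean value inequality on the segment from \<open>x\<close> to \<open>x - t\<close>. The
  weight at \<open>x\<close> is moved to the intermediate point at the cost of
  \<open>(1 + norm t) ^ N\<close>. The price is one extra derivative; the gain is the factor
  \<open>norm t\<close>.\<close>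

lemma weighted_increment:
  fixes f :: "'a::euclidean_space \<Rightarrow> complex"
  assumes "smooth f" "sbound N (Suc k) f C" "bs \<in> lists Basis" "length bs \<le> k"
  shows "(1 + norm x) ^ N * cmod (iterated_partial bs f (x - t) - iterated_partial bs f x)
    \<le> real DIM('a) * C * (norm t * (1 + norm t) ^ N)"
proof -
  let ?g = "iterated_partial bs f"
  define B where "B = real DIM('a) * (C * (1 + norm t) ^ N / (1 + norm x) ^ N)"
  have "cmod (?g (x - t) - ?g x) \<le> B * norm ((x - t) - x)"
  proof (rule differentiable_bound[of "closed_segment x (x - t)"])
    show "(?g has_derivative (\<lambda>h. \<Sum>b\<in>Basis. (h \<bullet> b) *\<^sub>R iterated_partial (b # bs) f r)) (at r within closed_segment x (x - t))" for r
      by (rule has_derivative_at_withinI[OF smooth_has_derivative[OF assms(1,3)]])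
    fix r assume r: "r \<in> closed_segment x (x - t)"
    then obtain u where u: "0 \<le> u" "u \<le> 1" "r = (1 - u) *\<^sub>R x + u *\<^sub>R (x - t)"
      by (auto simp: closed_segment_def)
    have "x = r + u *\<^sub>R t" using u(3) by (simp add: algebra_simps)
    then have "(1 + norm x) ^ N \<le> (1 + norm r) ^ N * (1 + norm (u *\<^sub>R t)) ^ N"
      using weight_add by metis
    also have "\<dots> \<le> (1 + norm r) ^ N * (1 + norm t) ^ N"
      using u by (intro mult_left_mono power_mono add_left_mono) (auto simp: mult_left_le_one_le)
    finally have w: "(1 + norm x) ^ N \<le> (1 + norm r) ^ N * (1 + norm t) ^ N" .
    show "onorm (\<lambda>h. \<Sum>b\<in>Basis. (h \<bullet> b) *\<^sub>R iterated_partial (b # bs) f r) \<le> B"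
      unfolding B_def
    proof (rule onorm_partials_le)
      fix b :: 'a assume b: "b \<in> Basis"
      have "(1 + norm x) ^ N * cmod (iterated_partial (b # bs) f r)
        \<le> (1 + norm r) ^ N * (1 + norm t) ^ N * cmod (iterated_partial (b # bs) f r)"
        by (rule mult_right_mono[OF w]) auto
      also have "\<dots> = (1 + norm t) ^ N * ((1 + norm r) ^ N * cmod (iterated_partial (b # bs) f r))"
        by (simp add: algebra_simps)
      also have "\<dots> \<le> (1 + norm t) ^ N * C"
        by (intro mult_left_mono sboundD[OF assms(2)]) (use b assms in auto)
      finally show "cmod (iterated_partial (b # bs) f r) \<le> C * (1 + norm t) ^ N / (1 + norm x) ^ N"
        using weight_pos[of x N] by (simp add: pos_le_divide_eq algebra_simps)
    qed
  qed auto
  then have "(1 + norm x) ^ N * cmod (?g (x - t) - ?g x) \<le> (1 + norm x) ^ N * (B * norm t)"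
    by (intro mult_left_mono) auto
  also have "\<dots> = real DIM('a) * C * (norm t * (1 + norm t) ^ N)"
    unfolding B_def using weight_pos[of x N] weight_pos[of t N] by (simp add: field_simps del: power_eq_0_iff)
  finally show ?thesis .
qed

text \<open>A Taylor remainder with a constant independent of both points. The increment of the
  derivative is controlled by \<open>weighted_increment\<close> with weight order 0, which is where
  two derivatives are spent and the dimension enters twice.\<close>

lemma linear_approximation_error:
  fixes f :: "'a::euclidean_space \<Rightarrow> complex"
  assumes "smooth f" "sbound 0 (Suc (Suc k)) f C" "bs \<in> lists Basis" "length bs \<le> k"
  shows "cmod (iterated_partial bs f z - iterated_partial bs f x -
      (\<Sum>b\<in>Basis. ((z - x) \<bullet> b) *\<^sub>R iterated_partial (b # bs) f x))
    \<le> (real DIM('a))\<^sup>2 * C * (norm (z - x))\<^sup>2"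
proof -
  let ?D = "\<lambda>r h. \<Sum>b\<in>Basis. (h \<bullet> b) *\<^sub>R iterated_partial (b # bs) f r"
  have "cmod (iterated_partial bs f z - iterated_partial bs f x - ?D x (z - x))
     \<le> norm (z - x) * (real DIM('a) * (real DIM('a) * C * norm (z - x)))"
  proof (rule differentiable_bound_linearization[where S="closed_segment x z" and f' = ?D])
    show "x + t *\<^sub>R (z - x) \<in> closed_segment x z" if "t \<in> {0..1}" for t
      using that by (auto simp: closed_segment_def algebra_simps intro!: exI[of _ t])
    show "(iterated_partial bs f has_derivative ?D r) (at r within closed_segment x z)" for r
      by (rule has_derivative_at_withinI[OF smooth_has_derivative[OF assms(1,3)]])
    fix r assume r: "r \<in> closed_segment x z"
    have "norm (r - x) \<le> norm (z - x)" using segment_bound(1)[OF r] by (simp add: norm_minus_commute)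
    have "?D r - ?D x = (\<lambda>h. \<Sum>b\<in>Basis. (h \<bullet> b) *\<^sub>R (iterated_partial (b # bs) f r - iterated_partial (b # bs) f x))"
      by (auto simp: fun_eq_iff sum_subtractf scaleR_diff_right)
    moreover have "onorm \<dots> \<le> real DIM('a) * (real DIM('a) * C * norm (z - x))"
    proof (rule onorm_partials_le)
      fix b :: 'a assume b: "b \<in> Basis"
      have "cmod (iterated_partial (b # bs) f (x - (x - r)) - iterated_partial (b # bs) f x)
         \<le> real DIM('a) * C * norm (x - r)"
        using weighted_increment[OF assms(1,2), of "b # bs" x "x - r"] b assms by auto
      also have "\<dots> \<le> real DIM('a) * C * norm (z - x)"
        using \<open>norm (r - x) \<le> norm (z - x)\<close> sbound_nonneg[OF assms(2)]
        by (intro mult_left_mono) (auto simp: norm_minus_commute)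
      finally show "cmod (iterated_partial (b # bs) f r - iterated_partial (b # bs) f x)
         \<le> real DIM('a) * C * norm (z - x)" by simp
    qed
    ultimately show "onorm (?D r - ?D x) \<le> real DIM('a) * (real DIM('a) * C * norm (z - x))" by simp
  qed auto
  then show ?thesis by (simp add: power2_eq_square algebra_simps)
qed

text \<open>Unlike a little-o, a quadratic remainder with an explicit constant can be summed and
  integrated. Differentiation under a series and under a convolution integral goes through this
  criterion.\<close>

lemma has_derivative_of_quadratic_error:
  assumes "bounded_linear L" "\<And>z. norm (F z - F x - L (z - x)) \<le> K * (norm (z - x))\<^sup>2"
  shows "(F has_derivative L) (at x)"
proof (rule has_derivativeI_sandwich[of 1])
  fix z assume "z \<noteq> x"
  then show "norm (F z - F x - L (z - x)) / norm (z - x) \<le> K * norm (z - x)"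
    using assms(2)[of z] by (simp add: pos_divide_le_eq power2_eq_square mult.assoc)
next
  have "((\<lambda>z. K * norm (z - x)) \<longlongrightarrow> K * norm (x - x)) (at x)" by (intro tendsto_intros)
  then show "((\<lambda>z. K * norm (z - x)) \<longlongrightarrow> 0) (at x)" by simp
qed (use assms in auto)

lemma bounded_linear_partials: "bounded_linear (\<lambda>h::'a::euclidean_space. \<Sum>b\<in>Basis. (h \<bullet> b) *\<^sub>R v b)"
  by (intro bounded_linear_sum bounded_linear_scaleR_const bounded_linear_inner_left)

text \<open>The termwise Taylor remainders have summable constants, so their sum is again a
  quadratic remainder. The tail bound expresses convergence of the partial sums in each Schwartz
  seminorm.\<close>

lemma
  fixes \<theta> :: "nat \<Rightarrow> 'a::euclidean_space \<Rightarrow> complex"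
  assumes \<theta>: "\<And>j. \<theta> j \<in> schwartz"
    and bound: "\<And>N k j. sbound N k (\<theta> j) (B N k j)" "\<And>N k. summable (B N k)"
  shows schwartz_suminf: "(\<lambda>x. \<Sum>j. \<theta> j x) \<in> schwartz"
    and sbound_suminf_tail: "sbound N k (\<lambda>x. (\<Sum>j. \<theta> j x) - (\<Sum>j<m. \<theta> j x)) (\<Sum>j. B N k (j + m))"
proof -
  have sm: "smooth (\<theta> j)" for j using \<theta> schwartz_smooth by blast
  define D where "D = (\<lambda>j bs x. iterated_partial bs (\<theta> j) x)"
  have norm_summable: "summable (\<lambda>j. cmod (D j bs x))" if "bs \<in> lists Basis" for bs x
  proof (rule summable_comparison_test'[OF bound(2)[of 0 "length bs"], of 0])
    show "norm (cmod (D j bs x)) \<le> B 0 (length bs) j" for j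
      using sboundD[OF bound(1)[of 0 "length bs" j] that order_refl, of x] by (simp add: D_def)
  qed
  have summable: "summable (\<lambda>j. D j bs x)" if "bs \<in> lists Basis" for bs x
    by (rule summable_norm_cancel[OF norm_summable[OF that]])
  \<comment> \<open>Stated for the series started at an arbitrary \<open>m\<close>: the case 0 is
    membership in the Schwartz space, the general case is the tail bound.\<close>
  have main: "(\<lambda>x. \<Sum>j. \<theta> (j + m) x) \<in> schwartz \<and> sbound N k (\<lambda>x. \<Sum>j. \<theta> (j + m) x) (\<Sum>j. B N k (j + m))" for m N k
  proof -
    let ?F = "\<lambda>bs x. \<Sum>j. D (j + m) bs x"
    have 1: "?F [] = (\<lambda>x. \<Sum>j. \<theta> (j + m) x)" by (simp add: D_def)
    have 2: "(?F bs has_derivative (\<lambda>h. \<Sum>b\<in>Basis. (h \<bullet> b) *\<^sub>R ?F (b # bs) x)) (at x)"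
      if l: "bs \<in> lists Basis" for bs x
    proof (rule has_derivative_of_quadratic_error)
      let ?k = "Suc (Suc (length bs))"
      fix z
      let ?E = "\<lambda>j. D j bs z - D j bs x - (\<Sum>b\<in>Basis. ((z - x) \<bullet> b) *\<^sub>R D j (b # bs) x)"
      have s: "summable (\<lambda>j. D (j + m) bs x)" if "bs \<in> lists Basis" for x and bs :: "'a list"
        by (rule summable_ignore_initial_segment[OF summable[OF that]])
      have S: "summable (\<lambda>j. B 0 ?k (j + m))" by (rule summable_ignore_initial_segment[OF bound(2)])
      have sb: "summable (\<lambda>j. D (j + m) (b # bs) x)" if "b \<in> Basis" for b
        by (rule s) (use l that in auto)
      have "?F bs z - ?F bs x - (\<Sum>b\<in>Basis. ((z - x) \<bullet> b) *\<^sub>R ?F (b # bs) x) = (\<Sum>j. ?E (j + m))"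
      proof -
        have "(\<Sum>b\<in>Basis. ((z - x) \<bullet> b) *\<^sub>R ?F (b # bs) x) = (\<Sum>b\<in>Basis. (\<Sum>j. ((z - x) \<bullet> b) *\<^sub>R D (j + m) (b # bs) x))"
          by (intro sum.cong refl suminf_scaleR_right sb)
        also have "\<dots> = (\<Sum>j. \<Sum>b\<in>Basis. ((z - x) \<bullet> b) *\<^sub>R D (j + m) (b # bs) x)"
          by (rule suminf_sum[symmetric]) (intro summable_scaleR_right sb)
        finally have 1: "(\<Sum>b\<in>Basis. ((z - x) \<bullet> b) *\<^sub>R ?F (b # bs) x) = (\<Sum>j. \<Sum>b\<in>Basis. ((z - x) \<bullet> b) *\<^sub>R D (j + m) (b # bs) x)" .
        have 2: "summable (\<lambda>j. \<Sum>b\<in>Basis. ((z - x) \<bullet> b) *\<^sub>R D (j + m) (b # bs) x)"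
          by (intro summable_sum summable_scaleR_right sb)
        show ?thesis
          unfolding 1 suminf_diff[OF s[OF l] s[OF l]] suminf_diff[OF summable_diff[OF s[OF l] s[OF l]] 2] ..
      qed
      moreover have "cmod (\<Sum>j. ?E (j + m)) \<le> (\<Sum>j. (real DIM('a))\<^sup>2 * B 0 ?k (j + m) * (norm (z - x))\<^sup>2)"
      proof (rule norm_suminf_le)
        show "cmod (?E (j + m)) \<le> (real DIM('a))\<^sup>2 * B 0 ?k (j + m) * (norm (z - x))\<^sup>2" for j
          unfolding D_def by (rule linear_approximation_error[OF sm bound(1) l]) simp
        show "summable (\<lambda>j. (real DIM('a))\<^sup>2 * B 0 ?k (j + m) * (norm (z - x))\<^sup>2)"
          by (intro summable_mult summable_mult2 summable_ignore_initial_segment bound)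
      qed
      moreover have "\<dots> = (real DIM('a))\<^sup>2 * (\<Sum>j. B 0 ?k (j + m)) * (norm (z - x))\<^sup>2"
        unfolding suminf_mult2[OF summable_mult[OF S], symmetric] suminf_mult[OF S] ..
      ultimately show "cmod (?F bs z - ?F bs x - (\<Sum>b\<in>Basis. ((z - x) \<bullet> b) *\<^sub>R ?F (b # bs) x))
        \<le> (real DIM('a))\<^sup>2 * (\<Sum>j. B 0 ?k (j + m)) * (norm (z - x))\<^sup>2" by simp
    qed (rule bounded_linear_partials)
    have eq: "bs \<in> lists Basis \<Longrightarrow> iterated_partial bs (\<lambda>x. \<Sum>j. \<theta> (j + m) x) = ?F bs" for bs
      by (rule iterated_partial_eqI[of ?F, OF 1 2])
    have smooth: "smooth (\<lambda>x. \<Sum>j. \<theta> (j + m) x)" by (rule smoothI[of ?F, OF 1 2])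
    have sb: "sbound N k (\<lambda>x. \<Sum>j. \<theta> (j + m) x) (\<Sum>j. B N k (j + m))" for N k
      unfolding sbound_def
    proof (intro ballI impI allI)
      fix bs :: "'a list" and x assume bs: "bs \<in> lists Basis" "length bs \<le> k"
      then have l: "bs \<in> lists Basis" by auto
      have s: "summable (\<lambda>j. cmod (D (j + m) bs x))"
        by (rule summable_ignore_initial_segment[OF norm_summable[OF l]])
      have "(1 + norm x) ^ N * cmod (?F bs x) \<le> (1 + norm x) ^ N * (\<Sum>j. cmod (D (j + m) bs x))"
        by (intro mult_left_mono summable_norm s) auto
      also have "\<dots> = (\<Sum>j. (1 + norm x) ^ N * cmod (D (j + m) bs x))"
        using suminf_mult[OF s] by simp
      also have "\<dots> \<le> (\<Sum>j. B N k (j + m))"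
      proof (rule suminf_le)
        show "(1 + norm x) ^ N * cmod (D (j + m) bs x) \<le> B N k (j + m)" for j
          unfolding D_def by (rule sboundD[OF bound(1) l bs(2)])
      qed (intro summable_mult s summable_ignore_initial_segment bound)+
      finally show "(1 + norm x) ^ N * cmod (iterated_partial bs (\<lambda>x. \<Sum>j. \<theta> (j + m) x) x) \<le> (\<Sum>j. B N k (j + m))"
        by (simp add: eq[OF l])
    qed
    show ?thesis using smooth sb by (auto intro: schwartzI)
  qed
  show "(\<lambda>x. \<Sum>j. \<theta> j x) \<in> schwartz" using main[of 0] by simp
  have "(\<lambda>x. (\<Sum>j. \<theta> j x) - (\<Sum>j<m. \<theta> j x)) = (\<lambda>x. \<Sum>j. \<theta> (j + m) x)"
  proof
    fix x
    have "summable (\<lambda>j. \<theta> j x)" using summable[of "[]" x] by (simp add: D_def)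
    from suminf_minus_initial_segment[OF this, of m]
    show "(\<Sum>j. \<theta> j x) - (\<Sum>j<m. \<theta> j x) = (\<Sum>j. \<theta> (j + m) x)" by simp
  qed
  then show "sbound N k (\<lambda>x. (\<Sum>j. \<theta> j x) - (\<Sum>j<m. \<theta> j x)) (\<Sum>j. B N k (j + m))"
    using main[of m] by simp
qed

section \<open>Integration on Euclidean space\<close>

lemma nn_integral_affine:
  fixes t :: "'a::euclidean_space"
  assumes [measurable]: "f \<in> borel_measurable borel" and c: "c \<noteq> 0"
  shows "(\<integral>\<^sup>+x. f x \<partial>lborel) = ennreal (\<bar>c\<bar> ^ DIM('a)) * (\<integral>\<^sup>+x. f (t + c *\<^sub>R x) \<partial>lborel)"
  by (subst lborel_affine[OF c, of t])
     (simp add: nn_integral_density nn_integral_distr nn_integral_cmult)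

lemma integrable_affine:
  fixes f :: "'a::euclidean_space \<Rightarrow> 'b :: {banach, second_countable_topology}"
  assumes f: "integrable lborel f" and c: "c \<noteq> 0"
  shows "integrable lborel (\<lambda>x. f (t + c *\<^sub>R x))"
proof -
  have [measurable]: "f \<in> borel_measurable borel" using f by auto
  have "(\<integral>\<^sup>+x. ennreal (norm (f x)) \<partial>lborel) < \<infinity>" using f by (simp add: integrable_iff_bounded)
  then have "(\<integral>\<^sup>+x. ennreal (norm (f (t + c *\<^sub>R x))) \<partial>lborel) < \<infinity>"
    using c by (subst (asm) nn_integral_affine[where c=c and t=t]) (auto simp: ennreal_mult_less_top)
  then show ?thesis by (simp add: integrable_iff_bounded)
qed

lemma integrable_affine_iff:
  fixes f :: "'a::euclidean_space \<Rightarrow> 'b :: {banach, second_countable_topology}"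
  assumes c: "c \<noteq> 0"
  shows "integrable lborel (\<lambda>x. f (t + c *\<^sub>R x)) \<longleftrightarrow> integrable lborel f"
proof
  assume "integrable lborel (\<lambda>x. f (t + c *\<^sub>R x))"
  from integrable_affine[OF this, of "1/c" "-(1/c) *\<^sub>R t"] c show "integrable lborel f"
    by (simp add: scaleR_diff_right)
qed (rule integrable_affine[OF _ c])

lemma integral_affine:
  fixes f :: "'a::euclidean_space \<Rightarrow> 'b :: {banach, second_countable_topology}"
  assumes c: "c \<noteq> 0"
  shows "(\<integral>x. f x \<partial>lborel) = \<bar>c\<bar> ^ DIM('a) *\<^sub>R (\<integral>x. f (t + c *\<^sub>R x) \<partial>lborel)"
proof cases
  assume f[measurable]: "integrable lborel f"
  have [measurable]: "f \<in> borel_measurable borel" using f by auto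
  show ?thesis
    using f integrable_affine[OF f c, of t] c
    by (subst lborel_affine[OF c, of t]) (simp add: integral_density integral_distr)
next
  \<comment> \<open>Integrability is preserved by the substitution, so here both Bochner integrals
    have the default value 0.\<close>
  assume "\<not> integrable lborel f" with c show ?thesis
    by (simp add: integrable_affine_iff not_integrable_integral_eq)
qed

lemma integral_shift:
  fixes f :: "'a::euclidean_space \<Rightarrow> 'b :: {banach, second_countable_topology}"
  shows "(\<integral>x. f (x + a) \<partial>lborel) = (\<integral>x. f x \<partial>lborel)"
  using integral_affine[of 1 f a] by (simp add: add.commute)

lemma integral_reflect:
  fixes f :: "'a::euclidean_space \<Rightarrow> 'b :: {banach, second_countable_topology}"
  shows "(\<integral>x. f (a - x) \<partial>lborel) = (\<integral>x. f x \<partial>lborel)"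
  using integral_affine[of "-1" f a] by simp

lemma nn_integral_shift:
  fixes f :: "'a::euclidean_space \<Rightarrow> ennreal"
  assumes "f \<in> borel_measurable borel"
  shows "(\<integral>\<^sup>+x. f (x + a) \<partial>lborel) = (\<integral>\<^sup>+x. f x \<partial>lborel)"
  using nn_integral_affine[OF assms, of 1 a] by (simp add: add.commute)

lemma nn_integral_reflect:
  fixes f :: "'a::euclidean_space \<Rightarrow> ennreal"
  assumes "f \<in> borel_measurable borel"
  shows "(\<integral>\<^sup>+x. f (a - x) \<partial>lborel) = (\<integral>\<^sup>+x. f x \<partial>lborel)"
  using nn_integral_affine[OF assms, of "-1" a] by simp

text \<open>Lebesgue measure is the image of the product measure over \<open>Basis\<close>, so
  tensor products integrate coordinate by coordinate. This serves the integrable weight and the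
  Gaussian.\<close>

lemma
  fixes f :: "'a::euclidean_space \<Rightarrow> real \<Rightarrow> 'b::{real_normed_field,banach,second_countable_topology}"
  assumes f: "\<And>b. b \<in> Basis \<Longrightarrow> integrable lborel (f b)"
  shows integrable_prod_Basis: "integrable lborel (\<lambda>x. \<Prod>b\<in>Basis. f b (x \<bullet> b))"
    and integral_prod_Basis: "(\<integral>x. (\<Prod>b\<in>Basis. f b (x \<bullet> b)) \<partial>lborel) = (\<Prod>b\<in>Basis. \<integral>x. f b x \<partial>lborel)"
proof -
  interpret product_sigma_finite "\<lambda>_::'a. lborel :: real measure" by standard
  have [measurable]: "f b \<in> borel_measurable borel" if "b \<in> Basis" for b
    using borel_measurable_integrable[OF f[OF that]] by simp
  have m: "(\<lambda>x. \<Prod>b\<in>Basis. f b (x \<bullet> b)) \<in> borel_measurable borel"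
    by measurable
  have e: "(\<Sum>b\<in>Basis. g b *\<^sub>R b) \<bullet> c = g c" if "c \<in> Basis" for g :: "'a \<Rightarrow> real" and c
    using that by (simp add: inner_sum_left inner_Basis if_distrib cong: if_cong)
  have p: "(\<lambda>g. \<Prod>b\<in>Basis. f b ((\<Sum>b\<in>Basis. g b *\<^sub>R b) \<bullet> b)) = (\<lambda>g. \<Prod>b\<in>Basis. f b (g b))"
    by (intro ext prod.cong) (auto simp: e)
  have t: "(\<lambda>g. \<Sum>b\<in>Basis. g b *\<^sub>R b) \<in> (\<Pi>\<^sub>M b\<in>Basis. (lborel :: real measure)) \<rightarrow>\<^sub>M (borel :: 'a measure)"
    by measurable
  show "integrable lborel (\<lambda>x. \<Prod>b\<in>Basis. f b (x \<bullet> b))"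
    by (subst lborel_eq, subst integrable_distr_eq[OF t m], unfold p)
      (intro product_integrable_prod f finite_Basis)
  show "(\<integral>x. (\<Prod>b\<in>Basis. f b (x \<bullet> b)) \<partial>lborel) = (\<Prod>b\<in>Basis. \<integral>x. f b x \<partial>lborel)"
    by (subst (1) lborel_eq, subst integral_distr[OF t m], unfold p)
      (intro product_integral_prod f finite_Basis)
qed

lemma weight_measurable [measurable]: "(\<lambda>x::'a::euclidean_space. (1 + norm x) ^ N) \<in> borel_measurable borel"
  by measurable

text \<open>Comparison with a product of one-dimensional Cauchy profiles: each factor
  \<open>1 + (x \<bullet> b)\<^sup>2\<close> is at most \<open>(1 + norm x)\<^sup>2\<close>, and
  there are \<open>DIM('a)\<close> of them, whence the order \<open>2 * DIM('a)\<close> used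
  throughout.\<close>

lemma integrable_inverse_weight:
  assumes "2 * DIM('a) \<le> M"
  shows "integrable lborel (\<lambda>x::'a::euclidean_space. 1 / (1 + norm x) ^ M)"
proof (rule Bochner_Integration.integrable_bound)
  have "integrable lborel (\<lambda>x::real. inverse (1 + x\<^sup>2))"
    using integrable_inverse_1_plus_square by (simp add: set_integrable_def)
  then show "integrable lborel (\<lambda>x::'a. \<Prod>b\<in>Basis. inverse (1 + (x \<bullet> b)\<^sup>2))"
    by (rule integrable_prod_Basis)
  have "1 / (1 + norm x) ^ M \<le> (\<Prod>b\<in>Basis. inverse (1 + (x \<bullet> b)\<^sup>2))" for x :: 'a
  proof -
    have "(\<Prod>b\<in>Basis. 1 + (x \<bullet> b)\<^sup>2) \<le> (\<Prod>b\<in>(Basis::'a set). (1 + norm x)\<^sup>2)"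
    proof (rule prod_mono)
      fix b :: 'a assume "b \<in> Basis"
      then have "(x \<bullet> b)\<^sup>2 \<le> (norm x)\<^sup>2"
        using Basis_le_norm by (metis abs_le_square_iff abs_norm_cancel)
      moreover have "(1 + norm x)\<^sup>2 = 1 + (norm x)\<^sup>2 + 2 * norm x" by (simp add: power2_sum)
      ultimately have "1 + (x \<bullet> b)\<^sup>2 \<le> (1 + norm x)\<^sup>2" using norm_ge_zero[of x] by linarith
      then show "0 \<le> 1 + (x \<bullet> b)\<^sup>2 \<and> 1 + (x \<bullet> b)\<^sup>2 \<le> (1 + norm x)\<^sup>2"
        by (simp add: add_nonneg_nonneg)
    qed
    also have "\<dots> = (1 + norm x) ^ (2 * DIM('a))" by (simp add: power_mult)
    also have "\<dots> \<le> (1 + norm x) ^ M" by (rule weight_mono[OF assms])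
    finally have "(\<Prod>b\<in>Basis. 1 + (x \<bullet> b)\<^sup>2) \<le> (1 + norm x) ^ M" .
    moreover have "0 < (\<Prod>b\<in>Basis. 1 + (x \<bullet> b)\<^sup>2)"
      by (intro prod_pos) (auto intro: add_pos_nonneg)
    ultimately have "1 / (1 + norm x) ^ M \<le> 1 / (\<Prod>b\<in>Basis. 1 + (x \<bullet> b)\<^sup>2)"
      by (intro divide_left_mono) auto
    also have "\<dots> = (\<Prod>b\<in>Basis. inverse (1 + (x \<bullet> b)\<^sup>2))"
      by (simp add: prod_inversef[symmetric] divide_inverse)
    finally show ?thesis .
  qed
  then show "AE x in lborel. norm (1 / (1 + norm x) ^ M) \<le> norm (\<Prod>b\<in>Basis. inverse (1 + ((x::'a) \<bullet> b)\<^sup>2))"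
    by (intro AE_I2) (auto simp: abs_prod intro: order_trans)
qed measurable


section \<open>Rapidly decreasing and polynomially growing functions\<close>

text \<open>Decay and continuity without derivatives. This class is stable under products with
  growing functions and under modulation, and it suffices for convolution and for Fourier
  transforms; regularity always comes from the other, Schwartz, factor.\<close>

definition rapid :: "('a::euclidean_space \<Rightarrow> complex) \<Rightarrow> bool" where
  "rapid f \<longleftrightarrow> continuous_on UNIV f \<and> (\<forall>N. \<exists>C. \<forall>x. (1 + norm x) ^ N * cmod (f x) \<le> C)"

definition growing :: "('a::euclidean_space \<Rightarrow> complex) \<Rightarrow> bool" where
  "growing f \<longleftrightarrow> continuous_on UNIV f \<and> (\<exists>N C. \<forall>x. cmod (f x) \<le> C * (1 + norm x) ^ N)"

lemma rapid_continuous: "rapid f \<Longrightarrow> continuous_on UNIV f"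
  by (simp add: rapid_def)

lemma growing_continuous: "growing f \<Longrightarrow> continuous_on UNIV f"
  by (simp add: growing_def)

lemma rapid_measurable: "rapid f \<Longrightarrow> f \<in> borel_measurable borel"
  by (simp add: rapid_def borel_measurable_continuous_onI)

lemma growing_measurable: "growing f \<Longrightarrow> f \<in> borel_measurable borel"
  by (simp add: growing_def borel_measurable_continuous_onI)

lemma rapidE:
  assumes "rapid f" obtains C where "0 < C" "\<And>x. (1 + norm x) ^ N * cmod (f x) \<le> C"
proof -
  obtain C where C: "\<forall>x. (1 + norm x) ^ N * cmod (f x) \<le> C" using assms by (auto simp: rapid_def)
  show ?thesis
  proof (rule that[of "max 1 C"])
    show "(1 + norm x) ^ N * cmod (f x) \<le> max 1 C" for x
      using C by (simp add: le_max_iff_disj)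
  qed simp
qed

lemma growingE:
  assumes "growing f" obtains N C where "0 < C" "\<And>x. cmod (f x) \<le> C * (1 + norm x) ^ N"
proof -
  obtain C N where C: "\<forall>x. cmod (f x) \<le> C * (1 + norm x) ^ N" using assms by (auto simp: growing_def)
  show ?thesis
  proof (rule that[of "max 1 C" N])
    show "cmod (f x) \<le> max 1 C * (1 + norm x) ^ N" for x
      by (rule order_trans[OF C[rule_format]]) (intro mult_right_mono, auto)
  qed simp
qed

lemma schwartz_rapid: "f \<in> schwartz \<Longrightarrow> rapid f"
  unfolding rapid_def
proof (intro conjI allI)
  assume f: "f \<in> schwartz"
  show "continuous_on UNIV f" using f by (rule schwartz_continuous)
  fix N
  obtain C where "sbound N 0 f C" by (rule schwartz_sboundE[OF f])
  then show "\<exists>C. \<forall>x. (1 + norm x) ^ N * cmod (f x) \<le> C" using sboundD0 by blast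
qed

lemma rapid_growing: assumes "rapid f" shows "growing f"
proof -
  obtain C where "\<And>x. (1 + norm x) ^ 0 * cmod (f x) \<le> C" by (rule rapidE[OF assms, of 0]) blast
  then show ?thesis using assms unfolding growing_def rapid_def
    by (intro conjI exI[of _ 0] exI[of _ C]) auto
qed

lemma rapid_mult_growing:
  assumes "rapid f" "growing g" shows "rapid (\<lambda>x. f x * g x)"
  unfolding rapid_def
proof (intro conjI allI)
  show "continuous_on UNIV (\<lambda>x. f x * g x)"
    using assms by (intro continuous_intros rapid_continuous growing_continuous)
  fix N
  obtain M C where C: "0 < C" "\<And>x. cmod (g x) \<le> C * (1 + norm x) ^ M" using growingE[OF assms(2)] by metis
  obtain D where D: "\<And>x. (1 + norm x) ^ (N + M) * cmod (f x) \<le> D" using rapidE[OF assms(1)] by metis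
  have "(1 + norm x) ^ N * cmod (f x * g x) \<le> C * D" for x
  proof -
    have "(1 + norm x) ^ N * cmod (f x * g x) \<le> (1 + norm x) ^ N * (cmod (f x) * (C * (1 + norm x) ^ M))"
      unfolding norm_mult by (intro mult_left_mono C) auto
    also have "\<dots> = C * ((1 + norm x) ^ (N + M) * cmod (f x))" by (simp add: power_add algebra_simps)
    also have "\<dots> \<le> C * D" using C D by (intro mult_left_mono) auto
    finally show ?thesis .
  qed
  then show "\<exists>C. \<forall>x. (1 + norm x) ^ N * cmod (f x * g x) \<le> C" by blast
qed

lemma growing_affine:
  assumes "growing f" shows "growing (\<lambda>x. f (a + c *\<^sub>R x))"
proof -
  obtain M C where C: "0 < C" "\<And>x. cmod (f x) \<le> C * (1 + norm x) ^ M" using growingE[OF assms] by metis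
  have "cmod (f (a + c *\<^sub>R x)) \<le> (C * (1 + norm a) ^ M * (1 + \<bar>c\<bar>) ^ M) * (1 + norm x) ^ M" for x
  proof -
    have "1 + norm (c *\<^sub>R x) \<le> (1 + \<bar>c\<bar>) * (1 + norm x)" by (simp add: algebra_simps)
    then have "(1 + norm (c *\<^sub>R x)) ^ M \<le> ((1 + \<bar>c\<bar>) * (1 + norm x)) ^ M" by (intro power_mono) auto
    then have "(1 + norm (a + c *\<^sub>R x)) ^ M \<le> (1 + norm a) ^ M * ((1 + \<bar>c\<bar>) ^ M * (1 + norm x) ^ M)"
      using weight_add[of a "c *\<^sub>R x" M]
      by (smt (verit) mult_left_mono power_mult_distrib weight_pos)
    then have "C * (1 + norm (a + c *\<^sub>R x)) ^ M \<le> C * ((1 + norm a) ^ M * ((1 + \<bar>c\<bar>) ^ M * (1 + norm x) ^ M))"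
      using C(1) by (intro mult_left_mono) auto
    with C(2)[of "a + c *\<^sub>R x"] show ?thesis by (simp add: mult.assoc)
  qed
  moreover have "continuous_on UNIV (\<lambda>x. f (a + c *\<^sub>R x))"
    by (rule continuous_on_compose2[OF growing_continuous[OF assms]]) (auto intro!: continuous_intros)
  ultimately show ?thesis unfolding growing_def by blast
qed

lemma rapid_affine:
  assumes "rapid f" "c \<noteq> 0" shows "rapid (\<lambda>x. f (a + c *\<^sub>R x))"
  unfolding rapid_def
proof (intro conjI allI)
  show "continuous_on UNIV (\<lambda>x. f (a + c *\<^sub>R x))"
    by (rule continuous_on_compose2[OF rapid_continuous[OF assms(1)]]) (auto intro!: continuous_intros)
  fix N
  obtain C where C: "0 < C" "\<And>x. (1 + norm x) ^ N * cmod (f x) \<le> C" using rapidE[OF assms(1)] by metis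
  let ?m = "max 1 (1 / \<bar>c\<bar>)"
  have "(1 + norm x) ^ N * cmod (f (a + c *\<^sub>R x)) \<le> ?m ^ N * (1 + norm a) ^ N * C" for x
  proof -
    let ?y = "a + c *\<^sub>R x"
    have "1 + norm x = 1 + norm (c *\<^sub>R x) * (1 / \<bar>c\<bar>)"
      using assms(2) by simp
    also have "\<dots> \<le> ?m + norm (c *\<^sub>R x) * ?m"
      by (intro add_mono mult_left_mono) auto
    also have "\<dots> = ?m * (1 + norm (?y - a))" by (simp add: algebra_simps)
    finally have "(1 + norm x) ^ N \<le> (?m * (1 + norm (?y - a))) ^ N"
      by (intro power_mono) auto
    also have "\<dots> \<le> ?m ^ N * ((1 + norm ?y) ^ N * (1 + norm a) ^ N)"
      unfolding power_mult_distrib by (intro mult_left_mono weight_diff) auto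
    finally have "(1 + norm x) ^ N * cmod (f ?y) \<le> ?m ^ N * ((1 + norm ?y) ^ N * (1 + norm a) ^ N) * cmod (f ?y)"
      by (intro mult_right_mono) auto
    also have "\<dots> = ?m ^ N * (1 + norm a) ^ N * ((1 + norm ?y) ^ N * cmod (f ?y))"
      by (simp add: algebra_simps)
    also have "\<dots> \<le> ?m ^ N * (1 + norm a) ^ N * C" by (intro mult_left_mono C) auto
    finally show ?thesis .
  qed
  then show "\<exists>C. \<forall>x. (1 + norm x) ^ N * cmod (f (a + c *\<^sub>R x)) \<le> C" by blast
qed

lemma rapid_shift: "rapid f \<Longrightarrow> rapid (\<lambda>x. f (x + a))"
  using rapid_affine[of f 1 a] by (simp add: add.commute)

lemma rapid_reflect: "rapid f \<Longrightarrow> rapid (\<lambda>x. f (a - x))"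
  using rapid_affine[of f "-1" a] by simp

lemma rapid_cmult: "rapid (f :: 'a::euclidean_space \<Rightarrow> complex) \<Longrightarrow> rapid (\<lambda>x. a * f x)"
proof -
  assume "rapid f"
  moreover have "growing (\<lambda>x::'a. a)"
    unfolding growing_def by (intro conjI continuous_intros exI[of _ 0] exI[of _ "cmod a"]) simp
  ultimately show ?thesis using rapid_mult_growing[of f "\<lambda>x. a"] by (simp add: mult.commute)
qed

lemma growing_shift: "growing f \<Longrightarrow> growing (\<lambda>x. f (x + a))"
  using growing_affine[of f a 1] by (simp add: add.commute)

lemma integrable_of_decay:
  fixes f :: "'a::euclidean_space \<Rightarrow> 'b :: {banach, second_countable_topology}"
  assumes [measurable]: "f \<in> borel_measurable borel"
    and "\<And>x. (1 + norm x) ^ (2 * DIM('a)) * norm (f x) \<le> C"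
  shows "integrable lborel f"
proof (rule Bochner_Integration.integrable_bound)
  show "integrable lborel (\<lambda>x::'a. C * (1 / (1 + norm x) ^ (2 * DIM('a))))"
    by (intro integrable_mult_right integrable_inverse_weight) simp
  show "AE x in lborel. norm (f x) \<le> norm (C * (1 / (1 + norm x) ^ (2 * DIM('a))))"
  proof (rule AE_I2)
    fix x :: 'a
    have "norm (f x) \<le> C / (1 + norm x) ^ (2 * DIM('a))"
      using assms(2)[of x] weight_pos[of x "2 * DIM('a)"] by (simp add: pos_le_divide_eq mult.commute)
    also have "\<dots> \<le> norm (C * (1 / (1 + norm x) ^ (2 * DIM('a))))"
      using abs_ge_self[of "C / (1 + norm x) ^ (2 * DIM('a))"] by simp
    finally show "norm (f x) \<le> norm (C * (1 / (1 + norm x) ^ (2 * DIM('a))))" .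
  qed
qed simp

lemma rapid_integrable: assumes "rapid f" shows "integrable lborel f"
proof -
  obtain C where "\<And>x. (1 + norm x) ^ (2 * DIM('a)) * cmod (f x) \<le> C" by (rule rapidE[OF assms]) blast
  then show ?thesis by (rule integrable_of_decay[OF rapid_measurable[OF assms]])
qed

lemma rapid_weight: assumes "rapid f" shows "rapid (\<lambda>x. of_real ((1 + norm x) ^ N) * f x)"
proof -
  have "growing (\<lambda>x::'a. complex_of_real ((1 + norm x) ^ N))"
    unfolding growing_def by (intro conjI exI[of _ N] exI[of _ 1] continuous_intros) (auto simp del: of_real_power)
  from rapid_mult_growing[OF assms this] show ?thesis by (simp add: mult.commute)
qed

lemma rapid_integrable_weight:
  assumes "rapid f" shows "integrable lborel (\<lambda>x. (1 + norm x) ^ N * cmod (f x))"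
  using integrable_norm[OF rapid_integrable[OF rapid_weight[OF assms, of N]]]
  by (simp add: norm_mult del: of_real_power)

lemma rapid_integrable_weight_increment:
  assumes "rapid f" shows "integrable lborel (\<lambda>x. norm x * (1 + norm x) ^ N * cmod (f x))"
proof (rule Bochner_Integration.integrable_bound[OF rapid_integrable_weight[OF assms, of "Suc N"]])
  have [measurable]: "f \<in> borel_measurable borel" using rapid_measurable[OF assms] .
  show "(\<lambda>x. norm x * (1 + norm x) ^ N * cmod (f x)) \<in> borel_measurable lborel" by measurable
  show "AE x in lborel. norm (norm x * (1 + norm x) ^ N * cmod (f x)) \<le> norm ((1 + norm x) ^ Suc N * cmod (f x))"
    by (intro AE_I2) (auto simp: abs_mult power_abs intro!: mult_right_mono)
qed

text \<open>The common form of the exchanges of integrals in Fourier and convolution identities: two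
  integrable factors and a bounded kernel, which is a product of characters or a weighted
  convolution kernel.\<close>

lemma
  fixes f :: "'a::euclidean_space \<Rightarrow> complex" and g :: "'b::euclidean_space \<Rightarrow> complex"
  assumes f: "integrable lborel f" and g: "integrable lborel g"
    and K [measurable]: "(\<lambda>(x, y). K x y) \<in> borel_measurable (borel \<Otimes>\<^sub>M borel)"
    and B: "\<And>x y. cmod (K x y) \<le> B"
  shows integrable_pair_kernel: "integrable (lborel \<Otimes>\<^sub>M lborel) (\<lambda>(x, y). f x * g y * K x y)"
    and Fubini_kernel: "(\<integral>y. (\<integral>x. f x * g y * K x y \<partial>lborel) \<partial>lborel) = (\<integral>x. (\<integral>y. f x * g y * K x y \<partial>lborel) \<partial>lborel)"
proof -
  have [measurable]: "f \<in> borel_measurable borel" "g \<in> borel_measurable borel" using f g by auto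
  have "integrable (lborel \<Otimes>\<^sub>M lborel) (\<lambda>(x, y). f x * g y)"
  proof (rule lborel_pair.Fubini_integrable)
    show "(\<lambda>(x, y). f x * g y) \<in> borel_measurable (lborel \<Otimes>\<^sub>M lborel)" by measurable
    show "integrable lborel (\<lambda>x. \<integral>y. norm (case (x, y) of (x, y) \<Rightarrow> f x * g y) \<partial>lborel)"
      using integrable_mult_left[OF integrable_norm[OF f]] by (simp add: norm_mult)
    show "AE x in lborel. integrable lborel (\<lambda>y. case (x, y) of (x, y) \<Rightarrow> f x * g y)"
      using integrable_mult_right[OF g] by simp
  qed
  then have "integrable (lborel \<Otimes>\<^sub>M lborel) (\<lambda>p. (case p of (x, y) \<Rightarrow> f x * g y) * complex_of_real B)"
    by (rule integrable_mult_left)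
  then show *: "integrable (lborel \<Otimes>\<^sub>M lborel) (\<lambda>(x, y). f x * g y * K x y)"
  proof (rule Bochner_Integration.integrable_bound)
    show "(\<lambda>(x, y). f x * g y * K x y) \<in> borel_measurable (lborel \<Otimes>\<^sub>M lborel)" by measurable
    have "0 \<le> B" using B[of undefined undefined] norm_ge_zero by (rule order_trans[rotated])
    then show "AE p in lborel \<Otimes>\<^sub>M lborel. norm (case p of (x, y) \<Rightarrow> f x * g y * K x y)
      \<le> norm ((case p of (x, y) \<Rightarrow> f x * g y) * complex_of_real B)"
      using B by (intro AE_I2) (auto simp: norm_mult split: prod.split intro!: mult_left_mono)
  qed
  show "(\<integral>y. (\<integral>x. f x * g y * K x y \<partial>lborel) \<partial>lborel) = (\<integral>x. (\<integral>y. f x * g y * K x y \<partial>lborel) \<partial>lborel)"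
    by (rule lborel_pair.Fubini_integral[OF *])
qed

lemma integrable_mult_bounded:
  fixes f g :: "'a::euclidean_space \<Rightarrow> complex"
  assumes "integrable lborel g" and [measurable]: "f \<in> borel_measurable borel" and "\<And>x. cmod (f x) \<le> B"
  shows "integrable lborel (\<lambda>x. f x * g x)"
proof (rule Bochner_Integration.integrable_bound)
  show "integrable lborel (\<lambda>x. of_real B * g x)" using assms by simp
  show "(\<lambda>x. f x * g x) \<in> borel_measurable lborel" using assms by measurable
  show "AE x in lborel. cmod (f x * g x) \<le> cmod (of_real B * g x)"
    using order_trans[OF assms(3) abs_ge_self] by (intro AE_I2) (auto simp: norm_mult intro!: mult_right_mono)
qed


section \<open>Convolution\<close>

definition fconv :: "('a::euclidean_space \<Rightarrow> complex) \<Rightarrow> ('a \<Rightarrow> complex) \<Rightarrow> 'a \<Rightarrow> complex" where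
  "fconv f g x = (LINT t|lborel. f (x - t) * g t)"

lemma fconv_commute: "fconv f g = fconv g f"
proof
  fix x
  have "fconv f g x = (LINT t|lborel. f (x - (x - t)) * g (x - t))"
    unfolding fconv_def by (rule integral_reflect[of "\<lambda>t. f (x - t) * g t" x, symmetric])
  then show "fconv f g x = fconv g f x" by (simp add: fconv_def mult.commute)
qed

lemma fconv_shift_left: "fconv (\<lambda>x. f (x + a)) g x = fconv f g (x + a)"
  by (simp add: fconv_def algebra_simps)

lemma fconv_shift_right: "fconv f (\<lambda>x. g (x + a)) x = fconv f g (x + a)"
  using fconv_shift_left[of g a f] by (simp add: fconv_commute[of f])

text \<open>Derivatives fall on the Schwartz factor: its quadratic remainder is uniform in the
  integration variable and therefore integrates against \<open>\<psi>\<close>.\<close>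

lemma
  fixes \<phi> \<psi> :: "'a::euclidean_space \<Rightarrow> complex"
  assumes \<phi>: "\<phi> \<in> schwartz" and \<psi>: "integrable lborel \<psi>"
  shows iterated_partial_fconv: "bs \<in> lists Basis \<Longrightarrow> iterated_partial bs (fconv \<phi> \<psi>) = fconv (iterated_partial bs \<phi>) \<psi>"
    and smooth_fconv: "smooth (fconv \<phi> \<psi>)"
    and fconv_partial_integrable: "bs \<in> lists Basis \<Longrightarrow> integrable lborel (\<lambda>t. iterated_partial bs \<phi> (x - t) * \<psi> t)"
proof -
  have [measurable]: "\<psi> \<in> borel_measurable borel" using \<psi> by auto
  have sm: "smooth \<phi>" using \<phi> by (rule schwartz_smooth)
  have int: "integrable lborel (\<lambda>t. iterated_partial bs \<phi> (x - t) * \<psi> t)" if l: "bs \<in> lists Basis" for bs x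
  proof -
    obtain C where C: "sbound 0 (length bs) \<phi> C" by (rule schwartz_sboundE[OF \<phi>])
    show ?thesis
    proof (rule integrable_mult_bounded[OF \<psi>])
      have "continuous_on UNIV (\<lambda>t. iterated_partial bs \<phi> (x - t))"
        by (rule continuous_on_compose2[OF smooth_continuous[OF sm l]]) (auto intro!: continuous_intros)
      then show "(\<lambda>t. iterated_partial bs \<phi> (x - t)) \<in> borel_measurable borel"
        by (rule borel_measurable_continuous_onI)
      show "cmod (iterated_partial bs \<phi> (x - t)) \<le> C" for t
        using sboundD[OF C l order_refl, of "x - t"] by simp
    qed
  qed
  then show "bs \<in> lists Basis \<Longrightarrow> integrable lborel (\<lambda>t. iterated_partial bs \<phi> (x - t) * \<psi> t)" by blast
  let ?F = "\<lambda>bs. fconv (iterated_partial bs \<phi>) \<psi>"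
  have 1: "?F [] = fconv \<phi> \<psi>" by simp
  have 2: "(?F bs has_derivative (\<lambda>h. \<Sum>b\<in>Basis. (h \<bullet> b) *\<^sub>R ?F (b # bs) x)) (at x)"
    if l: "bs \<in> lists Basis" for bs x
  proof -
    obtain C where C: "sbound 0 (Suc (Suc (length bs))) \<phi> C" by (rule schwartz_sboundE[OF \<phi>])
    show ?thesis
    proof (rule has_derivative_of_quadratic_error)
    fix z
    let ?D = "\<lambda>t. iterated_partial bs \<phi> (z - t) - iterated_partial bs \<phi> (x - t) -
      (\<Sum>b\<in>Basis. ((z - x) \<bullet> b) *\<^sub>R iterated_partial (b # bs) \<phi> (x - t))"
    have lb: "b # bs \<in> lists Basis" if "b \<in> Basis" for b using l that by auto
    have i: "integrable lborel (\<lambda>t. \<Sum>b\<in>Basis. ((z - x) \<bullet> b) *\<^sub>R (iterated_partial (b # bs) \<phi> (x - t) * \<psi> t))"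
      by (intro Bochner_Integration.integrable_sum integrable_scaleR_right int lb)
    have "(\<Sum>b\<in>Basis. ((z - x) \<bullet> b) *\<^sub>R ?F (b # bs) x) =
       (LINT t|lborel. (\<Sum>b\<in>Basis. ((z - x) \<bullet> b) *\<^sub>R (iterated_partial (b # bs) \<phi> (x - t) * \<psi> t)))"
      unfolding fconv_def
      by (subst Bochner_Integration.integral_sum) (auto intro!: integrable_scaleR_right int lb)
    moreover have e: "?D t * \<psi> t = iterated_partial bs \<phi> (z - t) * \<psi> t - iterated_partial bs \<phi> (x - t) * \<psi> t -
        (\<Sum>b\<in>Basis. ((z - x) \<bullet> b) *\<^sub>R (iterated_partial (b # bs) \<phi> (x - t) * \<psi> t))" for t
      by (simp add: left_diff_distrib sum_distrib_right)
    ultimately have "?F bs z - ?F bs x - (\<Sum>b\<in>Basis. ((z - x) \<bullet> b) *\<^sub>R ?F (b # bs) x) = (LINT t|lborel. ?D t * \<psi> t)"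
      unfolding fconv_def e
      by (simp only: Bochner_Integration.integral_diff[OF Bochner_Integration.integrable_diff[OF int[OF l] int[OF l]] i]
          Bochner_Integration.integral_diff[OF int[OF l] int[OF l]])
    also have "cmod \<dots> \<le> (LINT t|lborel. (real DIM('a))\<^sup>2 * C * (norm (z - x))\<^sup>2 * cmod (\<psi> t))"
    proof (rule Bochner_Integration.integral_norm_bound_integral)
      show "integrable lborel (\<lambda>t. ?D t * \<psi> t)"
        unfolding e by (rule Bochner_Integration.integrable_diff[OF Bochner_Integration.integrable_diff[OF int[OF l] int[OF l]] i])
      show "integrable lborel (\<lambda>t. (real DIM('a))\<^sup>2 * C * (norm (z - x))\<^sup>2 * cmod (\<psi> t))"
        using \<psi> by (intro integrable_mult_right integrable_norm)
      show "cmod (?D t * \<psi> t) \<le> (real DIM('a))\<^sup>2 * C * (norm (z - x))\<^sup>2 * cmod (\<psi> t)" for t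
        using linear_approximation_error[OF sm C l order_refl, of "z - t" "x - t"]
        by (simp add: norm_mult mult_right_mono)
    qed
    finally show "cmod (?F bs z - ?F bs x - (\<Sum>b\<in>Basis. ((z - x) \<bullet> b) *\<^sub>R ?F (b # bs) x))
       \<le> ((real DIM('a))\<^sup>2 * C * (LINT t|lborel. cmod (\<psi> t))) * (norm (z - x))\<^sup>2"
      by (simp add: mult_ac)
    qed (rule bounded_linear_partials)
  qed
  show "bs \<in> lists Basis \<Longrightarrow> iterated_partial bs (fconv \<phi> \<psi>) = fconv (iterated_partial bs \<phi>) \<psi>"
    by (rule iterated_partial_eqI[of ?F, OF 1 2])
  show "smooth (fconv \<phi> \<psi>)"
    by (rule smoothI[of ?F, OF 1 2])
qed

text \<open>Peetre's inequality splits the weight at \<open>x\<close> between \<open>x - t\<close>,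
  absorbed by the seminorm of \<open>\<phi>\<close>, and \<open>t\<close>, absorbed by the weighted
  mass of \<open>\<psi>\<close>. No derivative of \<open>\<psi>\<close> enters.\<close>

lemma sbound_fconv:
  fixes \<phi> \<psi> :: "'a::euclidean_space \<Rightarrow> complex"
  assumes \<phi>: "\<phi> \<in> schwartz" "sbound N k \<phi> C" and \<psi>: "rapid \<psi>"
  shows "sbound N k (fconv \<phi> \<psi>) (C * (LINT t|lborel. (1 + norm t) ^ N * cmod (\<psi> t)))"
  unfolding sbound_def
proof (intro ballI impI allI)
  fix bs :: "'a list" and x assume bs: "bs \<in> lists Basis" "length bs \<le> k"
  have "(1 + norm x) ^ N * cmod (fconv (iterated_partial bs \<phi>) \<psi> x) =
     cmod (LINT t|lborel. of_real ((1 + norm x) ^ N) * (iterated_partial bs \<phi> (x - t) * \<psi> t))"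
    unfolding fconv_def integral_mult_right_zero norm_mult norm_of_real by simp
  also have "\<dots> \<le> (LINT t|lborel. C * ((1 + norm t) ^ N * cmod (\<psi> t)))"
  proof (rule Bochner_Integration.integral_norm_bound_integral)
    show "integrable lborel (\<lambda>t. of_real ((1 + norm x) ^ N) * (iterated_partial bs \<phi> (x - t) * \<psi> t))"
      by (intro integrable_mult_right fconv_partial_integrable[OF \<phi>(1) rapid_integrable[OF \<psi>] bs(1)])
    show "integrable lborel (\<lambda>t. C * ((1 + norm t) ^ N * cmod (\<psi> t)))"
      by (intro integrable_mult_right rapid_integrable_weight[OF \<psi>])
    fix t
    have "(1 + norm x) ^ N * cmod (iterated_partial bs \<phi> (x - t))
      \<le> ((1 + norm (x - t)) ^ N * (1 + norm t) ^ N) * cmod (iterated_partial bs \<phi> (x - t))"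
      using weight_add[of "x - t" t N] by (intro mult_right_mono) auto
    also have "\<dots> = (1 + norm t) ^ N * ((1 + norm (x - t)) ^ N * cmod (iterated_partial bs \<phi> (x - t)))"
      by (simp add: mult_ac)
    also have "\<dots> \<le> (1 + norm t) ^ N * C"
      by (intro mult_left_mono sboundD[OF \<phi>(2) bs]) auto
    finally have "(1 + norm x) ^ N * cmod (iterated_partial bs \<phi> (x - t)) * cmod (\<psi> t) \<le> (1 + norm t) ^ N * C * cmod (\<psi> t)"
      by (rule mult_right_mono) auto
    then show "cmod (of_real ((1 + norm x) ^ N) * (iterated_partial bs \<phi> (x - t) * \<psi> t)) \<le> C * ((1 + norm t) ^ N * cmod (\<psi> t))"
      unfolding norm_mult norm_of_real by (simp add: mult_ac)
  qed
  finally show "(1 + norm x) ^ N * cmod (iterated_partial bs (fconv \<phi> \<psi>) x) \<le> C * (LINT t|lborel. (1 + norm t) ^ N * cmod (\<psi> t))"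
    by (simp add: iterated_partial_fconv[OF \<phi>(1) rapid_integrable[OF \<psi>] bs(1)])
qed

lemma schwartz_fconv: "\<phi> \<in> schwartz \<Longrightarrow> rapid \<psi> \<Longrightarrow> fconv \<phi> \<psi> \<in> schwartz"
proof (rule schwartzI)
  assume *: "\<phi> \<in> schwartz" "rapid \<psi>"
  then show "smooth (fconv \<phi> \<psi>)" by (intro smooth_fconv rapid_integrable)
  fix N k
  obtain C where "sbound N k \<phi> C" by (rule schwartz_sboundE[OF *(1)])
  then show "\<exists>C. sbound N k (fconv \<phi> \<psi>) C" using sbound_fconv[OF *(1) _ *(2)] by (intro exI)
qed

section \<open>Fourier inversion\<close>

definition echar :: "'a::euclidean_space \<Rightarrow> 'a \<Rightarrow> complex" where
  "echar \<xi> x = exp (2 * of_real pi * \<i> * of_real (x \<bullet> \<xi>))"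

lemma norm_echar [simp]: "cmod (echar \<xi> x) = 1"
  by (simp add: echar_def)

lemma echar_nonzero [simp]: "echar \<xi> x \<noteq> 0"
  by (simp add: echar_def)

lemma echar_add: "echar \<xi> (x + y) = echar \<xi> x * echar \<xi> y"
  by (simp add: echar_def exp_add[symmetric] inner_add_left algebra_simps)

lemma echar_add_left: "echar (\<xi> + \<eta>) x = echar \<xi> x * echar \<eta> x"
  by (simp add: echar_def exp_add[symmetric] inner_add_right algebra_simps)

lemma echar_zero [simp]: "echar \<xi> 0 = 1"
  by (simp add: echar_def)

lemma echar_minus_left: "echar (-\<xi>) x = echar \<xi> (-x)"
  by (simp add: echar_def)

lemma echar_scaleR: "echar \<xi> (c *\<^sub>R x) = echar (c *\<^sub>R \<xi>) x"
  by (simp add: echar_def)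

lemma continuous_echar: "continuous_on S (echar \<xi>)"
  unfolding echar_def by (intro continuous_intros)

lemma echar_measurable [measurable (raw)]:
  assumes [measurable]: "f \<in> borel_measurable M" "g \<in> borel_measurable M"
  shows "(\<lambda>x. echar (f x) (g x)) \<in> borel_measurable M"
proof -
  have [measurable]: "(exp :: complex \<Rightarrow> complex) \<in> borel_measurable borel"
    by (intro borel_measurable_continuous_onI continuous_on_exp continuous_on_id)
  show ?thesis unfolding echar_def by measurable
qed

lemma fourier_echar: "fourier f \<xi> = (LINT x|lborel. f x * echar \<xi> (- x))"
  by (simp add: fourier_def echar_def)

lemma fourier_measurable [measurable]:
  assumes [measurable]: "f \<in> borel_measurable borel" shows "fourier f \<in> borel_measurable borel"
  unfolding fourier_echar by measurable

lemma fourier_bound: "integrable lborel f \<Longrightarrow> cmod (fourier f \<xi>) \<le> (LINT x|lborel. cmod (f x))"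
  unfolding fourier_echar
  by (rule order_trans[OF integral_norm_bound]) (simp add: norm_mult)

lemma fourier_affine:
  fixes f :: "'a::euclidean_space \<Rightarrow> complex"
  assumes c: "c \<noteq> 0"
  shows "fourier (\<lambda>x. f (a + c *\<^sub>R x)) \<xi> = (1 / \<bar>c\<bar> ^ DIM('a)) *\<^sub>R (echar ((1 / c) *\<^sub>R \<xi>) a * fourier f ((1 / c) *\<^sub>R \<xi>))"
proof -
  have *: "f (a + c *\<^sub>R x) * echar ((1 / c) *\<^sub>R \<xi>) (- (a + c *\<^sub>R x)) * echar ((1 / c) *\<^sub>R \<xi>) a = f (a + c *\<^sub>R x) * echar \<xi> (- x)" for x
  proof -
    have "echar ((1 / c) *\<^sub>R \<xi>) (- (a + c *\<^sub>R x)) * echar ((1 / c) *\<^sub>R \<xi>) a = echar ((1 / c) *\<^sub>R \<xi>) (c *\<^sub>R (- x))"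
      by (simp add: echar_add[symmetric])
    also have "\<dots> = echar \<xi> (- x)" unfolding echar_scaleR using c by simp
    finally show ?thesis by (simp add: mult.assoc)
  qed
  have "fourier f ((1 / c) *\<^sub>R \<xi>) = \<bar>c\<bar> ^ DIM('a) *\<^sub>R (LINT x|lborel. f (a + c *\<^sub>R x) * echar ((1 / c) *\<^sub>R \<xi>) (- (a + c *\<^sub>R x)))"
    unfolding fourier_echar by (rule integral_affine[OF c])
  then have "echar ((1 / c) *\<^sub>R \<xi>) a * fourier f ((1 / c) *\<^sub>R \<xi>) = \<bar>c\<bar> ^ DIM('a) *\<^sub>R
     (LINT x|lborel. f (a + c *\<^sub>R x) * echar ((1 / c) *\<^sub>R \<xi>) (- (a + c *\<^sub>R x)) * echar ((1 / c) *\<^sub>R \<xi>) a)"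
    by (simp add: mult.commute)
  also have "\<dots> = \<bar>c\<bar> ^ DIM('a) *\<^sub>R fourier (\<lambda>x. f (a + c *\<^sub>R x)) \<xi>"
    unfolding * by (simp add: fourier_echar)
  finally show ?thesis using c by simp
qed

section \<open>Gaussian densities and the inversion formula\<close>

definition gauss :: "'a::euclidean_space \<Rightarrow> real" where
  "gauss x = (\<Prod>b\<in>Basis. std_normal_density (x \<bullet> b))"

lemma gauss_measurable [measurable]: "gauss \<in> borel_measurable borel"
  unfolding gauss_def by measurable

lemma gauss_nonneg: "0 \<le> gauss x"
  unfolding gauss_def by (intro prod_nonneg) (auto simp: normal_density_nonneg)

lemma gauss_zero: "gauss (0::'a::euclidean_space) = 1 / sqrt (2 * pi) ^ DIM('a)"
  by (simp add: gauss_def std_normal_density_def power_divide)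

lemma gauss_le: "gauss (x::'a) \<le> gauss (0::'a::euclidean_space)"
  unfolding gauss_def by (intro prod_mono) (auto simp: normal_density_nonneg std_normal_density_def intro!: divide_right_mono)

lemma continuous_gauss: "continuous_on S gauss"
  unfolding gauss_def std_normal_density_def by (intro continuous_intros) auto

lemma gauss_integrable: "integrable lborel gauss"
  unfolding gauss_def by (intro integrable_prod_Basis) auto

lemma gauss_integral: "(LINT x|lborel. gauss (x::'a::euclidean_space)) = 1"
proof -
  have "(LINT x|lborel. std_normal_density x) = 1"
    using integral_std_normal_moment_even[of 0] by simp
  then show ?thesis unfolding gauss_def by (subst integral_prod_Basis) auto
qed

text \<open>Each coordinate is the characteristic function of the standard normal law at
  \<open>2 * pi * (\<xi> \<bullet> b)\<close>, namely \<open>exp (- t\<^sup>2 / 2)\<close>.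
  Rewriting this as a density produces the factors \<open>sqrt (2 * pi)\<close>.\<close>

lemma gauss_fourier:
  "(LINT x|lborel. of_real (gauss x) * echar \<xi> x) =
     of_real (sqrt (2 * pi) ^ DIM('a) * gauss ((2 * pi) *\<^sub>R (\<xi>::'a::euclidean_space)))"
proof -
  define f where "f = (\<lambda>b::'a. \<lambda>s. complex_of_real (std_normal_density s) * iexp (2 * pi * (\<xi> \<bullet> b) * s))"
  have f: "integrable lborel (f b)" for b
  proof (rule Bochner_Integration.integrable_bound[where f=std_normal_density])
    show "f b \<in> borel_measurable lborel" unfolding f_def by measurable
  qed (auto simp: f_def norm_mult)
  have int: "(LINT s|lborel. f b s) = of_real (sqrt (2 * pi) * std_normal_density (2 * pi * (\<xi> \<bullet> b)))" for b
  proof -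
    have "char std_normal_distribution t = (LINT s|lborel. of_real (std_normal_density s) * iexp (t * s))" for t
      unfolding char_def by (subst integral_density) (auto simp: scaleR_conv_of_real normal_density_nonneg)
    then have "(LINT s|lborel. f b s) = of_real (exp (- ((2 * pi * (\<xi> \<bullet> b))\<^sup>2) / 2))"
      unfolding f_def using char_std_normal_distribution by metis
    then show ?thesis by (simp add: std_normal_density_def)
  qed
  have *: "of_real (gauss x) * echar \<xi> x = (\<Prod>b\<in>Basis. f b (x \<bullet> b))" for x
  proof -
    have "echar \<xi> x = exp (\<Sum>b\<in>Basis. \<i> * complex_of_real (2 * pi * (\<xi> \<bullet> b) * (x \<bullet> b)))"
      unfolding echar_def by (subst euclidean_inner) (simp add: sum_distrib_left mult_ac)
    then show ?thesis unfolding gauss_def f_def by (simp add: exp_sum prod.distrib)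
  qed
  have "(LINT x|lborel. of_real (gauss x) * echar \<xi> x) = (\<Prod>b\<in>Basis. LINT s|lborel. f b s)"
    unfolding * by (rule integral_prod_Basis[OF f])
  then show ?thesis
    by (simp add: int gauss_def prod.distrib)
qed

text \<open>Gaussian regularisation of the inversion integral turns it into a convolution of \<open>f\<close> with an
  approximate identity.\<close>

lemma fourier_inversion_regularised:
  fixes f :: "'a::euclidean_space \<Rightarrow> complex"
  assumes f: "integrable lborel f" and e: "0 < e"
  shows "(LINT \<xi>|lborel. fourier f \<xi> * echar \<xi> x * of_real (gauss (e *\<^sub>R \<xi>)))
    = of_real (1 / sqrt (2 * pi) ^ DIM('a)) * (LINT s|lborel. f (x - (e / (2 * pi)) *\<^sub>R s) * of_real (gauss s))"
proof -
  have [measurable]: "f \<in> borel_measurable borel" using f by auto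
  have g: "integrable lborel (\<lambda>\<xi>::'a. complex_of_real (gauss (e *\<^sub>R \<xi>)))"
    using integrable_affine[OF gauss_integrable, of e 0] e by auto
  have "(LINT \<xi>|lborel. fourier f \<xi> * echar \<xi> x * of_real (gauss (e *\<^sub>R \<xi>)))
     = (LINT \<xi>|lborel. LINT t|lborel. f t * of_real (gauss (e *\<^sub>R \<xi>)) * (echar \<xi> (- t) * echar \<xi> x))"
  proof (rule Bochner_Integration.integral_cong[OF refl])
    fix \<xi>
    have *: "(\<lambda>t. f t * of_real (gauss (e *\<^sub>R \<xi>)) * (echar \<xi> (- t) * echar \<xi> x))
      = (\<lambda>t. (f t * echar \<xi> (- t)) * (echar \<xi> x * of_real (gauss (e *\<^sub>R \<xi>))))"
      by (simp add: mult_ac)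
    show "fourier f \<xi> * echar \<xi> x * of_real (gauss (e *\<^sub>R \<xi>)) =
      (LINT t|lborel. f t * of_real (gauss (e *\<^sub>R \<xi>)) * (echar \<xi> (- t) * echar \<xi> x))"
      unfolding * fourier_echar integral_mult_left_zero by (rule mult.assoc)
  qed
  also have "\<dots> = (LINT t|lborel. LINT \<xi>|lborel. f t * of_real (gauss (e *\<^sub>R \<xi>)) * (echar \<xi> (- t) * echar \<xi> x))"
    by (rule Fubini_kernel[OF f g, where B=1]) (auto simp: norm_mult)
  also have "\<dots> = (LINT t|lborel. f t * of_real (1 / e ^ DIM('a) * (sqrt (2 * pi) ^ DIM('a) * gauss ((2 * pi / e) *\<^sub>R (x - t)))))"
  proof (rule Bochner_Integration.integral_cong[OF refl])
    fix t
    have "(LINT \<xi>|lborel. of_real (gauss (e *\<^sub>R \<xi>)) * (echar \<xi> (- t) * echar \<xi> x))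
      = (1 / e ^ DIM('a)) *\<^sub>R (LINT \<xi>|lborel. of_real (gauss (e *\<^sub>R ((1 / e) *\<^sub>R \<xi>))) * echar ((1 / e) *\<^sub>R \<xi>) (x - t))"
      by (subst integral_affine[of "1 / e" _ 0]) (use e in \<open>simp_all add: echar_add[symmetric] power_divide\<close>)
    also have "\<dots> = (1 / e ^ DIM('a)) *\<^sub>R (LINT \<xi>|lborel. of_real (gauss \<xi>) * echar ((1 / e) *\<^sub>R (x - t)) \<xi>)"
      using e by (simp add: echar_def inner_commute)
    also have "\<dots> = of_real (1 / e ^ DIM('a) * (sqrt (2 * pi) ^ DIM('a) * gauss ((2 * pi / e) *\<^sub>R (x - t))))"
      unfolding gauss_fourier by (simp add: scaleR_conv_of_real)
    finally show "(LINT \<xi>|lborel. f t * of_real (gauss (e *\<^sub>R \<xi>)) * (echar \<xi> (- t) * echar \<xi> x)) =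
      f t * of_real (1 / e ^ DIM('a) * (sqrt (2 * pi) ^ DIM('a) * gauss ((2 * pi / e) *\<^sub>R (x - t))))"
      by (simp add: mult.assoc)
  qed
  \<comment> \<open>The substitution t = x - (e / (2 pi)) s turns the argument of the Gaussian into
    s. Its Jacobian and the other constants combine to \<open>1 / sqrt (2 * pi) ^ DIM('a)\<close>,
    the value of \<open>gauss\<close> at 0.\<close>
  also have "\<dots> = \<bar>- (e / (2 * pi))\<bar> ^ DIM('a) *\<^sub>R (LINT s|lborel. f (x + (- (e / (2 * pi))) *\<^sub>R s) *
     of_real (1 / e ^ DIM('a) * (sqrt (2 * pi) ^ DIM('a) * gauss ((2 * pi / e) *\<^sub>R (x - (x + (- (e / (2 * pi))) *\<^sub>R s))))))"
    by (rule integral_affine) (use e in auto)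
  also have "\<dots> = (e / (2 * pi)) ^ DIM('a) *\<^sub>R (LINT s|lborel. of_real (1 / e ^ DIM('a) * sqrt (2 * pi) ^ DIM('a)) *
     (f (x - (e / (2 * pi)) *\<^sub>R s) * of_real (gauss s)))"
    using e by (simp add: mult_ac)
  also have "\<dots> = of_real ((e / (2 * pi)) ^ DIM('a) * (1 / e ^ DIM('a) * sqrt (2 * pi) ^ DIM('a))) *
    (LINT s|lborel. f (x - (e / (2 * pi)) *\<^sub>R s) * of_real (gauss s))"
    by (simp add: scaleR_conv_of_real)
  also have "(e / (2 * pi)) ^ DIM('a) * (1 / e ^ DIM('a) * sqrt (2 * pi) ^ DIM('a)) = 1 / sqrt (2 * pi) ^ DIM('a)"
  proof -
    have "(2 * pi) ^ DIM('a) = sqrt (2 * pi) ^ DIM('a) * sqrt (2 * pi) ^ DIM('a)"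
      unfolding power_mult_distrib[symmetric] by simp
    then show ?thesis using e by (simp add: power_divide divide_simps)
  qed
  finally show ?thesis .
qed

text \<open>Let the regularisation parameter tend to 0 by dominated convergence on both sides:
  integrability of the transform dominates the left, boundedness of \<open>f\<close> the right, and
  continuity of \<open>f\<close> identifies the limit. The common factor \<open>gauss 0\<close>
  cancels.\<close>

theorem fourier_inversion:
  fixes f :: "'a::euclidean_space \<Rightarrow> complex"
  assumes f: "integrable lborel f" "continuous_on UNIV f" "\<And>x. cmod (f x) \<le> B"
    and fhat: "integrable lborel (fourier f)"
  shows "(LINT \<xi>|lborel. fourier f \<xi> * echar \<xi> x) = f x"
proof -
  have [measurable]: "f \<in> borel_measurable borel" using f by auto
  define e where "e = (\<lambda>n. inverse (real (Suc n)))"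
  have e: "0 < e n" for n by (simp add: e_def)
  have e0: "e \<longlonglongrightarrow> 0" unfolding e_def by (rule LIMSEQ_inverse_real_of_nat)
  let ?k = "1 / sqrt (2 * pi) ^ DIM('a)"
  have B: "0 \<le> B" using f(3) norm_ge_zero order_trans by blast
  have L: "(\<lambda>n. LINT \<xi>|lborel. fourier f \<xi> * echar \<xi> x * of_real (gauss (e n *\<^sub>R \<xi>)))
     \<longlonglongrightarrow> (LINT \<xi>|lborel. fourier f \<xi> * echar \<xi> x * of_real ?k)"
  proof (rule integral_dominated_convergence[where w="\<lambda>\<xi>. cmod (fourier f \<xi>) * gauss (0::'a)"])
    have "(\<lambda>n. gauss (e n *\<^sub>R \<xi>)) \<longlonglongrightarrow> gauss (0 *\<^sub>R \<xi>)" for \<xi> :: 'a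
      by (rule continuous_on_tendsto_compose[OF continuous_gauss[of UNIV] tendsto_scaleR[OF e0 tendsto_const]]) auto
    then have "(\<lambda>n. gauss (e n *\<^sub>R \<xi>)) \<longlonglongrightarrow> ?k" for \<xi> :: 'a by (simp add: gauss_zero)
    then show "AE \<xi> in lborel. (\<lambda>n. fourier f \<xi> * echar \<xi> x * of_real (gauss (e n *\<^sub>R \<xi>))) \<longlonglongrightarrow> fourier f \<xi> * echar \<xi> x * of_real ?k"
      by (intro AE_I2 tendsto_intros)
    show "AE \<xi> in lborel. norm (fourier f \<xi> * echar \<xi> x * of_real (gauss (e n *\<^sub>R \<xi>))) \<le> cmod (fourier f \<xi>) * gauss (0::'a)" for n
      by (intro AE_I2) (auto simp: norm_mult abs_of_nonneg[OF gauss_nonneg] intro!: mult_left_mono gauss_le)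
    show "integrable lborel (\<lambda>\<xi>. cmod (fourier f \<xi>) * gauss (0::'a))"
      using fhat by (intro integrable_mult_left integrable_norm)
  qed measurable
  have R: "(\<lambda>n. of_real ?k * (LINT s|lborel. f (x - (e n / (2 * pi)) *\<^sub>R s) * of_real (gauss s)))
     \<longlonglongrightarrow> of_real ?k * (LINT s|lborel. f x * of_real (gauss (s::'a)))"
  proof (rule tendsto_mult_left, rule integral_dominated_convergence[where w="\<lambda>s. B * gauss s"])
    have "(\<lambda>n. f (x - (e n / (2 * pi)) *\<^sub>R s)) \<longlonglongrightarrow> f (x - (0 / (2 * pi)) *\<^sub>R s)" for s
      by (rule continuous_on_tendsto_compose[OF f(2) tendsto_diff[OF tendsto_const tendsto_scaleR[OF tendsto_divide[OF e0 tendsto_const] tendsto_const]]]) auto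
    then show "AE s in lborel. (\<lambda>n. f (x - (e n / (2 * pi)) *\<^sub>R s) * of_real (gauss s)) \<longlonglongrightarrow> f x * of_real (gauss s)"
      by (intro AE_I2 tendsto_intros) simp
    show "AE s in lborel. norm (f (x - (e n / (2 * pi)) *\<^sub>R s) * of_real (gauss s)) \<le> B * gauss s" for n
      by (intro AE_I2) (auto simp: norm_mult abs_of_nonneg[OF gauss_nonneg] intro!: mult_right_mono f(3) gauss_nonneg)
    show "integrable lborel (\<lambda>s. B * gauss (s::'a))"
      by (intro integrable_mult_right gauss_integrable)
  qed measurable
  have "of_real ?k * (LINT \<xi>|lborel. fourier f \<xi> * echar \<xi> x) = of_real ?k * (LINT s|lborel. f x * of_real (gauss (s::'a)))"
    using LIMSEQ_unique[OF L R[folded fourier_inversion_regularised[OF f(1) e]]]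
    by (simp add: mult_ac)
  moreover have "(LINT s|lborel. f x * of_real (gauss (s::'a))) = f x"
    by (simp add: gauss_integral)
  ultimately show ?thesis by simp
qed


section \<open>Band-limited functions\<close>

text \<open>The spectrum lies in the open ball of radius \<open>R\<close>. The transform is bounded
  because \<open>f\<close> is integrable, hence it is integrable, and inversion becomes available
  without any differentiability of \<open>f\<close>.\<close>

definition bandlimited :: "real \<Rightarrow> ('a::euclidean_space \<Rightarrow> complex) \<Rightarrow> bool" where
  "bandlimited R f \<longleftrightarrow> rapid f \<and> (\<forall>\<xi>. R \<le> norm \<xi> \<longrightarrow> fourier f \<xi> = 0)"

lemma bandlimited_rapid: "bandlimited R f \<Longrightarrow> rapid f"
  by (simp add: bandlimited_def)

lemma bandlimited_fourier_integrable:
  fixes f :: "'a::euclidean_space \<Rightarrow> complex"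
  assumes "bandlimited R f" shows "integrable lborel (fourier f)"
proof -
  let ?I = "LINT x|lborel. cmod (f x)"
  have f: "integrable lborel f" using assms bandlimited_rapid rapid_integrable by blast
  then have [measurable]: "f \<in> borel_measurable borel" by auto
  have "(1 + norm \<xi>) ^ (2 * DIM('a)) * cmod (fourier f \<xi>) \<le> (1 + \<bar>R\<bar>) ^ (2 * DIM('a)) * ?I" for \<xi>
  proof (cases "R \<le> norm \<xi>")
    case True
    then show ?thesis using assms by (auto simp: bandlimited_def)
  next
    case False
    then show ?thesis using fourier_bound[OF f, of \<xi>]
      by (intro mult_mono power_mono) auto
  qed
  then show ?thesis by (rule integrable_of_decay[rotated]) measurable
qed

lemma bandlimited_inversion:
  assumes "bandlimited R f"
  shows "(LINT \<xi>|lborel. fourier f \<xi> * echar \<xi> x) = f x"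
proof -
  have r: "rapid f" using assms by (rule bandlimited_rapid)
  obtain C where "\<And>x. (1 + norm x) ^ 0 * cmod (f x) \<le> C" by (rule rapidE[OF r, of 0]) blast
  then have C: "cmod (f x) \<le> C" for x by simp
  show ?thesis
    by (rule fourier_inversion[OF rapid_integrable[OF r] rapid_continuous[OF r] C bandlimited_fourier_integrable[OF assms]])
qed

lemma bandlimited_eqI:
  assumes "bandlimited R f" "bandlimited S g" "\<And>\<xi>. fourier f \<xi> = fourier g \<xi>"
  shows "f = g"
proof
  fix x
  have "fourier f = fourier g" using assms(3) by (rule ext)
  then show "f x = g x"
    using bandlimited_inversion[OF assms(1), of x] bandlimited_inversion[OF assms(2), of x] by simp
qed

lemma bandlimited_affine:
  assumes "bandlimited R f" "c \<noteq> 0"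
  shows "bandlimited (\<bar>c\<bar> * R) (\<lambda>x. f (a + c *\<^sub>R x))"
  unfolding bandlimited_def
proof (intro conjI allI impI)
  show "rapid (\<lambda>x. f (a + c *\<^sub>R x))" by (rule rapid_affine[OF bandlimited_rapid[OF assms(1)] assms(2)])
  fix \<xi> :: 'a assume "\<bar>c\<bar> * R \<le> norm \<xi>"
  then have "R \<le> norm ((1 / c) *\<^sub>R \<xi>)" using assms(2) by (simp add: pos_le_divide_eq mult.commute)
  then have "fourier f ((1 / c) *\<^sub>R \<xi>) = 0" using assms(1) by (auto simp: bandlimited_def simp del: norm_scaleR)
  then show "fourier (\<lambda>x. f (a + c *\<^sub>R x)) \<xi> = 0" by (simp add: fourier_affine[OF assms(2)])
qed

lemma bandlimited_shift: "bandlimited R f \<Longrightarrow> bandlimited R (\<lambda>x. f (x + a))"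
  using bandlimited_affine[of R f 1 a] by (simp add: add.commute)

lemma bandlimited_reflect: "bandlimited R f \<Longrightarrow> bandlimited R (\<lambda>x. f (a - x))"
  using bandlimited_affine[of R f "-1" a] by simp

lemma fourier_cmult: "fourier (\<lambda>x. c * f x) \<xi> = c * fourier f \<xi>"
  by (simp add: fourier_echar mult.assoc)

lemma bandlimited_cmult: "bandlimited R f \<Longrightarrow> bandlimited R (\<lambda>x. c * f x)"
  by (auto simp: bandlimited_def fourier_cmult intro: rapid_cmult)

lemma integrable_mult_echar: "integrable lborel f \<Longrightarrow> integrable lborel (\<lambda>x. f x * echar \<xi> (- x))"
  by (rule Bochner_Integration.integrable_bound[of _ f]) (auto simp: norm_mult)

lemma fourier_diff:
  assumes "integrable lborel f" "integrable lborel g"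
  shows "fourier (\<lambda>x. f x - g x) \<xi> = fourier f \<xi> - fourier g \<xi>"
  unfolding fourier_echar
  by (simp add: left_diff_distrib Bochner_Integration.integral_diff integrable_mult_echar assms)

text \<open>Insert the inversion formula for \<open>a\<close> and exchange the integrals. In this
  inverted form the convolution is read off from the product of transforms: it vanishes if the
  product does, and it returns \<open>b\<close> if the transform of \<open>a\<close> is 1 on the
  spectrum of \<open>b\<close>.\<close>

lemma fconv_fourier:
  fixes a b :: "'a::euclidean_space \<Rightarrow> complex"
  assumes a: "bandlimited R a" and b: "integrable lborel b"
  shows "fconv a b x = (LINT \<xi>|lborel. fourier a \<xi> * fourier b \<xi> * echar \<xi> x)"
proof -
  have [measurable]: "b \<in> borel_measurable borel" using b by auto
  note fa = bandlimited_fourier_integrable[OF a]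
  have "fconv a b x = (LINT t|lborel. (LINT \<xi>|lborel. fourier a \<xi> * echar \<xi> (x - t)) * b t)"
    by (simp add: fconv_def bandlimited_inversion[OF a])
  also have "\<dots> = (LINT t|lborel. LINT \<xi>|lborel. b t * fourier a \<xi> * (echar \<xi> x * echar \<xi> (- t)))"
  proof (rule Bochner_Integration.integral_cong[OF refl])
    fix t
    have *: "(\<lambda>\<xi>. b t * fourier a \<xi> * (echar \<xi> x * echar \<xi> (- t))) =
      (\<lambda>\<xi>. (fourier a \<xi> * echar \<xi> (x - t)) * b t)"
      using echar_add[of _ x "- t"] by (simp add: mult_ac)
    show "(LINT \<xi>|lborel. fourier a \<xi> * echar \<xi> (x - t)) * b t =
      (LINT \<xi>|lborel. b t * fourier a \<xi> * (echar \<xi> x * echar \<xi> (- t)))"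
      unfolding * integral_mult_left_zero ..
  qed
  also have "\<dots> = (LINT \<xi>|lborel. LINT t|lborel. b t * fourier a \<xi> * (echar \<xi> x * echar \<xi> (- t)))"
    by (rule Fubini_kernel[OF b fa, where B=1, symmetric]) (auto simp: norm_mult)
  also have "\<dots> = (LINT \<xi>|lborel. LINT t|lborel. (fourier a \<xi> * echar \<xi> x) * (b t * echar \<xi> (- t)))"
    by (simp add: mult_ac)
  also have "\<dots> = (LINT \<xi>|lborel. fourier a \<xi> * fourier b \<xi> * echar \<xi> x)"
  proof (rule Bochner_Integration.integral_cong[OF refl])
    fix \<xi>
    show "(LINT t|lborel. (fourier a \<xi> * echar \<xi> x) * (b t * echar \<xi> (- t))) = fourier a \<xi> * fourier b \<xi> * echar \<xi> x"
      unfolding fourier_echar[of b] integral_mult_right_zero by (simp add: mult_ac)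
  qed
  finally show ?thesis .
qed

lemma fconv_eq_0:
  assumes "bandlimited R a" "integrable lborel b" "\<And>\<xi>. fourier a \<xi> * fourier b \<xi> = 0"
  shows "fconv a b x = 0"
  unfolding fconv_fourier[OF assms(1,2)] assms(3) by simp

lemma fconv_eq_right:
  assumes "bandlimited R a" "bandlimited S b" "\<And>\<xi>. fourier b \<xi> \<noteq> 0 \<Longrightarrow> fourier a \<xi> = 1"
  shows "fconv a b = b"
proof
  fix x
  have "fourier a \<xi> * fourier b \<xi> = fourier b \<xi>" for \<xi> using assms(3)[of \<xi>] by (cases "fourier b \<xi> = 0") auto
  then show "fconv a b x = b x"
    unfolding fconv_fourier[OF assms(1) rapid_integrable[OF bandlimited_rapid[OF assms(2)]]]
    by (simp only: bandlimited_inversion[OF assms(2)])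
qed

text \<open>Writing \<open>b\<close> by inversion exhibits the transform of the product as the
  convolution of the transforms. For frequencies of norm at least \<open>R + S\<close> the triangle
  inequality puts one of the two arguments outside its band.\<close>

lemma bandlimited_mult:
  fixes a b :: "'a::euclidean_space \<Rightarrow> complex"
  assumes a: "bandlimited R a" and b: "bandlimited S b"
  shows "bandlimited (R + S) (\<lambda>x. a x * b x)"
  unfolding bandlimited_def
proof (intro conjI allI impI)
  note ra = bandlimited_rapid[OF a] and rb = bandlimited_rapid[OF b]
  have ia: "integrable lborel a" and fb: "integrable lborel (fourier b)"
    using rapid_integrable[OF ra] bandlimited_fourier_integrable[OF b] by auto
  have [measurable]: "a \<in> borel_measurable borel" using ia by auto
  show "rapid (\<lambda>x. a x * b x)" using ra rapid_growing[OF rb] by (rule rapid_mult_growing)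
  fix \<xi> :: 'a assume \<xi>: "R + S \<le> norm \<xi>"
  have "fourier (\<lambda>x. a x * b x) \<xi> = (LINT x|lborel. a x * (LINT \<eta>|lborel. fourier b \<eta> * echar \<eta> x) * echar \<xi> (- x))"
    unfolding fourier_echar[of "\<lambda>x. a x * b x"] bandlimited_inversion[OF b] ..
  also have "\<dots> = (LINT x|lborel. LINT \<eta>|lborel. a x * fourier b \<eta> * (echar \<eta> x * echar \<xi> (- x)))"
  proof (rule Bochner_Integration.integral_cong[OF refl])
    fix x
    have *: "(\<lambda>\<eta>. a x * fourier b \<eta> * (echar \<eta> x * echar \<xi> (- x))) =
      (\<lambda>\<eta>. a x * (fourier b \<eta> * echar \<eta> x) * echar \<xi> (- x))"
      by (simp add: mult_ac)
    show "a x * (LINT \<eta>|lborel. fourier b \<eta> * echar \<eta> x) * echar \<xi> (- x) =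
      (LINT \<eta>|lborel. a x * fourier b \<eta> * (echar \<eta> x * echar \<xi> (- x)))"
      unfolding * integral_mult_left_zero integral_mult_right_zero ..
  qed
  also have "\<dots> = (LINT \<eta>|lborel. LINT x|lborel. a x * fourier b \<eta> * (echar \<eta> x * echar \<xi> (- x)))"
    by (rule Fubini_kernel[OF ia fb, where B=1, symmetric]) (auto simp: norm_mult)
  also have "\<dots> = (LINT \<eta>|lborel. LINT x|lborel. fourier b \<eta> * (a x * echar (\<xi> - \<eta>) (- x)))"
  proof -
    have "echar \<eta> x * echar \<xi> (- x) = echar (\<xi> - \<eta>) (- x)" for \<eta> x
      using echar_add_left[of \<xi> "- \<eta>" "- x"] by (simp add: echar_minus_left)
    then show ?thesis by (simp add: mult_ac)
  qed
  also have "\<dots> = (LINT \<eta>|lborel. fourier b \<eta> * fourier a (\<xi> - \<eta>))"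
    by (simp add: fourier_echar[of a])
  also have "(\<lambda>\<eta>. fourier b \<eta> * fourier a (\<xi> - \<eta>)) = (\<lambda>\<eta>. 0)"
  proof
    fix \<eta>
    have "norm \<xi> \<le> norm \<eta> + norm (\<xi> - \<eta>)" using norm_triangle_ineq[of \<eta> "\<xi> - \<eta>"] by simp
    then have "S \<le> norm \<eta> \<or> R \<le> norm (\<xi> - \<eta>)" using \<xi> by linarith
    then show "fourier b \<eta> * fourier a (\<xi> - \<eta>) = 0" using a b by (auto simp: bandlimited_def)
  qed
  finally show "fourier (\<lambda>x. a x * b x) \<xi> = 0" by simp
qed

section \<open>Tempered distributions\<close>

lemma tempered_boundE:
  fixes u :: "('a::euclidean_space \<Rightarrow> complex) \<Rightarrow> complex"
  assumes "u \<in> tempered"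
  obtains N K where "0 < K" "\<And>\<psi> C. \<psi> \<in> schwartz \<Longrightarrow> sbound N N \<psi> C \<Longrightarrow> cmod (u \<psi>) \<le> K * C"
proof -
  obtain N :: nat and C :: real where C: "\<forall>f\<in>schwartz. ennreal (cmod (u f)) \<le> ennreal C * schwartz_seminorm N f"
    using assms unfolding tempered_def by blast
  show ?thesis
  proof (rule that[of "max 1 C"])
    fix \<psi> :: "'a \<Rightarrow> complex" and B assume \<psi>: "\<psi> \<in> schwartz" "sbound N N \<psi> B"
    have B: "0 \<le> B" using \<psi>(2) by (rule sbound_nonneg)
    have "ennreal (cmod (u \<psi>)) \<le> ennreal C * schwartz_seminorm N \<psi>" using C \<psi>(1) by blast
    also have "\<dots> \<le> ennreal (max 1 C) * ennreal B"
      by (intro mult_mono ennreal_leI) (use \<psi> B in \<open>auto simp: schwartz_seminorm_le_iff\<close>)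
    also have "\<dots> = ennreal (max 1 C * B)" using B by (simp add: ennreal_mult)
    finally show "cmod (u \<psi>) \<le> max 1 C * B"
      using B by (subst (asm) ennreal_le_iff) auto
  qed simp
qed

lemma temperedI:
  fixes u :: "('a::euclidean_space \<Rightarrow> complex) \<Rightarrow> complex"
  assumes "\<And>f g a b. f \<in> schwartz \<Longrightarrow> g \<in> schwartz \<Longrightarrow> u (\<lambda>x. a * f x + b * g x) = a * u f + b * u g"
    and K: "0 \<le> K" "\<And>\<psi> C. \<psi> \<in> schwartz \<Longrightarrow> sbound N N \<psi> C \<Longrightarrow> cmod (u \<psi>) \<le> K * C"
    and "\<And>f. f \<notin> schwartz \<Longrightarrow> u f = 0"
  shows "u \<in> tempered"
proof -
  have "ennreal (cmod (u f)) \<le> ennreal K * schwartz_seminorm N f" if f: "f \<in> schwartz" for f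
  proof -
    define B where "B = enn2real (schwartz_seminorm N f)"
    have B: "ennreal B = schwartz_seminorm N f" "0 \<le> B"
      using f by (auto simp: B_def schwartz_def less_top[symmetric])
    then have "sbound N N f B" by (subst schwartz_seminorm_le_iff[symmetric]) auto
    then have "cmod (u f) \<le> K * B" by (rule K(2)[OF f])
    then have "ennreal (cmod (u f)) \<le> ennreal (K * B)" by (rule ennreal_leI)
    then show ?thesis using B K(1) by (simp add: ennreal_mult)
  qed
  then show ?thesis using assms unfolding tempered_def by blast
qed

lemma tempered_lincomb:
  assumes "u \<in> tempered" "f \<in> schwartz" "g \<in> schwartz"
  shows "u (\<lambda>x. a * f x + b * g x) = a * u f + b * u g"
  using assms unfolding tempered_def by blast

lemma tempered_not_schwartz: "u \<in> tempered \<Longrightarrow> f \<notin> schwartz \<Longrightarrow> u f = 0"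
  unfolding tempered_def by blast

lemma tempered_diff: "u \<in> tempered \<Longrightarrow> f \<in> schwartz \<Longrightarrow> g \<in> schwartz \<Longrightarrow> u (\<lambda>x. f x - g x) = u f - u g"
  using tempered_lincomb[of u f g 1 "-1"] by simp

lemma tempered_cmult: "u \<in> tempered \<Longrightarrow> f \<in> schwartz \<Longrightarrow> u (\<lambda>x. a * f x) = a * u f"
  using tempered_lincomb[of u f f a 0] by simp

lemma tempered_zero: "u \<in> tempered \<Longrightarrow> u (\<lambda>x. 0) = 0"
  using tempered_cmult[OF _ schwartz_zero, of u 0] by simp

lemma tempered_sum:
  assumes u: "u \<in> tempered"
  shows "finite I \<Longrightarrow> (\<And>i. i \<in> I \<Longrightarrow> f i \<in> schwartz) \<Longrightarrow> u (\<lambda>x. \<Sum>i\<in>I. c i * f i x) = (\<Sum>i\<in>I. c i * u (f i))"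
proof (induction I rule: finite_induct)
  case empty
  then show ?case using tempered_zero[OF u] by simp
next
  case (insert i I)
  have "(\<lambda>x. \<Sum>i\<in>I. c i * f i x) \<in> schwartz"
    using insert by (intro schwartz_sum schwartz_cmult) auto
  then have "u (\<lambda>x. c i * f i x + 1 * (\<Sum>i\<in>I. c i * f i x)) = c i * u (f i) + 1 * u (\<lambda>x. \<Sum>i\<in>I. c i * f i x)"
    by (intro tempered_lincomb[OF u] insert) auto
  then show ?case using insert by simp
qed

lemma tempered_comb:
  fixes u v :: "('a::euclidean_space \<Rightarrow> complex) \<Rightarrow> complex"
  assumes u: "u \<in> tempered" and v: "v \<in> tempered"
  shows "(\<lambda>\<psi>. a * u \<psi> + b * v \<psi>) \<in> tempered"
proof -
  obtain N K where K: "0 < K" "\<And>\<psi> C. \<psi> \<in> schwartz \<Longrightarrow> sbound N N \<psi> C \<Longrightarrow> cmod (u \<psi>) \<le> K * C"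
    using tempered_boundE[OF u] by metis
  obtain M L where L: "0 < L" "\<And>\<psi> C. \<psi> \<in> schwartz \<Longrightarrow> sbound M M \<psi> C \<Longrightarrow> cmod (v \<psi>) \<le> L * C"
    using tempered_boundE[OF v] by metis
  show ?thesis
  proof (rule temperedI[where K="cmod a * K + cmod b * L" and N="max N M"])
    fix \<psi> :: "'a \<Rightarrow> complex" and C assume \<psi>: "\<psi> \<in> schwartz" "sbound (max N M) (max N M) \<psi> C"
    have "cmod (a * u \<psi> + b * v \<psi>) \<le> cmod a * cmod (u \<psi>) + cmod b * cmod (v \<psi>)"
      by (rule norm_triangle_le) (simp add: norm_mult)
    also have "\<dots> \<le> cmod a * (K * C) + cmod b * (L * C)"
      by (intro add_mono mult_left_mono K(2) L(2) \<psi> sbound_mono[OF \<psi>(2)]) auto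
    finally show "cmod (a * u \<psi> + b * v \<psi>) \<le> (cmod a * K + cmod b * L) * C"
      by (simp add: algebra_simps)
  next
    show "0 \<le> cmod a * K + cmod b * L" using K L by (intro add_nonneg_nonneg mult_nonneg_nonneg) auto
  qed (auto simp: tempered_lincomb[OF u] tempered_lincomb[OF v] tempered_not_schwartz[OF u]
      tempered_not_schwartz[OF v] algebra_simps)
qed

text \<open>The functional is controlled by a single seminorm, and the tails of the series tend to 0
  in that seminorm; so it can be applied term by term.\<close>

lemma tempered_sums:
  fixes \<theta> :: "nat \<Rightarrow> 'a::euclidean_space \<Rightarrow> complex"
  assumes u: "u \<in> tempered" and \<theta>: "\<And>j. \<theta> j \<in> schwartz"
    and B: "\<And>N k j. sbound N k (\<theta> j) (B N k j)" "\<And>N k. summable (B N k)"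
  shows "(\<lambda>j. u (\<theta> j)) sums u (\<lambda>x. \<Sum>j. \<theta> j x)"
proof -
  obtain N K where K: "0 < K" "\<And>\<psi> C. \<psi> \<in> schwartz \<Longrightarrow> sbound N N \<psi> C \<Longrightarrow> cmod (u \<psi>) \<le> K * C"
    using tempered_boundE[OF u] by metis
  note S = schwartz_suminf[OF \<theta> B] and T = sbound_suminf_tail[OF \<theta> B, of N N]
  have P: "(\<lambda>x. \<Sum>j<m. \<theta> j x) \<in> schwartz" for m by (intro schwartz_sum \<theta>) auto
  have b: "cmod ((\<Sum>j<m. u (\<theta> j)) - u (\<lambda>x. \<Sum>j. \<theta> j x)) \<le> K * (\<Sum>j. B N N (j + m))" for m
  proof -
    have 1: "u (\<lambda>x. \<Sum>j<m. \<theta> j x) = (\<Sum>j<m. u (\<theta> j))"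
      using tempered_sum[OF u finite_lessThan \<theta>, where c="\<lambda>_. 1"] by simp
    have "cmod ((\<Sum>j<m. u (\<theta> j)) - u (\<lambda>x. \<Sum>j. \<theta> j x)) = cmod (u (\<lambda>x. (\<Sum>j. \<theta> j x) - (\<Sum>j<m. \<theta> j x)))"
      unfolding tempered_diff[OF u S P] 1 by (rule norm_minus_commute)
    also have "\<dots> \<le> K * (\<Sum>j. B N N (j + m))" by (rule K(2)[OF schwartz_diff[OF S P] T])
    finally show ?thesis .
  qed
  have "(\<lambda>m. (\<Sum>j<m. u (\<theta> j)) - u (\<lambda>x. \<Sum>j. \<theta> j x)) \<longlonglongrightarrow> 0"
    by (rule Lim_null_comparison[OF always_eventually tendsto_mult_right_zero[OF suminf_exist_split2[OF B(2)]]])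
      (rule allI, rule b)
  then show ?thesis unfolding sums_def by (rule LIM_zero_cancel)
qed


subsection \<open>Convolution with a Schwartz function\<close>

lemma conv_bound:
  assumes K: "\<And>\<psi> C. \<psi> \<in> schwartz \<Longrightarrow> sbound N N \<psi> C \<Longrightarrow> cmod (u \<psi>) \<le> K * C"
    and \<phi>: "\<phi> \<in> schwartz" "sbound N N \<phi> C"
  shows "cmod (conv \<phi> u x) \<le> K * C * (1 + norm x) ^ N"
proof -
  have "cmod (u (\<lambda>t. \<phi> (x - t))) \<le> K * ((1 + norm x) ^ N * C)"
    by (intro K schwartz_reflect sbound_reflect schwartz_smooth \<phi>)
  then show ?thesis by (simp add: conv_def mult_ac)
qed

lemma iterated_partial_translate:
  "smooth \<kappa> \<Longrightarrow> bs \<in> lists Basis \<Longrightarrow> iterated_partial bs (\<lambda>w. \<kappa> (w - t)) w = iterated_partial bs \<kappa> (w - t)"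
  using iterated_partial_affine[of \<kappa> bs "-t" 1] by simp

lemma translation_increment:
  fixes \<kappa> :: "'a::euclidean_space \<Rightarrow> complex"
  assumes "smooth \<kappa>" "sbound N (Suc k) \<kappa> C" "bs \<in> lists Basis" "length bs \<le> k"
  shows "(1 + norm w) ^ N * cmod (iterated_partial bs \<kappa> (w - s) - iterated_partial bs \<kappa> (w - t))
    \<le> real DIM('a) * C * (norm (s - t) * (1 + norm (s - t)) ^ N) * (1 + norm t) ^ N"
proof -
  let ?d = "cmod (iterated_partial bs \<kappa> (w - s) - iterated_partial bs \<kappa> (w - t))"
  have "(1 + norm w) ^ N * ?d \<le> ((1 + norm (w - t)) ^ N * (1 + norm t) ^ N) * ?d"
    using weight_add[of "w - t" t N] by (intro mult_right_mono) auto
  also have "\<dots> = (1 + norm t) ^ N * ((1 + norm (w - t)) ^ N * cmod (iterated_partial bs \<kappa> (w - t - (s - t)) - iterated_partial bs \<kappa> (w - t)))"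
    by (simp add: mult_ac)
  also have "\<dots> \<le> (1 + norm t) ^ N * (real DIM('a) * C * (norm (s - t) * (1 + norm (s - t)) ^ N))"
    by (intro mult_left_mono weighted_increment[OF assms]) auto
  finally show ?thesis by (simp add: mult_ac)
qed

text \<open>Continuity in \<open>x\<close> is continuity of translation of the reflected kernel,
  measured in the seminorm that controls \<open>u\<close>. It costs one derivative of
  \<open>\<phi>\<close> beyond the order of \<open>u\<close>.\<close>

lemma conv_continuous:
  fixes \<phi> :: "'a::euclidean_space \<Rightarrow> complex"
  assumes u: "u \<in> tempered" and \<phi>: "\<phi> \<in> schwartz"
  shows "continuous_on UNIV (conv \<phi> u)"
proof -
  obtain N K where K: "0 < K" "\<And>\<psi> C. \<psi> \<in> schwartz \<Longrightarrow> sbound N N \<psi> C \<Longrightarrow> cmod (u \<psi>) \<le> K * C"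
    using tempered_boundE[OF u] by metis
  define \<kappa> where "\<kappa> = (\<lambda>x. \<phi> (- x))"
  have \<kappa>: "\<kappa> \<in> schwartz" unfolding \<kappa>_def using schwartz_reflect[OF \<phi>, of 0] by simp
  obtain C where C: "sbound N (Suc N) \<kappa> C" by (rule schwartz_sboundE[OF \<kappa>])
  have sh: "(\<lambda>w. \<kappa> (w - t)) \<in> schwartz" for t using schwartz_shift[OF \<kappa>, of "-t"] by simp
  have b: "cmod (conv \<phi> u s - conv \<phi> u t) \<le> K * (real DIM('a) * C * (norm (s - t) * (1 + norm (s - t)) ^ N) * (1 + norm t) ^ N)" for s t
  proof -
    have "conv \<phi> u s - conv \<phi> u t = u (\<lambda>w. \<kappa> (w - s)) - u (\<lambda>w. \<kappa> (w - t))"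
      by (simp add: conv_def \<kappa>_def)
    also have "\<dots> = u (\<lambda>w. \<kappa> (w - s) - \<kappa> (w - t))"
      by (rule tempered_diff[OF u sh sh, symmetric])
    finally have "conv \<phi> u s - conv \<phi> u t = u (\<lambda>w. \<kappa> (w - s) - \<kappa> (w - t))" .
    moreover have "sbound N N (\<lambda>w. \<kappa> (w - s) - \<kappa> (w - t))
      (real DIM('a) * C * (norm (s - t) * (1 + norm (s - t)) ^ N) * (1 + norm t) ^ N)"
      unfolding sbound_def
    proof (intro ballI impI allI)
      fix bs :: "'a list" and w assume bs: "bs \<in> lists Basis" "length bs \<le> N"
      have "iterated_partial bs (\<lambda>w. \<kappa> (w - s) - \<kappa> (w - t)) w = iterated_partial bs \<kappa> (w - s) - iterated_partial bs \<kappa> (w - t)"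
        using iterated_partial_lincomb[OF schwartz_smooth[OF sh] schwartz_smooth[OF sh] bs(1), of 1 s "-1" t]
        by (simp add: iterated_partial_translate[OF schwartz_smooth[OF \<kappa>] bs(1)])
      then show "(1 + norm w) ^ N * cmod (iterated_partial bs (\<lambda>w. \<kappa> (w - s) - \<kappa> (w - t)) w)
        \<le> real DIM('a) * C * (norm (s - t) * (1 + norm (s - t)) ^ N) * (1 + norm t) ^ N"
        using translation_increment[OF schwartz_smooth[OF \<kappa>] C bs] by simp
    qed
    ultimately show ?thesis using K(2) schwartz_diff[OF sh sh] by simp
  qed
  have z: "((\<lambda>s. K * (real DIM('a) * C * (norm (s - t) * (1 + norm (s - t)) ^ N) * (1 + norm t) ^ N)) \<longlongrightarrow> 0) (at t)" for t :: 'a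
  proof -
    have "((\<lambda>s. K * (real DIM('a) * C * (norm (s - t) * (1 + norm (s - t)) ^ N) * (1 + norm t) ^ N)) \<longlongrightarrow>
      K * (real DIM('a) * C * (norm (t - t) * (1 + norm (t - t)) ^ N) * (1 + norm t) ^ N)) (at t)"
      by (intro tendsto_intros)
    then show ?thesis by simp
  qed
  have "((\<lambda>s. conv \<phi> u s - conv \<phi> u t) \<longlongrightarrow> 0) (at t)" for t
    by (rule Lim_null_comparison[OF always_eventually z]) (rule allI, rule b)
  then have "(conv \<phi> u \<longlongrightarrow> conv \<phi> u t) (at t)" for t by (rule LIM_zero_cancel)
  then show ?thesis unfolding continuous_on_def by simp
qed

lemma conv_growing:
  assumes u: "u \<in> tempered" and \<phi>: "\<phi> \<in> schwartz"
  shows "growing (conv \<phi> u)"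
proof -
  obtain N K where K: "0 < K" "\<And>\<psi> C. \<psi> \<in> schwartz \<Longrightarrow> sbound N N \<psi> C \<Longrightarrow> cmod (u \<psi>) \<le> K * C"
    using tempered_boundE[OF u] by metis
  obtain C where C: "sbound N N \<phi> C" by (rule schwartz_sboundE[OF \<phi>])
  show ?thesis
    unfolding growing_def using conv_continuous[OF u \<phi>] conv_bound[where u=u, OF K(2) \<phi> C] by blast
qed

text \<open>With finitely many values of \<open>G\<close> the integral is a finite linear
  combination of values of \<open>h\<close>, so a linear functional can be moved through it. This is
  the discrete version of \<open>integral_conv\<close>.\<close>

lemma integral_simple_compose:
  fixes h :: "'a::euclidean_space \<Rightarrow> complex"
  assumes G: "simple_function lborel G" and \<psi>: "integrable lborel \<psi>"
  shows "(LINT t|lborel. h (G t) * \<psi> t) = (\<Sum>v\<in>range G. (LINT t|lborel. indicator (G -` {v}) t * \<psi> t) * h v)"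
    and "integrable lborel (\<lambda>t. h (G t) * \<psi> t)"
proof -
  have fin: "finite (range G)" using G by (auto simp: simple_function_def)
  have m: "G -` {v} \<in> sets lborel" for v using simple_functionD(2)[OF G, of "{v}"] by simp
  have int: "integrable lborel (\<lambda>t. indicator (G -` {v}) t * \<psi> t)" for v
    using integrable_mult_bounded[OF \<psi>, of "indicator (G -` {v})" 1] m by (simp add: indicator_def)
  have *: "h (G t) * \<psi> t = (\<Sum>v\<in>range G. (indicator (G -` {v}) t * \<psi> t) * h v)" for t
  proof -
    have "(\<Sum>v\<in>range G. (indicator (G -` {v}) t * \<psi> t) * h v) = (\<Sum>v\<in>range G. if v = G t then \<psi> t * h v else 0)"
      by (intro sum.cong) (auto simp: indicator_def)
    then show ?thesis using fin by simp
  qed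
  show "(LINT t|lborel. h (G t) * \<psi> t) = (\<Sum>v\<in>range G. (LINT t|lborel. indicator (G -` {v}) t * \<psi> t) * h v)"
    unfolding * by (subst Bochner_Integration.integral_sum) (auto intro: int)
  show "integrable lborel (\<lambda>t. h (G t) * \<psi> t)"
    unfolding * by (intro Bochner_Integration.integrable_sum integrable_mult_left int)
qed

text \<open>A continuous functional may be pulled under the integral: replace the integration variable \<open>t\<close>
  by simple functions \<open>G m t\<close>, for which the integral is a finite sum.\<close>

lemma integral_conv:
  fixes \<phi> \<psi> :: "'a::euclidean_space \<Rightarrow> complex"
  assumes u: "u \<in> tempered" and \<phi>: "\<phi> \<in> schwartz" and \<psi>: "rapid \<psi>"
  shows "(LINT t|lborel. conv \<phi> u t * \<psi> t) = u (fconv (\<lambda>x. \<phi> (- x)) \<psi>)"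
proof -
  obtain N K where K: "0 < K" "\<And>\<psi> C. \<psi> \<in> schwartz \<Longrightarrow> sbound N N \<psi> C \<Longrightarrow> cmod (u \<psi>) \<le> K * C"
    using tempered_boundE[OF u] by metis
  define \<kappa> where "\<kappa> = (\<lambda>x. \<phi> (- x))"
  have \<kappa>: "\<kappa> \<in> schwartz" unfolding \<kappa>_def using schwartz_reflect[OF \<phi>, of 0] by simp
  have sm: "smooth \<kappa>" using \<kappa> by (rule schwartz_smooth)
  obtain C where C: "sbound N (Suc N) \<kappa> C" by (rule schwartz_sboundE[OF \<kappa>])
  have C0: "0 \<le> C" using C by (rule sbound_nonneg)
  obtain D where D: "sbound N N \<phi> D" by (rule schwartz_sboundE[OF \<phi>])
  have sh: "(\<lambda>w. \<kappa> (w - t)) \<in> schwartz" for t using schwartz_shift[OF \<kappa>, of "-t"] by simp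
  have i\<psi>: "integrable lborel \<psi>" using \<psi> by (rule rapid_integrable)
  have [measurable]: "\<psi> \<in> borel_measurable borel" using \<psi> by (rule rapid_measurable)
  have [measurable]: "conv \<phi> u \<in> borel_measurable borel"
    using conv_continuous[OF u \<phi>] by (rule borel_measurable_continuous_onI)
  \<comment> \<open>The approximations of the identity satisfy
    \<open>norm (G m t) \<le> 2 * norm t\<close>. This bound supplies the dominating functions in
    both limits below.\<close>
  have "(\<lambda>x::'a. x) \<in> borel_measurable lborel" by simp
  from borel_measurable_implies_sequence_metric[OF this, of 0]
  obtain G :: "nat \<Rightarrow> 'a \<Rightarrow> 'a" where G: "\<And>m. simple_function lborel (G m)" "\<And>t. (\<lambda>m. G m t) \<longlonglongrightarrow> t"
    "\<And>m t. norm (G m t) \<le> 2 * norm t"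
    by auto
  have [measurable]: "G m \<in> borel_measurable borel" for m
    using borel_measurable_simple_function[OF G(1), of m] by simp
  define a where "a = (\<lambda>m v. LINT t|lborel. indicator (G m -` {v}) t * \<psi> t)"
  \<comment> \<open>A Riemann sum of the convolution \<open>fconv \<kappa> \<psi>\<close>:
    \<open>a m v\<close> is the integral of \<open>\<psi>\<close> over the cell on which
    \<open>G m\<close> takes the value \<open>v\<close>.\<close>
  define S where "S = (\<lambda>m w. \<Sum>v\<in>range (G m). a m v * \<kappa> (w - v))"
  have fin: "finite (range (G m))" for m using G(1)[of m] by (auto simp: simple_function_def)
  have S: "S m \<in> schwartz" for m unfolding S_def by (intro schwartz_sum schwartz_cmult sh fin)
  have F: "fconv \<kappa> \<psi> \<in> schwartz" using \<kappa> \<psi> by (rule schwartz_fconv)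
  have uS: "u (S m) = (LINT t|lborel. conv \<phi> u (G m t) * \<psi> t)" for m
  proof -
    have "u (S m) = (\<Sum>v\<in>range (G m). a m v * u (\<lambda>w. \<kappa> (w - v)))"
      unfolding S_def by (rule tempered_sum[OF u fin sh])
    also have "\<dots> = (\<Sum>v\<in>range (G m). a m v * conv \<phi> u v)" by (simp add: conv_def \<kappa>_def)
    also have "\<dots> = (LINT t|lborel. conv \<phi> u (G m t) * \<psi> t)"
      unfolding a_def by (rule integral_simple_compose(1)[OF G(1) i\<psi>, symmetric])
    finally show ?thesis .
  qed
  have Gd: "norm (G m t - t) \<le> 3 * norm t" for m t
    using norm_triangle_ineq4[of "G m t" t] G(3)[of m t] by linarith
  have L: "(\<lambda>m. u (S m)) \<longlonglongrightarrow> (LINT t|lborel. conv \<phi> u t * \<psi> t)"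
    unfolding uS
  proof (rule integral_dominated_convergence[where w="\<lambda>t. K * D * 2 ^ N * ((1 + norm t) ^ N * cmod (\<psi> t))"])
    show "integrable lborel (\<lambda>t. K * D * 2 ^ N * ((1 + norm t) ^ N * cmod (\<psi> t)))"
      by (intro integrable_mult_right rapid_integrable_weight \<psi>)
    have "(\<lambda>m. conv \<phi> u (G m t)) \<longlonglongrightarrow> conv \<phi> u t" for t
      by (rule continuous_on_tendsto_compose[OF conv_continuous[OF u \<phi>] G(2)]) auto
    then show "AE t in lborel. (\<lambda>m. conv \<phi> u (G m t) * \<psi> t) \<longlonglongrightarrow> conv \<phi> u t * \<psi> t"
      by (intro AE_I2 tendsto_mult_right)
    show "AE t in lborel. cmod (conv \<phi> u (G m t) * \<psi> t) \<le> K * D * 2 ^ N * ((1 + norm t) ^ N * cmod (\<psi> t))" for m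
    proof (rule AE_I2)
      fix t
      have "cmod (conv \<phi> u (G m t)) \<le> K * D * (1 + norm (G m t)) ^ N" by (rule conv_bound[where u=u, OF K(2) \<phi> D])
      also have "\<dots> \<le> K * D * (2 * (1 + norm t)) ^ N"
        using K(1) sbound_nonneg[OF D] G(3)[of m t] by (intro mult_left_mono power_mono) auto
      finally have "cmod (conv \<phi> u (G m t)) * cmod (\<psi> t) \<le> K * D * (2 * (1 + norm t)) ^ N * cmod (\<psi> t)"
        by (rule mult_right_mono) auto
      then show "cmod (conv \<phi> u (G m t) * \<psi> t) \<le> K * D * 2 ^ N * ((1 + norm t) ^ N * cmod (\<psi> t))"
        unfolding power_mult_distrib norm_mult by (simp only: mult_ac)
    qed
  qed measurable
  \<comment> \<open>Up to a constant this dominates the weighted difference of the integrands of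
    \<open>S m\<close> and \<open>fconv \<kappa> \<psi>\<close>, for every \<open>w\<close> and
    every derivative of order at most \<open>N\<close>. So convergence of its integral to 0 is
    convergence in the seminorm controlling \<open>u\<close>.\<close>
  define E where "E = (\<lambda>m t. norm (G m t - t) * (1 + norm (G m t - t)) ^ N * (1 + norm t) ^ N * cmod (\<psi> t))"
  have Em [measurable]: "E m \<in> borel_measurable borel" for m unfolding E_def by measurable
  have EB: "0 \<le> E m t \<and> E m t \<le> 3 * 3 ^ N * (norm t * (1 + norm t) ^ (2 * N) * cmod (\<psi> t))" for m t
  proof
    have "norm (G m t - t) * (1 + norm (G m t - t)) ^ N \<le> (3 * norm t) * (3 * (1 + norm t)) ^ N"
      by (intro mult_mono power_mono) (use Gd[of m t] in auto)
    then have "E m t \<le> ((3 * norm t) * (3 * (1 + norm t)) ^ N) * (1 + norm t) ^ N * cmod (\<psi> t)"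
      unfolding E_def by (intro mult_right_mono) auto
    then show "E m t \<le> 3 * 3 ^ N * (norm t * (1 + norm t) ^ (2 * N) * cmod (\<psi> t))"
      unfolding power_mult_distrib mult_2 power_add by (simp only: mult_ac)
  qed (simp add: E_def)
  have iB: "integrable lborel (\<lambda>t. 3 * 3 ^ N * (norm t * (1 + norm t) ^ (2 * N) * cmod (\<psi> t)))"
    by (intro integrable_mult_right rapid_integrable_weight_increment \<psi>)
  have iE: "integrable lborel (E m)" for m
  proof (rule Bochner_Integration.integrable_bound[OF iB])
    have "norm (E m t) \<le> norm (3 * 3 ^ N * (norm t * (1 + norm t) ^ (2 * N) * cmod (\<psi> t)))" for t
      using EB[of m t] by (simp only: real_norm_def) linarith
    then show "AE t in lborel. norm (E m t) \<le> norm (3 * 3 ^ N * (norm t * (1 + norm t) ^ (2 * N) * cmod (\<psi> t)))"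
      by (rule AE_I2)
  qed simp
  have E0: "(\<lambda>m. LINT t|lborel. E m t) \<longlonglongrightarrow> (LINT t|lborel. (0 * (1 + 0) ^ N * (1 + norm (t::'a)) ^ N * cmod (\<psi> t)))"
  proof (rule integral_dominated_convergence[OF _ _ iB])
    have "(\<lambda>m. norm (G m t - t)) \<longlonglongrightarrow> norm (t - t)" for t by (intro tendsto_intros G)
    then have "(\<lambda>m. norm (G m t - t)) \<longlonglongrightarrow> 0" for t by simp
    then show "AE t in lborel. (\<lambda>m. E m t) \<longlonglongrightarrow> 0 * (1 + 0) ^ N * (1 + norm t) ^ N * cmod (\<psi> t)"
      unfolding E_def by (intro AE_I2 tendsto_intros)
    have "norm (E m t) \<le> 3 * 3 ^ N * (norm t * (1 + norm t) ^ (2 * N) * cmod (\<psi> t))" for m t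
      using EB[of m t] by (simp only: real_norm_def) linarith
    then show "AE t in lborel. norm (E m t) \<le> 3 * 3 ^ N * (norm t * (1 + norm t) ^ (2 * N) * cmod (\<psi> t))" for m
      by (rule AE_I2)
  qed measurable
  have sb: "sbound N N (\<lambda>w. S m w - fconv \<kappa> \<psi> w) (real DIM('a) * C * (LINT t|lborel. E m t))" for m
    unfolding sbound_def
  proof (intro ballI impI allI)
    fix bs :: "'a list" and w assume bs: "bs \<in> lists Basis" "length bs \<le> N"
    let ?h = "\<lambda>v. iterated_partial bs \<kappa> (w - v)"
    have ipsum: "iterated_partial bs (\<lambda>w. \<Sum>v\<in>I. a m v * \<kappa> (w - v)) w = (\<Sum>v\<in>I. a m v * ?h v)"
      if "finite I" for I using that
    proof (induction I rule: finite_induct)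
      case empty
      show ?case using iterated_partial_lincomb[OF sm sm bs(1), of 0 0] by simp
    next
      case (insert v I)
      have "smooth (\<lambda>w. \<Sum>v\<in>I. a m v * \<kappa> (w - v))"
        by (intro schwartz_smooth schwartz_sum schwartz_cmult sh insert)
      from iterated_partial_lincomb[OF schwartz_smooth[OF sh] this bs(1), of "a m v" v 1]
      show ?case using insert by (simp add: iterated_partial_translate[OF sm bs(1)])
    qed
    have "iterated_partial bs (\<lambda>w. S m w - fconv \<kappa> \<psi> w) w = iterated_partial bs (S m) w - iterated_partial bs (fconv \<kappa> \<psi>) w"
      using iterated_partial_lincomb[OF schwartz_smooth[OF S] schwartz_smooth[OF F] bs(1), of 1 m "-1"] by simp
    also have "\<dots> = (LINT t|lborel. ?h (G m t) * \<psi> t) - (LINT t|lborel. ?h t * \<psi> t)"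
      unfolding integral_simple_compose(1)[OF G(1) i\<psi>, of ?h] iterated_partial_fconv[OF \<kappa> i\<psi> bs(1)] fconv_def
      unfolding S_def ipsum[OF fin] by (simp only: a_def)
    also have "\<dots> = (LINT t|lborel. (?h (G m t) - ?h t) * \<psi> t)"
      unfolding left_diff_distrib
      by (rule Bochner_Integration.integral_diff[symmetric, OF integral_simple_compose(2)[OF G(1) i\<psi>] fconv_partial_integrable[OF \<kappa> i\<psi> bs(1)]])
    finally have "(1 + norm w) ^ N * cmod (iterated_partial bs (\<lambda>w. S m w - fconv \<kappa> \<psi> w) w)
      = cmod (LINT t|lborel. of_real ((1 + norm w) ^ N) * ((?h (G m t) - ?h t) * \<psi> t))"
      unfolding integral_mult_right_zero norm_mult norm_of_real by simp
    also have "\<dots> \<le> (LINT t|lborel. real DIM('a) * C * E m t)"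
    proof (rule Bochner_Integration.integral_norm_bound_integral)
      show "integrable lborel (\<lambda>t. of_real ((1 + norm w) ^ N) * ((?h (G m t) - ?h t) * \<psi> t))"
        unfolding left_diff_distrib
        by (intro integrable_mult_right Bochner_Integration.integrable_diff
            integral_simple_compose(2)[OF G(1) i\<psi>] fconv_partial_integrable[OF \<kappa> i\<psi> bs(1)])
      show "integrable lborel (\<lambda>t. real DIM('a) * C * E m t)" by (intro integrable_mult_right iE)
      fix t
      have "(1 + norm w) ^ N * cmod (?h (G m t) - ?h t) * cmod (\<psi> t)
        \<le> real DIM('a) * C * (norm (G m t - t) * (1 + norm (G m t - t)) ^ N) * (1 + norm t) ^ N * cmod (\<psi> t)"
        by (rule mult_right_mono[OF translation_increment[OF sm C bs]]) auto
      then show "cmod (of_real ((1 + norm w) ^ N) * ((?h (G m t) - ?h t) * \<psi> t)) \<le> real DIM('a) * C * E m t"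
        unfolding norm_mult norm_of_real E_def by (simp add: mult_ac)
    qed
    finally show "(1 + norm w) ^ N * cmod (iterated_partial bs (\<lambda>w. S m w - fconv \<kappa> \<psi> w) w) \<le> real DIM('a) * C * (LINT t|lborel. E m t)"
      by simp
  qed
  have b: "cmod (u (S m) - u (fconv \<kappa> \<psi>)) \<le> K * (real DIM('a) * C * (LINT t|lborel. E m t))" for m
    using K(2)[OF schwartz_diff[OF S F] sb, of m] by (simp add: tempered_diff[OF u S F])
  have "(\<lambda>m. LINT t|lborel. E m t) \<longlonglongrightarrow> 0" using E0 by simp
  then have z: "(\<lambda>m. K * (real DIM('a) * C * (LINT t|lborel. E m t))) \<longlonglongrightarrow> 0"
    by (intro tendsto_mult_right_zero)
  have "(\<lambda>m. u (S m) - u (fconv \<kappa> \<psi>)) \<longlonglongrightarrow> 0"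
    by (rule Lim_null_comparison[OF always_eventually z]) (rule allI, rule b)
  then have "(\<lambda>m. u (S m)) \<longlonglongrightarrow> u (fconv \<kappa> \<psi>)" by (rule LIM_zero_cancel)
  from LIMSEQ_unique[OF L this] show ?thesis by (simp add: \<kappa>_def)
qed

subsection \<open>Functions as distributions\<close>

definition weight_mass :: "'a::euclidean_space itself \<Rightarrow> real" where
  "weight_mass _ = (LINT x|lborel. 1 / (1 + norm (x::'a)) ^ (2 * DIM('a)))"

lemma weight_mass_nonneg: "0 \<le> weight_mass TYPE('a::euclidean_space)"
  unfolding weight_mass_def by (rule Bochner_Integration.integral_nonneg) simp

lemma integral_pairing_bound:
  fixes g \<psi> :: "'a::euclidean_space \<Rightarrow> complex"
  assumes [measurable]: "g \<in> borel_measurable borel" "\<psi> \<in> borel_measurable borel"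
    and g: "\<And>x. cmod (g x) \<le> A * (1 + norm x) ^ M"
    and \<psi>: "\<And>x. (1 + norm x) ^ (M + 2 * DIM('a)) * cmod (\<psi> x) \<le> B"
  shows "integrable lborel (\<lambda>x. g x * \<psi> x)"
    and "cmod (LINT x|lborel. g x * \<psi> x) \<le> A * B * weight_mass TYPE('a)"
proof -
  have A: "0 \<le> A" using g[of 0] by (simp add: order_trans[OF norm_ge_zero])
  have *: "cmod (g x * \<psi> x) \<le> A * B * (1 / (1 + norm x) ^ (2 * DIM('a)))" for x
  proof -
    have "(1 + norm x) ^ (2 * DIM('a)) * cmod (g x * \<psi> x) \<le> (1 + norm x) ^ (2 * DIM('a)) * (A * (1 + norm x) ^ M * cmod (\<psi> x))"
      unfolding norm_mult by (intro mult_left_mono mult_right_mono g) auto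
    also have "\<dots> = A * ((1 + norm x) ^ (M + 2 * DIM('a)) * cmod (\<psi> x))" by (simp add: power_add mult_ac)
    also have "\<dots> \<le> A * B" by (intro mult_left_mono \<psi> A)
    finally show ?thesis using weight_pos[of x "2 * DIM('a)"] by (simp add: pos_le_divide_eq mult.commute)
  qed
  have w: "integrable lborel (\<lambda>x::'a. A * B * (1 / (1 + norm x) ^ (2 * DIM('a))))"
    by (intro integrable_mult_right integrable_inverse_weight) simp
  show i: "integrable lborel (\<lambda>x. g x * \<psi> x)"
  proof (rule Bochner_Integration.integrable_bound[OF w])
    show "AE x in lborel. norm (g x * \<psi> x) \<le> norm (A * B * (1 / (1 + norm x) ^ (2 * DIM('a))))"
      by (rule AE_I2, rule order_trans[OF *]) (simp only: real_norm_def abs_ge_self)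
  qed measurable
  have "cmod (LINT x|lborel. g x * \<psi> x) \<le> (LINT x|lborel. A * B * (1 / (1 + norm (x::'a)) ^ (2 * DIM('a))))"
    by (rule Bochner_Integration.integral_norm_bound_integral[OF i w *])
  then show "cmod (LINT x|lborel. g x * \<psi> x) \<le> A * B * weight_mass TYPE('a)"
    unfolding weight_mass_def integral_mult_right_zero .
qed

lemma distribution_of_tempered:
  fixes g :: "'a::euclidean_space \<Rightarrow> complex"
  assumes g: "growing g" shows "distribution_of g \<in> tempered"
proof -
  obtain M A where A: "0 < A" "\<And>x. cmod (g x) \<le> A * (1 + norm x) ^ M" using growingE[OF g] by metis
  have [measurable]: "g \<in> borel_measurable borel" using g by (rule growing_measurable)
  have int: "integrable lborel (\<lambda>x. g x * f x)" if "f \<in> schwartz" for f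
    using rapid_integrable[OF rapid_mult_growing[OF schwartz_rapid[OF that] g]] by (simp add: mult.commute)
  show ?thesis
  proof (rule temperedI[where K="A * weight_mass TYPE('a)" and N="M + 2 * DIM('a)"])
    show "0 \<le> A * weight_mass TYPE('a)" using A weight_mass_nonneg by (intro mult_nonneg_nonneg) auto
    fix \<psi> :: "'a \<Rightarrow> complex" and C assume \<psi>: "\<psi> \<in> schwartz" "sbound (M + 2 * DIM('a)) (M + 2 * DIM('a)) \<psi> C"
    then show "cmod (distribution_of g \<psi>) \<le> A * weight_mass TYPE('a) * C"
      using integral_pairing_bound(2)[OF growing_measurable[OF g] rapid_measurable[OF schwartz_rapid[OF \<psi>(1)]] A(2) sboundD0[OF \<psi>(2)]]
      by (simp add: distribution_of_def mult_ac)
  next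
    fix f1 f2 :: "'a \<Rightarrow> complex" and a b assume f: "f1 \<in> schwartz" "f2 \<in> schwartz"
    have "(LINT x|lborel. g x * (a * f1 x + b * f2 x)) = (LINT x|lborel. a * (g x * f1 x) + b * (g x * f2 x))"
      by (simp add: algebra_simps)
    also have "\<dots> = a * (LINT x|lborel. g x * f1 x) + b * (LINT x|lborel. g x * f2 x)"
      using int f by simp
    finally show "distribution_of g (\<lambda>x. a * f1 x + b * f2 x) = a * distribution_of g f1 + b * distribution_of g f2"
      using f schwartz_lincomb[OF f] by (simp add: distribution_of_def)
  qed (simp add: distribution_of_def)
qed

lemma conv_distribution_of:
  "\<phi> \<in> schwartz \<Longrightarrow> conv \<phi> (distribution_of g) x = fconv \<phi> g x"
  using schwartz_reflect[of \<phi> x] by (simp add: conv_def distribution_of_def fconv_def mult.commute)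


subsection \<open>The weak topology and the operator\<close>

lemma limitin_fun: "(f \<longlongrightarrow> l) F \<longleftrightarrow> (\<forall>i. ((\<lambda>n. f n i) \<longlongrightarrow> (l i :: 'c::topological_space)) F)"
proof -
  have "(f \<longlongrightarrow> l) F \<longleftrightarrow> limitin (product_topology (\<lambda>i. euclidean) UNIV) f l F"
    by (simp add: euclidean_product_topology)
  also have "\<dots> \<longleftrightarrow> (\<forall>i. ((\<lambda>n. f n i) \<longlongrightarrow> l i) F)"
    by (simp add: limitin_componentwise)
  finally show ?thesis .
qed

lemma limitin_tempered:
  "limitin tempered_topology X u F \<longleftrightarrow> u \<in> tempered \<and> (\<forall>\<^sub>F n in F. X n \<in> tempered) \<and> (\<forall>\<psi>. ((\<lambda>n. X n \<psi>) \<longlongrightarrow> u \<psi>) F)"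
  by (simp add: tempered_topology_def limitin_subtopology limitin_fun)

lemma T_sums_unique:
  assumes "T_sums \<phi> y f u" "T_sums \<phi> y f v" shows "u = v"
proof
  fix \<psi>
  let ?X = "\<lambda>N. \<Sum>j=1..N. distribution_of (translate (y j) (conv (\<phi> j) f)) \<psi>"
  have "?X \<longlonglongrightarrow> u \<psi>" "?X \<longlonglongrightarrow> v \<psi>"
    using assms unfolding T_sums_def limitin_tempered by auto
  then show "u \<psi> = v \<psi>" by (rule LIMSEQ_unique)
qed

lemma T_op_eqI: "T_sums \<phi> y f u \<Longrightarrow> T_op \<phi> y f = u"
  unfolding T_op_def using T_sums_unique by (intro the_equality)

lemma T_convergesI: "T_sums \<phi> y f u \<Longrightarrow> T_converges \<phi> y f"
  unfolding T_converges_def by blast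

lemma translate_eq: "translate y g = (\<lambda>x. g (x - y))"
  by (simp add: fun_eq_iff translate_def)

lemma tempered_fun_sum:
  "finite I \<Longrightarrow> (\<And>j. j \<in> I \<Longrightarrow> v j \<in> tempered) \<Longrightarrow> (\<lambda>\<psi>. \<Sum>j\<in>I. v j \<psi>) \<in> tempered"
proof (induction I rule: finite_induct)
  case empty
  show ?case by (rule temperedI[where K=0 and N=0]) auto
next
  case (insert j I)
  then have "(\<lambda>\<psi>. 1 * v j \<psi> + 1 * (\<Sum>j\<in>I. v j \<psi>)) \<in> tempered" by (intro tempered_comb) auto
  with insert show ?case by simp
qed

lemma growing_translate_conv:
  "\<phi> \<in> schwartz \<Longrightarrow> f \<in> tempered \<Longrightarrow> growing (translate y (conv \<phi> f))"
  using growing_shift[OF conv_growing[of f \<phi>], where a="- y"] by (simp add: translate_eq)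

lemma T_sums_iff:
  assumes "\<And>j. \<phi> j \<in> schwartz" "f \<in> tempered"
  shows "T_sums \<phi> y f u \<longleftrightarrow> u \<in> tempered \<and>
    (\<forall>\<psi>. (\<lambda>N. \<Sum>j=1..N. distribution_of (translate (y j) (conv (\<phi> j) f)) \<psi>) \<longlonglongrightarrow> u \<psi>)"
proof -
  have "(\<lambda>\<psi>. \<Sum>j=1..N. distribution_of (translate (y j) (conv (\<phi> j) f)) \<psi>) \<in> tempered" for N
    by (intro tempered_fun_sum distribution_of_tempered growing_translate_conv assms) auto
  then show ?thesis unfolding T_sums_def limitin_tempered by simp
qed

lemma T_sums_comb:
  fixes \<phi> :: "nat \<Rightarrow> 'a::euclidean_space \<Rightarrow> complex" and y :: "nat \<Rightarrow> 'a"
  assumes \<phi>: "\<And>j. \<phi> j \<in> schwartz"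
    and f: "f \<in> tempered" "T_sums \<phi> y f u" and g: "g \<in> tempered" "T_sums \<phi> y g v"
  shows "T_sums \<phi> y (\<lambda>\<psi>. a * f \<psi> + b * g \<psi>) (\<lambda>\<psi>. a * u \<psi> + b * v \<psi>)"
proof -
  let ?D = "\<lambda>f j. distribution_of (translate (y j) (conv (\<phi> j) f))"
  note gr = growing_translate_conv[OF \<phi>]
  have e: "?D (\<lambda>\<psi>. a * f \<psi> + b * g \<psi>) j \<psi> = a * ?D f j \<psi> + b * ?D g j \<psi>" for j \<psi>
  proof (cases "\<psi> \<in> schwartz")
    case True
    have int: "integrable lborel (\<lambda>x. translate (y j) (conv (\<phi> j) h) x * \<psi> x)" if "h \<in> tempered" for h
      using rapid_integrable[OF rapid_mult_growing[OF schwartz_rapid[OF True] gr[OF that]]] by (simp add: mult.commute)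
    have "(LINT x|lborel. translate (y j) (conv (\<phi> j) (\<lambda>\<psi>. a * f \<psi> + b * g \<psi>)) x * \<psi> x) =
       (LINT x|lborel. a * (translate (y j) (conv (\<phi> j) f) x * \<psi> x) + b * (translate (y j) (conv (\<phi> j) g) x * \<psi> x))"
      by (simp add: translate_def conv_def algebra_simps)
    also have "\<dots> = a * (LINT x|lborel. translate (y j) (conv (\<phi> j) f) x * \<psi> x) + b * (LINT x|lborel. translate (y j) (conv (\<phi> j) g) x * \<psi> x)"
      using int f g by simp
    finally show ?thesis using True by (simp add: distribution_of_def)
  qed (simp add: distribution_of_def)
  have s: "(\<Sum>j = 1..N. ?D (\<lambda>\<psi>. a * f \<psi> + b * g \<psi>) j \<psi>) = a * (\<Sum>j = 1..N. ?D f j \<psi>) + b * (\<Sum>j = 1..N. ?D g j \<psi>)" for N \<psi>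
    unfolding e by (simp add: sum.distrib sum_distrib_left)
  note c = tempered_comb[OF f(1) g(1), of a b]
  have 1: "u \<in> tempered" "v \<in> tempered"
    "(\<lambda>N. \<Sum>j=1..N. ?D f j \<psi>) \<longlonglongrightarrow> u \<psi>" "(\<lambda>N. \<Sum>j=1..N. ?D g j \<psi>) \<longlonglongrightarrow> v \<psi>" for \<psi>
    using f g by (auto simp: T_sums_iff[OF \<phi>])
  show ?thesis
    unfolding T_sums_iff[OF \<phi> c] s
  proof (intro conjI allI)
    show "(\<lambda>\<psi>. a * u \<psi> + b * v \<psi>) \<in> tempered" by (rule tempered_comb[OF 1(1,2)])
    show "(\<lambda>N. a * (\<Sum>j=1..N. ?D f j \<psi>) + b * (\<Sum>j=1..N. ?D g j \<psi>)) \<longlonglongrightarrow> a * u \<psi> + b * v \<psi>" for \<psi>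
      by (rule tendsto_add[OF tendsto_mult_left[OF 1(3)] tendsto_mult_left[OF 1(4)]])
  qed
qed

section \<open>Dilations\<close>

text \<open>Normalised to preserve the integral, so that on the Fourier side a dilation merely
  rescales the argument.\<close>

definition dilate :: "real \<Rightarrow> ('a::euclidean_space \<Rightarrow> complex) \<Rightarrow> 'a \<Rightarrow> complex" where
  "dilate c f x = of_real (c ^ DIM('a)) * f (c *\<^sub>R x)"

lemma dilate_eq: "dilate c (f :: 'a::euclidean_space \<Rightarrow> complex) = (\<lambda>x. of_real (c ^ DIM('a)) * f (0 + c *\<^sub>R x))"
  by (simp add: dilate_def fun_eq_iff)

lemma dilate_schwartz: "f \<in> schwartz \<Longrightarrow> c \<noteq> 0 \<Longrightarrow> dilate c f \<in> schwartz"
  unfolding dilate_eq by (intro schwartz_cmult schwartz_affine)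

lemma dilate_rapid: "rapid f \<Longrightarrow> c \<noteq> 0 \<Longrightarrow> rapid (dilate c f)"
  unfolding dilate_eq by (intro rapid_cmult rapid_affine)

lemma dilate_bandlimited: "bandlimited R f \<Longrightarrow> 0 < c \<Longrightarrow> bandlimited (c * R) (dilate c f)"
  unfolding dilate_eq using bandlimited_cmult[OF bandlimited_affine[of R f c 0]] by simp

lemma fourier_dilate: "0 < c \<Longrightarrow> fourier (dilate c f) \<xi> = fourier f ((1 / c) *\<^sub>R \<xi>)"
  unfolding dilate_eq fourier_cmult by (subst fourier_affine) (auto simp: scaleR_conv_of_real)

lemma sbound_cmult:
  assumes "smooth f" "sbound N k f C" shows "sbound N k (\<lambda>x. a * f x) (cmod a * C)"
  using sbound_lincomb[OF assms(1) assms(1) assms(2) assms(2), of a 0] by simp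

text \<open>The normalisation contributes \<open>DIM('a)\<close> powers of \<open>c\<close> and each
  derivative one more. The weights cost nothing, since contracting the graph towards the origin for
  \<open>c \<ge> 1\<close> only helps them.\<close>

lemma sbound_dilate:
  fixes f :: "'a::euclidean_space \<Rightarrow> complex"
  assumes "smooth f" "sbound N k f C" "1 \<le> c"
  shows "sbound N k (dilate c f) (c ^ (DIM('a) + k) * C)"
proof -
  have "sbound N k (\<lambda>x. f (0 + c *\<^sub>R x)) ((1 + norm (0::'a)) ^ N * max 1 (1 / \<bar>c\<bar>) ^ N * max 1 \<bar>c\<bar> ^ k * C)"
    using assms by (intro sbound_affine) auto
  moreover have "max 1 (1 / \<bar>c\<bar>) = 1" "max 1 \<bar>c\<bar> = c" using assms(3) by (auto simp: max_def)
  ultimately have "sbound N k (\<lambda>x. f (0 + c *\<^sub>R x)) (c ^ k * C)" by simp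
  from sbound_cmult[OF smooth_affine[OF assms(1)] this, of "of_real (c ^ DIM('a))"] assms(3)
  show ?thesis unfolding dilate_eq by (simp add: power_add mult_ac norm_power)
qed

text \<open>Dilation concentrates mass at the origin. The case \<open>i = 0\<close> keeps the
  weighted mass bounded in all scales; the case \<open>i = 1\<close> contracts the first moment by
  \<open>1 / c\<close>, which is the source of the gain per smoothing step.\<close>

lemma dilate_mass:
  fixes f :: "'a::euclidean_space \<Rightarrow> complex"
  assumes f: "rapid f" and c: "1 \<le> c"
  shows "(LINT t|lborel. norm t ^ i * (1 + norm t) ^ N * cmod (dilate c f t)) \<le>
    (1 / c ^ i) * (LINT t|lborel. norm t ^ i * (1 + norm t) ^ N * cmod (f t))"
proof -
  have [measurable]: "f \<in> borel_measurable borel" using f by (rule rapid_measurable)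
  have c0: "0 < c" using c by simp
  have int: "integrable lborel (\<lambda>t. norm t ^ i * (1 + norm t) ^ N * cmod (h t))" if "rapid h" for h :: "'a \<Rightarrow> complex"
  proof (rule Bochner_Integration.integrable_bound[OF rapid_integrable_weight[OF that, of "i + N"]])
    have [measurable]: "h \<in> borel_measurable borel" using that by (rule rapid_measurable)
    show "(\<lambda>t. norm t ^ i * (1 + norm t) ^ N * cmod (h t)) \<in> borel_measurable lborel" by measurable
    have "norm t ^ i * (1 + norm t) ^ N * cmod (h t) \<le> (1 + norm t) ^ (i + N) * cmod (h t)" for t
      unfolding power_add by (intro mult_right_mono power_mono) auto
    then show "AE t in lborel. norm (norm t ^ i * (1 + norm t) ^ N * cmod (h t)) \<le> norm ((1 + norm t) ^ (i + N) * cmod (h t))"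
      by (intro AE_I2) (simp add: abs_mult power_abs)
  qed
  have "(LINT t|lborel. norm t ^ i * (1 + norm t) ^ N * cmod (dilate c f t)) =
     \<bar>1 / c\<bar> ^ DIM('a) *\<^sub>R (LINT t|lborel. norm (0 + (1 / c) *\<^sub>R t) ^ i * (1 + norm (0 + (1 / c) *\<^sub>R (t::'a))) ^ N * cmod (dilate c f (0 + (1 / c) *\<^sub>R t)))"
    by (rule integral_affine) (use c0 in simp)
  also have "\<dots> = (LINT t|lborel. (1 / c ^ i) * (norm t ^ i * (1 + (1 / c) * norm t) ^ N * cmod (f t)))"
    unfolding integral_scaleR_right[symmetric]
    by (rule Bochner_Integration.integral_cong) (use c0 in \<open>simp_all add: dilate_def norm_mult norm_power power_divide\<close>)
  also have "\<dots> \<le> (LINT t|lborel. (1 / c ^ i) * (norm t ^ i * (1 + norm t) ^ N * cmod (f t)))"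
  proof (rule Bochner_Integration.integral_mono)
    have "norm t ^ i * (1 + (1 / c) * norm t) ^ N * cmod (f t) \<le> norm t ^ i * (1 + norm t) ^ N * cmod (f t)" for t
    proof (intro mult_right_mono mult_left_mono power_mono)
      have "(1 / c) * norm t \<le> 1 * norm t" using c by (intro mult_right_mono) auto
      then show "1 + (1 / c) * norm t \<le> 1 + norm t" by simp
    qed (use c0 in auto)
    then show le: "(1 / c ^ i) * (norm t ^ i * (1 + (1 / c) * norm t) ^ N * cmod (f t)) \<le> (1 / c ^ i) * (norm t ^ i * (1 + norm t) ^ N * cmod (f t))" for t
      using c0 by (intro mult_left_mono) auto
    show i2: "integrable lborel (\<lambda>t. (1 / c ^ i) * (norm t ^ i * (1 + norm t) ^ N * cmod (f t)))"
      by (intro integrable_mult_right int f)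
    show "integrable lborel (\<lambda>t. (1 / c ^ i) * (norm t ^ i * (1 + (1 / c) * norm t) ^ N * cmod (f t)))"
    proof (rule Bochner_Integration.integrable_bound[OF i2])
      have "norm ((1 / c ^ i) * (norm t ^ i * (1 + (1 / c) * norm t) ^ N * cmod (f t))) = (1 / c ^ i) * (norm t ^ i * (1 + (1 / c) * norm t) ^ N * cmod (f t))" for t
        unfolding real_norm_def using c0 by (intro abs_of_nonneg) auto
      then show "AE t in lborel. norm ((1 / c ^ i) * (norm t ^ i * (1 + (1 / c) * norm t) ^ N * cmod (f t))) \<le> norm ((1 / c ^ i) * (norm t ^ i * (1 + norm t) ^ N * cmod (f t)))"
        using order_trans[OF le abs_ge_self] by (intro AE_I2) (simp only: real_norm_def)
    qed measurable
  qed
  finally show ?thesis by simp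
qed


section \<open>Mean-zero kernels and associativity of convolution\<close>

text \<open>Since \<open>h\<close> has mean zero, the value of the derivative at \<open>x\<close>
  can be subtracted under the integral. The increment then brings in the first moment of
  \<open>h\<close> at the price of one derivative of \<open>\<psi>\<close>.\<close>

lemma sbound_fconv_mean_zero:
  fixes \<psi> h :: "'a::euclidean_space \<Rightarrow> complex"
  assumes \<psi>: "\<psi> \<in> schwartz" "sbound N (Suc k) \<psi> B" and h: "rapid h" "(LINT t|lborel. h t) = 0"
  shows "sbound N k (fconv \<psi> h) (real DIM('a) * B * (LINT t|lborel. norm t * (1 + norm t) ^ N * cmod (h t)))"
  unfolding sbound_def
proof (intro ballI impI allI)
  fix bs :: "'a list" and x assume bs: "bs \<in> lists Basis" "length bs \<le> k"
  let ?d = "\<lambda>t. (iterated_partial bs \<psi> (x - t) - iterated_partial bs \<psi> x) * h t"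
  note ih = rapid_integrable[OF h(1)]
  note i1 = fconv_partial_integrable[OF \<psi>(1) ih bs(1), of x]
  have i2: "integrable lborel (\<lambda>t. iterated_partial bs \<psi> x * h t)" using ih by simp
  have id: "integrable lborel ?d"
    unfolding left_diff_distrib by (rule Bochner_Integration.integrable_diff[OF i1 i2])
  have "(LINT t|lborel. ?d t) = fconv (iterated_partial bs \<psi>) h x - iterated_partial bs \<psi> x * (LINT t|lborel. h t)"
    unfolding left_diff_distrib Bochner_Integration.integral_diff[OF i1 i2] fconv_def by simp
  then have "iterated_partial bs (fconv \<psi> h) x = (LINT t|lborel. ?d t)"
    using h(2) by (simp add: iterated_partial_fconv[OF \<psi>(1) ih bs(1)])
  then have "(1 + norm x) ^ N * cmod (iterated_partial bs (fconv \<psi> h) x) =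
     cmod (LINT t|lborel. of_real ((1 + norm x) ^ N) * ?d t)"
    unfolding integral_mult_right_zero norm_mult norm_of_real by simp
  also have "\<dots> \<le> (LINT t|lborel. real DIM('a) * B * (norm t * (1 + norm t) ^ N * cmod (h t)))"
  proof (rule Bochner_Integration.integral_norm_bound_integral)
    show "integrable lborel (\<lambda>t. of_real ((1 + norm x) ^ N) * ?d t)" using id by (rule integrable_mult_right)
    show "integrable lborel (\<lambda>t. real DIM('a) * B * (norm t * (1 + norm t) ^ N * cmod (h t)))"
      by (intro integrable_mult_right rapid_integrable_weight_increment h)
    fix t
    have "(1 + norm x) ^ N * cmod (iterated_partial bs \<psi> (x - t) - iterated_partial bs \<psi> x) * cmod (h t)
      \<le> real DIM('a) * B * (norm t * (1 + norm t) ^ N) * cmod (h t)"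
      by (intro mult_right_mono weighted_increment[OF schwartz_smooth[OF \<psi>(1)] \<psi>(2) bs]) auto
    then show "cmod (of_real ((1 + norm x) ^ N) * ?d t) \<le> real DIM('a) * B * (norm t * (1 + norm t) ^ N * cmod (h t))"
      unfolding norm_mult norm_of_real by (simp add: mult_ac)
  qed
  finally show "(1 + norm x) ^ N * cmod (iterated_partial bs (fconv \<psi> h) x) \<le> real DIM('a) * B * (LINT t|lborel. norm t * (1 + norm t) ^ N * cmod (h t))"
    by simp
qed

lemma fconv_assoc:
  fixes a b c :: "'a::euclidean_space \<Rightarrow> complex"
  assumes a: "rapid a" and b: "rapid b" and c: "rapid c"
  shows "fconv a (fconv b c) = fconv (fconv a b) c"
proof
  fix x
  obtain B where B: "\<And>x. (1 + norm x) ^ 0 * cmod (b x) \<le> B" using rapidE[OF b] by metis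
  have [measurable]: "b \<in> borel_measurable borel" using b by (rule rapid_measurable)
  note ia = rapid_integrable[OF rapid_reflect[OF a, of x]] and ic = rapid_integrable[OF c]
  have F: "(LINT s|lborel. LINT t|lborel. a (x - t) * c s * b (t - s)) = (LINT t|lborel. LINT s|lborel. a (x - t) * c s * b (t - s))"
    by (rule Fubini_kernel[OF ia ic, where B=B]) (use B in auto)
  have "fconv a (fconv b c) x = (LINT t|lborel. LINT s|lborel. a (x - t) * (b (t - s) * c s))"
    by (simp add: fconv_def)
  also have "\<dots> = (LINT s|lborel. LINT t|lborel. a (x - t) * c s * b (t - s))"
    unfolding F by (simp only: mult_ac)
  also have "\<dots> = (LINT s|lborel. (LINT t|lborel. a (x - t) * b (t - s)) * c s)"
    unfolding integral_mult_left_zero[symmetric] by (simp only: mult_ac)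
  also have "\<dots> = (LINT s|lborel. fconv a b (x - s) * c s)"
  proof -
    have "(LINT t|lborel. a (x - t) * b (t - s)) = fconv a b (x - s)" for s
      using integral_shift[of "\<lambda>t. a (x - t) * b (t - s)" s] by (simp add: fconv_def algebra_simps)
    then show ?thesis by simp
  qed
  finally show "fconv a (fconv b c) x = fconv (fconv a b) c x" by (simp add: fconv_def)
qed

text \<open>The weights \<open>(1 + |t|) ^ L\<close> and \<open>(1 + |x|) ^ L\<close> make the growing factor integrable and leave a
  bounded kernel.\<close>

lemma fconv_pairing:
  fixes g h \<psi> :: "'a::euclidean_space \<Rightarrow> complex"
  assumes g: "growing g" and h: "rapid h" and \<psi>: "rapid \<psi>"
  shows "(LINT x|lborel. fconv h g x * \<psi> x) = (LINT t|lborel. g t * fconv (\<lambda>x. h (- x)) \<psi> t)"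
proof -
  obtain M A where A: "0 < A" "\<And>x. cmod (g x) \<le> A * (1 + norm x) ^ M" using growingE[OF g] by metis
  define L where "L = M + 2 * DIM('a)"
  obtain B where B: "\<And>x. (1 + norm x) ^ L * cmod (h x) \<le> B" using rapidE[OF h] by metis
  have [measurable]: "h \<in> borel_measurable borel" "g \<in> borel_measurable borel" "\<psi> \<in> borel_measurable borel"
    using h g \<psi> by (auto intro: rapid_measurable growing_measurable)
  define w where "w = (\<lambda>x::'a. complex_of_real ((1 + norm x) ^ L))"
  have [measurable]: "w \<in> borel_measurable borel" unfolding w_def by measurable
  have w0: "w x \<noteq> 0" for x using weight_pos[of x L] unfolding w_def of_real_eq_0_iff by linarith
  have nw: "cmod (w x) = (1 + norm x) ^ L" for x unfolding w_def norm_of_real using weight_pos[of x L] by simp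
  have i1: "integrable lborel (\<lambda>t. g t / w t)"
  proof (rule integrable_of_decay)
    fix t
    have "(1 + norm t) ^ (2 * DIM('a)) * cmod (g t) \<le> (1 + norm t) ^ (2 * DIM('a)) * (A * (1 + norm t) ^ M)"
      by (intro mult_left_mono A) auto
    also have "\<dots> = A * (1 + norm t) ^ L" by (simp add: L_def power_add)
    finally show "(1 + norm t) ^ (2 * DIM('a)) * cmod (g t / w t) \<le> A"
      unfolding norm_divide nw using weight_pos[of t L] by (simp add: pos_divide_le_eq)
  qed measurable
  have i2: "integrable lborel (\<lambda>x. w x * \<psi> x)"
    unfolding w_def by (rule rapid_integrable[OF rapid_weight[OF \<psi>]])
  have K: "cmod (h (x - t) * (w t / w x)) \<le> B" for t x
  proof -
    have "cmod (h (x - t)) * (1 + norm t) ^ L \<le> cmod (h (x - t)) * ((1 + norm x) ^ L * (1 + norm (x - t)) ^ L)"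
      using weight_diff[of x "x - t" L] by (intro mult_left_mono) auto
    also have "\<dots> = (1 + norm x) ^ L * ((1 + norm (x - t)) ^ L * cmod (h (x - t)))" by (simp add: mult_ac)
    also have "\<dots> \<le> (1 + norm x) ^ L * B" by (intro mult_left_mono B) auto
    finally show ?thesis
      unfolding norm_mult norm_divide nw using weight_pos[of x L] by (simp add: pos_divide_le_eq mult.commute)
  qed
  have e: "g t / w t * (w x * \<psi> x) * (h (x - t) * (w t / w x)) = h (x - t) * g t * \<psi> x" for t x
    using w0[of t] w0[of x] by simp
  have "(LINT x|lborel. fconv h g x * \<psi> x) = (LINT x|lborel. LINT t|lborel. h (x - t) * g t * \<psi> x)"
    by (simp add: fconv_def)
  also have "\<dots> = (LINT t|lborel. LINT x|lborel. h (x - t) * g t * \<psi> x)"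
    using Fubini_kernel[OF i1 i2, of "\<lambda>t x. h (x - t) * (w t / w x)" B] K unfolding e by simp
  also have "\<dots> = (LINT t|lborel. LINT x|lborel. g t * (h (x - t) * \<psi> x))" by (simp only: mult_ac)
  also have "\<dots> = (LINT t|lborel. g t * fconv (\<lambda>x. h (- x)) \<psi> t)" by (simp add: fconv_def)
  finally show ?thesis .
qed

text \<open>Associativity across a distribution: \<open>integral_conv\<close> brings the outer
  integral inside \<open>u\<close>, and reflecting the integration variable turns the inner kernel
  into \<open>fconv \<phi> h\<close>.\<close>

lemma fconv_conv:
  assumes "u \<in> tempered" "\<phi> \<in> schwartz" "rapid h"
  shows "fconv h (conv \<phi> u) x = conv (fconv \<phi> h) u x"
proof -
  have "fconv h (conv \<phi> u) x = (LINT t|lborel. conv \<phi> u t * h (x - t))"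
    by (simp add: fconv_def mult.commute)
  also have "\<dots> = u (fconv (\<lambda>x. \<phi> (- x)) (\<lambda>t. h (x - t)))"
    by (rule integral_conv[OF assms(1,2) rapid_reflect[OF assms(3)]])
  also have "fconv (\<lambda>x. \<phi> (- x)) (\<lambda>t. h (x - t)) = (\<lambda>w. fconv \<phi> h (x - w))"
  proof
    fix w
    show "fconv (\<lambda>x. \<phi> (- x)) (\<lambda>t. h (x - t)) w = fconv \<phi> h (x - w)"
      using integral_reflect[of "\<lambda>t. \<phi> (t - w) * h (x - t)" x] by (simp add: fconv_def algebra_simps)
  qed
  finally show ?thesis unfolding conv_def[of "fconv \<phi> h"] .
qed


section \<open>Littlewood-Paley families\<close>

text \<open>The profile of which \<open>\<phi> j\<close> is the dilate by \<open>2 ^ j\<close>. It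
  is the same function for all \<open>j \<ge> 1\<close>, so two profiles give bounds uniform over
  the family.\<close>

definition lp_bump :: "(nat \<Rightarrow> 'a::euclidean_space \<Rightarrow> complex) \<Rightarrow> nat \<Rightarrow> 'a \<Rightarrow> complex" where
  "lp_bump \<phi> j = (if j = 0 then \<phi> 0 else (\<lambda>x. \<phi> 0 x - dilate (1 / 2) (\<phi> 0) x))"

text \<open>The Fourier transform of \<open>lp_fat \<phi> j\<close> is \<open>1\<close> on the support of that of \<open>\<phi> j\<close> and vanishes near \<open>0\<close>.\<close>

definition lp_fat0 :: "(nat \<Rightarrow> 'a::euclidean_space \<Rightarrow> complex) \<Rightarrow> 'a \<Rightarrow> complex" where
  "lp_fat0 \<phi> x = dilate 2 (\<phi> 0) x - dilate (1 / 4) (\<phi> 0) x"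

definition lp_fat :: "(nat \<Rightarrow> 'a::euclidean_space \<Rightarrow> complex) \<Rightarrow> nat \<Rightarrow> 'a \<Rightarrow> complex" where
  "lp_fat \<phi> j = dilate (2 ^ j) (lp_fat0 \<phi>)"

text \<open>The transpose of convolution with \<open>lp_fat \<phi> j\<close> under the integral
  pairing, hence the reflected kernel.\<close>

definition smoothing :: "(nat \<Rightarrow> 'a::euclidean_space \<Rightarrow> complex) \<Rightarrow> nat \<Rightarrow> ('a \<Rightarrow> complex) \<Rightarrow> 'a \<Rightarrow> complex" where
  "smoothing \<phi> j \<psi> = fconv (\<lambda>x. lp_fat \<phi> j (- x)) \<psi>"

context
  fixes \<phi> :: "nat \<Rightarrow> 'a::euclidean_space \<Rightarrow> complex"
  assumes lp: "littlewood_paley \<phi>"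
begin

section \<open>Spectral localisation of the family\<close>

lemma
  shows lp_schwartz: "\<phi> j \<in> schwartz"
    and lp0_support: "closure {\<xi>. fourier (\<phi> 0) \<xi> \<noteq> 0} \<subseteq> ball 0 2"
    and lp0_plateau: "\<exists>U. open U \<and> cball 0 1 \<subseteq> U \<and> (\<forall>\<xi>\<in>U. fourier (\<phi> 0) \<xi> = 1)"
    and lp_fourier_powr: "1 \<le> j \<Longrightarrow> fourier (\<phi> j) \<xi> =
      fourier (\<phi> 0) ((2 powr (- real j)) *\<^sub>R \<xi>) - fourier (\<phi> 0) ((2 powr (1 - real j)) *\<^sub>R \<xi>)"
  using lp by (simp_all add: littlewood_paley_def)

lemma lp_rapid: "rapid (\<phi> j)"
  by (rule schwartz_rapid[OF lp_schwartz])

lemma lp0_outer: assumes "2 \<le> norm \<xi>" shows "fourier (\<phi> 0) \<xi> = 0"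
proof (rule ccontr)
  assume "fourier (\<phi> 0) \<xi> \<noteq> 0"
  then have "\<xi> \<in> {\<xi>. fourier (\<phi> 0) \<xi> \<noteq> 0}" by simp
  then have "\<xi> \<in> ball 0 2" by (rule subsetD[OF order_trans[OF closure_subset lp0_support]])
  with assms show False by simp
qed

lemma lp0_inner: assumes "norm \<xi> \<le> 1" shows "fourier (\<phi> 0) \<xi> = 1"
proof -
  obtain U where U: "cball 0 1 \<subseteq> U" "\<forall>\<xi>\<in>U. fourier (\<phi> 0) \<xi> = 1" using lp0_plateau by (elim exE conjE)
  have "\<xi> \<in> U" by (rule subsetD[OF U(1)]) (use assms in simp)
  then show ?thesis by (rule bspec[OF U(2)])
qed

lemma lp0_bandlimited: "bandlimited 2 (\<phi> 0)"
  unfolding bandlimited_def by (intro conjI allI impI lp_rapid lp0_outer)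

lemma lp_fourier:
  assumes "1 \<le> j"
  shows "fourier (\<phi> j) \<xi> = fourier (\<phi> 0) ((1 / 2 ^ j) *\<^sub>R \<xi>) - fourier (\<phi> 0) ((2 / 2 ^ j) *\<^sub>R \<xi>)"
proof -
  have "2 powr (- real j) = 1 / 2 ^ j" "2 powr (1 - real j) = 2 / 2 ^ j"
    by (simp_all add: powr_minus powr_realpow powr_diff divide_inverse)
  then show ?thesis using lp_fourier_powr[OF assms] by simp
qed

lemma lp_fourier_outer:
  assumes "2 * 2 ^ j \<le> norm \<xi>" shows "fourier (\<phi> j) \<xi> = 0"
proof (cases "j = 0")
  case True
  then show ?thesis using assms lp0_outer by simp
next
  case False
  have "0 < (2::real) ^ j" by simp
  with assms have "2 ^ j \<le> norm \<xi>" by linarith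
  then have "2 \<le> norm ((1 / 2 ^ j) *\<^sub>R \<xi>)" "2 \<le> norm ((2 / 2 ^ j) *\<^sub>R \<xi>)"
    using assms by (simp_all add: pos_le_divide_eq field_simps)
  then show ?thesis using False by (simp add: lp_fourier lp0_outer del: norm_scaleR)
qed

lemma lp_fourier_inner:
  assumes "1 \<le> j" "2 * norm \<xi> \<le> 2 ^ j" shows "fourier (\<phi> j) \<xi> = 0"
proof -
  have "norm ((1 / 2 ^ j) *\<^sub>R \<xi>) \<le> 1" "norm ((2 / 2 ^ j) *\<^sub>R \<xi>) \<le> 1"
    using assms(2) norm_ge_zero[of \<xi>] by (simp_all add: pos_divide_le_eq del: norm_ge_zero)
  then show ?thesis using assms(1) by (simp add: lp_fourier lp0_inner del: norm_scaleR)
qed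

lemma lp_bandlimited: "bandlimited (2 * 2 ^ j) (\<phi> j)"
  unfolding bandlimited_def by (intro conjI allI impI lp_rapid lp_fourier_outer)

lemma lp_bump_schwartz: "lp_bump \<phi> j \<in> schwartz"
  unfolding lp_bump_def by (auto intro!: lp_schwartz schwartz_diff dilate_schwartz)

text \<open>For \<open>j \<ge> 1\<close> the family is known only through its transforms. Both sides
  are band-limited with equal transforms, so Fourier inversion identifies them as functions.\<close>

lemma lp_eq_dilate: "\<phi> j = dilate (2 ^ j) (lp_bump \<phi> j)"
proof (cases "j = 0")
  case False
  note r = lp_rapid[of 0] dilate_rapid[OF lp_rapid[of 0], of "1 / 2"]
  have F: "fourier (dilate (2 ^ j) (lp_bump \<phi> j)) \<xi> = fourier (\<phi> j) \<xi>" for \<xi>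
    using False r by (simp add: fourier_dilate lp_bump_def fourier_diff rapid_integrable lp_fourier)
  have "bandlimited (2 * 2 ^ j) (dilate (2 ^ j) (lp_bump \<phi> j))"
    unfolding bandlimited_def F
    by (intro conjI dilate_rapid schwartz_rapid lp_bump_schwartz) (use lp_fourier_outer in auto)
  then show ?thesis by (rule bandlimited_eqI[OF lp_bandlimited]) (simp add: F)
qed (simp add: lp_bump_def dilate_def fun_eq_iff)

lemma lp_fat0_schwartz: "lp_fat0 \<phi> \<in> schwartz"
  unfolding lp_fat0_def[abs_def] by (intro schwartz_diff dilate_schwartz lp_schwartz) auto

lemma lp_fat_schwartz: "lp_fat \<phi> j \<in> schwartz"
  unfolding lp_fat_def by (intro dilate_schwartz lp_fat0_schwartz) auto

lemma lp_fat_rapid: "rapid (lp_fat \<phi> j)"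
  by (rule schwartz_rapid[OF lp_fat_schwartz])

lemma lp_fat0_fourier: "fourier (lp_fat0 \<phi>) \<xi> = fourier (\<phi> 0) ((1 / 2) *\<^sub>R \<xi>) - fourier (\<phi> 0) (4 *\<^sub>R \<xi>)"
  using dilate_rapid[OF lp_rapid[of 0], of 2] dilate_rapid[OF lp_rapid[of 0], of "1 / 4"]
  unfolding lp_fat0_def[abs_def] by (simp add: fourier_diff rapid_integrable fourier_dilate)

lemma lp_fat_fourier: "fourier (lp_fat \<phi> j) \<xi> = fourier (\<phi> 0) ((1 / (2 * 2 ^ j)) *\<^sub>R \<xi>) - fourier (\<phi> 0) ((4 / 2 ^ j) *\<^sub>R \<xi>)"
  unfolding lp_fat_def by (simp add: fourier_dilate lp_fat0_fourier)

lemma lp_fat_bandlimited: "bandlimited (4 * 2 ^ j) (lp_fat \<phi> j)"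
  unfolding bandlimited_def
proof (intro conjI allI impI lp_fat_rapid)
  fix \<xi> :: 'a assume "4 * 2 ^ j \<le> norm \<xi>"
  moreover have "0 < (2::real) ^ j" by simp
  ultimately have "2 ^ j \<le> 2 * norm \<xi>" "4 * 2 ^ j \<le> norm \<xi>" by linarith+
  then have "2 \<le> norm ((1 / (2 * 2 ^ j)) *\<^sub>R \<xi>)" "2 \<le> norm ((4 / 2 ^ j) *\<^sub>R \<xi>)"
    by (simp_all add: pos_le_divide_eq field_simps)
  then show "fourier (lp_fat \<phi> j) \<xi> = 0" by (simp add: lp_fat_fourier lp0_outer del: norm_scaleR)
qed

lemma lp_fat_mean: "(LINT x|lborel. lp_fat \<phi> j (- x)) = 0"
proof -
  have "fourier (lp_fat \<phi> j) 0 = 0" by (simp add: lp_fat_fourier)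
  then show ?thesis using integral_reflect[of "lp_fat \<phi> j" 0] by (simp add: fourier_def)
qed

text \<open>The spectrum of \<open>\<phi> j\<close> satisfies 2^j / 2 < |\<xi>| < 2 * 2^j. There the
  outer cut-off in \<open>lp_fat\<close>, scaled to \<open>2 * 2 ^ j\<close>, is still 1 and the
  inner one already 0.\<close>

lemma fconv_fat: assumes "1 \<le> j" shows "fconv (lp_fat \<phi> j) (\<phi> j) = \<phi> j"
proof (rule fconv_eq_right[OF lp_fat_bandlimited lp_bandlimited])
  fix \<xi> assume "fourier (\<phi> j) \<xi> \<noteq> 0"
  then have "norm \<xi> < 2 * 2 ^ j" "2 ^ j < 2 * norm \<xi>"
    using lp_fourier_outer[of j \<xi>] lp_fourier_inner[OF assms, of \<xi>] by force+
  then have "norm ((1 / (2 * 2 ^ j)) *\<^sub>R \<xi>) \<le> 1" "2 \<le> norm ((4 / 2 ^ j) *\<^sub>R \<xi>)"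
    by (simp_all add: pos_divide_le_eq field_simps)
  then show "fourier (lp_fat \<phi> j) \<xi> = 1" by (simp add: lp_fat_fourier lp0_inner lp0_outer del: norm_scaleR)
qed

text \<open>The spectrum of \<open>\<phi> j\<close> ends at radius 2^(j+1), that of
  \<open>\<phi> k\<close> begins at 2^(k-1), and the gap of two in the indices makes the second
  radius at least the first.\<close>

lemma lp_fourier_disjoint:
  assumes "j + 2 \<le> k" shows "fourier (\<phi> j) \<xi> * fourier (\<phi> k) \<xi> = 0"
proof -
  have "(2::real) ^ (j + 2) \<le> 2 ^ k" using assms by (intro power_increasing) auto
  then have "2 * 2 ^ j \<le> norm \<xi> \<or> 2 * norm \<xi> \<le> 2 ^ k" by auto
  then show ?thesis using lp_fourier_outer[of j \<xi>] lp_fourier_inner[of k \<xi>] assms by auto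
qed

lemma fconv_lp_disjoint:
  assumes "j + 2 \<le> k \<or> k + 2 \<le> j" shows "fconv (\<phi> j) (\<phi> k) x = 0"
  using assms lp_fourier_disjoint[of j k] lp_fourier_disjoint[of k j]
  by (intro fconv_eq_0[OF lp_bandlimited rapid_integrable[OF lp_rapid]]) (auto simp: mult.commute)

lemma fconv_lp_conv_disjoint:
  assumes "f \<in> tempered" "j + 2 \<le> k \<or> k + 2 \<le> j" shows "fconv (\<phi> k) (conv (\<phi> j) f) x = 0"
  unfolding fconv_conv[OF assms(1) lp_schwartz lp_rapid]
  using tempered_zero[OF assms(1)] fconv_lp_disjoint[OF assms(2)] by (simp add: conv_def)

lemma fconv_fat_conv:
  assumes "f \<in> tempered" "1 \<le> j" shows "fconv (lp_fat \<phi> j) (conv (\<phi> j) f) = conv (\<phi> j) f"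
proof
  fix x
  show "fconv (lp_fat \<phi> j) (conv (\<phi> j) f) x = conv (\<phi> j) f x"
    unfolding fconv_conv[OF assms(1) lp_schwartz lp_fat_rapid] fconv_commute[of "\<phi> j"] fconv_fat[OF assms(2)] ..
qed

text \<open>Dilating two fixed profiles loses only \<open>DIM('a) + N\<close> powers of
  \<open>2 ^ j\<close>, where \<open>N\<close> is the order of \<open>f\<close>. A single exponent
  \<open>M\<close> is used for both growths for convenience.\<close>

lemma lp_conv_bound:
  assumes f: "f \<in> tempered"
  obtains C M where "0 < C" "\<And>j x. cmod (conv (\<phi> j) f x) \<le> C * (2 ^ j) ^ M * (1 + norm x) ^ M"
proof -
  obtain N K where K: "0 < K" "\<And>\<psi> C. \<psi> \<in> schwartz \<Longrightarrow> sbound N N \<psi> C \<Longrightarrow> cmod (f \<psi>) \<le> K * C"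
    using tempered_boundE[OF f] by metis
  obtain A where A: "sbound N N (lp_bump \<phi> 0) A" "0 < A" using schwartz_sboundE[OF lp_bump_schwartz] by metis
  obtain B where B: "sbound N N (lp_bump \<phi> 1) B" "0 < B" using schwartz_sboundE[OF lp_bump_schwartz] by metis
  have AB: "sbound N N (lp_bump \<phi> j) (A + B)" for j
  proof (cases "j = 0")
    case True
    then show ?thesis using A B by (auto elim: sbound_mono)
  next
    case False
    then have "lp_bump \<phi> j = lp_bump \<phi> 1" by (simp add: lp_bump_def)
    then show ?thesis using A B by (auto elim: sbound_mono)
  qed
  show ?thesis
  proof (rule that[of "K * (A + B)" "DIM('a) + N"])
    show "0 < K * (A + B)" using K A B by simp
    fix j x
    have "sbound N N (\<phi> j) ((2 ^ j) ^ (DIM('a) + N) * (A + B))"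
      by (subst lp_eq_dilate) (intro sbound_dilate schwartz_smooth lp_bump_schwartz AB, simp)
    then have "cmod (conv (\<phi> j) f x) \<le> K * ((2 ^ j) ^ (DIM('a) + N) * (A + B)) * (1 + norm x) ^ N"
      by (intro conv_bound[where u=f and \<phi>="\<phi> j" and N=N and K=K] K(2) lp_schwartz)
    also have "\<dots> \<le> K * ((2 ^ j) ^ (DIM('a) + N) * (A + B)) * (1 + norm x) ^ (DIM('a) + N)"
      using K A B by (intro mult_left_mono weight_mono) auto
    finally show "cmod (conv (\<phi> j) f x) \<le> K * (A + B) * (2 ^ j) ^ (DIM('a) + N) * (1 + norm x) ^ (DIM('a) + N)"
      by (simp add: mult_ac)
  qed
qed

text \<open>Convolution with \<open>lp_fat \<phi> j\<close> gains a factor \<open>2 ^ - j\<close> for one derivative because its mean vanishes;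
  as \<open>\<phi> j\<close> is reproduced by it, the gain can be iterated.\<close>

lemma smoothing_schwartz: "\<psi> \<in> schwartz \<Longrightarrow> smoothing \<phi> j \<psi> \<in> schwartz"
  unfolding smoothing_def fconv_commute[of _ \<psi>]
  using schwartz_fconv[OF _ rapid_reflect[OF lp_fat_rapid, where a=0]] by simp

lemma smoothing_iter_schwartz: "\<psi> \<in> schwartz \<Longrightarrow> (smoothing \<phi> j ^^ m) \<psi> \<in> schwartz"
  by (induction m) (auto intro: smoothing_schwartz)

lemma smoothing_gain:
  obtains A where "0 \<le> A" "\<And>j k m \<psi> B. \<psi> \<in> schwartz \<Longrightarrow> sbound N (k + m) \<psi> B \<Longrightarrow>
    sbound N k ((smoothing \<phi> j ^^ m) \<psi>) ((A / 2 ^ j) ^ m * B)"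
proof -
  \<comment> \<open>The first moment of the undilated kernel; dilation by \<open>2 ^ j\<close>
    supplies the factor \<open>1 / 2 ^ j\<close>, so \<open>A\<close> does not depend on
    \<open>j\<close>, \<open>k\<close>, \<open>m\<close> or the test function.\<close>
  define I where "I = (LINT t|lborel. norm t ^ 1 * (1 + norm t) ^ N * cmod (lp_fat0 \<phi> t))"
  define A where "A = real DIM('a) * I"
  have I0: "0 \<le> I" unfolding I_def by (rule Bochner_Integration.integral_nonneg) simp
  have one: "sbound N k (smoothing \<phi> j \<psi>) ((A / 2 ^ j) * B)"
    if \<psi>: "\<psi> \<in> schwartz" "sbound N (Suc k) \<psi> B" for \<psi> B j k
  proof -
    have r: "rapid (\<lambda>x. lp_fat \<phi> j (- x))" using rapid_reflect[OF lp_fat_rapid, where a=0] by simp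
    have "(LINT t|lborel. norm t * (1 + norm t) ^ N * cmod (lp_fat \<phi> j (- t))) = (LINT t|lborel. norm t ^ 1 * (1 + norm t) ^ N * cmod (lp_fat \<phi> j t))"
      using integral_reflect[of "\<lambda>t. norm t * (1 + norm t) ^ N * cmod (lp_fat \<phi> j t)" 0] by simp
    also have "\<dots> \<le> (1 / (2 ^ j) ^ 1) * I"
      unfolding lp_fat_def I_def by (rule dilate_mass[OF schwartz_rapid[OF lp_fat0_schwartz]]) simp
    finally have "real DIM('a) * B * (LINT t|lborel. norm t * (1 + norm t) ^ N * cmod (lp_fat \<phi> j (- t)))
      \<le> real DIM('a) * B * ((1 / (2 ^ j) ^ 1) * I)"
      using sbound_nonneg[OF \<psi>(2)] by (intro mult_left_mono) auto
    also have "\<dots> = (A / 2 ^ j) * B" by (simp add: A_def)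
    finally show ?thesis
      unfolding smoothing_def fconv_commute[of _ \<psi>]
      by (intro sbound_mono[OF sbound_fconv_mean_zero[OF \<psi> r lp_fat_mean]]) auto
  qed
  show ?thesis
  proof (rule that[of A])
    show "0 \<le> A" using I0 by (simp add: A_def)
    show "sbound N k ((smoothing \<phi> j ^^ m) \<psi>) ((A / 2 ^ j) ^ m * B)"
      if "\<psi> \<in> schwartz" "sbound N (k + m) \<psi> B" for j k m \<psi> B
      using that(2)
    proof (induction m arbitrary: k)
      case (Suc m)
      then have "sbound N (Suc k) ((smoothing \<phi> j ^^ m) \<psi>) ((A / 2 ^ j) ^ m * B)" by simp
      from one[OF smoothing_iter_schwartz[OF that(1)] this] show ?case by (simp add: mult.assoc)
    qed simp
  qed
qed

text \<open>A function reproduced by \<open>lp_fat \<phi> j\<close> may have the kernel inserted in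
  front of it and transposed onto the test function, any number of times, without changing the
  pairing.\<close>

lemma pairing_smoothing:
  assumes g: "growing g" "fconv (lp_fat \<phi> j) g = g" and \<psi>: "\<psi> \<in> schwartz"
  shows "(LINT x|lborel. g x * \<psi> x) = (LINT x|lborel. g x * (smoothing \<phi> j ^^ m) \<psi> x)"
proof (induction m)
  case (Suc m)
  have "(LINT x|lborel. g x * (smoothing \<phi> j ^^ m) \<psi> x) = (LINT x|lborel. fconv (lp_fat \<phi> j) g x * (smoothing \<phi> j ^^ m) \<psi> x)"
    by (simp add: g(2))
  also have "\<dots> = (LINT x|lborel. g x * smoothing \<phi> j ((smoothing \<phi> j ^^ m) \<psi>) x)"
    unfolding smoothing_def[of \<phi> j "(smoothing \<phi> j ^^ m) \<psi>"]
    by (rule fconv_pairing[OF g(1) lp_fat_rapid schwartz_rapid[OF smoothing_iter_schwartz[OF \<psi>]]])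
  finally show ?case using Suc by simp
qed simp

text \<open>The blocks may grow like \<open>(2 ^ j) ^ M\<close>; smoothing the test function
  \<open>M + 1\<close> times gains \<open>(2 ^ j) ^ (M + 1)\<close>, so the pairings decay like
  \<open>1 / 2 ^ j\<close>. The estimate uses one seminorm of the test function, hence the sum is
  tempered. Reproduction by \<open>lp_fat\<close> is the only spectral information involved, so the
  lemma serves both \<open>T f\<close> and series of packets.\<close>

lemma lp_series:
  fixes g :: "nat \<Rightarrow> 'a \<Rightarrow> complex"
  assumes cont: "\<And>j. 1 \<le> j \<Longrightarrow> continuous_on UNIV (g j)"
    and bound: "\<And>j x. 1 \<le> j \<Longrightarrow> cmod (g j x) \<le> C * (2 ^ j) ^ M * (1 + norm x) ^ L"
    and fat: "\<And>j. 1 \<le> j \<Longrightarrow> fconv (lp_fat \<phi> j) (g j) = g j"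
  obtains u where "u \<in> tempered" "\<And>\<psi>. (\<lambda>N. \<Sum>j=1..N. distribution_of (g j) \<psi>) \<longlonglongrightarrow> u \<psi>"
proof -
  have gr: "growing (g j)" if "1 \<le> j" for j
    unfolding growing_def using cont[OF that] bound[OF that] by blast
  have C: "0 \<le> C"
  proof -
    have "0 \<le> C * (2 ^ 1) ^ M * (1 + norm (0::'a)) ^ L" using bound[of 1 0] norm_ge_zero order_trans by blast
    moreover have "\<not> (2::real) ^ M \<le> 0" by (simp add: not_le)
    ultimately show ?thesis by (auto simp: zero_le_mult_iff)
  qed
  define W where "W = weight_mass TYPE('a)"
  have W: "0 \<le> W" unfolding W_def by (rule weight_mass_nonneg)
  obtain A where A: "0 \<le> A" "\<And>j k m \<psi> B. \<psi> \<in> schwartz \<Longrightarrow> sbound (L + 2 * DIM('a)) (k + m) \<psi> B \<Longrightarrow>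
    sbound (L + 2 * DIM('a)) k ((smoothing \<phi> j ^^ m) \<psi>) ((A / 2 ^ j) ^ m * B)"
    using smoothing_gain by metis
  let ?m = "Suc M"
  define Q where "Q = C * A ^ ?m * W"
  have Q: "0 \<le> Q" using C A W by (simp add: Q_def)
  define v where "v = (\<lambda>j. distribution_of (g (Suc j)))"
  have vt: "v j \<in> tempered" for j unfolding v_def by (rule distribution_of_tempered[OF gr]) simp
  have vb: "cmod (v j \<psi>) \<le> Q * B * (1 / 2) ^ Suc j"
    if \<psi>: "\<psi> \<in> schwartz" "sbound (L + 2 * DIM('a)) ?m \<psi> B" for \<psi> B j
  proof -
    let ?P = "(smoothing \<phi> (Suc j) ^^ ?m) \<psi>"
    have s: "sbound (L + 2 * DIM('a)) 0 ?P ((A / 2 ^ Suc j) ^ ?m * B)" by (rule A(2)) (use \<psi> in auto)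
    have "v j \<psi> = (LINT x|lborel. g (Suc j) x * ?P x)"
      unfolding v_def distribution_of_def using pairing_smoothing[OF gr fat \<psi>(1), of "Suc j" ?m] \<psi>(1) by simp
    also have "cmod \<dots> \<le> C * (2 ^ Suc j) ^ M * ((A / 2 ^ Suc j) ^ ?m * B) * W"
      unfolding W_def
      by (rule integral_pairing_bound(2)[OF growing_measurable[OF gr] rapid_measurable[OF schwartz_rapid[OF smoothing_iter_schwartz[OF \<psi>(1)]]] bound sboundD0[OF s]]) auto
    also have "\<dots> = Q * B * (1 / 2 ^ Suc j)"
    proof -
      define z where "z = (2::real) ^ Suc j"
      have "z ^ M * (A / z) ^ ?m = A ^ ?m * (1 / z)" by (simp add: power_divide z_def)
      moreover have "C * z ^ M * ((A / z) ^ ?m * B) * W = C * (z ^ M * (A / z) ^ ?m) * B * W"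
        by (simp only: mult_ac)
      ultimately have "C * z ^ M * ((A / z) ^ ?m * B) * W = C * (A ^ ?m * (1 / z)) * B * W" by (simp only:)
      also have "\<dots> = C * A ^ ?m * W * B * (1 / z)" by (simp only: mult_ac)
      finally show ?thesis unfolding z_def Q_def .
    qed
    finally show ?thesis by (simp add: power_one_over)
  qed
  have summ: "summable (\<lambda>j. v j \<psi>)" for \<psi>
  proof (cases "\<psi> \<in> schwartz")
    case True
    obtain B where B: "sbound (L + 2 * DIM('a)) ?m \<psi> B" using schwartz_sboundE[OF True] by metis
    show ?thesis
    proof (rule summable_comparison_test'[where N=0])
      show "summable (\<lambda>j. Q * B * (1 / 2 :: real) ^ Suc j)"
        by (intro summable_mult summable_Suc_iff[THEN iffD2] summable_geometric) simp
    qed (rule vb[OF True B])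
  next
    case False
    then show ?thesis using tempered_not_schwartz[OF vt] by simp
  qed
  define u where "u = (\<lambda>\<psi>. \<Sum>j. v j \<psi>)"
  have lim: "(\<lambda>N. \<Sum>j=1..N. distribution_of (g j) \<psi>) \<longlonglongrightarrow> u \<psi>" for \<psi>
    using summable_LIMSEQ[OF summ, of \<psi>] unfolding u_def v_def
    by (simp add: sum.atLeast1_atMost_eq)
  have "u \<in> tempered"
  proof (rule temperedI[where K=Q and N="max (L + 2 * DIM('a)) ?m"])
    fix f1 f2 :: "'a \<Rightarrow> complex" and a b assume f: "f1 \<in> schwartz" "f2 \<in> schwartz"
    show "u (\<lambda>x. a * f1 x + b * f2 x) = a * u f1 + b * u f2"
      unfolding u_def tempered_lincomb[OF vt f]
      by (simp only: suminf_add[symmetric] suminf_mult summ summable_mult)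
  next
    fix \<psi> :: "'a \<Rightarrow> complex" and B assume \<psi>: "\<psi> \<in> schwartz" "sbound (max (L + 2 * DIM('a)) ?m) (max (L + 2 * DIM('a)) ?m) \<psi> B"
    have s: "sbound (L + 2 * DIM('a)) ?m \<psi> B" by (rule sbound_mono[OF \<psi>(2)]) auto
    have g: "(\<lambda>j. Q * B * (1 / 2 :: real) ^ Suc j) sums (Q * B * 1)"
      by (intro sums_mult) (use power_half_series in simp)
    have "cmod (u \<psi>) \<le> (\<Sum>j. Q * B * (1 / 2) ^ Suc j)"
      unfolding u_def by (rule norm_suminf_le[OF vb[OF \<psi>(1) s] sums_summable[OF g]])
    also have "\<dots> = Q * B" using sums_unique[OF g] by simp
    finally show "cmod (u \<psi>) \<le> Q * B" .
  next
    show "u f = 0" if "f \<notin> schwartz" for f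
      unfolding u_def using tempered_not_schwartz[OF vt that] by simp
  qed (rule Q)
  with lim show ?thesis by (rule that[rotated])
qed

end

section \<open>Continuity on tempered distributions\<close>

lemma T_op_linear:
  assumes \<phi>: "\<And>j. \<phi> j \<in> schwartz" and V: "V \<subseteq> tempered" "\<And>f. f \<in> V \<Longrightarrow> T_converges \<phi> y f"
  shows "linear_on_functionals V (T_op \<phi> y)"
  unfolding linear_on_functionals_def
proof (intro ballI allI)
  fix f g a b assume fg: "f \<in> V" "g \<in> V"
  obtain u v where u: "T_sums \<phi> y f u" and v: "T_sums \<phi> y g v"
    using V(2)[OF fg(1)] V(2)[OF fg(2)] unfolding T_converges_def by (elim exE)
  have "f \<in> tempered" "g \<in> tempered" using fg V(1) by auto
  from T_op_eqI[OF T_sums_comb[OF \<phi> this(1) u this(2) v, of a b]]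
  show "T_op \<phi> y (\<lambda>\<psi>. a * f \<psi> + b * g \<psi>) = (\<lambda>\<psi>. a * T_op \<phi> y f \<psi> + b * T_op \<phi> y g \<psi>)"
    by (simp only: T_op_eqI[OF u] T_op_eqI[OF v])
qed

context
  fixes \<phi> :: "nat \<Rightarrow> 'a::euclidean_space \<Rightarrow> complex" and y :: "nat \<Rightarrow> 'a"
  assumes lp: "littlewood_paley \<phi>"
begin

text \<open>Convolution commutes with translation, so the translated blocks are still reproduced by
  \<open>lp_fat\<close> and only their growth has to be supplied.\<close>

lemma T_sums_exists:
  assumes f: "f \<in> tempered"
    and bound: "\<And>j x. 1 \<le> j \<Longrightarrow> cmod (conv (\<phi> j) f (x - y j)) \<le> C * (2 ^ j) ^ M * (1 + norm x) ^ L"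
  obtains u where "T_sums \<phi> y f u"
proof (rule lp_series[OF lp, of "\<lambda>j. translate (y j) (conv (\<phi> j) f)" C M L])
  show "continuous_on UNIV (translate (y j) (conv (\<phi> j) f))" for j
    by (rule growing_continuous[OF growing_translate_conv[OF lp_schwartz[OF lp] f]])
  show "cmod (translate (y j) (conv (\<phi> j) f) x) \<le> C * (2 ^ j) ^ M * (1 + norm x) ^ L" if "1 \<le> j" for j x
    using bound[OF that] by (simp add: translate_def)
  show "fconv (lp_fat \<phi> j) (translate (y j) (conv (\<phi> j) f)) = translate (y j) (conv (\<phi> j) f)" if "1 \<le> j" for j
  proof
    fix x
    show "fconv (lp_fat \<phi> j) (translate (y j) (conv (\<phi> j) f)) x = translate (y j) (conv (\<phi> j) f) x"
      using fconv_shift_right[of "lp_fat \<phi> j" "conv (\<phi> j) f" "- y j" x]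
      by (simp add: translate_eq fconv_fat_conv[OF lp f that])
  qed
  fix u assume "u \<in> tempered"
    "\<And>\<psi>. (\<lambda>N. \<Sum>j=1..N. distribution_of (translate (y j) (conv (\<phi> j) f)) \<psi>) \<longlonglongrightarrow> u \<psi>"
  then show thesis by (intro that[of u]) (simp add: T_sums_iff[OF lp_schwartz[OF lp] f])
qed

text \<open>The reflected kernels inherit the reproduction property of \<open>lp_fat\<close>.
  Smoothing thus leaves these convolved test functions unchanged, and its gain can be claimed for
  them directly.\<close>

lemma smoothing_fixed:
  assumes "1 \<le> j" "\<psi> \<in> schwartz"
  shows "smoothing \<phi> j (fconv (\<lambda>x. \<phi> j (- x)) \<psi>) = fconv (\<lambda>x. \<phi> j (- x)) \<psi>"
proof -
  have r: "rapid (\<lambda>x. lp_fat \<phi> j (- x))" "rapid (\<lambda>x. \<phi> j (- x))"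
    using rapid_reflect[OF lp_fat_rapid[OF lp], where a=0] rapid_reflect[OF lp_rapid[OF lp], where a=0] by simp_all
  have "fconv (\<lambda>x. lp_fat \<phi> j (- x)) (\<lambda>x. \<phi> j (- x)) = (\<lambda>x. \<phi> j (- x))"
  proof
    fix x
    have "fconv (\<lambda>x. lp_fat \<phi> j (- x)) (\<lambda>x. \<phi> j (- x)) x = fconv (lp_fat \<phi> j) (\<phi> j) (- x)"
      using integral_reflect[of "\<lambda>t. lp_fat \<phi> j (- x - t) * \<phi> j t" 0] by (simp add: fconv_def)
    then show "fconv (\<lambda>x. lp_fat \<phi> j (- x)) (\<lambda>x. \<phi> j (- x)) x = \<phi> j (- x)"
      by (simp add: fconv_fat[OF lp assms(1)])
  qed
  then show ?thesis
    unfolding smoothing_def fconv_assoc[OF r schwartz_rapid[OF assms(2)]] by simp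
qed

text \<open>The function is a fixed point of smoothing, so the gain of \<open>m\<close> iterations
  bounds the function itself. It remains to bound the input uniformly in \<open>j\<close>, which
  holds because the weighted mass of \<open>\<phi> j\<close> does not grow with
  \<open>j\<close>.\<close>

lemma lp_test_decay:
  assumes \<psi>: "\<psi> \<in> schwartz"
  obtains D where "0 \<le> D" "\<And>j. 1 \<le> j \<Longrightarrow> sbound N k (fconv (\<lambda>x. \<phi> j (- x)) \<psi>) (D / (2 ^ j) ^ m)"
proof -
  obtain A where A: "0 \<le> A" "\<And>j k m \<psi> B. \<psi> \<in> schwartz \<Longrightarrow> sbound N (k + m) \<psi> B \<Longrightarrow>
    sbound N k ((smoothing \<phi> j ^^ m) \<psi>) ((A / 2 ^ j) ^ m * B)"
    using smoothing_gain[OF lp] by metis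
  obtain B where B: "sbound N (k + m) \<psi> B" "0 < B" using schwartz_sboundE[OF \<psi>] by metis
  define I where "I = (LINT t|lborel. norm t ^ 0 * (1 + norm t) ^ N * cmod (lp_bump \<phi> 1 t))"
  have I0: "0 \<le> I" unfolding I_def by (rule Bochner_Integration.integral_nonneg) simp
  show ?thesis
  proof (rule that[of "A ^ m * (B * I)"])
    show "0 \<le> A ^ m * (B * I)" using A B I0 by simp
    fix j :: nat assume j: "1 \<le> j"
    let ?r = "\<lambda>x. \<phi> j (- x)"
    have r: "?r \<in> schwartz" using schwartz_reflect[OF lp_schwartz[OF lp], where a=0] by simp
    have b: "lp_bump \<phi> j = lp_bump \<phi> 1" using j by (simp add: lp_bump_def)
    have "(LINT t|lborel. (1 + norm t) ^ N * cmod (?r t)) = (LINT t|lborel. norm t ^ 0 * (1 + norm t) ^ N * cmod (\<phi> j t))"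
      using integral_reflect[of "\<lambda>t. (1 + norm t) ^ N * cmod (\<phi> j t)" 0] by simp
    also have "\<dots> \<le> (1 / (2 ^ j) ^ 0) * I"
      unfolding I_def by (subst lp_eq_dilate[OF lp], unfold b, rule dilate_mass[OF schwartz_rapid[OF lp_bump_schwartz[OF lp]]]) simp
    finally have "B * (LINT t|lborel. (1 + norm t) ^ N * cmod (?r t)) \<le> B * I"
      using B by (intro mult_left_mono) auto
    then have "sbound N (k + m) (fconv ?r \<psi>) (B * I)"
      unfolding fconv_commute[of ?r]
      by (rule sbound_mono[OF sbound_fconv[OF \<psi> B(1) schwartz_rapid[OF r]] order_refl order_refl])
    then have "sbound N k ((smoothing \<phi> j ^^ m) (fconv ?r \<psi>)) ((A / 2 ^ j) ^ m * (B * I))"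
      by (rule A(2)[OF schwartz_fconv[OF r schwartz_rapid[OF \<psi>]]])
    moreover have "(smoothing \<phi> j ^^ m) (fconv ?r \<psi>) = fconv ?r \<psi>"
      by (induction m) (simp_all add: smoothing_fixed[OF j \<psi>])
    ultimately show "sbound N k (fconv ?r \<psi>) (A ^ m * (B * I) / (2 ^ j) ^ m)"
      by (simp add: power_divide)
  qed
qed

text \<open>Each block of \<open>T\<close> is moved onto the test function, so that the series for
  \<open>T\<close> becomes a series in the Schwartz space to which \<open>f\<close> is
  applied.\<close>

lemma T_transpose:
  assumes f: "f \<in> tempered" and \<psi>: "\<psi> \<in> schwartz"
  shows "distribution_of (translate a (conv (\<phi> j) f)) \<psi> = f (\<lambda>w. fconv (\<lambda>x. \<phi> j (- x)) \<psi> (w + a))"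
proof -
  have "distribution_of (translate a (conv (\<phi> j) f)) \<psi> = (LINT x|lborel. conv (\<phi> j) f (x - a) * \<psi> x)"
    using \<psi> by (simp add: distribution_of_def translate_def)
  also have "\<dots> = (LINT x|lborel. conv (\<phi> j) f x * \<psi> (x + a))"
    using integral_shift[of "\<lambda>x. conv (\<phi> j) f (x - a) * \<psi> x" a] by simp
  also have "\<dots> = f (fconv (\<lambda>x. \<phi> j (- x)) (\<lambda>x. \<psi> (x + a)))"
    by (rule integral_conv[OF f lp_schwartz[OF lp] rapid_shift[OF schwartz_rapid[OF \<psi>]]])
  also have "fconv (\<lambda>x. \<phi> j (- x)) (\<lambda>x. \<psi> (x + a)) = (\<lambda>w. fconv (\<lambda>x. \<phi> j (- x)) \<psi> (w + a))"
    by (rule ext) (rule fconv_shift_right)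
  finally show ?thesis .
qed

text \<open>For each \<open>\<psi>\<close> the transposed blocks sum to a Schwartz function at which
  every \<open>f\<close> is evaluated. Evaluation at a fixed test function is continuous in the
  product topology, and continuity into that topology is checked coordinatewise.\<close>

lemma T_continuous:
  assumes y: "\<And>j. 1 \<le> j \<Longrightarrow> norm (y j) \<le> (2 ^ j) ^ N\<^sub>1"
  shows "(\<forall>f\<in>tempered. T_converges \<phi> y f) \<and> continuous_map tempered_topology tempered_topology (T_op \<phi> y)"
proof -
  \<comment> \<open>The added 1 costs a factor 2, which is at most \<open>2 ^ j\<close> because
    \<open>j \<ge> 1\<close>; hence the exponent \<open>Suc N\<^sub>1\<close>.\<close>
  have y1: "(1 + norm (y j)) ^ M \<le> (2 ^ j) ^ (Suc N\<^sub>1 * M)" if j: "1 \<le> j" for j M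
  proof -
    have "(1::real) \<le> (2 ^ j) ^ N\<^sub>1" by (simp add: one_le_power)
    then have "1 + norm (y j) \<le> 2 * (2 ^ j) ^ N\<^sub>1" using y[OF j] by linarith
    also have "\<dots> \<le> 2 ^ j * (2 ^ j) ^ N\<^sub>1"
      using power_increasing[OF j, of "2::real"] by (intro mult_right_mono) auto
    finally have "(1 + norm (y j)) ^ M \<le> ((2 ^ j) ^ Suc N\<^sub>1) ^ M" by (intro power_mono) auto
    then show ?thesis by (simp only: power_mult)
  qed
  have ex: "\<exists>u. T_sums \<phi> y f u" if f: "f \<in> tempered" for f
  proof -
    obtain C M where C: "0 < C" "\<And>j x. cmod (conv (\<phi> j) f x) \<le> C * (2 ^ j) ^ M * (1 + norm x) ^ M"
      using lp_conv_bound[OF lp f] by metis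
    have "cmod (conv (\<phi> j) f (x - y j)) \<le> C * (2 ^ j) ^ (M + Suc N\<^sub>1 * M) * (1 + norm x) ^ M" if j: "1 \<le> j" for j x
    proof -
      have "(1 + norm (x - y j)) ^ M \<le> (1 + norm x) ^ M * (1 + norm (y j)) ^ M" by (rule weight_diff)
      also have "\<dots> \<le> (1 + norm x) ^ M * (2 ^ j) ^ (Suc N\<^sub>1 * M)" by (intro mult_left_mono y1[OF j]) auto
      finally have "C * (2 ^ j) ^ M * (1 + norm (x - y j)) ^ M \<le> C * (2 ^ j) ^ M * ((1 + norm x) ^ M * (2 ^ j) ^ (Suc N\<^sub>1 * M))"
        using C(1) by (intro mult_left_mono) auto
      also have "\<dots> = C * (2 ^ j) ^ (M + Suc N\<^sub>1 * M) * (1 + norm x) ^ M" by (simp only: power_add mult_ac)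
      finally show ?thesis by (rule order_trans[OF C(2)])
    qed
    from T_sums_exists[OF f this] show ?thesis by metis
  qed
  have Tt: "T_op \<phi> y f \<in> tempered" if f: "f \<in> tempered" for f
  proof -
    obtain u where u: "T_sums \<phi> y f u" using ex[OF f] by (elim exE)
    then show ?thesis unfolding T_op_eqI[OF u] by (simp add: T_sums_iff[OF lp_schwartz[OF lp] f])
  qed
  have rep: "\<exists>\<Theta>. \<forall>f\<in>tempered. T_op \<phi> y f \<psi> = f \<Theta>" if \<psi>: "\<psi> \<in> schwartz" for \<psi>
  proof -
    define \<theta> where "\<theta> = (\<lambda>i w. fconv (\<lambda>x. \<phi> (Suc i) (- x)) \<psi> (w + y (Suc i)))"
    have r: "(\<lambda>x. \<phi> j (- x)) \<in> schwartz" for j using schwartz_reflect[OF lp_schwartz[OF lp], where a=0] by simp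
    have \<theta>: "\<theta> i \<in> schwartz" for i
      unfolding \<theta>_def by (intro schwartz_shift schwartz_fconv r schwartz_rapid \<psi>)
    have "\<exists>D. \<forall>i. sbound N k (\<theta> i) (D * (1 / 2) ^ Suc i)" for N k
    proof -
      \<comment> \<open>The shift by \<open>y (Suc i)\<close> costs at most
        \<open>(2 ^ Suc i) ^ m\<close>. Decay of order \<open>Suc m\<close> is requested so that a
        summable \<open>(1 / 2) ^ Suc i\<close> is left.\<close>
      define m where "m = Suc N\<^sub>1 * N"
      obtain D where D: "0 \<le> D" "\<And>j. 1 \<le> j \<Longrightarrow> sbound N k (fconv (\<lambda>x. \<phi> j (- x)) \<psi>) (D / (2 ^ j) ^ Suc m)"
        using lp_test_decay[OF \<psi>] by metis
      have "sbound N k (\<theta> i) (D * (1 / 2) ^ Suc i)" for i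
      proof -
        let ?j = "Suc i"
        have s1: "sbound N k (\<theta> i) ((1 + norm (y ?j)) ^ N * (D / (2 ^ ?j) ^ Suc m))"
          unfolding \<theta>_def by (intro sbound_shift schwartz_smooth schwartz_fconv r schwartz_rapid \<psi> D(2)) simp
        have s2: "(1 + norm (y ?j)) ^ N * (D / (2 ^ ?j) ^ Suc m) \<le> (2 ^ ?j) ^ m * (D / (2 ^ ?j) ^ Suc m)"
          unfolding m_def by (intro mult_right_mono y1) (use D(1) in auto)
        have s3: "(2 ^ ?j) ^ m * (D / (2 ^ ?j) ^ Suc m) = D * (1 / 2) ^ Suc i"
        proof -
          have "z ^ m * (D / z ^ Suc m) = D * (1 / z)" if "z \<noteq> 0" for z :: real using that by simp
          from this[of "2 ^ ?j"] show ?thesis by (simp add: power_one_over)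
        qed
        show ?thesis by (rule sbound_mono[OF s1 order_refl order_refl order_trans[OF s2 eq_refl[OF s3]]])
      qed
      then show ?thesis by (intro exI[of _ D]) simp
    qed
    then obtain D where D: "\<And>N k i. sbound N k (\<theta> i) (D N k * (1 / 2) ^ Suc i)" by metis
    have s: "summable (\<lambda>i. D N k * (1 / 2 :: real) ^ Suc i)" for N k
      by (intro summable_mult summable_Suc_iff[THEN iffD2] summable_geometric) simp
    show ?thesis
    proof (intro exI ballI)
      fix f :: "('a \<Rightarrow> complex) \<Rightarrow> complex" assume f: "f \<in> tempered"
      obtain u where u: "T_sums \<phi> y f u" using ex[OF f] by (elim exE)
      have "(\<lambda>N. \<Sum>j=1..N. distribution_of (translate (y j) (conv (\<phi> j) f)) \<psi>) \<longlonglongrightarrow> u \<psi>"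
        using u by (simp add: T_sums_iff[OF lp_schwartz[OF lp] f])
      then have "(\<lambda>i. f (\<theta> i)) sums u \<psi>"
        unfolding sums_def \<theta>_def T_transpose[OF f \<psi>] by (simp add: sum.atLeast1_atMost_eq)
      moreover have "(\<lambda>i. f (\<theta> i)) sums f (\<lambda>x. \<Sum>i. \<theta> i x)" by (rule tempered_sums[OF f \<theta> D s])
      ultimately show "T_op \<phi> y f \<psi> = f (\<lambda>x. \<Sum>i. \<theta> i x)"
        unfolding T_op_eqI[OF u] by (rule sums_unique2)
    qed
  qed
  have "continuous_on tempered (\<lambda>f. T_op \<phi> y f \<psi>)" for \<psi>
  proof (cases "\<psi> \<in> schwartz")
    case True
    then obtain \<Theta> where "\<forall>f\<in>tempered. T_op \<phi> y f \<psi> = f \<Theta>" using rep by blast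
    moreover have "continuous_on tempered (\<lambda>f::('a \<Rightarrow> complex) \<Rightarrow> complex. f \<Theta>)"
      by (rule continuous_on_product_then_coordinatewise[OF continuous_on_id])
    ultimately show ?thesis by (subst continuous_on_cong[OF refl]) auto
  next
    case False
    then have "T_op \<phi> y f \<psi> = 0" if "f \<in> tempered" for f using tempered_not_schwartz[OF Tt[OF that]] by simp
    then show ?thesis by (subst continuous_on_cong[OF refl]) auto
  qed
  then have "continuous_on tempered (T_op \<phi> y)" by (rule continuous_on_coordinatewise_then_product)
  then have "continuous_map tempered_topology tempered_topology (T_op \<phi> y)"
    unfolding tempered_topology_def using Tt by (auto simp: continuous_map_in_subtopology)
  then show ?thesis using ex by (auto simp: T_converges_def)
qed

end


section \<open>Wave packets\<close>

definition wave :: "'a::euclidean_space \<Rightarrow> ('a \<Rightarrow> complex) \<Rightarrow> nat \<Rightarrow> 'a \<Rightarrow> complex" where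
  "wave e G j x = echar ((2 ^ j) *\<^sub>R e) x * G x"

text \<open>Packet \<open>j\<close> is seen by \<open>\<phi> j\<close> alone and is unchanged by it.
  The value at 0 gives lower bounds in the Triebel-Lizorkin norms, and a nonzero value of
  \<open>fconv G G\<close> lets a reflected packet detect one of the same frequency under the
  integral pairing.\<close>

definition lp_carrier :: "(nat \<Rightarrow> 'a::euclidean_space \<Rightarrow> complex) \<Rightarrow> 'a \<Rightarrow> ('a \<Rightarrow> complex) \<Rightarrow> bool" where
  "lp_carrier \<phi> e G \<longleftrightarrow> rapid G \<and> G 0 \<noteq> 0 \<and> (\<exists>z. fconv G G z \<noteq> 0) \<and>
     (\<forall>j\<ge>1. \<forall>k. fconv (\<phi> k) (wave e G j) = (if k = j then wave e G j else (\<lambda>x. 0)))"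

lemma norm_wave [simp]: "cmod (wave e G j x) = cmod (G x)"
  by (simp add: wave_def norm_mult)

lemma wave_rapid: assumes "rapid G" shows "rapid (wave e G j)"
proof -
  have "growing (echar ((2 ^ j) *\<^sub>R e))"
    unfolding growing_def by (intro conjI continuous_echar exI[of _ 0] exI[of _ 1]) simp
  from rapid_mult_growing[OF assms this] show ?thesis by (simp add: wave_def[abs_def] mult.commute)
qed

lemma fourier_wave: "fourier (wave e G j) \<xi> = fourier G (\<xi> - (2 ^ j) *\<^sub>R e)"
proof -
  have "echar ((2 ^ j) *\<^sub>R e) x * echar \<xi> (- x) = echar (\<xi> - (2 ^ j) *\<^sub>R e) (- x)" for x
    using echar_add_left[of \<xi> "- ((2 ^ j) *\<^sub>R e)" "- x"] by (simp add: echar_minus_left)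
  then have *: "wave e G j x * echar \<xi> (- x) = G x * echar (\<xi> - (2 ^ j) *\<^sub>R e) (- x)" for x
    unfolding wave_def by (metis mult.assoc mult.commute)
  show ?thesis unfolding fourier_echar * ..
qed

text \<open>Two boundary facts about the transform of \<open>\<phi> 0\<close> meet: it is 1 on a
  neighbourhood of the unit vector \<open>e\<close>, and it vanishes near
  \<open>2 *\<^sub>R e\<close>, since the closed support lies in the open ball of radius 2. At
  \<open>(2 ^ j) *\<^sub>R e\<close> the difference defining the transform of
  \<open>\<phi> j\<close> is therefore 1 - 0, and for other indices both terms agree, or the single
  term vanishes when the index is 0.\<close>

lemma lp_wave_frequency:
  fixes \<phi> :: "nat \<Rightarrow> 'a::euclidean_space \<Rightarrow> complex"
  assumes lp: "littlewood_paley \<phi>" and e: "norm e = 1"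
  obtains \<delta> where "0 < \<delta>" "\<And>j k \<xi>. 1 \<le> j \<Longrightarrow> norm (\<xi> - (2 ^ j) *\<^sub>R e) < \<delta> \<Longrightarrow> fourier (\<phi> k) \<xi> = (if k = j then 1 else 0)"
proof -
  obtain U where U: "open U" "cball 0 1 \<subseteq> U" "\<forall>\<xi>\<in>U. fourier (\<phi> 0) \<xi> = 1"
    using lp0_plateau[OF lp] by (elim exE conjE)
  have "e \<in> U" using U(2) e by auto
  then obtain d1 where d1: "0 < d1" "ball e d1 \<subseteq> U" using U(1) openE by blast
  define V where "V = - closure {\<xi>. fourier (\<phi> 0) \<xi> \<noteq> 0}"
  have "2 *\<^sub>R e \<notin> ball 0 2" using e by simp
  then have "2 *\<^sub>R e \<in> V" using lp0_support[OF lp] unfolding V_def by blast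
  moreover have "open V" unfolding V_def by (intro open_Compl closed_closure)
  ultimately obtain d2 where d2: "0 < d2" "ball (2 *\<^sub>R e) d2 \<subseteq> V" using openE by blast
  have V0: "fourier (\<phi> 0) \<xi> = 0" if "\<xi> \<in> V" for \<xi>
    using that closure_subset[of "{\<xi>. fourier (\<phi> 0) \<xi> \<noteq> 0}"] unfolding V_def by auto
  \<comment> \<open>The bounds by \<open>d1\<close> and \<open>d2 / 2\<close> keep
    \<open>\<eta>\<close> and \<open>2 *\<^sub>R \<eta>\<close> in the two neighbourhoods. The bound
    1/2 forces 1/2 \<le> |\<eta>| \<le> 3/2, so that multiplying by 4 or more leaves the ball of
    radius 2 and halving enters the unit ball.\<close>
  define \<delta> where "\<delta> = min (1 / 2) (min d1 (d2 / 2))"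
  have \<delta>: "0 < \<delta>" "\<delta> \<le> 1 / 2" "\<delta> \<le> d1" "2 * \<delta> \<le> d2" using d1(1) d2(1) by (auto simp: \<delta>_def)
  have main: "fourier (\<phi> k) ((2 ^ j) *\<^sub>R \<eta>) = (if k = j then 1 else 0)"
    if j: "1 \<le> j" and \<eta>: "norm (\<eta> - e) < \<delta>" for j k \<eta>
  proof -
    have n1: "norm \<eta> \<le> norm e + norm (\<eta> - e)" using norm_triangle_ineq[of e "\<eta> - e"] by simp
    have n2: "norm e \<le> norm \<eta> + norm (\<eta> - e)" using norm_triangle_ineq4[of \<eta> "\<eta> - e"] by simp
    have up: "norm \<eta> \<le> 3 / 2" and lo: "1 / 2 \<le> norm \<eta>" using n1 n2 \<eta> \<delta> e by auto
    have h1: "fourier (\<phi> 0) \<eta> = 1"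
    proof -
      have "\<eta> \<in> ball e d1" using \<eta> \<delta> by (simp add: dist_norm norm_minus_commute)
      then show ?thesis using U(3) d1(2) by blast
    qed
    have h2: "fourier (\<phi> 0) (2 *\<^sub>R \<eta>) = 0"
    proof -
      have "norm (2 *\<^sub>R e - 2 *\<^sub>R \<eta>) = 2 * norm (\<eta> - e)"
        by (simp add: scaleR_diff_right[symmetric] norm_minus_commute)
      then have "2 *\<^sub>R \<eta> \<in> ball (2 *\<^sub>R e) d2" using \<eta> \<delta> by (simp add: dist_norm)
      then show ?thesis using d2(2) V0 by blast
    qed
    have big: "fourier (\<phi> 0) ((2 ^ i) *\<^sub>R \<eta>) = 0" if "1 \<le> i" for i :: nat
    proof (cases "i = 1")
      case True then show ?thesis using h2 by simp
    next
      case False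
      then have "(2::real) ^ 2 \<le> 2 ^ i" using that by (intro power_increasing) auto
      then have "4 * (1 / 2) \<le> 2 ^ i * norm \<eta>" using lo by (intro mult_mono) auto
      then show ?thesis by (intro lp0_outer[OF lp]) simp
    qed
    have small: "fourier (\<phi> 0) ((1 / 2 ^ i) *\<^sub>R \<eta>) = 1" for i :: nat
    proof (cases "i = 0")
      case True then show ?thesis using h1 by simp
    next
      case False
      then have "(2::real) ^ 1 \<le> 2 ^ i" by (intro power_increasing) auto
      then have "norm \<eta> \<le> 2 ^ i" using up by simp
      then show ?thesis by (intro lp0_inner[OF lp]) simp
    qed
    consider "k = 0" | "1 \<le> k" "k < j" | "k = j" | "j < k" using j by linarith
    then show ?thesis
    proof cases
      case 1
      then show ?thesis using big[OF j] j by simp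
    next
      case 2
      obtain i where i: "j = k + i" "1 \<le> i" using 2 by (metis less_imp_add_positive Suc_leI One_nat_def)
      have "(1 / 2 ^ k) *\<^sub>R (2 ^ j) *\<^sub>R \<eta> = (2 ^ i) *\<^sub>R \<eta>" "(2 / 2 ^ k) *\<^sub>R (2 ^ j) *\<^sub>R \<eta> = (2 ^ Suc i) *\<^sub>R \<eta>"
        by (simp_all add: i power_add)
      then have "fourier (\<phi> k) ((2 ^ j) *\<^sub>R \<eta>) = fourier (\<phi> 0) ((2 ^ i) *\<^sub>R \<eta>) - fourier (\<phi> 0) ((2 ^ Suc i) *\<^sub>R \<eta>)"
        by (simp only: lp_fourier[OF lp 2(1)])
      also have "\<dots> = 0" unfolding big[OF i(2)] big[OF le_SucI[OF i(2)]] by simp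
      finally show ?thesis using 2 by simp
    next
      case 3
      have "(1 / 2 ^ k) *\<^sub>R (2 ^ j) *\<^sub>R \<eta> = \<eta>" "(2 / 2 ^ k) *\<^sub>R (2 ^ j) *\<^sub>R \<eta> = 2 *\<^sub>R \<eta>" by (simp_all add: 3)
      moreover have "1 \<le> k" using 3 j by simp
      ultimately have "fourier (\<phi> k) ((2 ^ j) *\<^sub>R \<eta>) = fourier (\<phi> 0) \<eta> - fourier (\<phi> 0) (2 *\<^sub>R \<eta>)"
        by (simp only: lp_fourier[OF lp])
      then show ?thesis using 3 h1 h2 by simp
    next
      case 4
      obtain i where i: "k = j + Suc i" using less_imp_Suc_add[OF 4] by auto
      have "(1 / 2 ^ k) *\<^sub>R (2 ^ j) *\<^sub>R \<eta> = (1 / 2 ^ Suc i) *\<^sub>R \<eta>" "(2 / 2 ^ k) *\<^sub>R (2 ^ j) *\<^sub>R \<eta> = (1 / 2 ^ i) *\<^sub>R \<eta>"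
        by (simp_all add: i power_add)
      moreover have "1 \<le> k" using 4 j by simp
      ultimately have "fourier (\<phi> k) ((2 ^ j) *\<^sub>R \<eta>) = fourier (\<phi> 0) ((1 / 2 ^ Suc i) *\<^sub>R \<eta>) - fourier (\<phi> 0) ((1 / 2 ^ i) *\<^sub>R \<eta>)"
        by (simp only: lp_fourier[OF lp])
      then show ?thesis unfolding small using 4 by simp
    qed
  qed
  show ?thesis
  proof (rule that[OF \<delta>(1)])
    fix j k :: nat and \<xi> :: 'a assume j: "1 \<le> j" and \<xi>: "norm (\<xi> - (2 ^ j) *\<^sub>R e) < \<delta>"
    \<comment> \<open>Rescaling by \<open>1 / 2 ^ j\<close> only shrinks the distance to the centre,
      so one width \<delta> serves all frequencies.\<close>
    define \<eta> where "\<eta> = (1 / 2 ^ j) *\<^sub>R \<xi>"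
    have \<xi>\<eta>: "\<xi> = (2 ^ j) *\<^sub>R \<eta>" by (simp add: \<eta>_def)
    have "norm (\<xi> - (2 ^ j) *\<^sub>R e) = 2 ^ j * norm (\<eta> - e)"
      unfolding \<xi>\<eta> scaleR_diff_right[symmetric] by simp
    moreover have "1 * norm (\<eta> - e) \<le> 2 ^ j * norm (\<eta> - e)" by (intro mult_right_mono) auto
    ultimately have "norm (\<eta> - e) < \<delta>" using \<xi> by simp
    then show "fourier (\<phi> k) \<xi> = (if k = j then 1 else 0)" unfolding \<xi>\<eta> by (rule main[OF j])
  qed
qed

lemma lp_carrier_exists:
  fixes \<phi> :: "nat \<Rightarrow> 'a::euclidean_space \<Rightarrow> complex"
  assumes lp: "littlewood_paley \<phi>"
  obtains e G where "lp_carrier \<phi> e G"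
proof -
  obtain e :: 'a where e: "norm e = 1" using norm_Basis SOME_Basis by blast
  obtain \<delta> where \<delta>: "0 < \<delta>" "\<And>j k \<xi>. 1 \<le> j \<Longrightarrow> norm (\<xi> - (2 ^ j) *\<^sub>R e) < \<delta> \<Longrightarrow> fourier (\<phi> k) \<xi> = (if k = j then 1 else 0)"
    using lp_wave_frequency[OF lp e] by metis
  have one: "fourier (\<phi> 0) 0 = 1" by (rule lp0_inner[OF lp]) simp
  have "\<exists>x0. \<phi> 0 x0 \<noteq> 0"
  proof (rule ccontr)
    assume "\<not> ?thesis"
    then have "\<phi> 0 = (\<lambda>x. 0)" by (simp add: fun_eq_iff)
    then show False using one by (simp add: fourier_def)
  qed
  then obtain x0 where x0: "\<phi> 0 x0 \<noteq> 0" by blast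
  \<comment> \<open>The dilation shrinks the band of \<open>\<phi> 0\<close> from radius 2 to
    \<delta>; the shift by \<open>x0\<close> makes the value at the origin nonzero.\<close>
  define G where "G = (\<lambda>x. \<phi> 0 (x0 + (\<delta> / 2) *\<^sub>R x))"
  have "bandlimited (\<bar>\<delta> / 2\<bar> * 2) G"
    unfolding G_def by (rule bandlimited_affine[OF lp0_bandlimited[OF lp]]) (use \<delta>(1) in simp)
  then have G: "bandlimited \<delta> G" using \<delta>(1) by simp
  have rG: "rapid G" using G by (rule bandlimited_rapid)
  have "fourier G 0 \<noteq> 0"
    unfolding G_def by (subst fourier_affine) (use \<delta>(1) one in auto)
  then have iG: "(LINT x|lborel. G x) \<noteq> 0" by (simp add: fourier_def)
  \<comment> \<open>Otherwise the integral of the convolution, which is the square of the integral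
    of \<open>G\<close>, would be 0. The identity is \<open>fconv_pairing\<close> with the constant
    function 1.\<close>
  have "\<exists>z. fconv G G z \<noteq> 0"
  proof (rule ccontr)
    assume "\<not> ?thesis"
    then have z: "fconv G G z = 0" for z by blast
    have r: "rapid (\<lambda>x. G (- x))" using rapid_reflect[OF rG, of 0] by simp
    have one: "growing (\<lambda>x::'a. 1)"
      unfolding growing_def by (intro conjI continuous_intros exI[of _ 0] exI[of _ 1]) simp
    have "fconv (\<lambda>x. G (- x)) (\<lambda>x. 1) x = (LINT x|lborel. G x)" for x
      using integral_shift[of G "- x"] by (simp add: fconv_def)
    with fconv_pairing[OF one r rG] have "(LINT x|lborel. G x) * (LINT x|lborel. G x) = 0" by (simp add: z)
    with iG show False by simp
  qed
  moreover have "G 0 \<noteq> 0" using x0 by (simp add: G_def)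
  moreover have "fconv (\<phi> k) (wave e G j) = (if k = j then wave e G j else (\<lambda>x. 0))" if j: "1 \<le> j" for j k
  proof -
    have nz: "fourier (\<phi> k) \<xi> = (if k = j then 1 else 0)" if "fourier (wave e G j) \<xi> \<noteq> 0" for k \<xi>
    proof (rule \<delta>(2)[OF j])
      show "norm (\<xi> - (2 ^ j) *\<^sub>R e) < \<delta>"
        using that G unfolding fourier_wave bandlimited_def by force
    qed
    have bw: "bandlimited (2 ^ j + \<delta>) (wave e G j)"
      unfolding bandlimited_def
    proof (intro conjI allI impI wave_rapid rG)
      fix \<xi> :: 'a assume "2 ^ j + \<delta> \<le> norm \<xi>"
      then have "\<delta> \<le> norm (\<xi> - (2 ^ j) *\<^sub>R e)"
        using norm_triangle_ineq2[of \<xi> "(2 ^ j) *\<^sub>R e"] e by simp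
      then show "fourier (wave e G j) \<xi> = 0" using G by (simp add: fourier_wave bandlimited_def)
    qed
    show ?thesis
    proof (cases "k = j")
      case True
      then show ?thesis using fconv_eq_right[OF lp_bandlimited[OF lp] bw, of k] nz[of _ k] by simp
    next
      case False
      have "fourier (\<phi> k) \<xi> * fourier (wave e G j) \<xi> = 0" for \<xi>
        using nz[of \<xi> k] False by (cases "fourier (wave e G j) \<xi> = 0") auto
      from fconv_eq_0[OF lp_bandlimited[OF lp] rapid_integrable[OF wave_rapid[OF rG]] this] False
      show ?thesis by (simp add: fun_eq_iff)
    qed
  qed
  ultimately show ?thesis using rG by (intro that[of e G]) (simp add: lp_carrier_def)
qed

section \<open>Interaction of packets with the family, with each other and with the operator\<close>

lemma fconv_cmult_right: "fconv f (\<lambda>x. c * g x) x = c * fconv f g x"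
  by (simp add: fconv_def mult.left_commute)

lemma fconv_cmult_shift: "fconv f (\<lambda>x. c * g (x + a)) x = c * fconv f g (x + a)"
  by (simp add: fconv_cmult_right fconv_shift_right)

context
  fixes \<phi> :: "nat \<Rightarrow> 'a::euclidean_space \<Rightarrow> complex" and e :: 'a and G :: "'a \<Rightarrow> complex"
  assumes lp: "littlewood_paley \<phi>" and carrier: "lp_carrier \<phi> e G"
begin

lemma G_rapid: "rapid G"
  using carrier by (simp add: lp_carrier_def)

lemma fconv_wave: "1 \<le> j \<Longrightarrow> fconv (\<phi> k) (wave e G j) = (if k = j then wave e G j else (\<lambda>x. 0))"
  using carrier by (simp add: lp_carrier_def)

lemma wave_shift_rapid: "rapid (\<lambda>x. c * wave e G j (x + a))"
  by (intro rapid_cmult rapid_shift wave_rapid G_rapid)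

lemma fconv_wave_shift:
  "1 \<le> j \<Longrightarrow> fconv (\<phi> k) (\<lambda>x. c * wave e G j (x + a)) x = (if k = j then c * wave e G j (x + a) else 0)"
  by (simp add: fconv_cmult_shift fconv_wave)

text \<open>The packet equals its convolution with \<open>\<phi> j\<close>, which
  \<open>lp_fat\<close> reproduces; associativity transfers the reproduction to the packet.\<close>

lemma fconv_fat_wave:
  assumes "1 \<le> j" shows "fconv (lp_fat \<phi> j) (\<lambda>x. c * wave e G j (x + a)) = (\<lambda>x. c * wave e G j (x + a))"
proof -
  let ?w = "wave e G j"
  have w: "fconv (\<phi> j) ?w = ?w" using fconv_wave[OF assms, of j] by simp
  have "fconv (lp_fat \<phi> j) ?w = fconv (lp_fat \<phi> j) (fconv (\<phi> j) ?w)" by (simp only: w)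
  also have "\<dots> = fconv (fconv (lp_fat \<phi> j) (\<phi> j)) ?w"
    by (rule fconv_assoc[OF lp_fat_rapid[OF lp] lp_rapid[OF lp] wave_rapid[OF G_rapid]])
  also have "\<dots> = ?w" unfolding fconv_fat[OF lp assms] w ..
  finally show ?thesis by (simp add: fun_eq_iff fconv_cmult_shift)
qed

text \<open>For equal frequencies the character is a common factor of the integrand. For different
  ones, insert \<open>\<phi> k\<close>, which fixes the second packet and annihilates the
  first.\<close>

lemma fconv_wave_wave:
  assumes "1 \<le> j" "1 \<le> k"
  shows "fconv (wave e G j) (wave e G k) z = (if j = k then echar ((2 ^ j) *\<^sub>R e) z * fconv G G z else 0)"
proof (cases "j = k")
  case True
  have "echar ((2 ^ j) *\<^sub>R e) (z - t) * echar ((2 ^ j) *\<^sub>R e) t = echar ((2 ^ j) *\<^sub>R e) z" for t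
    by (simp add: echar_add[symmetric])
  then have "wave e G j (z - t) * wave e G j t = echar ((2 ^ j) *\<^sub>R e) z * (G (z - t) * G t)" for t
    unfolding wave_def by (metis mult.assoc mult.left_commute)
  then show ?thesis using True by (simp add: fconv_def)
next
  case False
  note r = wave_rapid[OF G_rapid]
  have "fconv (wave e G j) (wave e G k) = fconv (wave e G j) (fconv (\<phi> k) (wave e G k))"
    using fconv_wave[OF assms(2), of k] by simp
  also have "\<dots> = fconv (fconv (wave e G j) (\<phi> k)) (wave e G k)" by (rule fconv_assoc[OF r lp_rapid[OF lp] r])
  also have "fconv (wave e G j) (\<phi> k) = (\<lambda>x. 0)"
    using fconv_wave[OF assms(1), of k] False by (simp add: fconv_commute[of "wave e G j"])
  finally have "fconv (wave e G j) (wave e G k) z = fconv (\<lambda>x. 0) (wave e G k) z" by (simp only:)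
  also have "\<dots> = 0" by (simp add: fconv_def[of "\<lambda>x. 0"])
  finally show ?thesis using False by simp
qed

text \<open>\<open>lp_carrier\<close> records no derivatives of \<open>G\<close>. The packet is its
  own convolution with \<open>\<phi> j\<close>, so derivatives are put on \<open>\<phi> j\<close>,
  while the weighted mass of the packet does not depend on \<open>j\<close>.\<close>

lemma wave_sbound:
  obtains D where "0 \<le> D" "\<And>j. 1 \<le> j \<Longrightarrow> sbound N k (wave e G j) (D * (2 ^ j) ^ (DIM('a) + k))"
proof -
  obtain C where C: "sbound N k (lp_bump \<phi> 1) C" "0 < C" using schwartz_sboundE[OF lp_bump_schwartz[OF lp]] by metis
  define I where "I = (LINT t|lborel. (1 + norm t) ^ N * cmod (G t))"
  have "0 \<le> I" unfolding I_def by (rule Bochner_Integration.integral_nonneg) simp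
  show ?thesis
  proof (rule that[of "C * I"])
    show "0 \<le> C * I" using C \<open>0 \<le> I\<close> by simp
    fix j :: nat assume j: "1 \<le> j"
    have b: "lp_bump \<phi> j = lp_bump \<phi> 1" using j by (simp add: lp_bump_def)
    have "sbound N k (\<phi> j) ((2 ^ j) ^ (DIM('a) + k) * C)"
      by (subst lp_eq_dilate[OF lp], unfold b) (intro sbound_dilate schwartz_smooth lp_bump_schwartz[OF lp] C, simp)
    from sbound_fconv[OF lp_schwartz[OF lp] this wave_rapid[OF G_rapid], of e j]
    show "sbound N k (wave e G j) (C * I * (2 ^ j) ^ (DIM('a) + k))"
      using fconv_wave[OF j, of j] by (simp add: I_def mult_ac)
  qed
qed

lemma wave_schwartz: assumes "1 \<le> j" shows "wave e G j \<in> schwartz"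
  using schwartz_fconv[OF lp_schwartz[OF lp] wave_rapid[OF G_rapid], of j e j] fconv_wave[OF assms, of j] by simp

text \<open>Only the block with index \<open>j\<close> sees the packet, and its translation cancels
  the displacement; the partial sums are constant from \<open>N = j\<close> on.\<close>

lemma T_sums_wave:
  assumes j: "1 \<le> j"
  shows "T_sums \<phi> y (distribution_of (\<lambda>x. c * wave e G j (x + y j))) (distribution_of (\<lambda>x. c * wave e G j x))"
proof -
  let ?f = "distribution_of (\<lambda>x. c * wave e G j (x + y j))"
  have f: "?f \<in> tempered" by (intro distribution_of_tempered rapid_growing wave_shift_rapid)
  have "translate (y i) (conv (\<phi> i) ?f) = (if i = j then (\<lambda>x. c * wave e G j x) else (\<lambda>x. 0))" for i
    by (simp add: fun_eq_iff translate_def conv_distribution_of lp_schwartz[OF lp] fconv_wave_shift[OF j])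
  then have s: "(\<Sum>i=1..N. distribution_of (translate (y i) (conv (\<phi> i) ?f)) \<psi>) = (if j \<le> N then distribution_of (\<lambda>x. c * wave e G j x) \<psi> else 0)"
    for N \<psi>
  proof -
    assume *: "\<And>i. translate (y i) (conv (\<phi> i) ?f) = (if i = j then (\<lambda>x. c * wave e G j x) else (\<lambda>x. 0))"
    have "distribution_of (\<lambda>x. 0) \<psi> = 0" by (simp add: distribution_of_def)
    then have "(\<Sum>i=1..N. distribution_of (translate (y i) (conv (\<phi> i) ?f)) \<psi>) = (\<Sum>i=1..N. if i = j then distribution_of (\<lambda>x. c * wave e G j x) \<psi> else 0)"
      unfolding * by (intro sum.cong) auto
    then show ?thesis using j by simp
  qed
  show ?thesis
    unfolding T_sums_iff[OF lp_schwartz[OF lp] f] s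
  proof (intro conjI allI)
    show "distribution_of (\<lambda>x. c * wave e G j x) \<in> tempered"
      by (intro distribution_of_tempered rapid_growing rapid_cmult wave_rapid G_rapid)
    show "(\<lambda>N. if j \<le> N then distribution_of (\<lambda>x. c * wave e G j x) \<psi> else 0) \<longlonglongrightarrow> distribution_of (\<lambda>x. c * wave e G j x) \<psi>" for \<psi>
      by (rule tendsto_eventually) (auto simp: eventually_sequentially)
  qed
qed

text \<open>If \<open>y\<close> grew faster than any power of \<open>2 ^ j\<close>, wave packets placed near \<open>- y j\<close> with polynomially
  growing coefficients would tend to \<open>0\<close>, but their images, placed near \<open>0\<close>, would not.\<close>

lemma T_continuous_imp_polynomial:
  assumes cont: "continuous_map tempered_topology tempered_topology (T_op \<phi> y)"
  shows "\<exists>N. \<forall>j\<ge>1. norm (y j) \<le> (2 ^ j) ^ N"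
proof (rule ccontr)
  assume "\<not> ?thesis"
  \<comment> \<open>The exponent is doubled on purpose: one half will cancel the amplitude of the
    packet, the other half will produce a factor tending to 0.\<close>
  then have "\<exists>j. 1 \<le> j \<and> (2 ^ j) ^ (2 * k) < norm (y j)" for k by (meson not_le)
  then obtain j where j: "\<And>k. 1 \<le> j k" "\<And>k. (2 ^ j k) ^ (2 * k) < norm (y (j k))" by metis
  obtain z where z: "fconv G G z \<noteq> 0" using carrier by (auto simp: lp_carrier_def)
  define X where "X = (\<lambda>k. (2::real) ^ j k)"
  have X: "2 \<le> X k" for k using power_increasing[OF j(1), of "2::real" k] by (simp add: X_def)
  have X0: "0 < X k" for k using X[of k] by simp
  \<comment> \<open>Inverse to the amplitude \<open>X k ^ k\<close> of the packets, so diagonal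
    pairings are of size 1. Since the exponent grows with \<open>k\<close>, it also beats the fixed
    power of \<open>X\<close> in every seminorm of a packet.\<close>
  define b where "b = (\<lambda>k. 1 / X k ^ k)"
  \<comment> \<open>Reflected about \<open>z\<close>, so that the pairing with a packet is the
    convolution of two packets at \<open>z\<close>.\<close>
  define \<theta> where "\<theta> = (\<lambda>l x. complex_of_real (b l) * wave e G (j l) (z - x))"
  have b0: "0 < b l" for l using X0[of l] by (simp add: b_def)
  have \<theta>: "\<theta> l \<in> schwartz" for l
    unfolding \<theta>_def by (intro schwartz_cmult schwartz_reflect wave_schwartz j)
  have "\<exists>D. 0 \<le> D \<and> (\<forall>j\<ge>1. sbound N k (wave e G j) (D * (2 ^ j) ^ (DIM('a) + k)))" for N k
    using wave_sbound[of N k] by metis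
  then obtain D where D: "\<And>N k. 0 \<le> D N k" "\<And>N k j. 1 \<le> j \<Longrightarrow> sbound N k (wave e G j) (D N k * (2 ^ j) ^ (DIM('a) + k))"
    by metis
  define B where "B = (\<lambda>N k l. (1 + norm z) ^ N * D N k * (b l * X l ^ (DIM('a) + k)))"
  have B: "sbound N k (\<theta> l) (B N k l)" for N k l
  proof -
    have "sbound N k (\<theta> l) (cmod (of_real (b l)) * ((1 + norm z) ^ N * (D N k * (2 ^ j l) ^ (DIM('a) + k))))"
      unfolding \<theta>_def by (intro sbound_cmult sbound_reflect schwartz_smooth schwartz_reflect wave_schwartz j D)
    then show ?thesis using b0[of l] unfolding B_def X_def norm_of_real by (simp add: mult_ac)
  qed
  have sB: "summable (B N k)" for N k
    unfolding B_def
  proof (rule summable_mult, rule summable_comparison_test'[where N="DIM('a) + k"])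
    let ?M = "DIM('a) + k"
    show "summable (\<lambda>l. 2 ^ ?M * (1 / 2 :: real) ^ l)" by (intro summable_mult summable_geometric) simp
    fix l assume l: "?M \<le> l"
    have "(X l / 2) ^ ?M \<le> (X l / 2) ^ l" using X[of l] l by (intro power_increasing) auto
    then have "b l * X l ^ ?M \<le> 2 ^ ?M * (1 / 2) ^ l"
      using X0[of l] by (simp add: b_def power_divide divide_simps mult_ac)
    moreover have "0 \<le> b l * X l ^ ?M" using b0[of l] X0[of l] by simp
    ultimately show "norm (b l * X l ^ ?M) \<le> 2 ^ ?M * (1 / 2) ^ l" by simp
  qed
  define \<psi> where "\<psi> = (\<lambda>x. \<Sum>l. \<theta> l x)"
  define f where "f = (\<lambda>k. distribution_of (\<lambda>x. of_real (X k ^ k) * wave e G (j k) (x + y (j k))))"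
  define u where "u = (\<lambda>k. distribution_of (\<lambda>x. of_real (X k ^ k) * wave e G (j k) x))"
  have ft: "f k \<in> tempered" for k unfolding f_def by (intro distribution_of_tempered rapid_growing wave_shift_rapid)
  have ut: "u k \<in> tempered" for k
    unfolding u_def by (intro distribution_of_tempered rapid_growing rapid_cmult wave_rapid G_rapid)
  have Tf: "T_sums \<phi> y (f k) (u k)" for k unfolding f_def u_def by (rule T_sums_wave[OF j(1)])
  have low: "cmod (fconv G G z) \<le> cmod (u k \<psi>)" for k
  proof -
    define \<gamma> where "\<gamma> = echar ((2 ^ j k) *\<^sub>R e) z * fconv G G z"
    \<comment> \<open>Several \<open>l\<close> may share the frequency \<open>j k\<close>. Their
      contributions are nonnegative multiples of the same \<gamma>, so the term
      \<open>l = k\<close>, which equals 1, cannot be cancelled.\<close>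
    define t where "t = (\<lambda>l. X k ^ k * b l * (if j l = j k then 1 else 0))"
    have "u k (\<theta> l) = of_real (t l) * \<gamma>" for l
    proof -
      have "u k (\<theta> l) = (LINT x|lborel. (of_real (X k ^ k) * of_real (b l)) * (wave e G (j l) (z - x) * wave e G (j k) x))"
        unfolding u_def distribution_of_def using \<theta>[of l] by (simp add: \<theta>_def mult_ac)
      also have "\<dots> = of_real (X k ^ k) * of_real (b l) * fconv (wave e G (j l)) (wave e G (j k)) z"
        unfolding integral_mult_right_zero fconv_def ..
      finally show ?thesis by (simp add: fconv_wave_wave[OF j(1) j(1)] t_def \<gamma>_def)
    qed
    then have s: "(\<lambda>l. of_real (t l) * \<gamma>) sums u k \<psi>"
      using tempered_sums[OF ut \<theta> B sB, of k] by (simp add: \<psi>_def)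
    have g0: "\<gamma> \<noteq> 0" using z by (simp add: \<gamma>_def)
    have "(\<lambda>l. of_real (t l) * \<gamma> * (1 / \<gamma>)) sums (u k \<psi> * (1 / \<gamma>))" by (rule sums_mult2[OF s])
    then have "(\<lambda>l. complex_of_real (t l)) sums (u k \<psi> / \<gamma>)" using g0 by simp
    then have r: "t sums Re (u k \<psi> / \<gamma>)" using sums_Re by fastforce
    have "t k = 1" using X0[of k] by (simp add: t_def b_def)
    moreover have "0 \<le> t l" for l using X0[of k] b0[of l] by (simp add: t_def)
    then have "t k \<le> suminf t" using sums_summable[OF r] by (intro sum_le_suminf[of t "{k}", simplified]) auto
    ultimately have "1 \<le> cmod (u k \<psi> / \<gamma>)"
      using sums_unique[OF r] complex_Re_le_cmod[of "u k \<psi> / \<gamma>"] by linarith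
    then have "cmod \<gamma> \<le> cmod (u k \<psi>)" using g0 by (simp add: norm_divide pos_le_divide_eq)
    then show ?thesis by (simp add: \<gamma>_def norm_mult)
  qed
  obtain A where A: "0 < A" "\<And>x. (1 + norm x) ^ 1 * cmod (G x) \<le> A" using rapidE[OF G_rapid] by metis
  have fb: "cmod (f k \<eta>) \<le> (1 / 2) ^ k * (A * C * weight_mass TYPE('a))"
    if \<eta>: "\<eta> \<in> schwartz" "sbound (1 + 2 * DIM('a)) 0 \<eta> C" for k \<eta> C
  proof -
    let ?y = "y (j k)"
    \<comment> \<open>With \<open>2 \<le> X k\<close>, the amplitude times \<open>2 ^ k\<close> is
      at most \<open>X k ^ (2 * k)\<close>, which lies below the displacement. Trading displacement
      for one power of the weight in \<open>x\<close> then leaves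
      \<open>(1 / 2) ^ k\<close>.\<close>
    have yk: "X k ^ k * 2 ^ k \<le> 1 + norm ?y"
    proof -
      have "X k ^ k * 2 ^ k \<le> X k ^ k * X k ^ k" using X[of k] by (intro mult_left_mono power_mono) auto
      also have "\<dots> = (2 ^ j k) ^ (2 * k)" by (simp add: X_def mult_2 power_add)
      finally show ?thesis using j(2)[of k] by linarith
    qed
    have "cmod (of_real (X k ^ k) * wave e G (j k) (x + ?y)) \<le> ((1 / 2) ^ k * A) * (1 + norm x) ^ 1" for x
    proof -
      have w: "1 + norm ?y \<le> (1 + norm (x + ?y)) * (1 + norm x)" using weight_diff[of "x + ?y" x 1] by simp
      have "X k ^ k * 2 ^ k * cmod (G (x + ?y)) \<le> (1 + norm ?y) * cmod (G (x + ?y))"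
        by (intro mult_right_mono yk) auto
      also have "\<dots> \<le> ((1 + norm (x + ?y)) * (1 + norm x)) * cmod (G (x + ?y))"
        by (intro mult_right_mono w) auto
      also have "\<dots> = (1 + norm x) * ((1 + norm (x + ?y)) ^ 1 * cmod (G (x + ?y)))" by simp
      also have "\<dots> \<le> (1 + norm x) * A" by (intro mult_left_mono A) auto
      finally show ?thesis
        using X0[of k] by (simp add: norm_mult norm_power power_one_over divide_simps mult_ac)
    qed
    then have "cmod (f k \<eta>) \<le> ((1 / 2) ^ k * A) * C * weight_mass TYPE('a)"
      using integral_pairing_bound(2)[OF rapid_measurable[OF wave_shift_rapid] rapid_measurable[OF schwartz_rapid[OF \<eta>(1)]] _ sboundD0[OF \<eta>(2)]] \<eta>(1)
      unfolding f_def distribution_of_def by simp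
    then show ?thesis by (simp add: mult_ac)
  qed
  have f0: "(\<lambda>k. f k \<eta>) \<longlonglongrightarrow> 0" for \<eta>
  proof (cases "\<eta> \<in> schwartz")
    case True
    obtain C where C: "sbound (1 + 2 * DIM('a)) 0 \<eta> C" using schwartz_sboundE[OF True] by metis
    have "(\<lambda>k. (1 / 2 :: real) ^ k * (A * C * weight_mass TYPE('a))) \<longlonglongrightarrow> 0"
      by (intro tendsto_mult_left_zero LIMSEQ_power_zero) simp
    then show ?thesis
      by (rule Lim_null_comparison[OF always_eventually, rotated]) (rule allI, rule fb[OF True C])
  next
    case False
    then show ?thesis by (simp add: f_def distribution_of_def)
  qed
  have T0: "T_sums \<phi> y (\<lambda>\<psi>. 0) (\<lambda>\<psi>. 0)"
    using T_sums_comb[OF lp_schwartz[OF lp] ft Tf ft Tf, of 0 0 0 0] by simp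
  have z0: "(\<lambda>\<psi>. 0) \<in> (tempered :: (('a \<Rightarrow> complex) \<Rightarrow> complex) set)" using tempered_comb[OF ft ft, of 0 0 0 0] by simp
  have "limitin tempered_topology f (\<lambda>\<psi>. 0) sequentially"
    unfolding limitin_tempered using z0 ft f0 by simp
  from continuous_map_limit[OF cont this]
  have "limitin tempered_topology u (\<lambda>\<psi>. 0) sequentially"
    by (simp add: o_def T_op_eqI[OF Tf] T_op_eqI[OF T0])
  then have "(\<lambda>k. u k \<psi>) \<longlonglongrightarrow> 0" unfolding limitin_tempered by blast
  then have "(\<lambda>k. cmod (u k \<psi>)) \<longlonglongrightarrow> 0" by (rule tendsto_norm_zero)
  from LIMSEQ_le_const[OF this] low have "cmod (fconv G G z) \<le> 0" by blast
  with z show False by simp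
qed

end

section \<open>Powers and quasi-norms in the extended nonnegative reals\<close>

lemma ennreal_powr_ennreal: "0 \<le> x \<Longrightarrow> ennreal_powr (ennreal x) a = ennreal (x powr a)"
  by (simp add: ennreal_powr_def)

lemma ennreal_powr_top [simp]: "ennreal_powr \<infinity> a = \<infinity>" "ennreal_powr top a = top"
  by (simp_all add: ennreal_powr_def)

lemma ennreal_powr_0 [simp]: "ennreal_powr 0 a = 0"
  by (simp add: ennreal_powr_def)

lemma ennreal_powr_1 [simp]: "ennreal_powr x 1 = x"
  by (cases x) (simp_all add: ennreal_powr_ennreal)

lemma ennreal_powr_mono: "0 \<le> a \<Longrightarrow> x \<le> y \<Longrightarrow> ennreal_powr x a \<le> ennreal_powr y a"
  by (cases x; cases y) (auto simp: ennreal_powr_ennreal top_unique intro!: ennreal_leI powr_mono2)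

lemma ennreal_powr_mult: "0 < a \<Longrightarrow> ennreal_powr (x * y) a = ennreal_powr x a * ennreal_powr y a"
proof (cases x; cases y)
  fix r s :: real assume "0 \<le> r" "x = ennreal r" "0 \<le> s" "y = ennreal s"
  then show ?thesis
    by (simp add: ennreal_mult[symmetric] ennreal_powr_ennreal powr_mult)
next
  fix r :: real assume "0 < a" "0 \<le> r" "x = ennreal r" "y = top"
  then show ?thesis by (cases "r = 0") (auto simp: ennreal_mult_top ennreal_powr_ennreal ennreal_powr_def)
next
  fix r :: real assume "0 < a" "0 \<le> r" "y = ennreal r" "x = top"
  then show ?thesis by (cases "r = 0") (auto simp: ennreal_top_mult ennreal_powr_ennreal ennreal_powr_def)
qed simp

lemma ennreal_powr_powr: "0 < a \<Longrightarrow> 0 < b \<Longrightarrow> ennreal_powr (ennreal_powr x a) b = ennreal_powr x (a * b)"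
  by (cases x) (simp_all add: ennreal_powr_ennreal powr_powr)

lemma ennreal_powr_inverse: "0 < a \<Longrightarrow> ennreal_powr (ennreal_powr x a) (1 / a) = x"
  by (simp add: ennreal_powr_powr)

lemma ennreal_powr_inverse': "0 < a \<Longrightarrow> ennreal_powr (ennreal_powr x (1 / a)) a = x"
  by (simp add: ennreal_powr_powr)

lemma ennreal_powr_eq_top: "ennreal_powr x a = top \<longleftrightarrow> x = top"
  by (simp add: ennreal_powr_def)

lemma ennreal_powr_add:
  assumes "0 < a"
  shows "ennreal_powr (x + y) a \<le> ennreal (2 powr a) * (ennreal_powr x a + ennreal_powr y a)"
proof -
  have "ennreal_powr (x + y) a \<le> ennreal_powr (ennreal 2 * max x y) a"
  proof (rule ennreal_powr_mono)
    have "x + y \<le> max x y + max x y" by (intro add_mono) auto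
    also have "\<dots> = ennreal 2 * max x y" by (simp add: mult_2)
    finally show "x + y \<le> ennreal 2 * max x y" .
  qed (use assms in simp)
  also have "\<dots> = ennreal (2 powr a) * ennreal_powr (max x y) a"
    using assms by (simp add: ennreal_powr_mult ennreal_powr_ennreal[of 2, simplified] del: ennreal_numeral)
      (simp add: ennreal_powr_def)
  also have "ennreal_powr (max x y) a \<le> ennreal_powr x a + ennreal_powr y a"
    by (simp add: max_def add_increasing add_increasing2)
  finally show ?thesis by (simp add: mult_left_mono)
qed

lemma ennreal_powr_measurable [measurable (raw)]:
  assumes [measurable]: "f \<in> borel_measurable M"
  shows "(\<lambda>x. ennreal_powr (f x) a) \<in> borel_measurable M"
  unfolding ennreal_powr_def by measurable

section \<open>Lebesgue quasi-norms for all positive exponents\<close>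

lemma Lp_norm_top: "Lp_norm \<infinity> M f = esssup M f" "Lp_norm top M f = esssup M f"
  by (simp_all add: Lp_norm_def)

lemma Lp_norm_ennreal:
  "0 < P \<Longrightarrow> Lp_norm (ennreal P) M f = ennreal_powr (\<integral>\<^sup>+x. ennreal_powr (f x) P \<partial>M) (1 / P)"
  by (simp add: Lp_norm_def)

lemma exponent_cases:
  assumes "0 < p" obtains "p = top" | P where "0 < P" "p = ennreal P"
  using assms by (cases p) auto

lemma Lp_norm_mono:
  assumes "0 < p" "f \<in> borel_measurable M" "\<And>x. f x \<le> g x"
  shows "Lp_norm p M f \<le> Lp_norm p M g"
  using assms(1)
proof (cases rule: exponent_cases)
  case 1
  then show ?thesis using assms by (simp add: Lp_norm_top esssup_mono)
next
  case (2 P)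
  show ?thesis
    unfolding 2(2) Lp_norm_ennreal[OF 2(1)]
    by (intro ennreal_powr_mono nn_integral_mono assms) (use 2 in auto)
qed

lemma Lp_norm_cmult:
  assumes "0 < p" and [measurable]: "f \<in> borel_measurable M"
  shows "Lp_norm p M (\<lambda>x. c * f x) \<le> c * Lp_norm p M f"
  using assms(1)
proof (cases rule: exponent_cases)
  case 1
  have "AE x in M. c * f x \<le> c * esssup M f" using esssup_AE[of f M] by eventually_elim (rule mult_left_mono, auto)
  then show ?thesis using 1 by (simp add: Lp_norm_top esssup_I)
next
  case (2 P)
  show ?thesis
    unfolding 2(2) Lp_norm_ennreal[OF 2(1)] ennreal_powr_mult[OF 2(1)]
    by (subst nn_integral_cmult) (use 2 in \<open>simp_all add: ennreal_powr_mult ennreal_powr_inverse\<close>)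
qed

text \<open>A quasi-triangle inequality valid also for exponents below 1, with a constant depending
  on the exponent but not on the measure. The elementary bound for powers of sums is used twice, for
  \<open>P\<close> inside the integral and for \<open>1 / P\<close> outside.\<close>

lemma Lp_norm_add:
  assumes "0 < p"
  obtains K :: real where "0 < K" "\<And>(M :: 'b measure) (f :: 'b \<Rightarrow> ennreal) g. f \<in> borel_measurable M \<Longrightarrow> g \<in> borel_measurable M \<Longrightarrow>
    Lp_norm p M (\<lambda>x. f x + g x) \<le> ennreal K * (Lp_norm p M f + Lp_norm p M g)"
  using assms
proof (cases rule: exponent_cases)
  case 1
  show ?thesis
  proof (rule that[of 1])
    fix M :: "'b measure" and f g :: "'b \<Rightarrow> ennreal" assume [measurable]: "f \<in> borel_measurable M" "g \<in> borel_measurable M"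
    have "AE x in M. f x + g x \<le> esssup M f + esssup M g"
      using esssup_AE[of f M] esssup_AE[of g M] by eventually_elim (rule add_mono)
    then show "Lp_norm p M (\<lambda>x. f x + g x) \<le> ennreal 1 * (Lp_norm p M f + Lp_norm p M g)"
      using 1 by (simp add: Lp_norm_top esssup_I)
  qed simp
next
  case (2 P)
  show ?thesis
  proof (rule that[of "2 * 2 powr (1 / P)"])
    fix M :: "'b measure" and f g :: "'b \<Rightarrow> ennreal" assume [measurable]: "f \<in> borel_measurable M" "g \<in> borel_measurable M"
    let ?F = "\<integral>\<^sup>+x. ennreal_powr (f x) P \<partial>M" and ?G = "\<integral>\<^sup>+x. ennreal_powr (g x) P \<partial>M"
    have "(\<integral>\<^sup>+x. ennreal_powr (f x + g x) P \<partial>M) \<le> (\<integral>\<^sup>+x. ennreal (2 powr P) * (ennreal_powr (f x) P + ennreal_powr (g x) P) \<partial>M)"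
      by (intro nn_integral_mono ennreal_powr_add 2)
    also have "\<dots> = ennreal (2 powr P) * (?F + ?G)"
      by (subst nn_integral_cmult) (simp_all add: nn_integral_add)
    finally have "Lp_norm p M (\<lambda>x. f x + g x) \<le> ennreal_powr (ennreal (2 powr P) * (?F + ?G)) (1 / P)"
      unfolding 2(2) Lp_norm_ennreal[OF 2(1)] using 2(1) by (intro ennreal_powr_mono) auto
    also have "\<dots> = ennreal 2 * ennreal_powr (?F + ?G) (1 / P)"
      using 2(1) by (simp add: ennreal_powr_mult ennreal_powr_ennreal powr_powr)
    also have "\<dots> \<le> ennreal 2 * (ennreal (2 powr (1 / P)) * (ennreal_powr ?F (1 / P) + ennreal_powr ?G (1 / P)))"
      using 2(1) by (intro mult_left_mono ennreal_powr_add) auto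
    finally show "Lp_norm p M (\<lambda>x. f x + g x) \<le> ennreal (2 * 2 powr (1 / P)) * (Lp_norm p M f + Lp_norm p M g)"
      unfolding 2(2) Lp_norm_ennreal[OF 2(1)] by (simp add: ennreal_mult mult.assoc)
  qed simp
qed

lemma Lp_norm_shift:
  fixes f :: "'a::euclidean_space \<Rightarrow> ennreal"
  assumes "0 < p" and [measurable]: "f \<in> borel_measurable borel"
  shows "Lp_norm p lborel (\<lambda>x. f (x + a)) \<le> Lp_norm p lborel f"
  using assms(1)
proof (cases rule: exponent_cases)
  case 1
  have "AE x in distr lborel borel ((+) a). f x \<le> esssup lborel f"
    unfolding lborel_distr_plus by (rule esssup_AE)
  then have "AE x in lborel. f (a + x) \<le> esssup lborel f"
    by (subst (asm) AE_distr_iff) auto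
  then show ?thesis using 1 by (simp add: Lp_norm_top esssup_I add.commute)
next
  case (2 P)
  show ?thesis
    unfolding 2(2) Lp_norm_ennreal[OF 2(1)]
    using nn_integral_shift[of "\<lambda>x. ennreal_powr (f x) P" a] by simp
qed

lemma Lp_norm_count_le:
  assumes "0 < p" "i \<in> A" shows "f i \<le> Lp_norm p (count_space A) f"
  using assms(1)
proof (cases rule: exponent_cases)
  case 1
  then show ?thesis using esssup_AE[of f "count_space A"] assms by (simp add: Lp_norm_top AE_count_space)
next
  case (2 P)
  have "ennreal_powr (f i) P = (\<integral>\<^sup>+x. ennreal_powr (f i) P * indicator {i} x \<partial>count_space A)"
    using assms(2) by (subst nn_integral_cmult_indicator) auto
  also have "\<dots> \<le> (\<integral>\<^sup>+x. ennreal_powr (f x) P \<partial>count_space A)"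
    by (intro nn_integral_mono) (auto simp: indicator_def)
  finally have "ennreal_powr (ennreal_powr (f i) P) (1 / P) \<le> ennreal_powr (\<integral>\<^sup>+x. ennreal_powr (f x) P \<partial>count_space A) (1 / P)"
    using 2(1) by (intro ennreal_powr_mono) auto
  then show ?thesis unfolding 2(2) Lp_norm_ennreal[OF 2(1)] by (simp add: ennreal_powr_inverse 2(1))
qed

lemma Lp_norm_count_inj:
  assumes "0 < p" "inj h"
    and b: "\<And>k. b (h k) = a k" "\<And>j. j \<notin> range h \<Longrightarrow> b j = 0"
  shows "Lp_norm p (count_space UNIV) b = Lp_norm p (count_space UNIV) a"
  using assms(1)
proof (cases rule: exponent_cases)
  case 1
  have "b j \<le> esssup (count_space UNIV) a" for j
    using esssup_AE[of a "count_space UNIV"] b by (cases "j \<in> range h") (auto simp: AE_count_space)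
  moreover have "a k \<le> esssup (count_space UNIV) b" for k
    using esssup_AE[of b "count_space UNIV"] b(1)[symmetric] by (simp add: AE_count_space)
  ultimately show ?thesis using 1 by (auto simp: Lp_norm_top AE_count_space intro!: antisym esssup_I)
next
  case (2 P)
  have "(\<integral>\<^sup>+j. ennreal_powr (b j) P \<partial>count_space UNIV) = (\<integral>\<^sup>+j. ennreal_powr (b j) P \<partial>count_space (range h))"
    by (subst nn_integral_count_space_indicator[of "range h"])
      (auto intro!: nn_integral_cong simp: indicator_def b)
  also have "\<dots> = (\<integral>\<^sup>+k. ennreal_powr (a k) P \<partial>count_space UNIV)"
    by (subst nn_integral_bij_count_space[of h UNIV "range h", symmetric])
      (use assms(2) in \<open>auto simp: b inj_on_imp_bij_betw\<close>)
  finally show ?thesis unfolding 2(2) Lp_norm_ennreal[OF 2(1)] by simp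
qed


section \<open>Weighted power inequalities\<close>

text \<open>Jensen's inequality with respect to the density \<open>w\<close> of mass at most
  \<open>A\<close>, obtained from Young's inequality with a free scale. The infinite and the zero
  right-hand side are separated, as the optimal scale degenerates there.\<close>

lemma weighted_power_ge1:
  fixes w g :: "'b \<Rightarrow> real"
  assumes [measurable]: "w \<in> borel_measurable M" "g \<in> borel_measurable M"
    and w0: "\<And>t. 0 \<le> w t" and g0: "\<And>t. 0 \<le> g t"
    and W: "(\<integral>\<^sup>+t. ennreal (w t) \<partial>M) \<le> ennreal A" "0 < A" and P: "1 \<le> P"
  shows "ennreal_powr (\<integral>\<^sup>+t. ennreal (w t * g t) \<partial>M) P \<le>
    ennreal (A powr (P - 1)) * (\<integral>\<^sup>+t. ennreal (w t * g t powr P) \<partial>M)"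
proof (cases "\<integral>\<^sup>+t. ennreal (w t * g t powr P) \<partial>M")
  case top
  have "ennreal (A powr (P - 1)) \<noteq> 0" using W(2) by simp
  then show ?thesis using top by (simp add: ennreal_mult_top)
next
  case (real Y)
  show ?thesis
  proof (cases "Y = 0")
    case True
    then have "(\<integral>\<^sup>+t. ennreal (w t * g t powr P) \<partial>M) = 0" using real by simp
    then have "AE t in M. ennreal (w t * g t powr P) = 0"
      by (subst (asm) nn_integral_0_iff_AE) auto
    then have "AE t in M. ennreal (w t * g t) = 0"
    proof eventually_elim
      case (elim t)
      then have "w t * g t powr P \<le> 0" by (simp add: ennreal_eq_0_iff)
      then have "w t = 0 \<or> g t = 0" using w0[of t] g0[of t] by (auto simp: mult_le_0_iff)
      then show ?case by auto
    qed
    then have "(\<integral>\<^sup>+t. ennreal (w t * g t) \<partial>M) = 0" by (subst nn_integral_0_iff_AE) auto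
    then show ?thesis by simp
  next
    case False
    then have Y: "0 < Y" using real by simp
    \<comment> \<open>The scale at which the two terms of Young's inequality add up to exactly
      \<open>l * A\<close>; its \<open>P\<close>-th power times \<open>A powr P\<close> is then
      \<open>A powr (P - 1) * Y\<close>.\<close>
    define l where "l = (Y / A) powr (1 / P)"
    have l: "0 < l" using Y W(2) by (simp add: l_def)
    have lP: "l powr P = Y / A" using Y W(2) P by (simp add: l_def powr_powr)
    have young: "x \<le> x powr P * (l powr (1 - P) / P) + l * (1 - 1 / P)" if x: "0 \<le> x" for x
    proof (cases "x = 0")
      case True
      then show ?thesis using l P by simp
    next
      case False
      then have x: "0 < x" using x by simp
      have "((x / l) powr P) powr (1 / P) * 1 powr (1 - 1 / P) \<le> (1 / P) * (x / l) powr P + (1 - 1 / P) * 1"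
        by (rule Youngs_inequality_0) (use P x l in \<open>auto simp: field_simps\<close>)
      then have "x / l \<le> (x / l) powr P / P + (1 - 1 / P)" using P x l by (simp add: powr_powr)
      then have "l * (x / l) \<le> l * ((x / l) powr P / P + (1 - 1 / P))" using l by (intro mult_left_mono) auto
      also have "\<dots> = x powr P * (l * (1 / l powr P) / P) + l * (1 - 1 / P)"
        using x l by (simp add: powr_divide algebra_simps)
      also have "l * (1 / l powr P) = l powr (1 - P)" using l by (simp add: powr_diff)
      finally show ?thesis using l by simp
    qed
    have "(\<integral>\<^sup>+t. ennreal (w t * g t) \<partial>M) \<le> (\<integral>\<^sup>+t. ennreal (l powr (1 - P) / P) * ennreal (w t * g t powr P) + ennreal (l * (1 - 1 / P)) * ennreal (w t) \<partial>M)"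
    proof (rule nn_integral_mono)
      fix t
      have "w t * g t \<le> w t * (g t powr P * (l powr (1 - P) / P) + l * (1 - 1 / P))"
        by (intro mult_left_mono young w0 g0)
      then have "ennreal (w t * g t) \<le> ennreal ((l powr (1 - P) / P) * (w t * g t powr P) + l * (1 - 1 / P) * w t)"
        by (intro ennreal_leI) (simp add: algebra_simps)
      also have "\<dots> = ennreal (l powr (1 - P) / P) * ennreal (w t * g t powr P) + ennreal (l * (1 - 1 / P)) * ennreal (w t)"
        using l P w0[of t] by (simp add: ennreal_plus[symmetric] ennreal_mult[symmetric] del: ennreal_plus)
      finally show "ennreal (w t * g t) \<le> ennreal (l powr (1 - P) / P) * ennreal (w t * g t powr P) + ennreal (l * (1 - 1 / P)) * ennreal (w t)" .
    qed
    also have "\<dots> = ennreal (l powr (1 - P) / P) * ennreal Y + ennreal (l * (1 - 1 / P)) * (\<integral>\<^sup>+t. ennreal (w t) \<partial>M)"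
      using real by (simp add: nn_integral_add nn_integral_cmult)
    also have "\<dots> \<le> ennreal (l powr (1 - P) / P) * ennreal Y + ennreal (l * (1 - 1 / P)) * ennreal A"
      by (intro add_left_mono mult_left_mono W) auto
    also have "\<dots> = ennreal (l powr (1 - P) / P * Y + l * (1 - 1 / P) * A)"
      using l P Y W(2) by (simp add: ennreal_plus[symmetric] ennreal_mult[symmetric] del: ennreal_plus)
    also have "l powr (1 - P) / P * Y + l * (1 - 1 / P) * A = l * A"
    proof -
      have "l powr (1 - P) = l / (Y / A)" using l by (simp add: powr_diff lP)
      then show ?thesis using Y W(2) P by (simp add: field_simps)
    qed
    finally have "ennreal_powr (\<integral>\<^sup>+t. ennreal (w t * g t) \<partial>M) P \<le> ennreal_powr (ennreal (l * A)) P"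
      using P by (intro ennreal_powr_mono) auto
    also have "\<dots> = ennreal ((l * A) powr P)" using l W(2) by (simp add: ennreal_powr_ennreal)
    also have "(l * A) powr P = A powr (P - 1) * Y"
      using l W(2) by (simp add: powr_mult lP powr_diff)
    finally show ?thesis using real W(2) Y by (simp add: ennreal_mult)
  qed
qed

text \<open>Jensen's inequality goes the wrong way for \<open>P < 1\<close>. A sup bound by
  \<open>S\<close> times the integral repairs it: factor h as h^(1-P) h^P, bound the first factor by
  that sup, and divide by the (1-P)-th power of the integral.\<close>

lemma weighted_power_le1:
  fixes h :: "'a::euclidean_space \<Rightarrow> real"
  assumes h: "integrable lborel h" and h0: "\<And>t. 0 \<le> h t"
    and S: "\<And>t. h t \<le> S * (LINT t|lborel. h t)" "0 < S" and P: "0 < P" "P \<le> 1"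
  shows "ennreal_powr (\<integral>\<^sup>+t. ennreal (h t) \<partial>lborel) P \<le> ennreal (S powr (1 - P)) * (\<integral>\<^sup>+t. ennreal (h t powr P) \<partial>lborel)"
proof -
  have [measurable]: "h \<in> borel_measurable borel" using h by auto
  define I where "I = (LINT t|lborel. h t)"
  have I: "(\<integral>\<^sup>+t. ennreal (h t) \<partial>lborel) = ennreal I" unfolding I_def by (rule nn_integral_eq_integral[OF h]) (simp add: h0)
  have I0: "0 \<le> I" unfolding I_def by (rule Bochner_Integration.integral_nonneg[OF h0])
  show ?thesis
  proof (cases "I = 0")
    case True
    then show ?thesis by (simp add: I)
  next
    case False
    then have I1: "0 < I" using I0 by simp
    have "ennreal I \<le> (\<integral>\<^sup>+t. ennreal ((S * I) powr (1 - P)) * ennreal (h t powr P) \<partial>lborel)"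
      unfolding I[symmetric]
    proof (rule nn_integral_mono)
      fix t
      have "h t \<le> (S * I) powr (1 - P) * h t powr P"
      proof (cases "h t = 0")
        case False
        then have "h t = h t powr (1 - P) * h t powr P" using h0[of t] by (simp add: powr_add[symmetric])
        also have "\<dots> \<le> (S * I) powr (1 - P) * h t powr P"
          using S(1)[of t] P h0[of t] by (intro mult_right_mono powr_mono2) (auto simp: I_def)
        finally show ?thesis .
      qed simp
      then show "ennreal (h t) \<le> ennreal ((S * I) powr (1 - P)) * ennreal (h t powr P)"
        by (simp add: ennreal_mult[symmetric] ennreal_leI)
    qed
    also have "\<dots> = ennreal ((S * I) powr (1 - P)) * (\<integral>\<^sup>+t. ennreal (h t powr P) \<partial>lborel)"
      by (simp add: nn_integral_cmult)
    finally have "ennreal (I powr (P - 1)) * ennreal I \<le> ennreal (I powr (P - 1)) * (ennreal ((S * I) powr (1 - P)) * (\<integral>\<^sup>+t. ennreal (h t powr P) \<partial>lborel))"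
      by (rule mult_left_mono) simp
    also have "\<dots> = ennreal (I powr (P - 1) * (S * I) powr (1 - P)) * (\<integral>\<^sup>+t. ennreal (h t powr P) \<partial>lborel)"
      by (simp add: ennreal_mult mult.assoc)
    also have "I powr (P - 1) * (S * I) powr (1 - P) = S powr (1 - P)"
      using I1 S(2) by (simp add: powr_mult powr_add[symmetric] mult.left_commute)
    also have "ennreal (I powr (P - 1)) * ennreal I = ennreal (I powr P)"
      using I1 by (simp add: ennreal_mult[symmetric] powr_diff)
    finally show ?thesis using I1 by (simp add: I ennreal_powr_ennreal)
  qed
qed

text \<open>Spread the integral over unit balls: the indicator of \<open>ball t 1\<close> is
  averaged over \<open>z\<close>, and the weights at \<open>x - t\<close> and \<open>x - z\<close>
  are comparable when \<open>z\<close> and \<open>t\<close> are at distance below 1. After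
  exchanging integrals the inner one is local and bounded by \<open>A\<close>, and the outer weight
  is integrable.\<close>

lemma local_average:
  fixes F :: "'a::euclidean_space \<Rightarrow> ennreal"
  assumes [measurable]: "F \<in> borel_measurable borel"
    and A: "\<And>z. (\<integral>\<^sup>+t. F t * indicator (ball z 1) t \<partial>lborel) \<le> A"
  shows "(\<integral>\<^sup>+t. ennreal (1 / (1 + norm (x - t)) ^ (2 * DIM('a))) * F t \<partial>lborel)
    \<le> ennreal (2 ^ (2 * DIM('a)) * weight_mass TYPE('a) / measure lborel (ball (0::'a) 1)) * A"
proof -
  let ?n = "2 * DIM('a)" and ?m = "measure lborel (ball (0::'a) 1)"
  have m0: "0 < ?m" by (rule content_ball_pos) simp
  have em: "(\<integral>\<^sup>+z. indicator (ball t 1) z \<partial>lborel) = ennreal ?m" for t :: 'a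
  proof -
    have "(\<integral>\<^sup>+z. indicator (ball t 1) z \<partial>lborel) = (\<integral>\<^sup>+z. indicator (ball t 1) (z + t) \<partial>lborel)"
      by (rule nn_integral_shift[symmetric]) (intro borel_measurable_indicator, simp)
    also have "\<dots> = (\<integral>\<^sup>+z. indicator (ball (0::'a) 1) z \<partial>lborel)"
      by (intro nn_integral_cong) (auto simp: indicator_def dist_norm)
    also have "\<dots> = emeasure lborel (ball (0::'a) 1)" by simp
    also have "\<dots> = ennreal ?m" using emeasure_lborel_ball_finite[of "0::'a" 1] by (intro emeasure_eq_ennreal_measure) auto
    finally show ?thesis .
  qed
  have w: "integrable lborel (\<lambda>z::'a. 1 / (1 + norm z) ^ ?n)" by (rule integrable_inverse_weight) simp
  let ?w = "\<lambda>z::'a. ennreal (1 / (1 + norm z) ^ ?n)"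
  have wm: "(\<integral>\<^sup>+z. ?w (x - z) \<partial>lborel) = ennreal (weight_mass TYPE('a))"
    using nn_integral_eq_integral[OF w] by (subst nn_integral_reflect) (auto simp: weight_mass_def)
  have dm [measurable]: "(\<lambda>p::'a \<times> 'a. indicator (ball (snd p) 1) (fst p) :: ennreal) \<in> borel_measurable (borel \<Otimes>\<^sub>M borel)"
  proof -
    have "(\<lambda>p::'a \<times> 'a. indicator (ball (snd p) 1) (fst p) :: ennreal) = indicator {p. dist (snd p) (fst p) < 1}"
      by (auto simp: fun_eq_iff indicator_def)
    moreover have "open {p::'a \<times> 'a. dist (snd p) (fst p) < 1}" by (intro open_Collect_less continuous_intros)
    ultimately show ?thesis unfolding borel_prod by simp
  qed
  have i2 [measurable]: "(\<lambda>(z::'a, t::'a). indicator (ball t 1) z :: ennreal) \<in> borel_measurable (borel \<Otimes>\<^sub>M borel)"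
    using dm by (simp add: case_prod_beta)
  have "ennreal ?m * (\<integral>\<^sup>+t. ?w (x - t) * F t \<partial>lborel) = (\<integral>\<^sup>+t. \<integral>\<^sup>+z. ?w (x - t) * F t * indicator (ball t 1) z \<partial>lborel \<partial>lborel)"
  proof -
    have "(\<integral>\<^sup>+z. ?w (x - t) * F t * indicator (ball t 1) z \<partial>lborel) = ?w (x - t) * F t * ennreal ?m" for t
      by (subst nn_integral_cmult) (auto simp: em intro!: borel_measurable_indicator)
    then have "(\<integral>\<^sup>+t. \<integral>\<^sup>+z. ?w (x - t) * F t * indicator (ball t 1) z \<partial>lborel \<partial>lborel) = (\<integral>\<^sup>+t. ?w (x - t) * F t * ennreal ?m \<partial>lborel)"
      by (simp only:)
    also have "\<dots> = (\<integral>\<^sup>+t. ?w (x - t) * F t \<partial>lborel) * ennreal ?m"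
      by (rule nn_integral_multc) measurable
    finally show ?thesis by (simp only: mult.commute)
  qed
  also have "\<dots> \<le> (\<integral>\<^sup>+t. \<integral>\<^sup>+z. ennreal (2 ^ ?n) * ?w (x - z) * (F t * indicator (ball t 1) z) \<partial>lborel \<partial>lborel)"
  proof (intro nn_integral_mono)
    fix t z
    show "?w (x - t) * F t * indicator (ball t 1) z \<le> ennreal (2 ^ ?n) * ?w (x - z) * (F t * indicator (ball t 1) z)"
    proof (cases "z \<in> ball t 1")
      case True
      have "(1 + norm (x - z)) ^ ?n \<le> (1 + norm (x - t)) ^ ?n * (1 + norm (z - t)) ^ ?n"
        using weight_diff[of "x - t" "z - t" ?n] by simp
      also have "\<dots> \<le> (1 + norm (x - t)) ^ ?n * 2 ^ ?n"
        using True by (intro mult_left_mono power_mono) (auto simp: dist_norm norm_minus_commute)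
      finally have "1 / (1 + norm (x - t)) ^ ?n \<le> 2 ^ ?n * (1 / (1 + norm (x - z)) ^ ?n)"
        using weight_pos[of "x - t" ?n] weight_pos[of "x - z" ?n] by (simp add: divide_simps mult_ac)
      then have "?w (x - t) \<le> ennreal (2 ^ ?n) * ?w (x - z)"
        by (subst ennreal_mult[symmetric]) (auto intro: ennreal_leI)
      then have "?w (x - t) * (F t * indicator (ball t 1) z) \<le> ennreal (2 ^ ?n) * ?w (x - z) * (F t * indicator (ball t 1) z)"
        by (rule mult_right_mono) simp
      then show ?thesis by (simp only: mult.assoc)
    qed simp
  qed
  also have "\<dots> = (\<integral>\<^sup>+z. \<integral>\<^sup>+t. ennreal (2 ^ ?n) * ?w (x - z) * (F t * indicator (ball t 1) z) \<partial>lborel \<partial>lborel)"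
    by (rule lborel_pair.Fubini'[symmetric]) measurable
  also have "\<dots> = (\<integral>\<^sup>+z. ennreal (2 ^ ?n) * ?w (x - z) * (\<integral>\<^sup>+t. F t * indicator (ball z 1) t \<partial>lborel) \<partial>lborel)"
  proof (rule nn_integral_cong)
    fix z :: 'a
    have "indicator (ball t 1) z = (indicator (ball z 1) t :: ennreal)" for t :: 'a
      by (simp add: indicator_def dist_commute)
    moreover have "(\<integral>\<^sup>+t. ennreal (2 ^ ?n) * ?w (x - z) * (F t * indicator (ball z 1) t) \<partial>lborel) =
      ennreal (2 ^ ?n) * ?w (x - z) * (\<integral>\<^sup>+t. F t * indicator (ball z 1) t \<partial>lborel)"
      by (rule nn_integral_cmult) (auto intro!: borel_measurable_times_ennreal borel_measurable_indicator)
    ultimately show "(\<integral>\<^sup>+t. ennreal (2 ^ ?n) * ?w (x - z) * (F t * indicator (ball t 1) z) \<partial>lborel) =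
      ennreal (2 ^ ?n) * ?w (x - z) * (\<integral>\<^sup>+t. F t * indicator (ball z 1) t \<partial>lborel)"
      by (simp only:)
  qed
  also have "\<dots> \<le> (\<integral>\<^sup>+z. ennreal (2 ^ ?n) * A * ?w (x - z) \<partial>lborel)"
  proof (rule nn_integral_mono)
    fix z
    have "ennreal (2 ^ ?n) * ?w (x - z) * (\<integral>\<^sup>+t. F t * indicator (ball z 1) t \<partial>lborel) \<le> ennreal (2 ^ ?n) * ?w (x - z) * A"
      by (intro mult_left_mono A) simp
    then show "ennreal (2 ^ ?n) * ?w (x - z) * (\<integral>\<^sup>+t. F t * indicator (ball z 1) t \<partial>lborel) \<le> ennreal (2 ^ ?n) * A * ?w (x - z)"
      by (simp only: mult_ac)
  qed
  also have "\<dots> = ennreal (2 ^ ?n) * A * ennreal (weight_mass TYPE('a))"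
    by (subst nn_integral_cmult) (auto simp: wm)
  finally have "ennreal (1 / ?m) * (ennreal ?m * (\<integral>\<^sup>+t. ?w (x - t) * F t \<partial>lborel)) \<le> ennreal (1 / ?m) * (ennreal (2 ^ ?n) * A * ennreal (weight_mass TYPE('a)))"
    by (rule mult_left_mono) simp
  moreover have "ennreal (1 / ?m) * (ennreal ?m * Z) = Z" for Z
    unfolding mult.assoc[symmetric] using m0 by (simp add: ennreal_mult[symmetric])
  moreover have "ennreal (1 / ?m) * (ennreal (2 ^ ?n) * A * ennreal (weight_mass TYPE('a))) = ennreal (2 ^ ?n * weight_mass TYPE('a) / ?m) * A"
  proof -
    have "ennreal (2 ^ ?n * weight_mass TYPE('a) / ?m) = ennreal (1 / ?m) * (ennreal (2 ^ ?n) * ennreal (weight_mass TYPE('a)))"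
      using m0 weight_mass_nonneg[where 'a='a] by (subst ennreal_mult[symmetric], simp, simp, subst ennreal_mult[symmetric]) auto
    then show ?thesis by (simp only: mult_ac)
  qed
  ultimately show ?thesis by simp
qed

section \<open>Nikolskii inequalities\<close>

lemma nn_integral_convolution:
  fixes F G :: "'a::euclidean_space \<Rightarrow> ennreal"
  assumes [measurable]: "F \<in> borel_measurable borel" "G \<in> borel_measurable borel"
  shows "(\<integral>\<^sup>+x. \<integral>\<^sup>+t. F (x - t) * G t \<partial>lborel \<partial>lborel) = (\<integral>\<^sup>+x. F x \<partial>lborel) * (\<integral>\<^sup>+t. G t \<partial>lborel)"
proof -
  have "(\<integral>\<^sup>+x. \<integral>\<^sup>+t. F (x - t) * G t \<partial>lborel \<partial>lborel) = (\<integral>\<^sup>+t. \<integral>\<^sup>+x. F (x - t) * G t \<partial>lborel \<partial>lborel)"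
    by (rule lborel_pair.Fubini'[symmetric]) measurable
  also have "\<dots> = (\<integral>\<^sup>+t. (\<integral>\<^sup>+x. F x \<partial>lborel) * G t \<partial>lborel)"
  proof (rule nn_integral_cong)
    fix t
    have "(\<integral>\<^sup>+x. F (x - t) * G t \<partial>lborel) = (\<integral>\<^sup>+x. F (x - t) \<partial>lborel) * G t"
      by (rule nn_integral_multc) measurable
    then show "(\<integral>\<^sup>+x. F (x - t) * G t \<partial>lborel) = (\<integral>\<^sup>+x. F x \<partial>lborel) * G t"
      using nn_integral_shift[of F "- t"] by simp
  qed
  also have "\<dots> = (\<integral>\<^sup>+x. F x \<partial>lborel) * (\<integral>\<^sup>+t. G t \<partial>lborel)"
    by (rule nn_integral_cmult) measurable
  finally show ?thesis .
qed

lemma rapid_powr_integral_finite: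
  fixes f :: "'a::euclidean_space \<Rightarrow> complex"
  assumes f: "rapid f" and r: "0 < r"
  obtains J where "0 < J" "(\<integral>\<^sup>+x. ennreal (cmod (f x) powr r) \<partial>lborel) \<le> ennreal J"
proof -
  have [measurable]: "f \<in> borel_measurable borel" using f by (rule rapid_measurable)
  define L where "L = nat \<lceil>real (2 * DIM('a)) / r\<rceil>"
  have L: "real (2 * DIM('a)) \<le> real L * r"
  proof -
    have "real (2 * DIM('a)) / r \<le> real L" unfolding L_def by linarith
    then show ?thesis using r by (simp add: pos_divide_le_eq)
  qed
  obtain C where C: "0 < C" "\<And>x. (1 + norm x) ^ L * cmod (f x) \<le> C" using rapidE[OF f] by metis
  have "(1 + norm x) ^ (2 * DIM('a)) * norm (cmod (f x) powr r) \<le> C powr r" for x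
  proof -
    have "(1 + norm x) ^ (2 * DIM('a)) = (1 + norm x) powr real (2 * DIM('a))"
      by (rule powr_realpow[symmetric]) (simp add: add_pos_nonneg)
    also have "\<dots> \<le> (1 + norm x) powr (real L * r)" by (intro powr_mono L) simp
    also have "\<dots> = ((1 + norm x) ^ L) powr r"
      by (simp add: powr_powr[symmetric] powr_realpow add_pos_nonneg)
    finally have "(1 + norm x) ^ (2 * DIM('a)) * cmod (f x) powr r \<le> ((1 + norm x) ^ L) powr r * cmod (f x) powr r"
      by (intro mult_right_mono) auto
    also have "\<dots> = ((1 + norm x) ^ L * cmod (f x)) powr r" by (simp add: powr_mult)
    also have "\<dots> \<le> C powr r" using C r by (intro powr_mono2) auto
    finally show ?thesis by simp
  qed
  then have i: "integrable lborel (\<lambda>x. cmod (f x) powr r)" by (rule integrable_of_decay[rotated]) measurable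
  show ?thesis
  proof (rule that[of "(LINT x|lborel. cmod (f x) powr r) + 1"])
    have "0 \<le> (LINT x|lborel. cmod (f x) powr r)" by (rule Bochner_Integration.integral_nonneg) simp
    then show "0 < (LINT x|lborel. cmod (f x) powr r) + 1" by linarith
    show "(\<integral>\<^sup>+x. ennreal (cmod (f x) powr r) \<partial>lborel) \<le> ennreal ((LINT x|lborel. cmod (f x) powr r) + 1)"
      by (subst nn_integral_eq_integral[OF i]) (auto intro: ennreal_leI)
  qed
qed

text \<open>For \<open>r < 1\<close> and \<open>c \<ge> 1\<close> the power integral shrinks under
  dilation. This is the factor that compensates the loss in the Nikolskii inequality.\<close>

lemma dilate_powr_integral:
  fixes f :: "'a::euclidean_space \<Rightarrow> complex"
  assumes [measurable]: "f \<in> borel_measurable borel" and c: "0 < c"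
  shows "(\<integral>\<^sup>+x. ennreal (cmod (dilate c f x) powr r) \<partial>lborel) = ennreal ((c ^ DIM('a)) powr (r - 1)) * (\<integral>\<^sup>+x. ennreal (cmod (f x) powr r) \<partial>lborel)"
proof -
  let ?J = "\<integral>\<^sup>+x. ennreal (cmod (f x) powr r) \<partial>lborel" and ?Jc = "\<integral>\<^sup>+x. ennreal (cmod (f (c *\<^sub>R x)) powr r) \<partial>lborel"
  have cn: "0 < c ^ DIM('a)" using c by simp
  have J: "?J = ennreal (c ^ DIM('a)) * ?Jc"
    using nn_integral_affine[of "\<lambda>x. ennreal (cmod (f x) powr r)" c 0] c by simp
  have "(\<integral>\<^sup>+x. ennreal (cmod (dilate c f x) powr r) \<partial>lborel) = (\<integral>\<^sup>+x. ennreal ((c ^ DIM('a)) powr r) * ennreal (cmod (f (c *\<^sub>R x)) powr r) \<partial>lborel)"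
    using c by (intro nn_integral_cong) (simp add: dilate_def norm_mult norm_power powr_mult ennreal_mult)
  also have "\<dots> = ennreal ((c ^ DIM('a)) powr r) * ?Jc" by (rule nn_integral_cmult) measurable
  also have "(c ^ DIM('a)) powr r = (c ^ DIM('a)) powr (r - 1) * c ^ DIM('a)"
    using cn by (simp add: powr_diff)
  also have "ennreal ((c ^ DIM('a)) powr (r - 1) * c ^ DIM('a)) = ennreal ((c ^ DIM('a)) powr (r - 1)) * ennreal (c ^ DIM('a))"
    using cn by (simp add: ennreal_mult)
  finally show ?thesis unfolding J by (simp only: mult.assoc)
qed

text \<open>The constant in the substitute for Young's inequality: for \<open>1 \<le> P\<close> it
  comes from Jensen with kernel mass \<open>A\<close>, for \<open>P < 1\<close> from a sup bound
  with constant \<open>S\<close>.\<close>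

definition power_const :: "real \<Rightarrow> real \<Rightarrow> real \<Rightarrow> real" where
  "power_const P A S = (if 1 \<le> P then A powr (P - 1) else S powr (1 - P))"

context
  fixes \<phi> :: "nat \<Rightarrow> 'a::euclidean_space \<Rightarrow> complex"
  assumes lp: "littlewood_paley \<phi>"
begin

text \<open>For fixed \<open>w\<close> the function t \<mapsto> b(x - t) \<phi>_j(t - w) has
  spectrum in the ball of radius \<open>R + 2 * 2 ^ j\<close>, where the transform of the dilated
  \<open>\<phi> 0\<close> is 1. It is thus reproduced by that kernel, and
  \<open>integral_conv\<close> carries this out inside \<open>f\<close>.\<close>

lemma lp_reproduce:
  assumes f: "f \<in> tempered" and b: "bandlimited R b" and m: "R + 2 * 2 ^ j \<le> 2 ^ m"
  shows "(LINT t|lborel. conv (\<phi> j) f t * (dilate (2 ^ m) (\<phi> 0) (s - t) * b (x - t))) = b (x - s) * conv (\<phi> j) f s"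
proof -
  let ?K = "dilate (2 ^ m) (\<phi> 0)"
  have rK: "rapid ?K" by (intro dilate_rapid lp_rapid[OF lp]) simp
  have bK: "bandlimited (2 ^ m * 2) ?K" by (rule dilate_bandlimited[OF lp0_bandlimited[OF lp]]) simp
  have K1: "fourier ?K \<xi> = 1" if "norm \<xi> \<le> 2 ^ m" for \<xi>
    using that by (subst fourier_dilate) (auto intro!: lp0_inner[OF lp] simp: pos_divide_le_eq)
  have r: "rapid (\<lambda>t. ?K (s - t) * b (x - t))"
    by (intro rapid_mult_growing rapid_reflect rK rapid_growing bandlimited_rapid[OF b])
  have "(LINT t|lborel. conv (\<phi> j) f t * (?K (s - t) * b (x - t))) = f (fconv (\<lambda>x. \<phi> j (- x)) (\<lambda>t. ?K (s - t) * b (x - t)))"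
    by (rule integral_conv[OF f lp_schwartz[OF lp] r])
  also have "fconv (\<lambda>x. \<phi> j (- x)) (\<lambda>t. ?K (s - t) * b (x - t)) = (\<lambda>w. b (x - s) * \<phi> j (s - w))"
  proof
    fix w
    let ?h = "\<lambda>t. b (x - t) * \<phi> j (t - w)"
    have bh: "bandlimited (R + 2 * 2 ^ j) ?h"
      using bandlimited_mult[OF bandlimited_reflect[OF b, of x] bandlimited_shift[OF lp_bandlimited[OF lp, of j], where a="- w"]] by simp
    have "fconv ?K ?h = ?h"
    proof (rule fconv_eq_right[OF bK bh])
      fix \<xi> assume "fourier ?h \<xi> \<noteq> 0"
      then have "norm \<xi> < R + 2 * 2 ^ j" using bh unfolding bandlimited_def by force
      then show "fourier ?K \<xi> = 1" using m by (intro K1) simp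
    qed
    then have "fconv ?K ?h s = ?h s" by simp
    then show "fconv (\<lambda>x. \<phi> j (- x)) (\<lambda>t. ?K (s - t) * b (x - t)) w = b (x - s) * \<phi> j (s - w)"
      by (simp add: fconv_def mult_ac)
  qed
  also have "f \<dots> = b (x - s) * f (\<lambda>w. \<phi> j (s - w))"
    by (rule tempered_cmult[OF f schwartz_reflect[OF lp_schwartz[OF lp]]])
  finally show ?thesis by (simp add: conv_def)
qed

text \<open>The sup of the reproducing kernel is at most \<open>(2 ^ m) ^ DIM('a) * s0\<close>, and
  a function reproduced by a bounded kernel is bounded by that sup times its integral norm.\<close>

lemma lp_nikolskii:
  obtains s0 where "1 \<le> s0"
    "\<And>f b R j m x s. f \<in> tempered \<Longrightarrow> bandlimited R b \<Longrightarrow> R + 2 * 2 ^ j \<le> 2 ^ m \<Longrightarrow>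
      cmod (b (x - s) * conv (\<phi> j) f s) \<le> ((2 ^ m) ^ DIM('a) * s0) * (LINT t|lborel. cmod (b (x - t) * conv (\<phi> j) f t))"
proof -
  obtain C where C: "0 < C" "\<And>x. (1 + norm x) ^ 0 * cmod (\<phi> 0 x) \<le> C" using rapidE[OF lp_rapid[OF lp, of 0]] by metis
  show ?thesis
  proof (rule that[of "max 1 C"])
    fix f :: "('a \<Rightarrow> complex) \<Rightarrow> complex" and b :: "'a \<Rightarrow> complex" and R :: real and j m :: nat and x s :: 'a
    assume f: "f \<in> tempered" and b: "bandlimited R b" and m: "R + 2 * 2 ^ j \<le> 2 ^ m"
    let ?K = "dilate (2 ^ m) (\<phi> 0)"
    have K: "cmod (?K v) \<le> (2 ^ m) ^ DIM('a) * max 1 C" for v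
    proof -
      have "cmod (\<phi> 0 ((2 ^ m) *\<^sub>R v)) \<le> max 1 C" using C(2)[of "(2 ^ m) *\<^sub>R v"] by simp
      then show ?thesis by (simp add: dilate_def norm_mult norm_power)
    qed
    have i: "integrable lborel (\<lambda>t. b (x - t) * conv (\<phi> j) f t)"
      by (rule rapid_integrable[OF rapid_mult_growing[OF rapid_reflect[OF bandlimited_rapid[OF b]] conv_growing[OF f lp_schwartz[OF lp]]]])
    have Km: "?K \<in> borel_measurable borel" by (intro rapid_measurable dilate_rapid lp_rapid[OF lp]) simp
    have "cmod (b (x - s) * conv (\<phi> j) f s) = cmod (LINT t|lborel. ?K (s - t) * (b (x - t) * conv (\<phi> j) f t))"
      unfolding lp_reproduce[OF f b m, of s x, symmetric] by (simp only: mult_ac)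
    also have "\<dots> \<le> (LINT t|lborel. ((2 ^ m) ^ DIM('a) * max 1 C) * cmod (b (x - t) * conv (\<phi> j) f t))"
    proof (rule Bochner_Integration.integral_norm_bound_integral)
      show "integrable lborel (\<lambda>t. ?K (s - t) * (b (x - t) * conv (\<phi> j) f t))"
        by (rule integrable_mult_bounded[OF i _ K]) (use Km in measurable)
      show "integrable lborel (\<lambda>t. ((2 ^ m) ^ DIM('a) * max 1 C) * cmod (b (x - t) * conv (\<phi> j) f t))"
        by (intro integrable_mult_right integrable_norm i)
      show "cmod (?K (s - t) * (b (x - t) * conv (\<phi> j) f t)) \<le> ((2 ^ m) ^ DIM('a) * max 1 C) * cmod (b (x - t) * conv (\<phi> j) f t)" for t
        unfolding norm_mult[of "?K (s - t)"] by (intro mult_right_mono K) simp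
    qed
    finally show "cmod (b (x - s) * conv (\<phi> j) f s) \<le> ((2 ^ m) ^ DIM('a) * max 1 C) * (LINT t|lborel. cmod (b (x - t) * conv (\<phi> j) f t))"
      by simp
  qed simp
qed

text \<open>The pointwise substitute for Young's inequality. For \<open>P < 1\<close> the integrand
  b(x - t) (\<phi>_j * f)(t) is itself band-limited in \<open>t\<close>, so the Nikolskii inequality
  provides the sup bound required by \<open>weighted_power_le1\<close>. The kernel then carries the
  power \<open>P\<close>, otherwise the power 1.\<close>

lemma lp_kernel_power:
  assumes P: "0 < P"
  obtains s0 where "1 \<le> s0"
    "\<And>f b R j m x A. f \<in> tempered \<Longrightarrow> bandlimited R b \<Longrightarrow> R + 2 * 2 ^ j \<le> 2 ^ m \<Longrightarrow> 0 < A \<Longrightarrow>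
      (\<integral>\<^sup>+t. ennreal (cmod (b t)) \<partial>lborel) \<le> ennreal A \<Longrightarrow>
      ennreal (cmod (fconv b (conv (\<phi> j) f) x) powr P) \<le> ennreal (power_const P A ((2 ^ m) ^ DIM('a) * s0)) *
        (\<integral>\<^sup>+t. ennreal (cmod (b (x - t)) powr min 1 P) * ennreal (cmod (conv (\<phi> j) f t) powr P) \<partial>lborel)"
proof (rule lp_nikolskii)
  fix s0 :: real
  assume s0: "1 \<le> s0"
    "\<And>f b R j m x s. f \<in> tempered \<Longrightarrow> bandlimited R b \<Longrightarrow> R + 2 * 2 ^ j \<le> 2 ^ m \<Longrightarrow>
      cmod (b (x - s) * conv (\<phi> j) f s) \<le> ((2 ^ m) ^ DIM('a) * s0) * (LINT t|lborel. cmod (b (x - t) * conv (\<phi> j) f t))"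
  show ?thesis
  proof (rule that[OF s0(1)])
    fix f :: "('a \<Rightarrow> complex) \<Rightarrow> complex" and b :: "'a \<Rightarrow> complex" and R A :: real and j m :: nat and x :: 'a
    assume f: "f \<in> tempered" and b: "bandlimited R b" and m: "R + 2 * 2 ^ j \<le> 2 ^ m" and A: "0 < A"
      "(\<integral>\<^sup>+t. ennreal (cmod (b t)) \<partial>lborel) \<le> ennreal A"
    let ?g = "conv (\<phi> j) f" and ?S = "(2 ^ m) ^ DIM('a) * s0"
    have gr: "growing ?g" by (rule conv_growing[OF f lp_schwartz[OF lp]])
    have [measurable]: "b \<in> borel_measurable borel" "?g \<in> borel_measurable borel"
      using rapid_measurable[OF bandlimited_rapid[OF b]] growing_measurable[OF gr] by auto
    have i: "integrable lborel (\<lambda>t. b (x - t) * ?g t)"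
      by (rule rapid_integrable[OF rapid_mult_growing[OF rapid_reflect[OF bandlimited_rapid[OF b]] gr]])
    let ?I = "\<integral>\<^sup>+t. ennreal (cmod (b (x - t)) * cmod (?g t)) \<partial>lborel"
    have "ennreal (cmod (fconv b ?g x)) \<le> ?I"
      using integral_norm_bound_ennreal[OF i] by (simp add: fconv_def norm_mult)
    then have "ennreal_powr (ennreal (cmod (fconv b ?g x))) P \<le> ennreal_powr ?I P"
      using P by (intro ennreal_powr_mono) auto
    then have 1: "ennreal (cmod (fconv b ?g x) powr P) \<le> ennreal_powr ?I P" by (simp add: ennreal_powr_ennreal)
    show "ennreal (cmod (fconv b ?g x) powr P) \<le> ennreal (power_const P A ?S) *
        (\<integral>\<^sup>+t. ennreal (cmod (b (x - t)) powr min 1 P) * ennreal (cmod (?g t) powr P) \<partial>lborel)"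
    proof (cases "1 \<le> P")
      case True
      have w: "(\<integral>\<^sup>+t. ennreal (cmod (b (x - t))) \<partial>lborel) \<le> ennreal A"
        using A(2) by (subst nn_integral_reflect) auto
      have "ennreal_powr ?I P \<le> ennreal (A powr (P - 1)) * (\<integral>\<^sup>+t. ennreal (cmod (b (x - t)) * cmod (?g t) powr P) \<partial>lborel)"
        by (rule weighted_power_ge1[OF _ _ _ _ w A(1) True]) auto
      with 1 show ?thesis using True by (simp add: power_const_def ennreal_mult order_trans)
    next
      case False
      have S: "0 < ?S" using s0(1) by simp
      have "ennreal_powr (\<integral>\<^sup>+t. ennreal (cmod (b (x - t) * ?g t)) \<partial>lborel) P \<le> ennreal (?S powr (1 - P)) * (\<integral>\<^sup>+t. ennreal (cmod (b (x - t) * ?g t) powr P) \<partial>lborel)"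
        by (rule weighted_power_le1[OF integrable_norm[OF i] _ s0(2)[OF f b m] S P]) (use False in auto)
      with 1 show ?thesis using False by (simp add: power_const_def norm_mult powr_mult ennreal_mult order_trans)
    qed
  qed
qed

text \<open>Apply the substitute for Young's inequality to the reproduction by
  \<open>lp_fat \<phi> j\<close>, dominate the kernel by an integrable weight, and average locally.
  A polynomial loss in \<open>2 ^ j\<close> is affordable, since \<open>lp_series\<close> tolerates
  it.\<close>

lemma lp_local_bound:
  assumes P: "0 < P"
  obtains C M where "0 < C" "\<And>f j x A. f \<in> tempered \<Longrightarrow> 1 \<le> j \<Longrightarrow>
    (\<And>z. (\<integral>\<^sup>+t. ennreal (cmod (conv (\<phi> j) f t) powr P) * indicator (ball z 1) t \<partial>lborel) \<le> A) \<Longrightarrow>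
    ennreal (cmod (conv (\<phi> j) f x) powr P) \<le> ennreal (C * (2 ^ j) ^ M) * A"
proof (rule lp_kernel_power[OF P])
  fix s0 :: real
  assume s0: "1 \<le> s0"
    "\<And>f b R j m x A. f \<in> tempered \<Longrightarrow> bandlimited R b \<Longrightarrow> R + 2 * 2 ^ j \<le> 2 ^ m \<Longrightarrow> 0 < A \<Longrightarrow>
      (\<integral>\<^sup>+t. ennreal (cmod (b t)) \<partial>lborel) \<le> ennreal A \<Longrightarrow>
      ennreal (cmod (fconv b (conv (\<phi> j) f) x) powr P) \<le> ennreal (power_const P A ((2 ^ m) ^ DIM('a) * s0)) *
        (\<integral>\<^sup>+t. ennreal (cmod (b (x - t)) powr min 1 P) * ennreal (cmod (conv (\<phi> j) f t) powr P) \<partial>lborel)"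
  define r where "r = min 1 P"
  have r: "0 < r" "r \<le> 1" using P by (auto simp: r_def)
  note fat0 = schwartz_rapid[OF lp_fat0_schwartz[OF lp]]
  obtain I where I: "0 < I" "(\<integral>\<^sup>+x. ennreal (cmod (lp_fat0 \<phi> x) powr 1) \<partial>lborel) \<le> ennreal I"
    using rapid_powr_integral_finite[OF fat0, of 1] by auto
  \<comment> \<open>The order of decay whose \<open>r\<close>-th power still reaches the integrable
    weight of order \<open>2 * DIM('a)\<close>.\<close>
  define L where "L = nat \<lceil>real (2 * DIM('a)) / r\<rceil>"
  have L: "real (2 * DIM('a)) \<le> real L * r"
  proof -
    have "real (2 * DIM('a)) / r \<le> real L" unfolding L_def by linarith
    then show ?thesis using r by (simp add: pos_divide_le_eq)
  qed
  obtain D0 where D0: "0 < D0" "\<And>x. (1 + norm x) ^ L * cmod (lp_fat0 \<phi> x) \<le> D0" using rapidE[OF fat0] by metis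
  define D where "D = max 1 D0"
  have D: "1 \<le> D" "\<And>x. (1 + norm x) ^ L * cmod (lp_fat0 \<phi> x) \<le> D"
    using D0(2) by (simp_all add: D_def le_max_iff_disj)
  define E where "E = 2 ^ (2 * DIM('a)) * weight_mass TYPE('a) / measure lborel (ball (0::'a) 1)"
  have E: "0 \<le> E" unfolding E_def by (intro divide_nonneg_nonneg mult_nonneg_nonneg weight_mass_nonneg) auto
  \<comment> \<open>Covers both branches of \<open>power_const\<close>. The 8 comes from the
    reproducing scale \<open>2 ^ (j + 3)\<close>, which exceeds the total band
    \<open>6 * 2 ^ j\<close>.\<close>
  define Q where "Q = I powr (P - 1) + 8 ^ DIM('a) * s0"
  have Q: "0 < Q" using s0(1) I(1) by (simp add: Q_def add_pos_pos)
  have kernel: "cmod (lp_fat \<phi> j v) powr r \<le> (2 ^ j) ^ DIM('a) * D * (1 / (1 + norm v) ^ (2 * DIM('a)))" for j v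
  proof -
    define q where "q = (2::real) ^ j"
    have q: "1 \<le> q" by (simp add: q_def one_le_power)
    have "norm v \<le> q * norm v" using q by (simp add: mult_le_cancel_right1)
    then have "(1 + norm v) ^ L \<le> (1 + norm (q *\<^sub>R v)) ^ L" using q by (intro power_mono) auto
    then have "(1 + norm v) ^ L * cmod (lp_fat0 \<phi> (q *\<^sub>R v)) \<le> (1 + norm (q *\<^sub>R v)) ^ L * cmod (lp_fat0 \<phi> (q *\<^sub>R v))"
      by (intro mult_right_mono) auto
    also have "\<dots> \<le> D" by (rule D)
    finally have "(1 + norm v) ^ L * cmod (lp_fat0 \<phi> (q *\<^sub>R v)) \<le> D" .
    then have "q ^ DIM('a) * ((1 + norm v) ^ L * cmod (lp_fat0 \<phi> (q *\<^sub>R v))) \<le> q ^ DIM('a) * D"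
      using q by (intro mult_left_mono) auto
    moreover have "cmod (lp_fat \<phi> j v) = q ^ DIM('a) * cmod (lp_fat0 \<phi> (q *\<^sub>R v))"
      using q by (simp add: lp_fat_def dilate_def norm_mult norm_power q_def)
    ultimately have "(1 + norm v) ^ L * cmod (lp_fat \<phi> j v) \<le> q ^ DIM('a) * D" by (simp add: mult_ac)
    then have "((1 + norm v) ^ L * cmod (lp_fat \<phi> j v)) powr r \<le> (q ^ DIM('a) * D) powr r"
      using r by (intro powr_mono2) auto
    also have "\<dots> \<le> (q ^ DIM('a) * D) powr 1"
    proof (rule powr_mono)
      have "1 * 1 \<le> q ^ DIM('a) * D" using q D(1) by (intro mult_mono one_le_power) auto
      then show "1 \<le> q ^ DIM('a) * D" by simp
    qed (rule r)
    finally have *: "((1 + norm v) ^ L) powr r * cmod (lp_fat \<phi> j v) powr r \<le> q ^ DIM('a) * D"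
      using q D(1) by (simp add: powr_mult)
    have "(1 + norm v) ^ (2 * DIM('a)) = (1 + norm v) powr real (2 * DIM('a))"
      by (rule powr_realpow[symmetric]) (simp add: add_pos_nonneg)
    also have "\<dots> \<le> (1 + norm v) powr (real L * r)" by (intro powr_mono L) simp
    also have "\<dots> = ((1 + norm v) ^ L) powr r"
      by (simp add: powr_powr[symmetric] powr_realpow add_pos_nonneg)
    finally have "(1 + norm v) ^ (2 * DIM('a)) * cmod (lp_fat \<phi> j v) powr r \<le> ((1 + norm v) ^ L) powr r * cmod (lp_fat \<phi> j v) powr r"
      by (intro mult_right_mono) auto
    with * have "(1 + norm v) ^ (2 * DIM('a)) * cmod (lp_fat \<phi> j v) powr r \<le> q ^ DIM('a) * D" by linarith
    then show ?thesis
      using weight_pos[of v "2 * DIM('a)"] unfolding q_def by (simp add: pos_le_divide_eq mult.commute)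
  qed
  show ?thesis
  proof (rule that[of "Q * D * E + 1" "2 * DIM('a)"])
    show "0 < Q * D * E + 1" using Q D(1) E by (simp add: add_nonneg_pos)
    fix f :: "('a \<Rightarrow> complex) \<Rightarrow> complex" and j :: nat and x :: 'a and A :: ennreal
    assume f: "f \<in> tempered" and j: "1 \<le> j"
      and A: "\<And>z. (\<integral>\<^sup>+t. ennreal (cmod (conv (\<phi> j) f t) powr P) * indicator (ball z 1) t \<partial>lborel) \<le> A"
    let ?g = "conv (\<phi> j) f" and ?q = "((2::real) ^ j) ^ DIM('a)"
    have gm [measurable]: "?g \<in> borel_measurable borel" by (rule growing_measurable[OF conv_growing[OF f lp_schwartz[OF lp]]])
    have q1: "1 \<le> ?q" by (simp add: one_le_power)
    have m: "4 * 2 ^ j + 2 * 2 ^ j \<le> (2::real) ^ (j + 3)" by (simp add: power_add)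
    have If: "(\<integral>\<^sup>+t. ennreal (cmod (lp_fat \<phi> j t)) \<partial>lborel) \<le> ennreal I"
      using dilate_powr_integral[OF rapid_measurable[OF fat0], of "2 ^ j" 1] I(2) by (simp add: lp_fat_def)
    have pc: "power_const P I ((2 ^ (j + 3)) ^ DIM('a) * s0) \<le> Q * ?q"
    proof (cases "1 \<le> P")
      case True
      have "I powr (P - 1) \<le> Q * 1" using s0(1) by (simp add: Q_def)
      also have "\<dots> \<le> Q * ?q" using Q q1 by (intro mult_left_mono) auto
      finally show ?thesis using True by (simp add: power_const_def)
    next
      case False
      let ?S = "(2 ^ (j + 3)) ^ DIM('a) * s0"
      have "1 * 1 \<le> ?S" using s0(1) by (intro mult_mono one_le_power) auto
      then have "?S powr (1 - P) \<le> ?S powr 1" using P by (intro powr_mono) auto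
      also have "\<dots> = ?S" using s0(1) by simp
      also have "\<dots> = 8 ^ DIM('a) * s0 * ?q" by (simp add: power_add power_mult_distrib)
      also have "\<dots> \<le> Q * ?q" unfolding Q_def by (intro mult_right_mono) auto
      finally show ?thesis using False by (simp add: power_const_def)
    qed
    have "ennreal (cmod (?g x) powr P) = ennreal (cmod (fconv (lp_fat \<phi> j) ?g x) powr P)"
      by (simp add: fconv_fat_conv[OF lp f j])
    also have "\<dots> \<le> ennreal (power_const P I ((2 ^ (j + 3)) ^ DIM('a) * s0)) *
        (\<integral>\<^sup>+t. ennreal (cmod (lp_fat \<phi> j (x - t)) powr r) * ennreal (cmod (?g t) powr P) \<partial>lborel)"
      unfolding r_def by (rule s0(2)[OF f lp_fat_bandlimited[OF lp] m I(1) If])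
    also have "\<dots> \<le> ennreal (Q * ?q) * (\<integral>\<^sup>+t. ennreal (?q * D) * (ennreal (1 / (1 + norm (x - t)) ^ (2 * DIM('a))) * ennreal (cmod (?g t) powr P)) \<partial>lborel)"
    proof (rule mult_mono[OF ennreal_leI[OF pc] nn_integral_mono])
      fix t
      have "ennreal (cmod (lp_fat \<phi> j (x - t)) powr r) \<le> ennreal (?q * D) * ennreal (1 / (1 + norm (x - t)) ^ (2 * DIM('a)))"
        using kernel[of j "x - t"] D(1) by (subst ennreal_mult[symmetric]) (auto intro: ennreal_leI)
      then show "ennreal (cmod (lp_fat \<phi> j (x - t)) powr r) * ennreal (cmod (?g t) powr P) \<le>
        ennreal (?q * D) * (ennreal (1 / (1 + norm (x - t)) ^ (2 * DIM('a))) * ennreal (cmod (?g t) powr P))"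
        unfolding mult.assoc[symmetric] by (rule mult_right_mono) simp
    qed auto
    also have "\<dots> = ennreal (Q * ?q) * (ennreal (?q * D) * (\<integral>\<^sup>+t. ennreal (1 / (1 + norm (x - t)) ^ (2 * DIM('a))) * ennreal (cmod (?g t) powr P) \<partial>lborel))"
      by (subst nn_integral_cmult) auto
    also have "\<dots> \<le> ennreal (Q * ?q) * (ennreal (?q * D) * (ennreal E * A))"
      unfolding E_def by (intro mult_left_mono local_average A) auto
    also have "\<dots> = ennreal (Q * ?q * (?q * D) * E) * A"
      using Q D(1) E by (simp add: ennreal_mult mult.assoc)
    also have "\<dots> \<le> ennreal ((Q * D * E + 1) * (2 ^ j) ^ (2 * DIM('a))) * A"
    proof (intro mult_right_mono ennreal_leI)
      have "Q * ?q * (?q * D) * E = (Q * D * E) * (2 ^ j) ^ (2 * DIM('a))" unfolding mult_2 power_add by (simp only: mult_ac)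
      also have "\<dots> \<le> (Q * D * E + 1) * (2 ^ j) ^ (2 * DIM('a))" by (intro mult_right_mono) auto
      finally show "Q * ?q * (?q * D) * E \<le> (Q * D * E + 1) * (2 ^ j) ^ (2 * DIM('a))" .
    qed simp
    finally show "ennreal (cmod (?g x) powr P) \<le> ennreal ((Q * D * E + 1) * (2 ^ j) ^ (2 * DIM('a))) * A" .
  qed
qed

text \<open>No growth condition on \<open>y\<close> is needed here since the hypothesis is invariant under translations.\<close>

lemma T_converges_local:
  assumes f: "f \<in> tempered" and P: "0 < P" and A: "0 \<le> A"
    and local: "\<And>j z. 1 \<le> j \<Longrightarrow> (\<integral>\<^sup>+t. ennreal (cmod (conv (\<phi> j) f t) powr P) * indicator (ball z 1) t \<partial>lborel) \<le> ennreal (A * (2 ^ j) ^ m)"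
  obtains u where "T_sums \<phi> y f u"
proof (rule lp_local_bound[OF P])
  fix C :: real and M :: nat
  assume C: "0 < C" "\<And>f j x A. f \<in> tempered \<Longrightarrow> 1 \<le> j \<Longrightarrow>
    (\<And>z. (\<integral>\<^sup>+t. ennreal (cmod (conv (\<phi> j) f t) powr P) * indicator (ball z 1) t \<partial>lborel) \<le> A) \<Longrightarrow>
    ennreal (cmod (conv (\<phi> j) f x) powr P) \<le> ennreal (C * (2 ^ j) ^ M) * A"
  \<comment> \<open>Taking the root of order \<open>P\<close> divides the exponent of
    \<open>2 ^ j\<close> by \<open>P\<close>; it is rounded up to an integer.\<close>
  define L where "L = nat \<lceil>real (M + m) / P\<rceil>"
  have L: "real (M + m) / P \<le> real L" unfolding L_def by linarith
  have "cmod (conv (\<phi> j) f x) \<le> (C * A) powr (1 / P) * (2 ^ j) ^ L" if j: "1 \<le> j" for j x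
  proof -
    have "ennreal (cmod (conv (\<phi> j) f x) powr P) \<le> ennreal (C * (2 ^ j) ^ M) * ennreal (A * (2 ^ j) ^ m)"
      by (rule C(2)[OF f j local[OF j]])
    also have "\<dots> = ennreal (C * A * (2 ^ j) ^ (M + m))"
      using C(1) A by (subst ennreal_mult[symmetric]) (auto simp: power_add mult_ac)
    finally have "cmod (conv (\<phi> j) f x) powr P \<le> C * A * (2 ^ j) ^ (M + m)"
      using C(1) A by (subst (asm) ennreal_le_iff) auto
    then have "(cmod (conv (\<phi> j) f x) powr P) powr (1 / P) \<le> (C * A * (2 ^ j) ^ (M + m)) powr (1 / P)"
      using P by (intro powr_mono2) auto
    then have "cmod (conv (\<phi> j) f x) \<le> (C * A * (2 ^ j) ^ (M + m)) powr (1 / P)"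
      using P by (simp add: powr_powr)
    also have "\<dots> = (C * A) powr (1 / P) * ((2 ^ j) ^ (M + m)) powr (1 / P)"
      using C(1) A by (subst powr_mult) auto
    also have "((2::real) ^ j) ^ (M + m) = (2 ^ j) powr real (M + m)" by (rule powr_realpow[symmetric]) simp
    also have "(((2::real) ^ j) powr real (M + m)) powr (1 / P) = (2 ^ j) powr (real (M + m) / P)"
      by (simp add: powr_powr)
    also have "((2::real) ^ j) powr (real (M + m) / P) \<le> (2 ^ j) powr real L" by (intro powr_mono L) (simp add: one_le_power)
    also have "((2::real) ^ j) powr real L = (2 ^ j) ^ L" by (rule powr_realpow) simp
    finally show ?thesis by (simp add: mult_left_mono)
  qed
  then have "cmod (conv (\<phi> j) f (x - y j)) \<le> (C * A) powr (1 / P) * (2 ^ j) ^ L * (1 + norm x) ^ 0" if "1 \<le> j" for j x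
    using that by simp
  from T_sums_exists[OF lp f this] that show ?thesis by metis
qed

text \<open>Global block bounds imply local ones: by enlarging the ball to the whole space with the
  same exponent if it is finite, and by the volume of the unit ball with exponent 1 if it is
  infinite.\<close>

lemma T_converges_Lp:
  assumes f: "f \<in> tempered" and p: "0 < p" and Y: "0 \<le> Y"
    and norm: "\<And>j. Lp_norm p lborel (\<lambda>x. ennreal (cmod (conv (\<phi> j) f x))) \<le> ennreal (Y * (2 powr (real j * a)))"
  obtains u where "T_sums \<phi> y f u"
  using p
proof (cases rule: exponent_cases)
  case 1
  define m where "m = nat \<lceil>\<bar>a\<bar>\<rceil>"
  let ?V = "measure lborel (ball (0::'a) 1)"
  have "(\<integral>\<^sup>+t. ennreal (cmod (conv (\<phi> j) f t) powr 1) * indicator (ball z 1) t \<partial>lborel) \<le> ennreal (Y * ?V * (2 ^ j) ^ m)" for j z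
  proof -
    have "AE t in lborel. ennreal (cmod (conv (\<phi> j) f t)) \<le> ennreal (Y * (2 powr (real j * a)))"
      using esssup_AE[of "\<lambda>x. ennreal (cmod (conv (\<phi> j) f x))" lborel] norm[of j] 1
      by (auto simp: Lp_norm_top elim: eventually_mono)
    then have "(\<integral>\<^sup>+t. ennreal (cmod (conv (\<phi> j) f t) powr 1) * indicator (ball z 1) t \<partial>lborel)
       \<le> (\<integral>\<^sup>+t. ennreal (Y * (2 powr (real j * a))) * indicator (ball z 1) t \<partial>lborel)"
      by (intro nn_integral_mono_AE) (auto elim!: eventually_mono intro!: mult_right_mono)
    also have "\<dots> = ennreal (Y * (2 powr (real j * a))) * emeasure lborel (ball z 1)"
      by (rule nn_integral_cmult_indicator) simp
    also have "emeasure lborel (ball z 1) = ennreal ?V"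
    proof -
      have "emeasure lborel (ball z 1) = (\<integral>\<^sup>+t. indicator (ball z 1) t \<partial>lborel)" by simp
      also have "\<dots> = (\<integral>\<^sup>+t. indicator (ball z 1) (t + z) \<partial>lborel)"
        by (rule nn_integral_shift[symmetric]) (intro borel_measurable_indicator, simp)
      also have "\<dots> = (\<integral>\<^sup>+t. indicator (ball (0::'a) 1) t \<partial>lborel)"
        by (intro nn_integral_cong) (auto simp: indicator_def dist_norm)
      also have "\<dots> = emeasure lborel (ball (0::'a) 1)" by simp
      also have "\<dots> = ennreal ?V" using emeasure_lborel_ball_finite[of "0::'a" 1] by (intro emeasure_eq_ennreal_measure) auto
      finally show ?thesis .
    qed
    also have "ennreal (Y * (2 powr (real j * a))) * ennreal ?V = ennreal (Y * ?V * (2 powr (real j * a)))"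
      using Y by (subst ennreal_mult[symmetric]) (auto simp: mult_ac)
    also have "\<dots> \<le> ennreal (Y * ?V * (2 ^ j) ^ m)"
    proof (intro ennreal_leI mult_left_mono)
      have "a \<le> real m" unfolding m_def by linarith
      then have "2 powr (real j * a) \<le> 2 powr (real (j * m))" by (intro powr_mono) (auto intro: mult_left_mono)
      also have "\<dots> = (2 ^ j) ^ m" by (subst powr_realpow) (auto simp: power_mult)
      finally show "2 powr (real j * a) \<le> (2 ^ j) ^ m" .
    qed (use Y in auto)
    finally show ?thesis .
  qed
  from T_converges_local[OF f zero_less_one _ this] Y that show ?thesis by auto
next
  case (2 P)
  define m where "m = nat \<lceil>\<bar>a\<bar> * P\<rceil>"
  have "(\<integral>\<^sup>+t. ennreal (cmod (conv (\<phi> j) f t) powr P) * indicator (ball z 1) t \<partial>lborel) \<le> ennreal (Y powr P * (2 ^ j) ^ m)" for j z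
  proof -
    have "(\<integral>\<^sup>+t. ennreal (cmod (conv (\<phi> j) f t) powr P) * indicator (ball z 1) t \<partial>lborel)
       \<le> (\<integral>\<^sup>+t. ennreal_powr (ennreal (cmod (conv (\<phi> j) f t))) P \<partial>lborel)"
      by (intro nn_integral_mono) (auto simp: ennreal_powr_ennreal indicator_def)
    also have "\<dots> = ennreal_powr (Lp_norm p lborel (\<lambda>x. ennreal (cmod (conv (\<phi> j) f x)))) P"
      unfolding 2(2) Lp_norm_ennreal[OF 2(1)] by (simp add: ennreal_powr_inverse' 2(1))
    also have "\<dots> \<le> ennreal_powr (ennreal (Y * (2 powr (real j * a)))) P"
      using 2(1) by (intro ennreal_powr_mono norm) auto
    also have "\<dots> = ennreal (Y powr P * 2 powr (real j * a * P))"
      using Y by (simp add: ennreal_powr_ennreal powr_mult powr_powr)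
    also have "\<dots> \<le> ennreal (Y powr P * (2 ^ j) ^ m)"
    proof (intro ennreal_leI mult_left_mono)
      have "a * P \<le> \<bar>a\<bar> * P" using 2(1) by (intro mult_right_mono) auto
      also have "\<dots> \<le> real m" unfolding m_def by linarith
      finally have "real j * (a * P) \<le> real j * real m" by (intro mult_left_mono) auto
      then have "2 powr (real j * a * P) \<le> 2 powr (real (j * m))" by (intro powr_mono) (auto simp: mult.assoc)
      also have "\<dots> = (2 ^ j) ^ m" by (subst powr_realpow) (auto simp: power_mult)
      finally show "2 powr (real j * a * P) \<le> (2 ^ j) ^ m" .
    qed auto
    finally show ?thesis .
  qed
  from T_converges_local[OF f 2(1) _ this] that show ?thesis by auto
qed

end

section \<open>Boundedness on Besov spaces\<close>

lemma norm_measurable: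
  "growing g \<Longrightarrow> (\<lambda>x. ennreal (cmod (g x))) \<in> borel_measurable lborel"
  using growing_measurable[of g] by measurable

context
  fixes \<phi> :: "nat \<Rightarrow> 'a::euclidean_space \<Rightarrow> complex"
  assumes lp: "littlewood_paley \<phi>"
begin

lemma growing_lp_conv: "f \<in> tempered \<Longrightarrow> growing (conv (\<phi> j) f)"
  by (rule conv_growing[OF _ lp_schwartz[OF lp]])

lemma growing_fconv_lp_conv: "f \<in> tempered \<Longrightarrow> growing (fconv (\<phi> k) (conv (\<phi> j) f))"
proof -
  assume f: "f \<in> tempered"
  have "fconv (\<phi> k) (conv (\<phi> j) f) = conv (fconv (\<phi> j) (\<phi> k)) f"
    by (rule ext) (rule fconv_conv[OF f lp_schwartz[OF lp] lp_rapid[OF lp]])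
  then show ?thesis using conv_growing[OF f schwartz_fconv[OF lp_schwartz[OF lp] lp_rapid[OF lp]]] by simp
qed

lemma lp_powr_integral:
  assumes r: "0 < r"
  obtains J where "0 < J" "\<And>k. (\<integral>\<^sup>+x. ennreal (cmod (\<phi> k x) powr r) \<partial>lborel) \<le> ennreal (((2 ^ k) ^ DIM('a)) powr (r - 1) * J)"
proof -
  obtain J0 where J0: "0 < J0" "(\<integral>\<^sup>+x. ennreal (cmod (lp_bump \<phi> 0 x) powr r) \<partial>lborel) \<le> ennreal J0"
    by (rule rapid_powr_integral_finite[OF schwartz_rapid[OF lp_bump_schwartz[OF lp]] r])
  obtain J1 where J1: "0 < J1" "(\<integral>\<^sup>+x. ennreal (cmod (lp_bump \<phi> 1 x) powr r) \<partial>lborel) \<le> ennreal J1"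
    by (rule rapid_powr_integral_finite[OF schwartz_rapid[OF lp_bump_schwartz[OF lp]] r])
  have J: "(\<integral>\<^sup>+x. ennreal (cmod (lp_bump \<phi> k x) powr r) \<partial>lborel) \<le> ennreal (J0 + J1)" for k
  proof (cases "k = 0")
    case True
    then show ?thesis using J0 J1 by (auto intro: order_trans ennreal_leI)
  next
    case False
    then have "lp_bump \<phi> k = lp_bump \<phi> 1" by (simp add: lp_bump_def)
    then have "(\<integral>\<^sup>+x. ennreal (cmod (lp_bump \<phi> k x) powr r) \<partial>lborel) \<le> ennreal J1" using J1(2) by simp
    also have "\<dots> \<le> ennreal (J0 + J1)" using J0(1) by (intro ennreal_leI) simp
    finally show ?thesis .
  qed
  show ?thesis
  proof (rule that[of "J0 + J1"])
    show "0 < J0 + J1" using J0 J1 by simp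
    fix k
    have "(\<integral>\<^sup>+x. ennreal (cmod (\<phi> k x) powr r) \<partial>lborel) = ennreal (((2 ^ k) ^ DIM('a)) powr (r - 1)) * (\<integral>\<^sup>+x. ennreal (cmod (lp_bump \<phi> k x) powr r) \<partial>lborel)"
      by (subst lp_eq_dilate[OF lp]) (rule dilate_powr_integral[OF rapid_measurable[OF schwartz_rapid[OF lp_bump_schwartz[OF lp]]]], simp)
    also have "\<dots> \<le> ennreal (((2 ^ k) ^ DIM('a)) powr (r - 1)) * ennreal (J0 + J1)"
      by (intro mult_left_mono J) simp
    also have "\<dots> = ennreal (((2 ^ k) ^ DIM('a)) powr (r - 1) * (J0 + J1))"
      using J0 J1 by (subst ennreal_mult) auto
    finally show "(\<integral>\<^sup>+x. ennreal (cmod (\<phi> k x) powr r) \<partial>lborel) \<le> ennreal (((2 ^ k) ^ DIM('a)) powr (r - 1) * (J0 + J1))" .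
  qed
qed

text \<open>For \<open>P < 1\<close> the Nikolskii loss (2^(j+3))^(n(1-P)) meets the power integral
  of \<open>\<phi> k\<close>, of order (2^k)^(n(P-1)). As \<open>j\<close> and \<open>k\<close>
  differ by at most 1, the product is bounded. For finite \<open>P \<ge> 1\<close> this is Young's
  inequality, and for the infinite exponent the sup is taken out of the integral.\<close>

lemma Lp_norm_fconv_lp:
  assumes p: "0 < p"
  obtains C :: real where "0 < C" "\<And>f j k. f \<in> tempered \<Longrightarrow> j \<le> k + 1 \<Longrightarrow> k \<le> j + 1 \<Longrightarrow>
    Lp_norm p lborel (\<lambda>x. ennreal (cmod (fconv (\<phi> k) (conv (\<phi> j) f) x))) \<le>
      ennreal C * Lp_norm p lborel (\<lambda>x. ennreal (cmod (conv (\<phi> j) f x)))"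
  using p
proof (cases rule: exponent_cases)
  case 1
  obtain J where J: "0 < J" "\<And>k. (\<integral>\<^sup>+x. ennreal (cmod (\<phi> k x) powr 1) \<partial>lborel) \<le> ennreal (((2 ^ k) ^ DIM('a)) powr (1 - 1) * J)"
    using lp_powr_integral[of 1] by auto
  show ?thesis
  proof (rule that[OF J(1)])
    fix f :: "('a \<Rightarrow> complex) \<Rightarrow> complex" and j k :: nat assume f: "f \<in> tempered"
    let ?g = "conv (\<phi> j) f" and ?N = "Lp_norm p lborel (\<lambda>x. ennreal (cmod (conv (\<phi> j) f x)))"
    have [measurable]: "?g \<in> borel_measurable borel" "\<phi> k \<in> borel_measurable borel"
      using growing_measurable[OF growing_lp_conv[OF f]] rapid_measurable[OF lp_rapid[OF lp]] by auto
    have ae: "AE t in lborel. ennreal (cmod (?g t)) \<le> ?N"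
      unfolding 1 Lp_norm_top by (rule esssup_AE)
    have "ennreal (cmod (fconv (\<phi> k) ?g x)) \<le> ennreal J * ?N" for x
    proof -
      have "integrable lborel (\<lambda>t. \<phi> k (x - t) * ?g t)"
        by (rule rapid_integrable[OF rapid_mult_growing[OF rapid_reflect[OF lp_rapid[OF lp]] growing_lp_conv[OF f]]])
      then have "ennreal (cmod (fconv (\<phi> k) ?g x)) \<le> (\<integral>\<^sup>+t. ennreal (cmod (\<phi> k (x - t))) * ennreal (cmod (?g t)) \<partial>lborel)"
        unfolding fconv_def by (rule order_trans[OF integral_norm_bound_ennreal]) (simp add: norm_mult ennreal_mult)
      also have "\<dots> \<le> (\<integral>\<^sup>+t. ennreal (cmod (\<phi> k (x - t))) * ?N \<partial>lborel)"
        using ae by (intro nn_integral_mono_AE) (auto elim!: eventually_mono intro!: mult_left_mono)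
      also have "\<dots> = (\<integral>\<^sup>+t. ennreal (cmod (\<phi> k (x - t))) \<partial>lborel) * ?N" by (rule nn_integral_multc) measurable
      also have "(\<integral>\<^sup>+t. ennreal (cmod (\<phi> k (x - t))) \<partial>lborel) = (\<integral>\<^sup>+t. ennreal (cmod (\<phi> k t)) \<partial>lborel)"
        by (rule nn_integral_reflect) measurable
      also have "\<dots> \<le> ennreal J" using J(2)[of k] by simp
      finally show ?thesis by (simp add: mult_right_mono)
    qed
    then show "Lp_norm p lborel (\<lambda>x. ennreal (cmod (fconv (\<phi> k) ?g x))) \<le> ennreal J * ?N"
      unfolding 1 Lp_norm_top by (intro esssup_I norm_measurable growing_fconv_lp_conv f AE_I2) auto
  qed
next
  case (2 P)
  define r where "r = min 1 P"
  have r: "0 < r" using 2 by (simp add: r_def)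
  obtain I where I: "0 < I" "\<And>k. (\<integral>\<^sup>+x. ennreal (cmod (\<phi> k x) powr 1) \<partial>lborel) \<le> ennreal (((2 ^ k) ^ DIM('a)) powr (1 - 1) * I)"
    using lp_powr_integral[of 1] by auto
  obtain J where J: "0 < J" "\<And>k. (\<integral>\<^sup>+x. ennreal (cmod (\<phi> k x) powr r) \<partial>lborel) \<le> ennreal (((2 ^ k) ^ DIM('a)) powr (r - 1) * J)"
    using lp_powr_integral[OF r] by metis
  show ?thesis
  proof (rule lp_kernel_power[OF lp 2(1)])
    fix s0 :: real
    assume s0: "1 \<le> s0"
      "\<And>f b R j m x A. f \<in> tempered \<Longrightarrow> bandlimited R b \<Longrightarrow> R + 2 * 2 ^ j \<le> 2 ^ m \<Longrightarrow> 0 < A \<Longrightarrow>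
      (\<integral>\<^sup>+t. ennreal (cmod (b t)) \<partial>lborel) \<le> ennreal A \<Longrightarrow>
      ennreal (cmod (fconv b (conv (\<phi> j) f) x) powr P) \<le> ennreal (power_const P A ((2 ^ m) ^ DIM('a) * s0)) *
        (\<integral>\<^sup>+t. ennreal (cmod (b (x - t)) powr min 1 P) * ennreal (cmod (conv (\<phi> j) f t) powr P) \<partial>lborel)"
    \<comment> \<open>One summand for each branch of \<open>power_const\<close>; the 16 comes from
      \<open>2 ^ (j + 3) \<le> 2 ^ (k + 4)\<close>.\<close>
    define Q where "Q = I powr (P - 1) * J + (16 ^ DIM('a) * s0) powr (1 - P) * J"
    have Q: "0 < Q" using I J s0(1) by (simp add: Q_def add_pos_pos)
    show ?thesis
    proof (rule that[of "Q powr (1 / P)"])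
      show "0 < Q powr (1 / P)" using Q by simp
      fix f :: "('a \<Rightarrow> complex) \<Rightarrow> complex" and j k :: nat assume f: "f \<in> tempered" and jk: "j \<le> k + 1" "k \<le> j + 1"
      let ?g = "conv (\<phi> j) f"
      have [measurable]: "?g \<in> borel_measurable borel" "\<phi> k \<in> borel_measurable borel"
        using growing_measurable[OF growing_lp_conv[OF f]] rapid_measurable[OF lp_rapid[OF lp]] by auto
      have m: "2 * 2 ^ k + 2 * 2 ^ j \<le> (2::real) ^ (j + 3)"
      proof -
        have "(2::real) ^ k \<le> 2 ^ (j + 1)" by (rule power_increasing[OF jk(2)]) simp
        moreover have "(2::real) ^ (j + 1) = 2 * 2 ^ j" "(2::real) ^ (j + 3) = 8 * 2 ^ j" by (simp_all add: power_add)
        moreover have "0 \<le> (2::real) ^ j" by simp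
        ultimately show ?thesis by linarith
      qed
      let ?A = "power_const P I ((2 ^ (j + 3)) ^ DIM('a) * s0)"
      have key: "ennreal ?A * (\<integral>\<^sup>+x. ennreal (cmod (\<phi> k x) powr r) \<partial>lborel) \<le> ennreal Q"
      proof -
        have A0: "0 \<le> ?A" by (simp add: power_const_def)
        have "ennreal ?A * (\<integral>\<^sup>+x. ennreal (cmod (\<phi> k x) powr r) \<partial>lborel) \<le> ennreal ?A * ennreal (((2 ^ k) ^ DIM('a)) powr (r - 1) * J)"
          by (intro mult_left_mono J) simp
        also have "\<dots> = ennreal (?A * (((2 ^ k) ^ DIM('a)) powr (r - 1) * J))" using A0 J(1) by (subst ennreal_mult) auto
        also have "\<dots> \<le> ennreal Q"
        proof (rule ennreal_leI, cases "1 \<le> P")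
          case True
          then show "?A * (((2 ^ k) ^ DIM('a)) powr (r - 1) * J) \<le> Q"
            using J(1) s0(1) by (simp add: power_const_def r_def Q_def)
        next
          case False
          let ?K = "((2::real) ^ k) ^ DIM('a)" and ?S = "(2 ^ (j + 3)) ^ DIM('a) * s0"
          have K: "0 < ?K" by simp
          have "(2::real) ^ (j + 3) \<le> 2 ^ (k + 4)" by (rule power_increasing) (use jk in auto)
          then have "((2::real) ^ (j + 3)) ^ DIM('a) \<le> (2 ^ (k + 4)) ^ DIM('a)" by (rule power_mono) simp
          also have "\<dots> = 16 ^ DIM('a) * ?K" by (simp add: power_add power_mult_distrib)
          finally have "?S \<le> 16 ^ DIM('a) * ?K * s0" using s0(1) by (intro mult_right_mono) auto
          then have "?S \<le> (16 ^ DIM('a) * s0) * ?K" by (simp only: mult_ac)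
          then have "?S powr (1 - P) \<le> ((16 ^ DIM('a) * s0) * ?K) powr (1 - P)"
            using False s0(1) by (intro powr_mono2) auto
          also have "\<dots> = (16 ^ DIM('a) * s0) powr (1 - P) * ?K powr (1 - P)" using s0(1) K by (subst powr_mult) auto
          finally have "?S powr (1 - P) * ?K powr (P - 1) \<le> (16 ^ DIM('a) * s0) powr (1 - P) * ?K powr (1 - P) * ?K powr (P - 1)"
            by (rule mult_right_mono) simp
          also have "\<dots> = (16 ^ DIM('a) * s0) powr (1 - P)" using K by (simp add: mult.assoc powr_add[symmetric])
          finally have "?S powr (1 - P) * ?K powr (P - 1) * J \<le> (16 ^ DIM('a) * s0) powr (1 - P) * J"
            using J(1) by (intro mult_right_mono) auto
          also have "\<dots> \<le> Q" using J(1) by (simp add: Q_def)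
          finally show "?A * (?K powr (r - 1) * J) \<le> Q" using False by (simp add: power_const_def r_def mult.assoc)
        qed
        finally show ?thesis .
      qed
      have "(\<integral>\<^sup>+x. ennreal (cmod (fconv (\<phi> k) ?g x) powr P) \<partial>lborel) \<le>
         (\<integral>\<^sup>+x. ennreal ?A * (\<integral>\<^sup>+t. ennreal (cmod (\<phi> k (x - t)) powr r) * ennreal (cmod (?g t) powr P) \<partial>lborel) \<partial>lborel)"
        unfolding r_def by (intro nn_integral_mono s0(2)[OF f lp_bandlimited[OF lp] m I(1)]) (use I(2)[of k] in simp)
      also have "\<dots> = ennreal ?A * (\<integral>\<^sup>+x. \<integral>\<^sup>+t. ennreal (cmod (\<phi> k (x - t)) powr r) * ennreal (cmod (?g t) powr P) \<partial>lborel \<partial>lborel)"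
        by (rule nn_integral_cmult) measurable
      also have "\<dots> = ennreal ?A * ((\<integral>\<^sup>+x. ennreal (cmod (\<phi> k x) powr r) \<partial>lborel) * (\<integral>\<^sup>+t. ennreal (cmod (?g t) powr P) \<partial>lborel))"
        by (subst nn_integral_convolution[of "\<lambda>x. ennreal (cmod (\<phi> k x) powr r)" "\<lambda>t. ennreal (cmod (?g t) powr P)"]) simp_all
      also have "\<dots> = ennreal ?A * (\<integral>\<^sup>+x. ennreal (cmod (\<phi> k x) powr r) \<partial>lborel) * (\<integral>\<^sup>+t. ennreal (cmod (?g t) powr P) \<partial>lborel)"
        by (simp only: mult.assoc)
      also have "\<dots> \<le> ennreal Q * (\<integral>\<^sup>+t. ennreal (cmod (?g t) powr P) \<partial>lborel)"
        by (rule mult_right_mono[OF key]) simp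
      finally have "ennreal_powr (\<integral>\<^sup>+x. ennreal (cmod (fconv (\<phi> k) ?g x) powr P) \<partial>lborel) (1 / P) \<le>
        ennreal_powr (ennreal Q * (\<integral>\<^sup>+t. ennreal (cmod (?g t) powr P) \<partial>lborel)) (1 / P)"
        using 2(1) by (intro ennreal_powr_mono) auto
      also have "\<dots> = ennreal (Q powr (1 / P)) * ennreal_powr (\<integral>\<^sup>+t. ennreal (cmod (?g t) powr P) \<partial>lborel) (1 / P)"
        using 2(1) Q by (simp add: ennreal_powr_mult ennreal_powr_ennreal)
      finally show "Lp_norm p lborel (\<lambda>x. ennreal (cmod (fconv (\<phi> k) ?g x))) \<le>
        ennreal (Q powr (1 / P)) * Lp_norm p lborel (\<lambda>x. ennreal (cmod (?g x)))"
        unfolding 2(2) Lp_norm_ennreal[OF 2(1)] by (simp add: ennreal_powr_ennreal)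
    qed
  qed
qed

text \<open>Only the terms \<open>j = k - 1, k, k + 1\<close> of \<open>T f\<close> are seen by \<open>\<phi> k\<close>; the guard removes indices below \<open>1\<close>.\<close>

lemma conv_T:
  assumes f: "f \<in> tempered" and u: "T_sums \<phi> y f u"
  shows "conv (\<phi> k) u x = (\<Sum>i<3. if 2 \<le> k + i then fconv (\<phi> k) (conv (\<phi> (k + i - 1)) f) (x - y (k + i - 1)) else 0)"
proof -
  define a where "a = (\<lambda>j. fconv (\<phi> k) (conv (\<phi> j) f) (x - y j))"
  \<comment> \<open>The kernel \<open>\<phi> k\<close> reflected about \<open>x\<close> is an
    admissible test function, so convergence of the series as distributions gives pointwise
    convergence after convolution with \<open>\<phi> k\<close>.\<close>
  have t: "distribution_of (translate (y j) (conv (\<phi> j) f)) (\<lambda>t. \<phi> k (x - t)) = a j" for j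
  proof -
    have "distribution_of (translate (y j) (conv (\<phi> j) f)) (\<lambda>t. \<phi> k (x - t)) = conv (\<phi> k) (distribution_of (translate (y j) (conv (\<phi> j) f))) x"
      by (simp add: conv_def)
    also have "\<dots> = fconv (\<phi> k) (translate (y j) (conv (\<phi> j) f)) x" by (rule conv_distribution_of[OF lp_schwartz[OF lp]])
    also have "\<dots> = a j" unfolding a_def translate_eq
      using fconv_shift_right[of "\<phi> k" "conv (\<phi> j) f" "- y j" x] by simp
    finally show ?thesis .
  qed
  have a0: "a j = 0" if "j + 2 \<le> k \<or> k + 2 \<le> j" for j
    unfolding a_def by (rule fconv_lp_conv_disjoint[OF lp f that])
  have "(\<lambda>N. \<Sum>j=1..N. a j) \<longlonglongrightarrow> conv (\<phi> k) u x"
    using u unfolding T_sums_iff[OF lp_schwartz[OF lp] f] conv_def t[symmetric] by blast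
  moreover have "(\<lambda>N. \<Sum>j=1..N. a j) \<longlonglongrightarrow> (\<Sum>j=1..k+1. a j)"
  proof (rule tendsto_eventually, unfold eventually_sequentially, intro exI allI impI)
    fix N assume "k + 1 \<le> N"
    then show "(\<Sum>j=1..N. a j) = (\<Sum>j=1..k+1. a j)"
      by (intro sum.mono_neutral_right) (auto intro: a0)
  qed
  ultimately have "conv (\<phi> k) u x = (\<Sum>j=1..k+1. a j)" by (rule LIMSEQ_unique)
  also have "\<dots> = (\<Sum>i<3. if 2 \<le> k + i then a (k + i - 1) else 0)"
  proof -
    have "(\<Sum>i<3. if 2 \<le> k + i then a (k + i - 1) else 0) = (\<Sum>i\<in>{i. i < 3 \<and> 2 \<le> k + i}. a (k + i - 1))"
      by (subst sum.inter_filter[symmetric]) (auto intro!: sum.cong)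
    also have "\<dots> = (\<Sum>j\<in>{j. 1 \<le> j \<and> j \<le> k + 1 \<and> k \<le> j + 1}. a j)"
      by (rule sum.reindex_bij_witness[of _ "\<lambda>j. j + 1 - k" "\<lambda>i. k + i - 1"]) auto
    also have "\<dots> = (\<Sum>j=1..k+1. a j)"
      by (rule sum.mono_neutral_left) (auto intro: a0)
    finally show ?thesis by simp
  qed
  finally show ?thesis unfolding a_def .
qed

lemma Lp_norm_zero: "0 < p \<Longrightarrow> Lp_norm p M (\<lambda>x. 0) = 0"
  using Lp_norm_cmult[of p "\<lambda>x. 0" M 0] by simp

text \<open>In each of the three surviving terms the translation disappears from the norm,
  \<open>Lp_norm_fconv_lp\<close> removes \<open>\<phi> k\<close>, and replacing the weight at
  \<open>k\<close> by that at the neighbouring index costs \<open>2 powr \<bar>s\<bar>\<close>. What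
  remains are shifts of the sequence defining the norm of \<open>f\<close>.\<close>

lemma besov_T_bound:
  assumes p: "0 < p" and q: "0 < q"
  obtains C :: real where "\<And>f u. f \<in> tempered \<Longrightarrow> T_sums \<phi> y f u \<Longrightarrow> besov_norm \<phi> s p q u \<le> ennreal C * besov_norm \<phi> s p q f"
proof -
  obtain C where C: "0 < C" "\<And>f j k. f \<in> tempered \<Longrightarrow> j \<le> k + 1 \<Longrightarrow> k \<le> j + 1 \<Longrightarrow>
    Lp_norm p lborel (\<lambda>x. ennreal (cmod (fconv (\<phi> k) (conv (\<phi> j) f) x))) \<le>
      ennreal C * Lp_norm p lborel (\<lambda>x. ennreal (cmod (conv (\<phi> j) f x)))"
    using Lp_norm_fconv_lp[OF p] by metis
  obtain K where K: "0 < K" "\<And>(M :: 'a measure) (f :: 'a \<Rightarrow> ennreal) g. f \<in> borel_measurable M \<Longrightarrow> g \<in> borel_measurable M \<Longrightarrow>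
    Lp_norm p M (\<lambda>x. f x + g x) \<le> ennreal K * (Lp_norm p M f + Lp_norm p M g)"
    using Lp_norm_add[OF p] by metis
  obtain L where L: "0 < L" "\<And>(M :: nat measure) (f :: nat \<Rightarrow> ennreal) g. f \<in> borel_measurable M \<Longrightarrow> g \<in> borel_measurable M \<Longrightarrow>
    Lp_norm q M (\<lambda>x. f x + g x) \<le> ennreal L * (Lp_norm q M f + Lp_norm q M g)"
    using Lp_norm_add[OF q] by metis
  have K3: "Lp_norm p lborel (\<lambda>x. f x + g x + h x) \<le> ennreal K * (ennreal K * (Lp_norm p lborel f + Lp_norm p lborel g) + Lp_norm p lborel h)"
    if [measurable]: "f \<in> borel_measurable lborel" "g \<in> borel_measurable lborel" "h \<in> borel_measurable lborel" for f g h :: "'a \<Rightarrow> ennreal"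
    by (rule order_trans[OF K(2)]) (measurable, intro mult_left_mono add_right_mono K(2), auto)
  have L3: "Lp_norm q (count_space UNIV) (\<lambda>x. f x + g x + h x) \<le> ennreal L * (ennreal L * (Lp_norm q (count_space UNIV) f + Lp_norm q (count_space UNIV) g) + Lp_norm q (count_space UNIV) h)"
    for f g h :: "nat \<Rightarrow> ennreal"
    by (rule order_trans[OF L(2)]) (simp_all, intro mult_left_mono add_right_mono L(2), auto)
  \<comment> \<open>The nesting in \<open>K\<close> is the quasi-triangle inequality applied twice
    to three summands; \<open>D'\<close> repeats the pattern in the sequence space with
    \<open>L\<close>.\<close>
  define D where "D = 2 powr \<bar>s\<bar> * ((K * (K + K) + K) * C)"
  have D: "0 < D" using K(1) C(1) by (simp add: D_def add_pos_pos)
  define D' where "D' = D * (L * (L + L) + L)"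
  show ?thesis
  proof (rule that[of D'])
    fix f u assume f: "f \<in> tempered" and u: "T_sums \<phi> y f u"
    define N where "N = (\<lambda>j. Lp_norm p lborel (\<lambda>x. ennreal (cmod (conv (\<phi> j) f x))))"
    define B where "B = (\<lambda>j. ennreal (2 powr (real j * s)) * N j)"
    \<comment> \<open>The weighted block norms shifted by \<open>i - 1\<close>, with the
      contributions from blocks of index below 1 set to 0 because the series defining
      \<open>T\<close> starts at 1.\<close>
    define b where "b = (\<lambda>i k. if 2 \<le> k + i then B (k + i - 1) else 0)"
    define E where "E = (\<lambda>k i x. ennreal (cmod (if 2 \<le> k + i then fconv (\<phi> k) (conv (\<phi> (k + i - 1)) f) (x - y (k + i - 1)) else 0)))"
    have Em: "E k i \<in> borel_measurable lborel" for k i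
    proof (cases "2 \<le> k + i")
      case True
      then show ?thesis
        using norm_measurable[OF growing_shift[OF growing_fconv_lp_conv[OF f, of k "k + i - 1"], where a="- y (k + i - 1)"]]
        by (simp add: E_def)
    qed (simp add: E_def)
    have EN: "ennreal (2 powr (real k * s)) * Lp_norm p lborel (E k i) \<le> ennreal (2 powr \<bar>s\<bar> * C) * b i k" if i: "i < 3" for k i
    proof (cases "2 \<le> k + i")
      case True
      define j where "j = k + i - 1"
      have jk: "j \<le> k + 1" "k \<le> j + 1" using i True by (auto simp: j_def)
      have m: "(\<lambda>x. ennreal (cmod (fconv (\<phi> k) (conv (\<phi> j) f) x))) \<in> borel_measurable borel"
        using norm_measurable[OF growing_fconv_lp_conv[OF f]] by simp
      have "Lp_norm p lborel (E k i) \<le> Lp_norm p lborel (\<lambda>x. ennreal (cmod (fconv (\<phi> k) (conv (\<phi> j) f) x)))"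
        using Lp_norm_shift[OF p m, of "- y j"] True by (simp add: E_def j_def)
      also have "\<dots> \<le> ennreal C * N j" unfolding N_def by (rule C(2)[OF f jk])
      finally have "ennreal (2 powr (real k * s)) * Lp_norm p lborel (E k i) \<le> ennreal (2 powr (real k * s)) * (ennreal C * N j)"
        by (rule mult_left_mono) simp
      also have "\<dots> \<le> ennreal (2 powr \<bar>s\<bar> * 2 powr (real j * s)) * (ennreal C * N j)"
      proof (intro mult_right_mono ennreal_leI)
        have "\<bar>real k - real j\<bar> * \<bar>s\<bar> \<le> 1 * \<bar>s\<bar>" using jk by (intro mult_right_mono) auto
        then have "(real k - real j) * s \<le> \<bar>s\<bar>" using abs_ge_self[of "(real k - real j) * s"] by (simp add: abs_mult)
        then have "real k * s \<le> \<bar>s\<bar> + real j * s" by (simp add: algebra_simps)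
        then show "2 powr (real k * s) \<le> 2 powr \<bar>s\<bar> * 2 powr (real j * s)" by (simp add: powr_add[symmetric])
      qed simp
      also have "\<dots> = ennreal (2 powr \<bar>s\<bar> * C) * b i k"
        using True C(1) by (simp add: b_def B_def j_def ennreal_mult mult_ac)
      finally show ?thesis .
    next
      case False
      then show ?thesis by (simp add: E_def Lp_norm_zero[OF p])
    qed
    have main: "ennreal (2 powr (real k * s)) * Lp_norm p lborel (\<lambda>x. ennreal (cmod (conv (\<phi> k) u x))) \<le> ennreal D * (b 0 k + b 1 k + b 2 k)" for k
    proof -
      let ?w = "ennreal (2 powr (real k * s))" and ?c = "ennreal (2 powr \<bar>s\<bar> * C)" and ?n = "\<lambda>i. Lp_norm p lborel (E k i)"
      have "Lp_norm p lborel (\<lambda>x. ennreal (cmod (conv (\<phi> k) u x))) \<le> Lp_norm p lborel (\<lambda>x. E k 0 x + E k 1 x + E k 2 x)"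
      proof (rule Lp_norm_mono[OF p])
        have "u \<in> tempered" using u by (simp add: T_sums_iff[OF lp_schwartz[OF lp] f])
        then show "(\<lambda>x. ennreal (cmod (conv (\<phi> k) u x))) \<in> borel_measurable lborel"
          by (intro norm_measurable growing_lp_conv)
        fix x
        let ?e = "\<lambda>i. if 2 \<le> k + i then fconv (\<phi> k) (conv (\<phi> (k + i - 1)) f) (x - y (k + i - 1)) else 0"
        have "conv (\<phi> k) u x = ?e 0 + ?e 1 + ?e 2"
          unfolding conv_T[OF f u] by (simp add: numeral_3_eq_3 numeral_2_eq_2)
        then have "cmod (conv (\<phi> k) u x) \<le> cmod (?e 0) + cmod (?e 1) + cmod (?e 2)"
          by (simp only:) (intro order_trans[OF norm_triangle_ineq] add_mono norm_triangle_ineq order_refl)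
        then have "ennreal (cmod (conv (\<phi> k) u x)) \<le> ennreal (cmod (?e 0) + cmod (?e 1) + cmod (?e 2))" by (rule ennreal_leI)
        also have "\<dots> = E k 0 x + E k 1 x + E k 2 x"
          unfolding E_def by (subst ennreal_plus, simp, simp, subst ennreal_plus) auto
        finally show "ennreal (cmod (conv (\<phi> k) u x)) \<le> E k 0 x + E k 1 x + E k 2 x" .
      qed
      also have "\<dots> \<le> ennreal K * (ennreal K * (?n 0 + ?n 1) + ?n 2)" by (rule K3[OF Em Em Em])
      finally have "?w * Lp_norm p lborel (\<lambda>x. ennreal (cmod (conv (\<phi> k) u x))) \<le> ?w * (ennreal K * (ennreal K * (?n 0 + ?n 1) + ?n 2))"
        by (rule mult_left_mono) simp
      also have "\<dots> = ennreal K * (ennreal K * (?w * ?n 0 + ?w * ?n 1) + ?w * ?n 2)"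
        by (simp add: distrib_left mult_ac)
      also have "\<dots> \<le> ennreal K * (ennreal K * (?c * b 0 k + ?c * b 1 k) + ?c * b 2 k)"
        by (intro mult_left_mono add_mono EN) auto
      also have "\<dots> \<le> ennreal K * (ennreal K * (?c * (b 0 k + b 1 k + b 2 k) + ?c * (b 0 k + b 1 k + b 2 k)) + ?c * (b 0 k + b 1 k + b 2 k))"
        by (intro mult_left_mono add_mono) (auto simp: add_increasing add_increasing2)
      also have "\<dots> = ennreal D * (b 0 k + b 1 k + b 2 k)"
      proof -
        define z where "z = b 0 k + b 1 k + b 2 k"
        have "ennreal D = ennreal K * (ennreal K * (?c + ?c) + ?c)"
          using K(1) C(1) unfolding D_def
          by (simp add: ennreal_mult[symmetric] ennreal_plus[symmetric] algebra_simps del: ennreal_plus)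
        then show ?thesis unfolding z_def[symmetric] by (simp add: distrib_left distrib_right mult_ac)
      qed
      finally show ?thesis .
    qed
    \<comment> \<open>For \<open>i = 0\<close> the sequence is shifted up and padded by zeros, for
      \<open>i = 2\<close> shifted down; neither increases the norm. For \<open>i = 1\<close> only
      the entry at 0 is removed.\<close>
    have bB: "Lp_norm q (count_space UNIV) (b i) \<le> Lp_norm q (count_space UNIV) B" if "i < 3" for i
    proof -
      consider "i = 0" | "i = 1" | "i = 2" using \<open>i < 3\<close> by linarith
      then show ?thesis
      proof cases
        case 1
        define b' where "b' = (\<lambda>k. if k = 0 then 0 else B (k - 1))"
        have "Lp_norm q (count_space UNIV) (b i) \<le> Lp_norm q (count_space UNIV) b'"
          by (rule Lp_norm_mono[OF q]) (auto simp: 1 b_def b'_def)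
        also have "\<dots> = Lp_norm q (count_space UNIV) B"
          by (rule Lp_norm_count_inj[OF q, of Suc]) (auto simp: b'_def image_iff gr0_conv_Suc)
        finally show ?thesis .
      next
        case 2
        then show ?thesis by (intro Lp_norm_mono[OF q]) (auto simp: b_def)
      next
        case 3
        define b' where "b' = (\<lambda>k. if k = 0 then 0 else B k)"
        have "Lp_norm q (count_space UNIV) (b i) = Lp_norm q (count_space UNIV) b'"
          by (rule Lp_norm_count_inj[OF q, of Suc, symmetric]) (auto simp: 3 b_def b'_def image_iff gr0_conv_Suc)
        also have "\<dots> \<le> Lp_norm q (count_space UNIV) B"
          by (rule Lp_norm_mono[OF q]) (auto simp: b'_def)
        finally show ?thesis .
      qed
    qed
    let ?c = "count_space (UNIV :: nat set)"
    have "besov_norm \<phi> s p q u \<le> Lp_norm q ?c (\<lambda>k. ennreal D * (b 0 k + b 1 k + b 2 k))"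
      unfolding besov_norm_def by (rule Lp_norm_mono[OF q _ main]) simp
    also have "\<dots> \<le> ennreal D * Lp_norm q ?c (\<lambda>k. b 0 k + b 1 k + b 2 k)"
      by (rule Lp_norm_cmult[OF q]) simp
    also have "\<dots> \<le> ennreal D * (ennreal L * (ennreal L * (Lp_norm q ?c (b 0) + Lp_norm q ?c (b 1)) + Lp_norm q ?c (b 2)))"
      by (intro mult_left_mono L3) simp
    also have "\<dots> \<le> ennreal D * (ennreal L * (ennreal L * (Lp_norm q ?c B + Lp_norm q ?c B) + Lp_norm q ?c B))"
      by (intro mult_left_mono add_mono bB) auto
    also have "\<dots> = ennreal D' * Lp_norm q ?c B"
    proof -
      have "ennreal D' = ennreal D * (ennreal L * (ennreal L + ennreal L) + ennreal L)"
        using D L(1) unfolding D'_def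
        by (simp add: ennreal_mult[symmetric] ennreal_plus[symmetric] del: ennreal_plus)
      then show ?thesis by (simp add: distrib_left distrib_right mult_ac)
    qed
    finally show "besov_norm \<phi> s p q u \<le> ennreal D' * besov_norm \<phi> s p q f"
      unfolding besov_norm_def B_def N_def .
  qed
qed

text \<open>A single entry is bounded by the sequence norm, which gives block bounds with the factor
  \<open>2 powr (- (real j * s))\<close>.\<close>

lemma besov_T_converges:
  assumes p: "0 < p" and q: "0 < q" and f: "f \<in> besov \<phi> s p q"
  obtains u where "T_sums \<phi> y f u"
proof -
  have ft: "f \<in> tempered" and fin: "besov_norm \<phi> s p q f < \<infinity>" using f by (auto simp: besov_def)
  define Y where "Y = enn2real (besov_norm \<phi> s p q f)"
  have Y: "besov_norm \<phi> s p q f = ennreal Y" "0 \<le> Y" using fin by (auto simp: Y_def less_top)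
  have "Lp_norm p lborel (\<lambda>x. ennreal (cmod (conv (\<phi> j) f x))) \<le> ennreal (Y * (2 powr (real j * (- s))))" for j
  proof -
    let ?N = "Lp_norm p lborel (\<lambda>x. ennreal (cmod (conv (\<phi> j) f x)))"
    have "ennreal (2 powr (real j * s)) * ?N \<le> ennreal Y"
      using Lp_norm_count_le[OF q UNIV_I, of "\<lambda>j. ennreal (2 powr (real j * s)) * Lp_norm p lborel (\<lambda>x. ennreal (cmod (conv (\<phi> j) f x)))" j]
      by (simp add: besov_norm_def Y(1)[symmetric])
    then have "ennreal (2 powr (real j * (- s))) * (ennreal (2 powr (real j * s)) * ?N) \<le> ennreal (2 powr (real j * (- s))) * ennreal Y"
      by (rule mult_left_mono) simp
    moreover have "ennreal (2 powr (real j * (- s))) * (ennreal (2 powr (real j * s)) * ?N) = ?N"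
      unfolding mult.assoc[symmetric] by (simp add: ennreal_mult[symmetric] powr_add[symmetric])
    ultimately show ?thesis using Y(2) by (simp add: ennreal_mult[symmetric] mult.commute)
  qed
  from T_converges_Lp[OF lp ft p Y(2) this] that show ?thesis by metis
qed

end

section \<open>Triebel-Lizorkin spaces\<close>

lemma triebel_norm_top:
  "triebel_norm \<phi> s top q (f :: ('a::euclidean_space \<Rightarrow> complex) \<Rightarrow> complex) = (SUP (x, J::int)\<in>UNIV.
     ennreal (2 powr (of_int J * real DIM('a) * enn2real (1 / q))) *
     Lp_norm q (restrict_space lborel (ball x (2 powr (- of_int J))))
       (\<lambda>z. Lp_norm q (count_space {nat (max J 0)..}) (\<lambda>j. ennreal (2 powr (real j * s) * cmod (conv (\<phi> j) f z)))))"
  unfolding triebel_norm_def infinity_ennreal_def by (rule if_P) (rule refl)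

lemma triebel_norm_ennreal:
  "triebel_norm \<phi> s (ennreal P) q f = Lp_norm (ennreal P) lborel
     (\<lambda>x. Lp_norm q (count_space UNIV) (\<lambda>j. ennreal (2 powr (real j * s) * cmod (conv (\<phi> j) f x))))"
  by (simp add: triebel_norm_def)

lemma Lp_norm_mono_finite:
  assumes "0 < P" "\<And>x. x \<in> space M \<Longrightarrow> f x \<le> g x"
  shows "Lp_norm (ennreal P) M f \<le> Lp_norm (ennreal P) M g"
  unfolding Lp_norm_ennreal[OF assms(1)]
  by (intro ennreal_powr_mono nn_integral_mono assms) (use assms(1) in auto)

lemma Lp_norm_finite_powr:
  assumes "0 < P" shows "ennreal_powr (Lp_norm (ennreal P) M f) P = (\<integral>\<^sup>+x. ennreal_powr (f x) P \<partial>M)"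
  unfolding Lp_norm_ennreal[OF assms] by (rule ennreal_powr_inverse'[OF assms])

lemma Lp_norm_eq_top_iff:
  assumes "0 < P" shows "Lp_norm (ennreal P) M f = top \<longleftrightarrow> (\<integral>\<^sup>+x. ennreal_powr (f x) P \<partial>M) = top"
  unfolding Lp_norm_ennreal[OF assms] by (rule ennreal_powr_eq_top)

context
  fixes \<phi> :: "nat \<Rightarrow> 'a::euclidean_space \<Rightarrow> complex"
  assumes lp: "littlewood_paley \<phi>"
begin

text \<open>For finite \<open>p\<close> each block is dominated pointwise by the inner sequence
  norm. For infinite \<open>p\<close> the assumption \<open>p \<noteq> q\<close> makes
  \<open>q\<close> finite, and the norm at scale \<open>J = 0\<close> contains exactly the local
  bounds with exponent \<open>q\<close> on unit balls.\<close>

lemma triebel_T_converges: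
  assumes p: "0 < p" and q: "0 < q" and pq: "p \<noteq> q" and f: "f \<in> triebel \<phi> s p q"
  obtains u where "T_sums \<phi> y f u"
proof -
  have ft: "f \<in> tempered" and fin: "triebel_norm \<phi> s p q f < \<infinity>" using f by (auto simp: triebel_def)
  define Y where "Y = enn2real (triebel_norm \<phi> s p q f)"
  have Y: "triebel_norm \<phi> s p q f = ennreal Y" "0 \<le> Y" using fin by (auto simp: Y_def less_top)
  note gm = growing_measurable[OF growing_lp_conv[OF lp ft]]
  have inner: "ennreal (2 powr (real j * s)) * ennreal (cmod (conv (\<phi> j) f x)) \<le>
      Lp_norm q (count_space A) (\<lambda>j. ennreal (2 powr (real j * s) * cmod (conv (\<phi> j) f x)))" if "j \<in> A" for j x A
    using Lp_norm_count_le[OF q that, of "\<lambda>j. ennreal (2 powr (real j * s) * cmod (conv (\<phi> j) f x))"]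
    by (simp add: ennreal_mult)
  show ?thesis
    using p
  proof (cases rule: exponent_cases)
    case (2 P)
    have "Lp_norm p lborel (\<lambda>x. ennreal (cmod (conv (\<phi> j) f x))) \<le> ennreal (Y * (2 powr (real j * (- s))))" for j
    proof -
      let ?g = "\<lambda>x. ennreal (cmod (conv (\<phi> j) f x))"
      have m: "?g \<in> borel_measurable lborel" using gm by measurable
      have m2: "(\<lambda>x. ennreal (2 powr (real j * s)) * ?g x) \<in> borel_measurable lborel" using gm by measurable
      have "Lp_norm p lborel ?g = Lp_norm p lborel (\<lambda>x. ennreal (2 powr (real j * (- s))) * (ennreal (2 powr (real j * s)) * ?g x))"
        unfolding mult.assoc[symmetric] by (simp add: ennreal_mult[symmetric] powr_add[symmetric])
      also have "\<dots> \<le> ennreal (2 powr (real j * (- s))) * Lp_norm p lborel (\<lambda>x. ennreal (2 powr (real j * s)) * ?g x)"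
        by (rule Lp_norm_cmult[OF p m2])
      also have "\<dots> \<le> ennreal (2 powr (real j * (- s))) * ennreal Y"
      proof (rule mult_left_mono)
        show "Lp_norm p lborel (\<lambda>x. ennreal (2 powr (real j * s)) * ?g x) \<le> ennreal Y"
          using Lp_norm_mono[OF p m2 inner[of j UNIV]] 2 by (simp add: triebel_norm_def Y(1)[symmetric])
      qed simp
      also have "\<dots> = ennreal (Y * (2 powr (real j * (- s))))" using Y(2) by (simp add: ennreal_mult[symmetric] mult.commute)
      finally show ?thesis .
    qed
    from T_converges_Lp[OF lp ft p Y(2) this] that show ?thesis by metis
  next
    case 1
    then have "q \<noteq> top" using pq by auto
    with q obtain Q where Q: "0 < Q" "q = ennreal Q" by (cases q) auto
    define m where "m = nat \<lceil>\<bar>s\<bar> * Q\<rceil>"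
    have "(\<integral>\<^sup>+t. ennreal (cmod (conv (\<phi> j) f t) powr Q) * indicator (ball z 1) t \<partial>lborel) \<le> ennreal (Y powr Q * (2 ^ j) ^ m)" for j z
    proof -
      let ?R = "restrict_space lborel (ball z 1)"
      let ?in = "\<lambda>t. Lp_norm q (count_space {0..}) (\<lambda>j. ennreal (2 powr (real j * s) * cmod (conv (\<phi> j) f t)))"
      have "Lp_norm q ?R ?in \<le> ennreal Y"
      proof -
        \<comment> \<open>At \<open>J = 0\<close> the balls have radius 1, the normalising factor is
          1 and all frequencies take part.\<close>
        have "ennreal (2 powr (of_int 0 * real DIM('a) * enn2real (1 / q))) * Lp_norm q (restrict_space lborel (ball z (2 powr (- of_int 0))))
             (\<lambda>z. Lp_norm q (count_space {nat (max 0 0)..}) (\<lambda>j. ennreal (2 powr (real j * s) * cmod (conv (\<phi> j) f z)))) \<le> triebel_norm \<phi> s p q f"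
          unfolding 1 triebel_norm_top by (rule SUP_upper2[of "(z, 0)"]; simp)
        then show ?thesis by (simp add: Y(1))
      qed
      then have "(\<integral>\<^sup>+t. ennreal_powr (?in t) Q \<partial>?R) \<le> ennreal_powr (ennreal Y) Q"
        unfolding Q(2) Lp_norm_finite_powr[OF Q(1), symmetric] using Q(1) by (intro ennreal_powr_mono) auto
      then have i: "(\<integral>\<^sup>+t. ennreal_powr (?in t) Q * indicator (ball z 1) t \<partial>lborel) \<le> ennreal (Y powr Q)"
        using Y(2) by (subst (asm) nn_integral_restrict_space) (auto simp: ennreal_powr_ennreal)
      let ?c = "2 powr (real j * (- s) * Q)"
      have "(\<integral>\<^sup>+t. ennreal (cmod (conv (\<phi> j) f t) powr Q) * indicator (ball z 1) t \<partial>lborel)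
        = (\<integral>\<^sup>+t. ennreal ?c * (ennreal ((2 powr (real j * s) * cmod (conv (\<phi> j) f t)) powr Q) * indicator (ball z 1) t) \<partial>lborel)"
      proof (rule nn_integral_cong)
        fix t
        have "ennreal ?c * ennreal ((2 powr (real j * s) * cmod (conv (\<phi> j) f t)) powr Q) = ennreal (cmod (conv (\<phi> j) f t) powr Q)"
          by (simp add: ennreal_mult[symmetric] powr_mult powr_powr mult.assoc[symmetric] powr_add[symmetric])
        then show "ennreal (cmod (conv (\<phi> j) f t) powr Q) * indicator (ball z 1) t =
          ennreal ?c * (ennreal ((2 powr (real j * s) * cmod (conv (\<phi> j) f t)) powr Q) * indicator (ball z 1) t)"
          by (simp only: mult.assoc[symmetric])
      qed
      also have "\<dots> = ennreal ?c * (\<integral>\<^sup>+t. ennreal ((2 powr (real j * s) * cmod (conv (\<phi> j) f t)) powr Q) * indicator (ball z 1) t \<partial>lborel)"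
      proof (rule nn_integral_cmult)
        have "(\<lambda>t. cmod (conv (\<phi> j) f t)) \<in> borel_measurable lborel" using gm[of j] by measurable
        then show "(\<lambda>t. ennreal ((2 powr (real j * s) * cmod (conv (\<phi> j) f t)) powr Q) * indicator (ball z 1) t) \<in> borel_measurable lborel"
          by measurable simp
      qed
      also have "\<dots> \<le> ennreal ?c * (\<integral>\<^sup>+t. ennreal_powr (?in t) Q * indicator (ball z 1) t \<partial>lborel)"
      proof (intro mult_left_mono nn_integral_mono mult_right_mono)
        fix t
        have "ennreal ((2 powr (real j * s) * cmod (conv (\<phi> j) f t)) powr Q) = ennreal_powr (ennreal (2 powr (real j * s)) * ennreal (cmod (conv (\<phi> j) f t))) Q"
          by (simp add: ennreal_mult[symmetric] ennreal_powr_ennreal)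
        also have "\<dots> \<le> ennreal_powr (?in t) Q" using Q(1) by (intro ennreal_powr_mono inner) auto
        finally show "ennreal ((2 powr (real j * s) * cmod (conv (\<phi> j) f t)) powr Q) \<le> ennreal_powr (?in t) Q" .
      qed auto
      also have "\<dots> \<le> ennreal ?c * ennreal (Y powr Q)" by (intro mult_left_mono i) simp
      also have "\<dots> = ennreal (Y powr Q * ?c)" by (simp add: ennreal_mult[symmetric] mult.commute)
      also have "\<dots> \<le> ennreal (Y powr Q * (2 ^ j) ^ m)"
      proof (intro ennreal_leI mult_left_mono)
        have "- s * Q \<le> \<bar>s\<bar> * Q" using Q(1) by (intro mult_right_mono) auto
        also have "\<dots> \<le> real m" unfolding m_def by linarith
        finally have "real j * (- s * Q) \<le> real j * real m" by (intro mult_left_mono) auto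
        then have "?c \<le> 2 powr (real (j * m))" by (intro powr_mono) (auto simp: mult.assoc)
        also have "\<dots> = (2 ^ j) ^ m" by (subst powr_realpow) (auto simp: power_mult)
        finally show "?c \<le> (2 ^ j) ^ m" .
      qed auto
      finally show ?thesis .
    qed
    from T_converges_local[OF lp ft Q(1) _ this] that show ?thesis by auto
  qed
qed

end

subsection \<open>Lacunary wave packets\<close>

text \<open>The borderline sequence: its powers of order \<open>r\<close> form the harmonic series,
  those of any higher order are summable. Since \<open>0 powr a = 0\<close>, the entry at 0
  vanishes, which agrees with \<open>1 / real 0 = 0\<close>.\<close>

definition coef :: "real \<Rightarrow> nat \<Rightarrow> real" where
  "coef r k = real k powr (- 1 / r)"

lemma coef_0 [simp]: "coef r 0 = 0"
  by (simp add: coef_def)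

lemma coef_nonneg [simp]: "0 \<le> coef r k"
  by (simp add: coef_def)

lemma coef_le_1: "0 < r \<Longrightarrow> coef r k \<le> 1"
proof (cases "k = 0")
  case False
  assume "0 < r"
  then have "real k powr (- 1 / r) \<le> real k powr 0" using False by (intro powr_mono) auto
  then show ?thesis using False by (simp add: coef_def)
qed simp

lemma coef_powr: "0 < r \<Longrightarrow> coef r k powr r = 1 / real k"
proof (cases "k = 0")
  case False
  assume "0 < r"
  then have "coef r k powr r = real k powr (- 1)" unfolding coef_def powr_powr by simp
  with False show ?thesis by (simp add: powr_minus_divide)
qed simp

lemma summable_coef: "0 < r \<Longrightarrow> r < t \<Longrightarrow> summable (\<lambda>k. coef r k powr t)"
proof -
  assume r: "0 < r" "r < t"
  have "coef r k powr t = real k powr (- t / r)" for k by (simp add: coef_def powr_powr)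
  moreover have "- t / r < - 1" using r by (simp add: divide_simps)
  ultimately show ?thesis by (simp add: summable_real_powr_iff)
qed

lemma not_summable_inverse: "\<not> summable (\<lambda>k. 1 / real k)"
  using not_summable_harmonic[where 'a=real] by (simp add: inverse_eq_divide)

lemma nn_integral_inverse: "(\<integral>\<^sup>+k. ennreal (1 / real k) \<partial>count_space UNIV) = top"
proof (rule ccontr)
  assume "\<not> ?thesis"
  then have "(\<Sum>k. ennreal (1 / real k)) \<noteq> top" by (simp add: nn_integral_count_space_nat)
  then have "summable (\<lambda>k. 1 / real k)" by (intro summable_suminf_not_top) auto
  with not_summable_inverse show False by simp
qed

lemma emeasure_ball_shift: 
  "emeasure lborel (ball (a::'a::euclidean_space) r) = ennreal (measure lborel (ball (0::'a) r))"
proof -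
  have "emeasure lborel (ball a r) = (\<integral>\<^sup>+t. indicator (ball a r) t \<partial>lborel)" by simp
  also have "\<dots> = (\<integral>\<^sup>+t. indicator (ball a r) (t + a) \<partial>lborel)"
    by (rule nn_integral_shift[symmetric]) (intro borel_measurable_indicator, simp)
  also have "\<dots> = (\<integral>\<^sup>+t. indicator (ball (0::'a) r) t \<partial>lborel)"
    by (intro nn_integral_cong) (auto simp: indicator_def dist_norm)
  also have "\<dots> = emeasure lborel (ball (0::'a) r)" by simp
  also have "\<dots> = ennreal (measure lborel (ball (0::'a) r))"
    using emeasure_lborel_ball_finite[of "0::'a" r] by (intro emeasure_eq_ennreal_measure) auto
  finally show ?thesis .
qed

lemma separated_balls:
  fixes y :: "nat \<Rightarrow> 'a::euclidean_space"
  assumes sep: "\<And>j k. 1 \<le> j \<Longrightarrow> 1 \<le> k \<Longrightarrow> j \<noteq> k \<Longrightarrow> d \<le> norm (y j - y k)" and \<rho>: "2 * \<rho> \<le> d"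
    and x: "x \<in> ball (y j) \<rho>" "x \<in> ball (y k) \<rho>" "1 \<le> j" "1 \<le> k"
  shows "j = k"
proof (rule ccontr)
  assume "j \<noteq> k"
  have "norm (y j - y k) \<le> dist (y j) x + dist (y k) x"
    using dist_triangle2[of "y j" "y k" x] by (simp add: dist_norm)
  then show False using sep[OF x(3,4) \<open>j \<noteq> k\<close>] \<rho> x(1,2) by simp
qed

context
  fixes \<phi> :: "nat \<Rightarrow> 'a::euclidean_space \<Rightarrow> complex" and e :: 'a and G :: "'a \<Rightarrow> complex"
  assumes lp: "littlewood_paley \<phi>" and carrier: "lp_carrier \<phi> e G"
begin

text \<open>The factor \<open>2 powr (- (real k * s))\<close> will cancel the weight in the norm.
  The blocks are bounded uniformly in \<open>x\<close> and in the positions \<open>z k\<close>, up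
  to a power of \<open>2 ^ k\<close>, so \<open>lp_series\<close> applies with weight order 0
  wherever the packets sit.\<close>

lemma wave_series:
  assumes r: "0 < r"
  obtains f where "f \<in> tempered"
    "\<And>k. conv (\<phi> k) f = (\<lambda>x. of_real (coef r k * 2 powr (- (real k * s))) * wave e G k (x + z k))"
proof -
  note rG = G_rapid[OF lp carrier]
  define c where "c = (\<lambda>k. complex_of_real (coef r k * 2 powr (- (real k * s))))"
  define g where "g = (\<lambda>j x. c j * wave e G j (x + z j))"
  obtain C where C: "0 < C" "\<And>x. (1 + norm x) ^ 0 * cmod (G x) \<le> C" using rapidE[OF rG] by metis
  define M where "M = nat \<lceil>\<bar>s\<bar>\<rceil>"
  have gr: "rapid (g j)" for j unfolding g_def by (rule wave_shift_rapid[OF lp carrier])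
  show ?thesis
  proof (rule lp_series[OF lp, of g C M 0])
    show "continuous_on UNIV (g j)" for j by (rule rapid_continuous[OF gr])
    show "fconv (lp_fat \<phi> j) (g j) = g j" if "1 \<le> j" for j
      unfolding g_def by (rule fconv_fat_wave[OF lp carrier that])
    show "cmod (g j x) \<le> C * (2 ^ j) ^ M * (1 + norm x) ^ 0" for j x
    proof -
      have "cmod (c j) = coef r j * 2 powr (- (real j * s))" unfolding c_def norm_of_real by (rule abs_of_nonneg) simp
      also have "\<dots> \<le> 1 * (2 ^ j) ^ M"
      proof (rule mult_mono[OF coef_le_1[OF r]])
        have "- s \<le> real M" unfolding M_def by linarith
        then have "real j * (- s) \<le> real j * real M" by (intro mult_left_mono) auto
        then have "2 powr (- (real j * s)) \<le> 2 powr (real (j * M))" by (intro powr_mono) auto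
        also have "\<dots> = (2 ^ j) ^ M" by (subst powr_realpow) (auto simp: power_mult)
        finally show "2 powr (- (real j * s)) \<le> (2 ^ j) ^ M" .
      qed auto
      finally have "cmod (c j) * cmod (G (x + z j)) \<le> (2 ^ j) ^ M * C"
        using C(2)[of "x + z j"] by (intro mult_mono) auto
      then show ?thesis by (simp add: g_def norm_mult mult.commute)
    qed
    fix f assume f: "f \<in> tempered" and lim: "\<And>\<psi>. (\<lambda>N. \<Sum>j=1..N. distribution_of (g j) \<psi>) \<longlonglongrightarrow> f \<psi>"
    have "conv (\<phi> k) f x = c k * wave e G k (x + z k)" for k x
    proof -
      have "distribution_of (g j) (\<lambda>t. \<phi> k (x - t)) = (if k = j then g k x else 0)" if "1 \<le> j" for j
      proof -
        have "distribution_of (g j) (\<lambda>t. \<phi> k (x - t)) = fconv (\<phi> k) (g j) x"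
          using conv_distribution_of[OF lp_schwartz[OF lp], of k "g j" x] by (simp add: conv_def)
        then show ?thesis using fconv_wave_shift[OF lp carrier that, of k "c j" "z j" x] by (auto simp: g_def)
      qed
      then have "(\<Sum>j=1..N. distribution_of (g j) (\<lambda>t. \<phi> k (x - t))) = (\<Sum>j=1..N. if k = j then g k x else 0)" for N
        by (intro sum.cong) auto
      then have s: "(\<Sum>j=1..N. distribution_of (g j) (\<lambda>t. \<phi> k (x - t))) = (if 1 \<le> k \<and> k \<le> N then g k x else 0)" for N
        by simp
      have "(\<lambda>N. if 1 \<le> k \<and> k \<le> N then g k x else 0) \<longlonglongrightarrow> conv (\<phi> k) f x"
        using lim[of "\<lambda>t. \<phi> k (x - t)"] unfolding s conv_def .
      moreover have "(\<lambda>N. if 1 \<le> k \<and> k \<le> N then g k x else 0) \<longlonglongrightarrow> g k x"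
      \<comment> \<open>The series starts at 1, whereas the formula is also claimed at 0; there it
        holds because \<open>coef r 0 = 0\<close>.\<close>
      proof (cases "k = 0")
        case True
        then show ?thesis by (simp add: g_def c_def)
      next
        case False
        then show ?thesis by (intro tendsto_eventually) (auto simp: eventually_sequentially)
      qed
      ultimately have "conv (\<phi> k) f x = g k x" by (rule LIMSEQ_unique)
      then show ?thesis by (simp add: g_def)
    qed
    then show ?thesis using f by (intro that[of f]) (auto simp: c_def fun_eq_iff)
  qed
qed

text \<open>Each block of \<open>f\<close> is a packet annihilated by the neighbouring
  \<open>\<phi> k\<close>, so only the middle one of the three terms survives and \<open>T\<close>
  moves packet \<open>k\<close> by exactly \<open>y k\<close>. At \<open>k = 0\<close> both sides
  vanish.\<close>

lemma conv_T_wave_series: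
  assumes f: "f \<in> tempered" and u: "T_sums \<phi> y f u"
    and conv: "\<And>k. conv (\<phi> k) f = (\<lambda>x. of_real (coef r k * 2 powr (- (real k * s))) * wave e G k (x + z k))"
  shows "conv (\<phi> k) u = (\<lambda>x. of_real (coef r k * 2 powr (- (real k * s))) * wave e G k (x + (z k - y k)))"
proof
  fix x
  let ?c = "\<lambda>k. complex_of_real (coef r k * 2 powr (- (real k * s)))"
  have "(if 2 \<le> k + i then fconv (\<phi> k) (conv (\<phi> (k + i - 1)) f) (x - y (k + i - 1)) else 0) =
      (if i = 1 then ?c k * wave e G k (x + (z k - y k)) else 0)" for i
  proof (cases "2 \<le> k + i")
    case True
    then have "1 \<le> k + i - 1" by simp
    from fconv_wave_shift[OF lp carrier this, of k "?c (k + i - 1)" "z (k + i - 1)" "x - y (k + i - 1)"] True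
    show ?thesis unfolding conv by (auto simp: algebra_simps)
  next
    case False
    then show ?thesis by (cases "k = 0") auto
  qed
  then show "conv (\<phi> k) u x = ?c k * wave e G k (x + (z k - y k))"
    unfolding conv_T[OF lp f u] by simp
qed

lemma wave_series_size:
  assumes "conv (\<phi> k) f = (\<lambda>x. of_real (coef r k * 2 powr (- (real k * s))) * wave e G k (x + z))"
  shows "2 powr (real k * s) * cmod (conv (\<phi> k) f x) = coef r k * cmod (G (x + z))"
proof -
  have "cmod (of_real (coef r k * 2 powr (- (real k * s)))) = coef r k * 2 powr (- (real k * s))"
    unfolding norm_of_real by (rule abs_of_nonneg) simp
  then have "2 powr (real k * s) * cmod (conv (\<phi> k) f x) =
      (2 powr (real k * s) * 2 powr (- (real k * s))) * (coef r k * cmod (G (x + z)))"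
    unfolding assms norm_mult norm_wave by (simp only: mult_ac)
  then show ?thesis by (simp add: powr_add[symmetric])
qed

text \<open>Continuity at 0 with half the value there as lower bound.
  \<open>2 * \<rho> \<le> d\<close> makes the balls around separated points disjoint, and
  \<open>\<rho> \<le> 1\<close> places them in unit balls, where weights are comparable.\<close>

lemma G_lower:
  assumes "0 < d" obtains \<rho> \<kappa> where "0 < \<rho>" "\<rho> \<le> 1" "2 * \<rho> \<le> d" "0 < \<kappa>" "\<And>x. x \<in> ball 0 \<rho> \<Longrightarrow> \<kappa> \<le> cmod (G x)"
proof -
  define \<kappa> where "\<kappa> = cmod (G 0) / 2"
  have \<kappa>: "0 < \<kappa>" using carrier by (simp add: \<kappa>_def lp_carrier_def)
  have "continuous_on UNIV G" by (rule rapid_continuous[OF G_rapid[OF lp carrier]])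
  then obtain \<delta> where \<delta>: "0 < \<delta>" "\<And>x. dist x 0 < \<delta> \<Longrightarrow> dist (G x) (G 0) < \<kappa>"
    using \<kappa> unfolding continuous_on_iff by (metis UNIV_I)
  show ?thesis
  proof (rule that[of "min \<delta> (min (d / 2) 1)" \<kappa>])
    fix x :: 'a assume "x \<in> ball 0 (min \<delta> (min (d / 2) 1))"
    then have "dist (G x) (G 0) < \<kappa>" by (intro \<delta>(2)) (simp add: dist_commute)
    moreover have "cmod (G 0) \<le> cmod (G x) + dist (G x) (G 0)"
      using norm_triangle_ineq2[of "G 0" "G x"] by (simp add: dist_norm norm_minus_commute)
    ultimately show "\<kappa> \<le> cmod (G x)" by (simp add: \<kappa>_def)
  qed (use \<delta> \<kappa> assms in auto)
qed

text \<open>The spread-out packets \<open>G (x - y k)\<close> have uniformly bounded overlap: compare each value with an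
  integral over a ball around \<open>y k\<close>.\<close>

lemma overlap_bound:
  fixes y :: "nat \<Rightarrow> 'a"
  assumes d: "0 < d" and sep: "\<And>j k. 1 \<le> j \<Longrightarrow> 1 \<le> k \<Longrightarrow> j \<noteq> k \<Longrightarrow> d \<le> norm (y j - y k)" and Q: "0 < Q"
  obtains W where "0 < W" "\<And>x. (\<integral>\<^sup>+k. (if 1 \<le> k then ennreal (cmod (G (x - y k)) powr Q) else 0) \<partial>count_space UNIV) \<le> ennreal W"
proof -
  note rG = G_rapid[OF lp carrier]
  obtain \<rho> \<kappa> where \<rho>: "0 < \<rho>" "\<rho> \<le> 1" "2 * \<rho> \<le> d" using G_lower[OF d] by metis
  let ?n = "2 * DIM('a)"
  define L where "L = nat \<lceil>real ?n / Q\<rceil>"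
  have L: "real ?n \<le> real L * Q"
  proof -
    have "real ?n / Q \<le> real L" unfolding L_def by linarith
    then show ?thesis using Q by (simp add: pos_divide_le_eq)
  qed
  obtain C where C: "0 < C" "\<And>x. (1 + norm x) ^ L * cmod (G x) \<le> C" using rapidE[OF rG] by metis
  define D where "D = C powr Q"
  have D: "0 < D" using C by (simp add: D_def)
  have G: "(1 + norm v) ^ ?n * cmod (G v) powr Q \<le> D" for v
  proof -
    have "(1 + norm v) ^ ?n = (1 + norm v) powr real ?n"
      by (rule powr_realpow[symmetric]) (simp add: add_pos_nonneg)
    also have "\<dots> \<le> (1 + norm v) powr (real L * Q)" by (intro powr_mono L) simp
    also have "\<dots> = ((1 + norm v) ^ L) powr Q"
      by (simp add: powr_powr[symmetric] powr_realpow add_pos_nonneg)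
    finally have "(1 + norm v) ^ ?n * cmod (G v) powr Q \<le> ((1 + norm v) ^ L) powr Q * cmod (G v) powr Q"
      by (intro mult_right_mono) auto
    also have "\<dots> = ((1 + norm v) ^ L * cmod (G v)) powr Q" by (simp add: powr_mult)
    also have "\<dots> \<le> D" unfolding D_def using C Q by (intro powr_mono2) auto
    finally show ?thesis .
  qed
  define V where "V = measure lborel (ball (0::'a) \<rho>)"
  have V: "0 < V" unfolding V_def using \<rho> by (intro content_ball_pos)
  define F where "F = (\<lambda>x t::'a. ennreal (1 / (1 + norm (x - t)) ^ ?n))"
  have Fm [measurable]: "F x \<in> borel_measurable borel" for x unfolding F_def by measurable
  have mass: "(\<integral>\<^sup>+t. F x t \<partial>lborel) = ennreal (weight_mass TYPE('a))" for x
    unfolding F_def using nn_integral_eq_integral[OF integrable_inverse_weight[of ?n]]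
    by (subst nn_integral_reflect) (auto simp: weight_mass_def)
  \<comment> \<open>On \<open>ball (y k) \<rho>\<close> the weights at \<open>x - t\<close> and
    \<open>x - y k\<close> differ by at most \<open>2 ^ (2 * DIM('a))\<close>, so the decay of
    \<open>G\<close> bounds its value by an average of the weight. The sum over disjoint balls is
    then at most the total mass of the weight.\<close>
  have one: "ennreal V * ennreal (cmod (G (x - y k)) powr Q) \<le> ennreal (D * 2 ^ ?n) * (\<integral>\<^sup>+t. F x t * indicator (ball (y k) \<rho>) t \<partial>lborel)" for x k
  proof -
    let ?g = "cmod (G (x - y k)) powr Q"
    have "ennreal V * ennreal ?g = (\<integral>\<^sup>+t. ennreal ?g * indicator (ball (y k) \<rho>) t \<partial>lborel)"
      by (subst nn_integral_cmult_indicator) (auto simp: emeasure_ball_shift V_def mult.commute)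
    also have "\<dots> \<le> (\<integral>\<^sup>+t. ennreal (D * 2 ^ ?n) * (F x t * indicator (ball (y k) \<rho>) t) \<partial>lborel)"
    proof (rule nn_integral_mono)
      fix t
      show "ennreal ?g * indicator (ball (y k) \<rho>) t \<le> ennreal (D * 2 ^ ?n) * (F x t * indicator (ball (y k) \<rho>) t)"
      proof (cases "t \<in> ball (y k) \<rho>")
        case True
        have "(1 + norm (x - t)) ^ ?n \<le> (1 + norm (x - y k)) ^ ?n * (1 + norm (t - y k)) ^ ?n"
          using weight_diff[of "x - y k" "t - y k" ?n] by simp
        also have "\<dots> \<le> (1 + norm (x - y k)) ^ ?n * 2 ^ ?n"
          using True \<rho> by (intro mult_left_mono power_mono) (auto simp: dist_norm norm_minus_commute)
        finally have "(1 + norm (x - t)) ^ ?n * ?g \<le> (1 + norm (x - y k)) ^ ?n * 2 ^ ?n * ?g"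
          by (rule mult_right_mono) simp
        also have "\<dots> = 2 ^ ?n * ((1 + norm (x - y k)) ^ ?n * ?g)" by (simp only: mult_ac)
        also have "\<dots> \<le> 2 ^ ?n * D" by (intro mult_left_mono G) simp
        finally have "?g \<le> D * 2 ^ ?n * (1 / (1 + norm (x - t)) ^ ?n)"
          using weight_pos[of "x - t" ?n] by (simp add: pos_le_divide_eq mult_ac)
        then have "ennreal ?g \<le> ennreal (D * 2 ^ ?n) * F x t"
          unfolding F_def using D by (subst ennreal_mult[symmetric]) (auto intro: ennreal_leI)
        then show ?thesis using True by simp
      qed simp
    qed
    also have "\<dots> = ennreal (D * 2 ^ ?n) * (\<integral>\<^sup>+t. F x t * indicator (ball (y k) \<rho>) t \<partial>lborel)"
      by (rule nn_integral_cmult) (auto intro!: borel_measurable_times_ennreal borel_measurable_indicator)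
    finally show ?thesis .
  qed
  define W where "W = D * 2 ^ ?n * weight_mass TYPE('a) / V + 1"
  show ?thesis
  proof (rule that[of W])
    have "0 \<le> D * 2 ^ ?n * weight_mass TYPE('a) / V" using D V weight_mass_nonneg[where 'a='a] by simp
    then show "0 < W" by (simp add: W_def)
    fix x
    let ?g = "\<lambda>k. if 1 \<le> k then ennreal (cmod (G (x - y k)) powr Q) else 0"
    let ?i = "\<lambda>k t. if 1 \<le> k then F x t * indicator (ball (y k) \<rho>) t else (0::ennreal)"
    have im [measurable]: "?i k \<in> borel_measurable lborel" for k
      by (cases "1 \<le> k") (auto intro!: borel_measurable_times_ennreal borel_measurable_indicator)
    have "ennreal V * (\<Sum>k. ?g k) = (\<Sum>k. ennreal V * ?g k)" by simp
    also have "\<dots> \<le> (\<Sum>k. ennreal (D * 2 ^ ?n) * (\<integral>\<^sup>+t. ?i k t \<partial>lborel))"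
      using one by (intro suminf_le) auto
    also have "\<dots> = ennreal (D * 2 ^ ?n) * (\<Sum>k. \<integral>\<^sup>+t. ?i k t \<partial>lborel)" by simp
    also have "(\<Sum>k. \<integral>\<^sup>+t. ?i k t \<partial>lborel) = (\<integral>\<^sup>+t. (\<Sum>k. ?i k t) \<partial>lborel)"
      by (rule nn_integral_suminf[symmetric]) (rule im)
    also have "\<dots> \<le> (\<integral>\<^sup>+t. F x t \<partial>lborel)"
    proof (rule nn_integral_mono)
      fix t
      show "(\<Sum>k. ?i k t) \<le> F x t"
      proof (cases "\<exists>k. 1 \<le> k \<and> t \<in> ball (y k) \<rho>")
        case True
        then obtain k0 where k0: "1 \<le> k0" "t \<in> ball (y k0) \<rho>" by blast
        have "?i k t = (if k = k0 then F x t else 0)" for k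
        proof (cases "1 \<le> k \<and> t \<in> ball (y k) \<rho>")
          case True
          then have "k = k0" by (intro separated_balls[where y=y and d=d and \<rho>=\<rho> and x=t] sep \<rho> k0) auto
          with k0 show ?thesis by simp
        next
          case False
          with k0 have "k \<noteq> k0" by auto
          with False show ?thesis by auto
        qed
        then have "(\<Sum>k. ?i k t) = (\<Sum>k. if k = k0 then F x t else 0)" by simp
        also have "\<dots> = F x t" using sums_unique[OF sums_single[of k0 "\<lambda>k. F x t"]] by simp
        finally show ?thesis by simp
      next
        case False
        then have "?i k t = 0" for k by (auto simp: indicator_def)
        then show ?thesis by simp
      qed
    qed
    also have "\<dots> = ennreal (weight_mass TYPE('a))" by (rule mass)
    finally have "ennreal V * (\<Sum>k. ?g k) \<le> ennreal (D * 2 ^ ?n) * ennreal (weight_mass TYPE('a))"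
      by (simp add: mult_left_mono)
    then have "ennreal (1 / V) * (ennreal V * (\<Sum>k. ?g k)) \<le> ennreal (1 / V) * (ennreal (D * 2 ^ ?n) * ennreal (weight_mass TYPE('a)))"
      by (rule mult_left_mono) simp
    moreover have "ennreal (1 / V) * (ennreal V * Z) = Z" for Z
      unfolding mult.assoc[symmetric] using V by (simp add: ennreal_mult[symmetric])
    moreover have "ennreal (1 / V) * (ennreal (D * 2 ^ ?n) * ennreal (weight_mass TYPE('a))) = ennreal (D * 2 ^ ?n * weight_mass TYPE('a) / V)"
      using D V weight_mass_nonneg[where 'a='a] by (simp add: ennreal_mult[symmetric])
    ultimately have "(\<Sum>k. ?g k) \<le> ennreal (D * 2 ^ ?n * weight_mass TYPE('a) / V)" by (simp only:)
    also have "\<dots> \<le> ennreal W" unfolding W_def by (rule ennreal_leI) simp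
    finally show "(\<integral>\<^sup>+k. ?g k \<partial>count_space UNIV) \<le> ennreal W"
      by (simp add: nn_integral_count_space_nat)
  qed
qed

end

subsection \<open>Failure of boundedness on Triebel-Lizorkin spaces\<close>

text \<open>A ball has positive measure. The version restricted to the unit ball serves the norm
  with \<open>p = \<infinity>\<close> at the origin and \<open>J = 0\<close>.\<close>

lemma nn_integral_powr_top_on_ball:
  fixes f :: "'a::euclidean_space \<Rightarrow> ennreal"
  assumes \<rho>: "0 < \<rho>" "\<rho> \<le> 1" and f: "\<And>x. x \<in> ball 0 \<rho> \<Longrightarrow> f x = top"
  shows "(\<integral>\<^sup>+x. ennreal_powr (f x) P \<partial>lborel) = top"
    and "(\<integral>\<^sup>+x. ennreal_powr (f x) P \<partial>restrict_space lborel (ball 0 1)) = top"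
proof -
  have *: "top \<le> (\<integral>\<^sup>+x. F x \<partial>lborel)" if "\<And>x. x \<in> ball 0 \<rho> \<Longrightarrow> F x = top" for F :: "'a \<Rightarrow> ennreal"
  proof -
    have "0 < measure lborel (ball (0::'a) \<rho>)" using \<rho> by (intro content_ball_pos)
    then have "emeasure lborel (ball (0::'a) \<rho>) \<noteq> 0" unfolding emeasure_ball_shift by simp
    then have "top = (\<integral>\<^sup>+x. top * indicator (ball (0::'a) \<rho>) x \<partial>lborel)"
      by (subst nn_integral_cmult_indicator) (auto simp: ennreal_top_mult)
    also have "\<dots> \<le> (\<integral>\<^sup>+x. F x \<partial>lborel)"
      by (intro nn_integral_mono) (use that in \<open>auto simp: indicator_def\<close>)
    finally show ?thesis .
  qed
  show "(\<integral>\<^sup>+x. ennreal_powr (f x) P \<partial>lborel) = top" using *[of "\<lambda>x. ennreal_powr (f x) P"] f by (simp add: top_unique)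
  have "top \<le> (\<integral>\<^sup>+x. ennreal_powr (f x) P * indicator (ball 0 1) x \<partial>lborel)"
  proof (rule *)
    fix x :: 'a assume x: "x \<in> ball 0 \<rho>"
    then have "x \<in> ball 0 1" using \<rho> by auto
    with f[OF x] show "ennreal_powr (f x) P * indicator (ball 0 1) x = top" by simp
  qed
  then show "(\<integral>\<^sup>+x. ennreal_powr (f x) P \<partial>restrict_space lborel (ball 0 1)) = top"
    by (subst nn_integral_restrict_space) (auto simp: top_unique)
qed

lemma Lp_norm_coef_finite:
  assumes r: "0 < r" "ennreal r < q"
  obtains K where "0 \<le> K" "Lp_norm q (count_space UNIV) (\<lambda>k. ennreal (coef r k)) = ennreal K"
proof -
  have "0 < q" using r by (meson le_less_trans zero_le)
  then have "Lp_norm q (count_space UNIV) (\<lambda>k. ennreal (coef r k)) < top"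
  proof (cases rule: exponent_cases)
    case 1
    have "Lp_norm q (count_space UNIV) (\<lambda>k. ennreal (coef r k)) \<le> 1"
      unfolding 1 Lp_norm_top by (rule esssup_I) (use coef_le_1[OF r(1)] in \<open>auto simp: AE_count_space\<close>)
    then show ?thesis by (rule le_less_trans) simp
  next
    case (2 Q)
    have "r < Q" using r 2 by (simp add: ennreal_less_iff)
    note s = summable_coef[OF r(1) this]
    have "(\<integral>\<^sup>+k. ennreal_powr (ennreal (coef r k)) Q \<partial>count_space UNIV) = (\<Sum>k. ennreal (coef r k powr Q))"
      by (simp add: nn_integral_count_space_nat ennreal_powr_ennreal)
    also have "\<dots> = ennreal (\<Sum>k. coef r k powr Q)" by (rule suminf_ennreal2[OF _ s]) simp
    finally have "Lp_norm q (count_space UNIV) (\<lambda>k. ennreal (coef r k)) \<noteq> top"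
      unfolding 2 Lp_norm_eq_top_iff[OF 2(1)] by simp
    then show ?thesis by (simp add: less_top)
  qed
  with that show ?thesis by (cases "Lp_norm q (count_space UNIV) (\<lambda>k. ennreal (coef r k))") auto
qed

context
  fixes \<phi> :: "nat \<Rightarrow> 'a::euclidean_space \<Rightarrow> complex" and e :: 'a and G :: "'a \<Rightarrow> complex" and y :: "nat \<Rightarrow> 'a" and d :: real
  assumes lp: "littlewood_paley \<phi>" and carrier: "lp_carrier \<phi> e G"
    and d: "0 < d" and sep: "\<And>j k. 1 \<le> j \<Longrightarrow> 1 \<le> k \<Longrightarrow> j \<noteq> k \<Longrightarrow> d \<le> norm (y j - y k)"
begin

text \<open>For \<open>p < q\<close> all packets of \<open>f\<close> sit at the origin, and \<open>T\<close> spreads them out.\<close>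

lemma triebel_counterexample_less:
  assumes P: "0 < P" "ennreal P < q"
  obtains f where "f \<in> triebel \<phi> s (ennreal P) q" "\<And>u. T_sums \<phi> y f u \<Longrightarrow> u \<notin> triebel \<phi> s (ennreal P) q"
proof (rule wave_series[OF lp carrier P(1)])
  fix f assume f: "f \<in> tempered"
    and "\<And>k. conv (\<phi> k) f = (\<lambda>x. of_real (coef P k * 2 powr (- (real k * s))) * wave e G k (x + (\<lambda>k. 0) k))"
  then have cf: "conv (\<phi> k) f = (\<lambda>x. of_real (coef P k * 2 powr (- (real k * s))) * wave e G k (x + 0))" for k by simp
  have q: "0 < q" using P by (meson le_less_trans zero_le)
  note rG = G_rapid[OF lp carrier]
  have [measurable]: "G \<in> borel_measurable borel" by (rule rapid_measurable[OF rG])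
  \<comment> \<open>All packets have the same modulus profile \<open>G\<close>, so the inner norm
    factors into \<open>cmod (G x)\<close> and the sequence norm of the coefficients, which is
    finite because \<open>P < q\<close>.\<close>
  obtain K where K: "0 \<le> K" "Lp_norm q (count_space UNIV) (\<lambda>k. ennreal (coef P k)) = ennreal K"
    by (rule Lp_norm_coef_finite[OF P])
  have inner: "Lp_norm q (count_space UNIV) (\<lambda>k. ennreal (2 powr (real k * s) * cmod (conv (\<phi> k) f x))) \<le> ennreal (K * cmod (G x))" for x
  proof -
    have "Lp_norm q (count_space UNIV) (\<lambda>k. ennreal (2 powr (real k * s) * cmod (conv (\<phi> k) f x)))
        = Lp_norm q (count_space UNIV) (\<lambda>k. ennreal (cmod (G x)) * ennreal (coef P k))"
      unfolding wave_series_size[OF lp carrier cf] by (simp add: ennreal_mult[symmetric] mult.commute)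
    also have "\<dots> \<le> ennreal (cmod (G x)) * ennreal K" unfolding K(2)[symmetric] by (rule Lp_norm_cmult[OF q]) simp
    finally show ?thesis using K(1) by (simp add: ennreal_mult[symmetric] mult.commute)
  qed
  have "triebel_norm \<phi> s (ennreal P) q f < top"
  proof -
    obtain J where J: "(\<integral>\<^sup>+x. ennreal (cmod (G x) powr P) \<partial>lborel) \<le> ennreal J"
      by (rule rapid_powr_integral_finite[OF rG P(1)])
    have "(\<integral>\<^sup>+x. ennreal_powr (ennreal (K * cmod (G x))) P \<partial>lborel) = (\<integral>\<^sup>+x. ennreal (K powr P) * ennreal (cmod (G x) powr P) \<partial>lborel)"
      using K(1) by (intro nn_integral_cong) (simp add: ennreal_powr_ennreal powr_mult ennreal_mult[symmetric])
    also have "\<dots> = ennreal (K powr P) * (\<integral>\<^sup>+x. ennreal (cmod (G x) powr P) \<partial>lborel)" by (rule nn_integral_cmult) measurable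
    also have "\<dots> \<noteq> top" using J by (auto simp: ennreal_mult_eq_top_iff top_unique)
    finally have "Lp_norm (ennreal P) lborel (\<lambda>x. ennreal (K * cmod (G x))) \<noteq> top" unfolding Lp_norm_eq_top_iff[OF P(1)] .
    moreover have "triebel_norm \<phi> s (ennreal P) q f \<le> Lp_norm (ennreal P) lborel (\<lambda>x. ennreal (K * cmod (G x)))"
      unfolding triebel_norm_ennreal by (rule Lp_norm_mono_finite[OF P(1) inner])
    ultimately show ?thesis by (auto simp: less_top[symmetric] top_unique)
  qed
  then have "f \<in> triebel \<phi> s (ennreal P) q" using f by (simp add: triebel_def)
  moreover have "u \<notin> triebel \<phi> s (ennreal P) q" if u: "T_sums \<phi> y f u" for u
  proof -
    obtain \<rho> \<kappa> where \<rho>: "0 < \<rho>" "\<rho> \<le> 1" "2 * \<rho> \<le> d" and \<kappa>: "0 < \<kappa>" "\<And>x. x \<in> ball 0 \<rho> \<Longrightarrow> \<kappa> \<le> cmod (G x)"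
      using G_lower[OF lp carrier d] by metis
    define V where "V = measure lborel (ball (0::'a) \<rho>)"
    have V: "0 < V" unfolding V_def using \<rho> by (intro content_ball_pos)
    have cu: "conv (\<phi> k) u = (\<lambda>x. of_real (coef P k * 2 powr (- (real k * s))) * wave e G k (x + (0 - y k)))" for k
      using conv_T_wave_series[OF lp carrier f u, where z="\<lambda>k. 0" and r=P and s=s and k=k] cf by simp
    let ?in = "\<lambda>x. Lp_norm q (count_space UNIV) (\<lambda>k. ennreal (2 powr (real k * s) * cmod (conv (\<phi> k) u x)))"
    let ?h = "\<lambda>k x. ennreal (\<kappa> powr P * (1 / real k)) * indicator (ball (y k) \<rho>) x"
    \<comment> \<open>By separation at most one summand is nonzero at \<open>x\<close>, and the
      inner sequence norm, whatever \<open>q\<close>, is at least the single entry of that packet.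
      So the outer exponent \<open>P\<close> decides.\<close>
    have le: "(\<Sum>k. ?h k x) \<le> ennreal_powr (?in x) P" for x
    proof (cases "\<exists>k. 1 \<le> k \<and> x \<in> ball (y k) \<rho>")
      case True
      then obtain k0 where k0: "1 \<le> k0" "x \<in> ball (y k0) \<rho>" by blast
      have "?h k x = (if k = k0 then ?h k0 x else 0)" for k
      proof (cases "1 \<le> k \<and> x \<in> ball (y k) \<rho>")
        case True
        then have "k = k0" by (intro separated_balls[where y=y and d=d and \<rho>=\<rho> and x=x] sep \<rho> k0) auto
        then show ?thesis by simp
      next
        case False
        then have "k \<noteq> k0" "k = 0 \<or> x \<notin> ball (y k) \<rho>" using k0 by auto
        then show ?thesis by auto
      qed
      then have "(\<Sum>k. ?h k x) = (\<Sum>k. if k = k0 then ?h k0 x else 0)" by simp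
      also have "\<dots> = ?h k0 x" using sums_unique[OF sums_single[of k0 "\<lambda>k. ?h k0 x"]] by simp
      also have "\<dots> = ennreal ((\<kappa> * coef P k0) powr P)"
        using k0 \<kappa>(1) by (simp add: powr_mult coef_powr[OF P(1)])
      also have "\<dots> \<le> ennreal ((2 powr (real k0 * s) * cmod (conv (\<phi> k0) u x)) powr P)"
        unfolding wave_series_size[OF lp carrier cu]
      proof (intro ennreal_leI powr_mono2)
        have "\<kappa> \<le> cmod (G (x + (0 - y k0)))" using k0 by (intro \<kappa>(2)) (simp add: dist_norm norm_minus_commute)
        then show "\<kappa> * coef P k0 \<le> coef P k0 * cmod (G (x + (0 - y k0)))" unfolding mult.commute[of \<kappa>] by (rule mult_left_mono) simp
      qed (use P \<kappa> in auto)
      also have "\<dots> = ennreal_powr (ennreal (2 powr (real k0 * s) * cmod (conv (\<phi> k0) u x))) P"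
        by (simp add: ennreal_powr_ennreal)
      also have "\<dots> \<le> ennreal_powr (?in x) P"
        using P by (intro ennreal_powr_mono Lp_norm_count_le[OF q]) auto
      finally show ?thesis .
    next
      case False
      have "?h k x = 0" for k
      proof (cases "k = 0")
        case k: False
        with False have "x \<notin> ball (y k) \<rho>" by auto
        then show ?thesis by simp
      qed simp
      then have "(\<Sum>k. ?h k x) = 0" by (simp only: suminf_zero)
      then show ?thesis by (simp only: zero_le)
    qed
    have "(\<integral>\<^sup>+x. ?h k x \<partial>lborel) = ennreal (\<kappa> powr P * V) * ennreal (1 / real k)" for k
    proof -
      have "(\<integral>\<^sup>+x. ?h k x \<partial>lborel) = ennreal (\<kappa> powr P * (1 / real k)) * ennreal V"
        unfolding V_def emeasure_ball_shift[of "y k", symmetric] by (rule nn_integral_cmult_indicator) simp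
      also have "\<dots> = ennreal (\<kappa> powr P * (1 / real k) * V)" using V by (intro ennreal_mult[symmetric]) auto
      also have "\<kappa> powr P * (1 / real k) * V = \<kappa> powr P * V * (1 / real k)" by simp
      also have "ennreal \<dots> = ennreal (\<kappa> powr P * V) * ennreal (1 / real k)" using V by (intro ennreal_mult) auto
      finally show ?thesis .
    qed
    then have "(\<Sum>k. \<integral>\<^sup>+x. ?h k x \<partial>lborel) = ennreal (\<kappa> powr P * V) * (\<Sum>k. ennreal (1 / real k))"
      by (simp only: ennreal_suminf_cmult)
    \<comment> \<open>All balls have the same volume, hence the sum of the integrals is a positive
      multiple of the harmonic series.\<close>
    also have "(\<Sum>k. ennreal (1 / real k)) = top"
      using nn_integral_inverse unfolding nn_integral_count_space_nat .
    also have "ennreal (\<kappa> powr P * V) * top = top" using \<kappa>(1) V by (simp add: ennreal_mult_top)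
    finally have "(\<Sum>k. \<integral>\<^sup>+x. ?h k x \<partial>lborel) = top" .
    then have "top = (\<Sum>k. \<integral>\<^sup>+x. ?h k x \<partial>lborel)" by (rule sym)
    also have "\<dots> = (\<integral>\<^sup>+x. (\<Sum>k. ?h k x) \<partial>lborel)"
      by (rule nn_integral_suminf[symmetric], intro borel_measurable_times_ennreal borel_measurable_const borel_measurable_indicator) simp
    also have "\<dots> \<le> (\<integral>\<^sup>+x. ennreal_powr (?in x) P \<partial>lborel)" by (rule nn_integral_mono) (rule le)
    finally have "triebel_norm \<phi> s (ennreal P) q u = top"
      unfolding triebel_norm_ennreal Lp_norm_eq_top_iff[OF P(1)] by (simp only: top_unique)
    then show ?thesis by (simp add: triebel_def)
  qed
  ultimately show ?thesis by (rule that)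
qed

text \<open>For \<open>q < p\<close> the packets of \<open>f\<close> sit at the points \<open>- y k\<close>, and \<open>T\<close> moves all of them to the origin.\<close>

lemma triebel_counterexample_greater:
  assumes Q: "0 < Q" "ennreal Q < p"
  obtains f where "f \<in> triebel \<phi> s p (ennreal Q)" "\<And>u. T_sums \<phi> y f u \<Longrightarrow> u \<notin> triebel \<phi> s p (ennreal Q)"
proof (rule wave_series[OF lp carrier Q(1)])
  fix f assume f: "f \<in> tempered"
    and cf: "\<And>k. conv (\<phi> k) f = (\<lambda>x. of_real (coef Q k * 2 powr (- (real k * s))) * wave e G k (x + (\<lambda>k. y k) k))"
  have p: "0 < p" using Q by (meson le_less_trans zero_le)
  note rG = G_rapid[OF lp carrier]
  have [measurable]: "G \<in> borel_measurable borel" by (rule rapid_measurable[OF rG])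
  have sep': "d \<le> norm (- y j - - y k)" if "1 \<le> j" "1 \<le> k" "j \<noteq> k" for j k
    using sep[OF that] by (simp add: norm_minus_commute)
  obtain W where W: "0 < W" "\<And>x. (\<integral>\<^sup>+k. (if 1 \<le> k then ennreal (cmod (G (x + y k)) powr Q) else 0) \<partial>count_space UNIV) \<le> ennreal W"
  proof (rule overlap_bound[OF lp carrier d sep' Q(1)])
    fix W :: real
    assume "0 < W" "\<And>x. (\<integral>\<^sup>+k. (if 1 \<le> k then ennreal (cmod (G (x - - y k)) powr Q) else 0) \<partial>count_space UNIV) \<le> ennreal W"
    then show ?thesis unfolding diff_minus_eq_add by (rule that)
  qed
  \<comment> \<open>Index 0 is masked, as the overlap bound concerns indices from 1 on; this loses
    nothing, because \<open>w\<close> will be multiplied by \<open>1 / real k\<close>, which is 0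
    there.\<close>
  define w where "w = (\<lambda>x k. if 1 \<le> k then cmod (G (x + y k)) powr Q else 0)"
  have w0: "0 \<le> w x k" for x k by (simp add: w_def)
  have w: "(\<integral>\<^sup>+k. ennreal (w x k) \<partial>count_space UNIV) \<le> ennreal W" for x
    using W(2)[of x] by (simp add: w_def if_distrib[of ennreal] cong: if_cong)
  let ?in = "\<lambda>A x. Lp_norm (ennreal Q) (count_space A) (\<lambda>k. ennreal (2 powr (real k * s) * cmod (conv (\<phi> k) f x)))"
  have inner: "ennreal_powr (?in A x) Q = (\<integral>\<^sup>+k. ennreal (w x k * (1 / real k)) \<partial>count_space A)" for A x
    unfolding Lp_norm_finite_powr[OF Q(1)]
  proof (rule nn_integral_cong)
    fix k
    have "ennreal_powr (ennreal (2 powr (real k * s) * cmod (conv (\<phi> k) f x))) Q = ennreal (coef Q k powr Q * cmod (G (x + y k)) powr Q)"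
      unfolding wave_series_size[OF lp carrier cf] by (simp add: ennreal_powr_ennreal powr_mult)
    then show "ennreal_powr (ennreal (2 powr (real k * s) * cmod (conv (\<phi> k) f x))) Q = ennreal (w x k * (1 / real k))"
      unfolding coef_powr[OF Q(1)] by (cases "k = 0") (simp_all add: w_def)
  qed
  have "triebel_norm \<phi> s p (ennreal Q) f < top"
    using p
  proof (cases rule: exponent_cases)
    case 1
    define V where "V = measure lborel (ball (0::'a) 1)"
    have V: "0 \<le> V" by (simp add: V_def)
    \<comment> \<open>By the overlap bound and 1/k \<le> 1 the inner norm is bounded at every point.
      The volume of the ball, proportional to 2^(-Jn), cancels the normalising factor of the norm,
      uniformly in \<open>x\<close> and \<open>J\<close>.\<close>
    have "ennreal (2 powr (of_int J * real DIM('a) * enn2real (1 / ennreal Q))) *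
       Lp_norm (ennreal Q) (restrict_space lborel (ball x (2 powr (- of_int J)))) (?in {nat (max J 0)..}) \<le> ennreal ((W * V) powr (1 / Q))" for x and J :: int
    proof -
      let ?r = "2 powr (- of_int J)" let ?n = "real DIM('a)"
      have "ennreal_powr (?in A t) Q \<le> ennreal W" for A t
      proof -
        have "ennreal_powr (?in A t) Q \<le> (\<integral>\<^sup>+k. ennreal (w t k) \<partial>count_space A)"
          unfolding inner
        proof (intro nn_integral_mono ennreal_leI)
          fix k
          have "w t k * (1 / real k) \<le> w t k * 1" by (intro mult_left_mono w0) (cases "k = 0", auto)
          then show "w t k * (1 / real k) \<le> w t k" by simp
        qed
        also have "\<dots> = (\<integral>\<^sup>+k. ennreal (w t k) * indicator A k \<partial>count_space UNIV)"
          by (rule nn_integral_count_space_indicator) simp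
        also have "\<dots> \<le> (\<integral>\<^sup>+k. ennreal (w t k) \<partial>count_space UNIV)"
          by (intro nn_integral_mono) (auto simp: indicator_def)
        finally show ?thesis using w[of t] by (rule order_trans)
      qed
      then have "(\<integral>\<^sup>+t. ennreal_powr (?in {nat (max J 0)..} t) Q \<partial>restrict_space lborel (ball x ?r)) \<le> (\<integral>\<^sup>+t. ennreal W \<partial>restrict_space lborel (ball x ?r))"
        by (intro nn_integral_mono)
      also have "\<dots> = ennreal W * emeasure lborel (ball x ?r)"
        by (simp add: emeasure_restrict_space space_restrict_space)
      also have "\<dots> = ennreal (W * (?r ^ DIM('a) * V))"
        unfolding emeasure_ball_shift V_def using W(1) content_ball_conv_unit_ball[of ?r "0::'a"] by (simp add: ennreal_mult[symmetric])
      finally have "Lp_norm (ennreal Q) (restrict_space lborel (ball x ?r)) (?in {nat (max J 0)..}) \<le> ennreal_powr (ennreal (W * (?r ^ DIM('a) * V))) (1 / Q)"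
        unfolding Lp_norm_ennreal[OF Q(1)] using Q(1) by (intro ennreal_powr_mono) auto
      also have "\<dots> = ennreal (2 powr (- (of_int J * ?n * (1 / Q))) * (W * V) powr (1 / Q))"
      proof -
        have "?r ^ DIM('a) = 2 powr (- (of_int J * ?n))"
          by (subst powr_realpow[symmetric]) (auto simp: powr_powr)
        then have eq: "W * (?r ^ DIM('a) * V) = 2 powr (- (of_int J * ?n)) * (W * V)" by simp
        show ?thesis unfolding eq using W(1) V by (simp add: ennreal_powr_ennreal powr_mult powr_powr)
      qed
      finally have "ennreal (2 powr (of_int J * ?n * (1 / Q))) * Lp_norm (ennreal Q) (restrict_space lborel (ball x ?r)) (?in {nat (max J 0)..})
          \<le> ennreal (2 powr (of_int J * ?n * (1 / Q))) * ennreal (2 powr (- (of_int J * ?n * (1 / Q))) * (W * V) powr (1 / Q))"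
        by (rule mult_left_mono) simp
      also have "\<dots> = ennreal ((2 powr (of_int J * ?n * (1 / Q)) * 2 powr (- (of_int J * ?n * (1 / Q)))) * (W * V) powr (1 / Q))"
        by (simp only: ennreal_mult[symmetric] powr_ge_zero mult_nonneg_nonneg mult.assoc)
      also have "\<dots> = ennreal ((W * V) powr (1 / Q))" by (simp add: powr_add[symmetric])
      finally show ?thesis using Q(1) by (simp add: divide_ennreal ennreal_1[symmetric] del: ennreal_1)
    qed
    then have "triebel_norm \<phi> s p (ennreal Q) f \<le> ennreal ((W * V) powr (1 / Q))"
      unfolding 1 triebel_norm_top by (auto intro!: SUP_least)
    then show ?thesis by (rule le_less_trans) simp
  next
    case (2 P)
    have PQ: "Q < P" using Q 2 by (simp add: ennreal_less_iff)
    obtain J where J: "(\<integral>\<^sup>+x. ennreal (cmod (G x) powr Q) \<partial>lborel) \<le> ennreal J"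
      by (rule rapid_powr_integral_finite[OF rG Q(1)])
    let ?g = "\<lambda>k. (1 / real k) powr (P / Q)"
    have "summable (\<lambda>k. coef Q k powr P)" by (rule summable_coef[OF Q(1) PQ])
    moreover have "coef Q k powr P = ?g k" for k
      unfolding coef_powr[OF Q(1), symmetric] powr_powr using Q(1) by simp
    ultimately have sum: "summable ?g" by simp
    have "(\<integral>\<^sup>+x. ennreal_powr (?in UNIV x) P \<partial>lborel) \<le>
        (\<integral>\<^sup>+x. ennreal (W powr (P / Q - 1)) * (\<Sum>k. ennreal (?g k) * ennreal (cmod (G (x + y k)) powr Q)) \<partial>lborel)"
    proof (rule nn_integral_mono)
      fix x
      have "ennreal_powr (?in UNIV x) P = ennreal_powr (ennreal_powr (?in UNIV x) Q) (P / Q)"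
        using Q(1) 2(1) by (simp add: ennreal_powr_powr)
      \<comment> \<open>Jensen with exponent \<open>P / Q\<close> over the index \<open>k\<close>:
        the weights \<open>w\<close> have mass at most \<open>W\<close> by bounded overlap, and the
        averaged function is \<open>1 / real k\<close>. Its power \<open>P / Q > 1\<close> is
        summable, and integration in \<open>x\<close> is then harmless term by term.\<close>
      also have "\<dots> \<le> ennreal (W powr (P / Q - 1)) * (\<integral>\<^sup>+k. ennreal (w x k * ?g k) \<partial>count_space UNIV)"
        unfolding inner using PQ Q(1) W(1) w[of x] w0 by (intro weighted_power_ge1) auto
      also have "\<dots> \<le> ennreal (W powr (P / Q - 1)) * (\<Sum>k. ennreal (?g k) * ennreal (cmod (G (x + y k)) powr Q))"
        unfolding nn_integral_count_space_nat
        by (intro mult_left_mono suminf_le) (auto simp: ennreal_mult[symmetric] w_def mult.commute)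
      finally show "ennreal_powr (?in UNIV x) P \<le> ennreal (W powr (P / Q - 1)) * (\<Sum>k. ennreal (?g k) * ennreal (cmod (G (x + y k)) powr Q))" .
    qed
    also have "\<dots> = ennreal (W powr (P / Q - 1)) * (\<integral>\<^sup>+x. (\<Sum>k. ennreal (?g k) * ennreal (cmod (G (x + y k)) powr Q)) \<partial>lborel)"
      by (rule nn_integral_cmult) measurable
    also have "(\<integral>\<^sup>+x. (\<Sum>k. ennreal (?g k) * ennreal (cmod (G (x + y k)) powr Q)) \<partial>lborel) =
        (\<Sum>k. \<integral>\<^sup>+x. ennreal (?g k) * ennreal (cmod (G (x + y k)) powr Q) \<partial>lborel)"
      by (rule nn_integral_suminf) measurable
    also have "\<dots> \<le> (\<Sum>k. ennreal (?g k) * ennreal J)"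
    proof (intro suminf_le)
      fix k
      have "(\<integral>\<^sup>+x. ennreal (?g k) * ennreal (cmod (G (x + y k)) powr Q) \<partial>lborel) = ennreal (?g k) * (\<integral>\<^sup>+x. ennreal (cmod (G (x + y k)) powr Q) \<partial>lborel)"
        by (rule nn_integral_cmult) measurable
      also have "(\<integral>\<^sup>+x. ennreal (cmod (G (x + y k)) powr Q) \<partial>lborel) = (\<integral>\<^sup>+x. ennreal (cmod (G x) powr Q) \<partial>lborel)"
        using nn_integral_shift[of "\<lambda>x. ennreal (cmod (G x) powr Q)" "y k"] by simp
      finally show "(\<integral>\<^sup>+x. ennreal (?g k) * ennreal (cmod (G (x + y k)) powr Q) \<partial>lborel) \<le> ennreal (?g k) * ennreal J"
        using J by (simp add: mult_left_mono)
    qed (rule summableI)+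
    also have "\<dots> = ennreal (\<Sum>k. ?g k) * ennreal J"
      unfolding ennreal_suminf_multc by (subst suminf_ennreal2[OF _ sum]) simp_all
    finally have "(\<integral>\<^sup>+x. ennreal_powr (?in UNIV x) P \<partial>lborel) \<le> ennreal (W powr (P / Q - 1)) * (ennreal (\<Sum>k. ?g k) * ennreal J)"
      by (simp add: mult_left_mono)
    also have "\<dots> < top" by (simp add: ennreal_mult_less_top)
    finally have "Lp_norm (ennreal P) lborel (?in UNIV) \<noteq> top" unfolding Lp_norm_eq_top_iff[OF 2(1)] by simp
    then show ?thesis unfolding 2 triebel_norm_ennreal by (simp add: less_top)
  qed
  then have "f \<in> triebel \<phi> s p (ennreal Q)" using f by (simp add: triebel_def)
  moreover have "u \<notin> triebel \<phi> s p (ennreal Q)" if u: "T_sums \<phi> y f u" for u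
  proof -
    obtain \<rho> \<kappa> where \<rho>: "0 < \<rho>" "\<rho> \<le> 1" and \<kappa>: "0 < \<kappa>" "\<And>x. x \<in> ball 0 \<rho> \<Longrightarrow> \<kappa> \<le> cmod (G x)"
      using G_lower[OF lp carrier d] by metis
    let ?inu = "\<lambda>x. Lp_norm (ennreal Q) (count_space UNIV) (\<lambda>k. ennreal (2 powr (real k * s) * cmod (conv (\<phi> k) u x)))"
    have cu: "conv (\<phi> k) u = (\<lambda>x. of_real (coef Q k * 2 powr (- (real k * s))) * wave e G k (x + 0))" for k
      using conv_T_wave_series[OF lp carrier f u, where z="\<lambda>k. y k" and r=Q and s=s and k=k] cf by simp
    \<comment> \<open>All packets now lie over the origin: where \<open>G\<close> is bounded below,
      the inner sum with exponent \<open>Q\<close> is a positive multiple of the harmonic series at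
      every point.\<close>
    have "?inu x = top" if "x \<in> ball 0 \<rho>" for x
      unfolding Lp_norm_eq_top_iff[OF Q(1)]
    proof -
      have "ennreal_powr (ennreal (2 powr (real k * s) * cmod (conv (\<phi> k) u x))) Q = ennreal (cmod (G x) powr Q) * ennreal (1 / real k)" for k
        unfolding wave_series_size[OF lp carrier cu] using coef_powr[OF Q(1), of k]
        by (simp add: ennreal_powr_ennreal powr_mult ennreal_mult[symmetric] mult.commute)
      then have "(\<integral>\<^sup>+k. ennreal_powr (ennreal (2 powr (real k * s) * cmod (conv (\<phi> k) u x))) Q \<partial>count_space UNIV)
          = ennreal (cmod (G x) powr Q) * (\<integral>\<^sup>+k. ennreal (1 / real k) \<partial>count_space UNIV)"
        by (simp add: nn_integral_cmult)
      also have "\<dots> = top" using \<kappa>(1) \<kappa>(2)[OF that] unfolding nn_integral_inverse by (auto simp: ennreal_mult_top)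
      finally show "(\<integral>\<^sup>+k. ennreal_powr (ennreal (2 powr (real k * s) * cmod (conv (\<phi> k) u x))) Q \<partial>count_space UNIV) = top" .
    qed
    note top = nn_integral_powr_top_on_ball[where f="?inu", OF \<rho> this]
    have "triebel_norm \<phi> s p (ennreal Q) u = top"
      using p
    proof (cases rule: exponent_cases)
      case 1
      have "top = Lp_norm (ennreal Q) (restrict_space lborel (ball 0 1)) ?inu"
        using top(2)[where P=Q] by (subst eq_commute) (simp only: Lp_norm_eq_top_iff[OF Q(1)])
      also have "\<dots> \<le> triebel_norm \<phi> s p (ennreal Q) u"
        unfolding 1 triebel_norm_top by (rule SUP_upper2[of "(0, 0)"]; simp)
      finally show ?thesis by (simp add: top_unique)
    next
      case (2 P)
      show ?thesis using top(1)[where P=P] unfolding 2 triebel_norm_ennreal Lp_norm_eq_top_iff[OF 2(1)] .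
    qed
    then show ?thesis by (simp add: triebel_def)
  qed
  ultimately show ?thesis by (rule that)
qed

end

lemma separation_of_INF:
  fixes y :: "nat \<Rightarrow> 'a::real_normed_vector"
  assumes "1 \<le> j" "1 \<le> k" "j \<noteq> k"
  shows "(INF (j, k)\<in>{(j, k). 1 \<le> j \<and> 1 \<le> k \<and> j \<noteq> k}. norm (y j - y k)) \<le> norm (y j - y k)"
proof -
  have "bdd_below ((\<lambda>(j, k). norm (y j - y k)) ` {(j, k). 1 \<le> j \<and> 1 \<le> k \<and> j \<noteq> k})"
    by (rule bdd_belowI2[of _ 0]) auto
  from cINF_lower[OF this, of "(j, k)"] assms show ?thesis by simp
qed

theorem theorem1:
  fixes \<phi> :: "nat \<Rightarrow> real ^ 'n \<Rightarrow> complex" and y :: "nat \<Rightarrow> real ^ 'n"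
  assumes "littlewood_paley \<phi>"
    and "0 < (INF (j, k)\<in>{(j, k). 1 \<le> j \<and> 1 \<le> k \<and> j \<noteq> k}. norm (y j - y k))"
  shows
    "((\<forall>f\<in>tempered. T_converges \<phi> y f) \<and>
      linear_on_functionals tempered (T_op \<phi> y) \<and>
      continuous_map tempered_topology tempered_topology (T_op \<phi> y)
      \<longleftrightarrow> (\<exists>N\<^sub>0::real. N\<^sub>0 > 0 \<and> (\<forall>j\<ge>1. norm (y j) \<le> 2 powr (N\<^sub>0 * real j))))
   \<and> (\<forall>(s::real) (p::ennreal) (q::ennreal). 0 < p \<longrightarrow> 0 < q \<longrightarrow>
        (\<forall>f\<in>besov \<phi> s p q. T_converges \<phi> y f \<and> T_op \<phi> y f \<in> besov \<phi> s p q) \<and>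
        linear_on_functionals (besov \<phi> s p q) (T_op \<phi> y) \<and>
        (\<exists>C::real. \<forall>f\<in>besov \<phi> s p q.
           besov_norm \<phi> s p q (T_op \<phi> y f) \<le> ennreal C * besov_norm \<phi> s p q f))
   \<and> (\<forall>(s::real) (p::ennreal) (q::ennreal). 0 < p \<longrightarrow> 0 < q \<longrightarrow> p \<noteq> q \<longrightarrow>
        (\<forall>f\<in>triebel \<phi> s p q. T_converges \<phi> y f) \<and>
        \<not> T_op \<phi> y ` triebel \<phi> s p q \<subseteq> triebel \<phi> s p q)"
    (is "(?converges \<and> ?linear \<and> ?continuous \<longleftrightarrow> ?polynomial) \<and> ?besov \<and> ?triebel")
proof (intro conjI)
  note lp = assms(1)
  note sch = lp_schwartz[OF lp]
  obtain e G where carrier: "lp_carrier \<phi> e G" using lp_carrier_exists[OF lp] by metis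
  show "?converges \<and> ?linear \<and> ?continuous \<longleftrightarrow> ?polynomial"
  proof
    assume "?converges \<and> ?linear \<and> ?continuous"
    then obtain N where N: "\<forall>j\<ge>1. norm (y j) \<le> (2 ^ j) ^ N"
      using T_continuous_imp_polynomial[OF lp carrier] by blast
    \<comment> \<open>The exponent is raised by 1 because the constant must be positive, while
      \<open>N\<close> may be 0.\<close>
    have "norm (y j) \<le> 2 powr (real (N + 1) * real j)" if "1 \<le> j" for j
    proof -
      have "norm (y j) \<le> (2 ^ j) ^ N" using N that by blast
      also have "\<dots> \<le> (2 ^ j) ^ (N + 1)" by (intro power_increasing) auto
      also have "\<dots> = 2 powr real ((N + 1) * j)"
        by (subst powr_realpow) (simp_all only: power_mult[symmetric] mult.commute zero_less_numeral)
      finally show ?thesis by (simp only: of_nat_mult)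
    qed
    then show ?polynomial by (intro exI[of _ "real (N + 1)"]) auto
  next
    assume ?polynomial
    then obtain N\<^sub>0 where N0: "\<And>j. 1 \<le> j \<Longrightarrow> norm (y j) \<le> 2 powr (N\<^sub>0 * real j)" by blast
    define N where "N = nat \<lceil>N\<^sub>0\<rceil>"
    have "norm (y j) \<le> (2 ^ j) ^ N" if "1 \<le> j" for j
    proof -
      have "N\<^sub>0 * real j \<le> real N * real j" by (intro mult_right_mono) (simp_all add: N_def real_nat_ceiling_ge)
      then have "2 powr (N\<^sub>0 * real j) \<le> 2 powr (real (N * j))" by (intro powr_mono) auto
      also have "\<dots> = (2 ^ j) ^ N"
        by (subst powr_realpow) (simp_all only: power_mult[symmetric] mult.commute zero_less_numeral)
      finally show ?thesis using N0[OF that] by simp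
    qed
    note T_continuous[OF lp this]
    moreover from this have ?linear by (intro T_op_linear sch) auto
    ultimately show "?converges \<and> ?linear \<and> ?continuous" by blast
  qed
  show ?besov
  proof (intro allI impI)
    fix s :: real and p q :: ennreal
    assume p: "0 < p" and q: "0 < q"
    obtain C where C: "\<And>f u. f \<in> tempered \<Longrightarrow> T_sums \<phi> y f u \<Longrightarrow> besov_norm \<phi> s p q u \<le> ennreal C * besov_norm \<phi> s p q f"
      using besov_T_bound[OF lp p q] by metis
    have T: "T_converges \<phi> y f \<and> T_op \<phi> y f \<in> besov \<phi> s p q \<and> besov_norm \<phi> s p q (T_op \<phi> y f) \<le> ennreal C * besov_norm \<phi> s p q f"
      if f: "f \<in> besov \<phi> s p q" for f
    proof -
      obtain u where u: "T_sums \<phi> y f u" using besov_T_converges[OF lp p q f] by metis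
      have ft: "f \<in> tempered" and fin: "besov_norm \<phi> s p q f < \<infinity>" using f by (auto simp: besov_def)
      have b: "besov_norm \<phi> s p q u \<le> ennreal C * besov_norm \<phi> s p q f" by (rule C[OF ft u])
      also have "\<dots> < \<infinity>" using fin by (simp add: ennreal_mult_less_top)
      finally have "u \<in> besov \<phi> s p q" using u T_sums_iff[of \<phi> f y u] sch ft by (simp add: besov_def)
      with b T_op_eqI[OF u] T_convergesI[OF u] show ?thesis by simp
    qed
    moreover have "linear_on_functionals (besov \<phi> s p q) (T_op \<phi> y)"
      using T by (intro T_op_linear sch) (auto simp: besov_def)
    ultimately show "(\<forall>f\<in>besov \<phi> s p q. T_converges \<phi> y f \<and> T_op \<phi> y f \<in> besov \<phi> s p q) \<and>
        linear_on_functionals (besov \<phi> s p q) (T_op \<phi> y) \<and>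
        (\<exists>C::real. \<forall>f\<in>besov \<phi> s p q. besov_norm \<phi> s p q (T_op \<phi> y f) \<le> ennreal C * besov_norm \<phi> s p q f)"
      by blast
  qed
  show ?triebel
  proof (intro allI impI conjI)
    fix s :: real and p q :: ennreal
    assume p: "0 < p" and q: "0 < q" and pq: "p \<noteq> q"
    have conv: "\<exists>u. T_sums \<phi> y f u" if "f \<in> triebel \<phi> s p q" for f
      using triebel_T_converges[OF lp p q pq that] by metis
    then show "\<forall>f\<in>triebel \<phi> s p q. T_converges \<phi> y f" by (simp add: T_converges_def)
    note sep = separation_of_INF[where y=y]
    have "\<exists>f\<in>triebel \<phi> s p q. \<forall>u. T_sums \<phi> y f u \<longrightarrow> u \<notin> triebel \<phi> s p q"
    \<comment> \<open>The smaller of two different exponents is finite; it is the one that enters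
      \<open>coef\<close> as a real number.\<close>
    proof (cases "p < q")
      case True
      then obtain P where P: "p = ennreal P" "0 < P" using p by (cases p) auto
      show ?thesis
        unfolding P(1) using triebel_counterexample_less[where y=y, OF lp carrier assms(2) sep P(2) True[unfolded P(1)]] by metis
    next
      case False
      then have "q < p" using pq by auto
      moreover from this obtain Q where Q: "q = ennreal Q" "0 < Q" using q by (cases q) auto
      ultimately show ?thesis
        unfolding Q(1) using triebel_counterexample_greater[where y=y, OF lp carrier assms(2) sep Q(2)] by metis
    qed
    then obtain f where f: "f \<in> triebel \<phi> s p q" "\<And>u. T_sums \<phi> y f u \<Longrightarrow> u \<notin> triebel \<phi> s p q" by blast
    obtain u where "T_sums \<phi> y f u" using conv f(1) by blast
    with f T_op_eqI have "T_op \<phi> y f \<notin> triebel \<phi> s p q" by metis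
    with f(1) show "\<not> T_op \<phi> y ` triebel \<phi> s p q \<subseteq> triebel \<phi> s p q" by blast
  qed
qed

end
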